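(* Let $0<b<1$, $s_c=\frac{1+b}{2}$, and let $V:\mathbf R^3\to[0,\infty)$ be such that $V,\ x\cdot\nabla V\in L^\delta(\mathbf R^3)$ for some $\delta>\frac32$ and $$x\cdot\nabla V\le0,\qquad 2V+x\cdot\nabla V\ge0.$$ Let $u_0\in H^1(\mathbf R^3)$ satisfy $$M(u_0)^{1-s_c}E(u_0)^{s_c}<\mathcal E\quad\text{and}\quad\|u_0\|_{L^2}^{2(1-s_c)}\|H^{1/2}u_0\|_{L^2}^{2s_c}>\mathcal K,$$ and let $u\in C([0,T_{max}),H^1(\mathbf R^3))$ be the (maximal forward) solution of $$iu_t-Hu+|x|^{-b}|u|^2u=0,\quad u(0,x)=u_0(x),\qquad H=-\Delta+V.$$ If there exists $\beta_0<0$ such that $$\sup_{t\in[0,T_{max})}K(u(t))\le\beta_0<0,$$ then there is no global solution $u\in C([0,+\infty),H^1(\mathbf R^3))$ (i.e. it is not the case that $T_{max}=\infty$) with $$\sup_{t\in[0,\infty)}\|\nabla u(t,\cdot)\|_{L^2}<\infty.$$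
   Context: $K(f)=\int|\nabla f|^2dx-\frac12\int(x\cdot\nabla V)|f|^2dx-\frac{3+b}4\int|x|^{-b}|f|^4dx$ (integrals over $\mathbf R^3$). $\|H^{1/2}f\|_{L^2}^2=\int_{\mathbf R^3}(|\nabla f|^2+V|f|^2)\,dx$. Mass and energy: $M(f)=\int|f|^2dx$, $E(f)=\frac12\int|\nabla f|^2dx+\frac12\int V|f|^2dx-\frac14\int|x|^{-b}|f|^4dx$; $E_0$ is $E$ with $V=0$. For nonnegative $V\in L^\delta$, $\delta>\frac32$, the Cauchy problem is locally well-posed in $H^1(\mathbf R^3)$ with conservation of $M$ and $E$; $T_{max}$ is the maximal forward existence time. $Q$ is the unique positive radial (ground state) solution in $H^1$ of $\Delta Q-Q+|x|^{-b}|Q|^2Q=0$ on $\mathbf R^3$, and (since $V\ge0$) $\mathcal E=M(Q)^{1-s_c}E_0(Q)^{s_c}$, $\mathcal K=\|Q\|_{L^2}^{2(1-s_c)}\|\nabla Q\|_{L^2}^{2s_c}$. Convention: the condition $M(u_0)^{1-s_c}E(u_0)^{s_c}<\mathcal E$ is read as $M(u_0)^{(1-s_c)/s_c}E(u_0)<\mathcal E^{1/s_c}$, so it holds when $E(u_0)<0$. *)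

theory Defs
  imports "HOL-Analysis.Analysis"
begin

section \<open>Test functions\<close>

definition partial_deriv :: "3 \<Rightarrow> (real^3 \<Rightarrow> real) \<Rightarrow> real^3 \<Rightarrow> real" where
  "partial_deriv i f x = frechet_derivative f (at x) (axis i 1)"

text \<open>As a greatest fixed point: \<open>f\<close> and all its iterated partial derivatives are
  (Frechet) differentiable everywhere, which is \<open>C\<^sup>\<infinity>\<close>.\<close>

coinductive smooth :: "(real^3 \<Rightarrow> real) \<Rightarrow> bool" where
  "(\<And>x. f differentiable (at x)) \<Longrightarrow> (\<And>i. smooth (partial_deriv i f)) \<Longrightarrow> smooth f"

definition test_function :: "(real^3 \<Rightarrow> real) \<Rightarrow> bool" where
  "test_function \<phi> \<longleftrightarrow> smooth \<phi> \<and> compact (closure {x. \<phi> x \<noteq> 0})"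


section \<open>Lebesgue and Sobolev spaces\<close>

text \<open>Elements of function spaces are represented by concrete functions; equality of elements
  is equality almost everywhere.\<close>

definition in_Lp :: "real \<Rightarrow> (real^3 \<Rightarrow> 'a::real_normed_vector) \<Rightarrow> bool" where
  "in_Lp p f \<longleftrightarrow> f \<in> borel_measurable lebesgue \<and> integrable lebesgue (\<lambda>x. norm (f x) powr p)"

definition L2_nrm :: "(real^3 \<Rightarrow> 'a::real_normed_vector) \<Rightarrow> real" where
  "L2_nrm f = sqrt (LINT x|lebesgue. (norm (f x))\<^sup>2)"

definition weak_gradient :: "(real^3 \<Rightarrow> complex) \<Rightarrow> (real^3 \<Rightarrow> complex^3) \<Rightarrow> bool" where
  "weak_gradient f g \<longleftrightarrow> (\<forall>\<phi> i. test_function \<phi> \<longrightarrow>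
     (LINT x|lebesgue. partial_deriv i \<phi> x *\<^sub>R f x) = - (LINT x|lebesgue. \<phi> x *\<^sub>R (g x $ i)))"

definition in_H1 :: "(real^3 \<Rightarrow> complex) \<Rightarrow> bool" where
  "in_H1 f \<longleftrightarrow> in_Lp 2 f \<and> (\<exists>g. in_Lp 2 g \<and> weak_gradient f g)"

text \<open>Determined almost everywhere, for \<open>f\<close> in \<open>H\<^sup>1\<close>.\<close>

definition grad :: "(real^3 \<Rightarrow> complex) \<Rightarrow> real^3 \<Rightarrow> complex^3" where
  "grad f = (SOME g. in_Lp 2 g \<and> weak_gradient f g)"

definition H1_nrm :: "(real^3 \<Rightarrow> complex) \<Rightarrow> real" where
  "H1_nrm f = sqrt ((L2_nrm f)\<^sup>2 + (L2_nrm (grad f))\<^sup>2)"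

text \<open>\<open>W\<close> represents the distribution
  \<open>x \<cdot> \<nabla>V = (\<Sum>i. x\<^sub>i \<partial>\<^sub>i V)\<close>, whose pairing with \<open>\<phi>\<close> is
  \<open>(\<Sum>i. \<langle>\<partial>\<^sub>i V, x\<^sub>i \<phi>\<rangle>) = - (\<Sum>i. \<integral> V \<partial>\<^sub>i (x\<^sub>i \<phi>))\<close>.\<close>

definition x_dot_grad :: "(real^3 \<Rightarrow> real) \<Rightarrow> (real^3 \<Rightarrow> real) \<Rightarrow> bool" where
  "x_dot_grad V W \<longleftrightarrow> (\<forall>\<phi>. test_function \<phi> \<longrightarrow>
     (LINT x|lebesgue. W x * \<phi> x) =
       - (\<Sum>i\<in>UNIV. LINT x|lebesgue. V x * partial_deriv i (\<lambda>y. y $ i * \<phi> y) x))"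


section \<open>Functionals\<close>

definition mass :: "(real^3 \<Rightarrow> complex) \<Rightarrow> real" where
  "mass f = (LINT x|lebesgue. (cmod (f x))\<^sup>2)"

definition energy :: "real \<Rightarrow> (real^3 \<Rightarrow> real) \<Rightarrow> (real^3 \<Rightarrow> complex) \<Rightarrow> real" where
  "energy b V f = 1/2 * (LINT x|lebesgue. (norm (grad f x))\<^sup>2)
     + 1/2 * (LINT x|lebesgue. V x * (cmod (f x))\<^sup>2)
     - 1/4 * (LINT x|lebesgue. norm x powr (-b) * cmod (f x) ^ 4)"

text \<open>The norm of \<open>H\<^sup>1\<^sup>/\<^sup>2 f\<close> in \<open>L\<^sup>2\<close>, where \<open>H = - \<Delta> + V\<close>.\<close>

definition Hhalf_nrm :: "(real^3 \<Rightarrow> real) \<Rightarrow> (real^3 \<Rightarrow> complex) \<Rightarrow> real" where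
  "Hhalf_nrm V f = sqrt (LINT x|lebesgue. (norm (grad f x))\<^sup>2 + V x * (cmod (f x))\<^sup>2)"

text \<open>\<open>W\<close> stands for \<open>x \<cdot> \<nabla>V\<close>.\<close>

definition virial :: "real \<Rightarrow> (real^3 \<Rightarrow> real) \<Rightarrow> (real^3 \<Rightarrow> complex) \<Rightarrow> real" where
  "virial b W f = (LINT x|lebesgue. (norm (grad f x))\<^sup>2)
     - 1/2 * (LINT x|lebesgue. W x * (cmod (f x))\<^sup>2)
     - (3 + b)/4 * (LINT x|lebesgue. norm x powr (-b) * cmod (f x) ^ 4)"


section \<open>The equations\<close>

text \<open>Equations are understood in \<open>H\<^sup>-\<^sup>1\<close>, the dual of \<open>H\<^sup>1\<close>. The next two
  definitions are the pairings of \<open>H f\<close>, with \<open>H = - \<Delta> + V\<close>, and of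
  \<open>|x|\<^sup>-\<^sup>b |f|\<^sup>2 f\<close> with \<open>\<phi>\<close> in \<open>H\<^sup>1\<close>.\<close>

definition pair_H :: "(real^3 \<Rightarrow> real) \<Rightarrow> (real^3 \<Rightarrow> complex) \<Rightarrow> (real^3 \<Rightarrow> complex) \<Rightarrow> complex" where
  "pair_H V f \<phi> = (LINT x|lebesgue. (\<Sum>i\<in>UNIV. grad f x $ i * cnj (grad \<phi> x $ i)))
     + (LINT x|lebesgue. complex_of_real (V x) * f x * cnj (\<phi> x))"

definition pair_N :: "real \<Rightarrow> (real^3 \<Rightarrow> complex) \<Rightarrow> (real^3 \<Rightarrow> complex) \<Rightarrow> complex" where
  "pair_N b f \<phi> =
     (LINT x|lebesgue. complex_of_real (norm x powr (-b) * (cmod (f x))\<^sup>2) * f x * cnj (\<phi> x))"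

definition pair_L2 :: "(real^3 \<Rightarrow> complex) \<Rightarrow> (real^3 \<Rightarrow> complex) \<Rightarrow> complex" where
  "pair_L2 f \<phi> = (LINT x|lebesgue. f x * cnj (\<phi> x))"

text \<open>Positive radial \<open>H\<^sup>1\<close> solutions of
  \<open>\<Delta>Q - Q + |x|\<^sup>-\<^sup>b |Q|\<^sup>2 Q = 0\<close>; for \<open>0 < b < 1\<close> there is exactly one, up to
  equality almost everywhere.\<close>

definition ground_state :: "real \<Rightarrow> (real^3 \<Rightarrow> complex) \<Rightarrow> bool" where
  "ground_state b Q \<longleftrightarrow> in_H1 Q
     \<and> (\<forall>x. Q x \<in> \<real> \<and> 0 < Re (Q x))
     \<and> (\<forall>x y. norm x = norm y \<longrightarrow> Q x = Q y)
     \<and> (\<forall>\<phi>. in_H1 \<phi> \<longrightarrow> - pair_H (\<lambda>_. 0) Q \<phi> - pair_L2 Q \<phi> + pair_N b Q \<phi> = 0)"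

definition time_interval :: "ereal \<Rightarrow> real set" where
  "time_interval T = {t. 0 \<le> t \<and> ereal t < T}"

definition continuous_H1 :: "ereal \<Rightarrow> (real \<Rightarrow> real^3 \<Rightarrow> complex) \<Rightarrow> bool" where
  "continuous_H1 T u \<longleftrightarrow> (\<forall>t\<in>time_interval T. in_H1 (u t)
     \<and> ((\<lambda>s. H1_nrm (\<lambda>x. u s x - u t x)) \<longlongrightarrow> 0) (at t within time_interval T))"

text \<open>\<open>u \<in> C([0,T), H\<^sup>1)\<close> solves \<open>i u\<^sub>t - H u + |x|\<^sup>-\<^sup>b |u|\<^sup>2 u = 0\<close>,
  \<open>u(0) = u\<^sub>0\<close>. The derivative at \<open>t = 0\<close> is one-sided.\<close>

definition nls_solution :: "real \<Rightarrow> (real^3 \<Rightarrow> real) \<Rightarrow> (real^3 \<Rightarrow> complex) \<Rightarrow> ereal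
    \<Rightarrow> (real \<Rightarrow> real^3 \<Rightarrow> complex) \<Rightarrow> bool" where
  "nls_solution b V u0 T u \<longleftrightarrow> 0 < T \<and> continuous_H1 T u
     \<and> (AE x in lebesgue. u 0 x = u0 x)
     \<and> (\<forall>t\<in>time_interval T. \<forall>\<phi>. in_H1 \<phi> \<longrightarrow>
          (\<exists>D. ((\<lambda>s. pair_L2 (u s) \<phi>) has_vector_derivative D) (at t within time_interval T)
             \<and> \<i> * D - pair_H V (u t) \<phi> + pair_N b (u t) \<phi> = 0))"

text \<open>\<open>T\<close> is then the maximal forward existence time.\<close>

definition maximal_nls_solution :: "real \<Rightarrow> (real^3 \<Rightarrow> real) \<Rightarrow> (real^3 \<Rightarrow> complex) \<Rightarrow> ereal
    \<Rightarrow> (real \<Rightarrow> real^3 \<Rightarrow> complex) \<Rightarrow> bool" where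
  "maximal_nls_solution b V u0 T u \<longleftrightarrow> nls_solution b V u0 T u
     \<and> \<not> (\<exists>T' v. T < T' \<and> nls_solution b V u0 T' v
            \<and> (\<forall>t\<in>time_interval T. AE x in lebesgue. v t x = u t x))"

end

theory Submission
  imports Defs
begin

text \<open>
  Suppose that \<open>T = \<infinity>\<close> and that \<open>\<nabla>u\<close> stays bounded; by mass conservation
  \<open>u\<close> is then bounded in \<open>H\<^sup>1\<close>. With the Gaussian \<open>\<chi> = exp (- |x|\<^sup>2 / (2 R\<^sup>2))\<close>
  and the symmetric difference quotient \<open>D\<^sub>h\<close> of the unitary dilations, which approximates
  \<open>x \<cdot> \<nabla> + 3/2\<close>, the operator \<open>\<chi> D\<^sub>h \<chi>\<close> is skew-symmetric and preserves
  \<open>H\<^sup>1\<close>. So \<open>G\<^sub>h(t) = Im \<langle>u, \<chi> D\<^sub>h \<chi> u\<rangle>\<close> may be differentiated by the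
  equation without any further regularity of \<open>u\<close>, and it is bounded uniformly in \<open>h\<close> and
  \<open>t\<close> for fixed \<open>R\<close>. As \<open>h \<rightarrow> 0\<close>, the lower limit of \<open>G\<^sub>h'\<close> is at least
  \<open>- 2 K(u(t)) - O(1/R + R\<^sup>-\<^sup>b)\<close>, which exceeds \<open>|\<beta>\<^sub>0|\<close> for \<open>R\<close> large. The
  errors are small without radial symmetry because \<open>|x|\<^sup>-\<^sup>b\<close> decays; the inequality
  \<open>x \<cdot> \<nabla>V \<le> 0\<close> gives the potential term its sign. Since \<open>G\<^sub>h'\<close> is bounded
  below uniformly in \<open>h\<close>, Fatou's lemma turns this into linear growth of a bounded quantity.
\<close>

section \<open>Smooth functions\<close>

text \<open>For data in H^1 the variance may be infinite and x . \<nabla>u need not lie in H^1,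
  while the equation may be tested only with H^1 functions. At fixed h the operator is bounded on
  H^1, but with a norm of order 1/h; so h tends to 0 only after differentiating in time, at fixed t,
  where convergence is weak. Each of the three contributions is therefore bounded from one side by
  an inequality valid before any limit or along a quotient: the kinetic one by Cauchy-Schwarz
  between k and its unitary dilation, the potential one by monotonicity of V along rays, the
  nonlinear one by Young's inequality for quartic terms. The Gaussian is chosen because its gradient
  is -x/R^2 times itself. The cutoff terms then form an explicit quadratic form in x .
  \<nabla>(\<chi>u) and \<chi>u, bounded below by completing the square; the constant 9/8 is the
  cost, and the prefactor 1/R^2 makes it small. The rate R^-b comes from bounding |x|^-b min(1,
  |x|^2/R^2). Weak derivatives enter the analysis as a fundamental theorem of calculus along flows:
  translations give the Sobolev inequality, dilations the quotients.\<close>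

primrec Ck :: "nat \<Rightarrow> (real^3 \<Rightarrow> real) \<Rightarrow> bool" where
  "Ck 0 f = True"
| "Ck (Suc k) f \<longleftrightarrow> (\<forall>x. f differentiable (at x)) \<and> (\<forall>i. Ck k (partial_deriv i f))"

text \<open>Unfolding the greatest fixed point \<open>k\<close> times gives \<open>Ck k\<close>, and
  having all finite orders is itself a post-fixed point. Closure under products and compositions
  becomes an induction on \<open>k\<close>; a bare coinduction does not close, because the
  derivative of a product is a sum of products.\<close>

lemma smooth_iff_Ck: "smooth f \<longleftrightarrow> (\<forall>k. Ck k f)"
proof
  show "\<forall>k. Ck k f" if "smooth f"
  proof
    fix k show "Ck k f"
      using that by (induction k arbitrary: f) (auto elim: smooth.cases)
  qed
next
  assume "\<forall>k. Ck k f"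
  then show "smooth f"
  proof (coinduction arbitrary: f)
    case (smooth f)
    have "f differentiable at x" for x
      using spec[OF smooth, of "Suc 0"] by auto
    moreover have "Ck k (partial_deriv i f)" for k i
      using spec[OF smooth, of "Suc k"] by auto
    ultimately show ?case by auto
  qed
qed

lemma Ck_Suc_imp: "Ck (Suc k) f \<Longrightarrow> Ck k f"
  by (induction k arbitrary: f) auto

lemma smooth_differentiable: "smooth f \<Longrightarrow> f differentiable (at x)"
  and smooth_partial_deriv: "smooth f \<Longrightarrow> smooth (partial_deriv i f)"
  by (auto elim: smooth.cases)

lemma has_derivative_partial_deriv:
  assumes "(f has_derivative f') (at x)"
  shows "partial_deriv i f x = f' (axis i 1)"
  unfolding partial_deriv_def using frechet_derivative_at[OF assms] by simp

lemma smooth_has_derivative: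
  "smooth f \<Longrightarrow> (f has_derivative frechet_derivative f (at x)) (at x)"
  using frechet_derivative_works smooth_differentiable by blast

lemma frechet_derivative_eq_sum_partial_deriv:
  assumes "f differentiable (at x)"
  shows "frechet_derivative f (at x) h = (\<Sum>i\<in>UNIV. h $ i * partial_deriv i f x)"
proof -
  have lin: "linear (frechet_derivative f (at x))"
    using assms linear_frechet_derivative by blast
  have "frechet_derivative f (at x) h = frechet_derivative f (at x) (\<Sum>i\<in>UNIV. (h $ i) *\<^sub>R axis i 1)"
    by (simp add: basis_expansion[of h, unfolded scalar_mult_eq_scaleR])
  also have "\<dots> = (\<Sum>i\<in>UNIV. h $ i * partial_deriv i f x)"
    by (simp add: linear_sum[OF lin] linear_scale[OF lin] partial_deriv_def)
  finally show ?thesis .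
qed

lemma smooth_continuous_on: "smooth f \<Longrightarrow> continuous_on A f"
  by (meson continuous_at_imp_continuous_on differentiable_imp_continuous_within smooth_differentiable)

lemma partial_deriv_add:
  "f differentiable (at x) \<Longrightarrow> g differentiable (at x) \<Longrightarrow>
   partial_deriv i (\<lambda>x. f x + g x) x = partial_deriv i f x + partial_deriv i g x"
  by (rule has_derivative_partial_deriv[THEN trans, OF has_derivative_add])
     (auto simp: frechet_derivative_works partial_deriv_def)

lemma partial_deriv_mult:
  "f differentiable (at x) \<Longrightarrow> g differentiable (at x) \<Longrightarrow>
   partial_deriv i (\<lambda>x. f x * g x) x = f x * partial_deriv i g x + partial_deriv i f x * g x"
  by (rule has_derivative_partial_deriv[THEN trans, OF has_derivative_mult])
     (auto simp: frechet_derivative_works partial_deriv_def)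

lemma partial_deriv_const [simp]: "partial_deriv i (\<lambda>x. a) x = 0"
  by (rule has_derivative_partial_deriv[THEN trans, OF has_derivative_const]) simp

lemma partial_deriv_nth: "partial_deriv i (\<lambda>x. x $ j) x = (if i = j then 1 else 0)"
  by (rule has_derivative_partial_deriv[THEN trans,
        OF bounded_linear_imp_has_derivative[OF bounded_linear_vec_nth]])
     (simp add: axis_def)

lemma differentiable_nth: "(\<lambda>x::real^3. x $ j) differentiable (at x)"
  using bounded_linear_imp_differentiable[OF bounded_linear_vec_nth] .

lemma partial_deriv_DERIV_compose:
  assumes "(F has_field_derivative F') (at (p x))" and "p differentiable (at x)"
  shows "(\<lambda>x. F (p x)) differentiable (at x)"
    and "partial_deriv i (\<lambda>x. F (p x)) x = F' * partial_deriv i p x"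
proof -
  have "((\<lambda>x. F (p x)) has_derivative (\<lambda>h. F' * frechet_derivative p (at x) h)) (at x)"
    using has_derivative_compose[OF assms(2)[unfolded frechet_derivative_works]
        assms(1)[unfolded has_field_derivative_def]] .
  then show "(\<lambda>x. F (p x)) differentiable (at x)"
    and "partial_deriv i (\<lambda>x. F (p x)) x = F' * partial_deriv i p x"
    by (auto simp: differentiable_def has_derivative_partial_deriv partial_deriv_def[of i p])
qed

lemma affine_compose_differentiable:
  assumes "f differentiable (at (c *\<^sub>R x + v))"
  shows "(\<lambda>x. f (c *\<^sub>R x + v)) differentiable (at x)"
    and "partial_deriv i (\<lambda>x. f (c *\<^sub>R x + v)) x = c * partial_deriv i f (c *\<^sub>R x + v)"
proof -
  have "((\<lambda>x::real^3. c *\<^sub>R x + v) has_derivative (\<lambda>h. c *\<^sub>R h)) (at x)"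
    by (auto intro!: derivative_eq_intros)
  from has_derivative_compose[OF this assms[unfolded frechet_derivative_works]]
  have d: "((\<lambda>x. f (c *\<^sub>R x + v)) has_derivative
      (\<lambda>h. frechet_derivative f (at (c *\<^sub>R x + v)) (c *\<^sub>R h))) (at x)" .
  then show "(\<lambda>x. f (c *\<^sub>R x + v)) differentiable (at x)"
    by (auto simp: differentiable_def)
  show "partial_deriv i (\<lambda>x. f (c *\<^sub>R x + v)) x = c * partial_deriv i f (c *\<^sub>R x + v)"
    using has_derivative_partial_deriv[OF d] linear_scale[OF linear_frechet_derivative[OF assms]]
    by (simp add: partial_deriv_def[of i f])
qed

lemma Ck_add: "Ck k f \<Longrightarrow> Ck k g \<Longrightarrow> Ck k (\<lambda>x. f x + g x)"
proof (induction k arbitrary: f g)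
  case (Suc k)
  then have "partial_deriv i (\<lambda>x. f x + g x) = (\<lambda>x. partial_deriv i f x + partial_deriv i g x)" for i
    by (auto simp: partial_deriv_add)
  with Suc show ?case by auto
qed simp

lemma Ck_mult: "Ck k f \<Longrightarrow> Ck k g \<Longrightarrow> Ck k (\<lambda>x. f x * g x)"
proof (induction k arbitrary: f g)
  case (Suc k)
  then have *: "partial_deriv i (\<lambda>x. f x * g x) =
      (\<lambda>x. f x * partial_deriv i g x + partial_deriv i f x * g x)" for i
    by (auto simp: partial_deriv_mult)
  \<comment> \<open>Leibniz keeps the undifferentiated factors, which the hypotheses give at order
    \<open>Suc k\<close> and the induction hypothesis wants at order \<open>k\<close>.\<close>
  have "Ck k f" "Ck k g" using Suc.prems Ck_Suc_imp by blast+
  then have "Ck k (partial_deriv i (\<lambda>x. f x * g x))" for i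
    unfolding * using Suc.prems by (intro Ck_add Suc.IH) auto
  with Suc.prems show ?case by auto
qed simp

lemma smooth_add: "smooth f \<Longrightarrow> smooth g \<Longrightarrow> smooth (\<lambda>x. f x + g x)"
  and smooth_mult: "smooth f \<Longrightarrow> smooth g \<Longrightarrow> smooth (\<lambda>x. f x * g x)"
  by (auto simp: smooth_iff_Ck Ck_add Ck_mult)

lemma smooth_const: "smooth (\<lambda>x. a)"
proof -
  have "Ck k (\<lambda>x. a)" for k a
    by (induction k arbitrary: a) (auto simp: fun_eq_iff cong: if_cong, metis partial_deriv_const ext)
  then show ?thesis by (simp add: smooth_iff_Ck)
qed

lemma smooth_nth: "smooth (\<lambda>x. x $ j)"
proof (rule smooth.intros)
  fix i
  have "partial_deriv i (\<lambda>x. x $ j) = (\<lambda>x. if i = j then 1 else 0)"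
    by (auto simp: partial_deriv_nth)
  then show "smooth (partial_deriv i (\<lambda>x. x $ j))" by (simp add: smooth_const)
qed (rule differentiable_nth)

lemma smooth_minus: "smooth f \<Longrightarrow> smooth (\<lambda>x. - f x)"
  using smooth_mult[OF smooth_const[of "-1"]] by simp

lemma smooth_diff: "smooth f \<Longrightarrow> smooth g \<Longrightarrow> smooth (\<lambda>x. f x - g x)"
  using smooth_add[OF _ smooth_minus] by simp

lemma smooth_sum: "(\<And>i. i \<in> I \<Longrightarrow> smooth (f i)) \<Longrightarrow> smooth (\<lambda>x. \<Sum>i\<in>I. f i x)"
  by (induction I rule: infinite_finite_induct) (auto simp: smooth_const smooth_add)

lemma smooth_prod: "(\<And>i. i \<in> I \<Longrightarrow> smooth (f i)) \<Longrightarrow> smooth (\<lambda>x. \<Prod>i\<in>I. f i x)"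
  by (induction I rule: infinite_finite_induct) (auto simp: smooth_const smooth_mult)

lemma smooth_affine:
  assumes "smooth f" shows "smooth (\<lambda>x. f (c *\<^sub>R x + v))"
proof -
  have "Ck k f \<Longrightarrow> Ck k (\<lambda>x. f (c *\<^sub>R x + v))" for k f
  proof (induction k arbitrary: f)
    case (Suc k)
    then have "partial_deriv i (\<lambda>x. f (c *\<^sub>R x + v)) = (\<lambda>x. c * partial_deriv i f (c *\<^sub>R x + v))" for i
      by (auto simp: affine_compose_differentiable)
    moreover have "Ck k (\<lambda>x. c * partial_deriv i f (c *\<^sub>R x + v))" for i
      using smooth_const Suc by (intro Ck_mult) (auto simp: smooth_iff_Ck)
    ultimately show ?case using Suc.prems by (auto simp: affine_compose_differentiable)
  qed simp
  with assms show ?thesis by (auto simp: smooth_iff_Ck)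
qed

lemma smooth_exp:
  assumes "smooth p" shows "smooth (\<lambda>x. exp (p x))"
    and "partial_deriv i (\<lambda>x. exp (p x)) x = exp (p x) * partial_deriv i p x"
proof -
  have D: "(exp has_field_derivative exp (p x)) (at (p x))" for x by (rule DERIV_exp)
  note d = partial_deriv_DERIV_compose[OF D smooth_differentiable[OF assms]]
  have e: "partial_deriv i (\<lambda>x. exp (p x)) = (\<lambda>x. exp (p x) * partial_deriv i p x)" for i
    using d by auto
  have "Ck k (\<lambda>x. exp (p x))" for k
    by (induction k) (use assms d e smooth_partial_deriv in \<open>auto simp: smooth_iff_Ck intro!: Ck_mult\<close>)
  then show "smooth (\<lambda>x. exp (p x))" by (simp add: smooth_iff_Ck)
  show "partial_deriv i (\<lambda>x. exp (p x)) x = exp (p x) * partial_deriv i p x" by (simp add: e)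
qed

text \<open>The family \<open>exp_flat m\<close> is closed under differentiation, which makes the smoothness
  of \<open>exp (-1/t)\<close> at \<open>t = 0\<close> a plain induction.\<close>

definition exp_flat :: "nat \<Rightarrow> real \<Rightarrow> real" where
  "exp_flat m t = (if t \<le> 0 then 0 else exp (- 1 / t) / t ^ m)"

text \<open>The substitution \<open>x = 1 / t\<close> turns the limit from the right into that of
  \<open>x ^ m / exp x\<close> at infinity; on the left the function is zero.\<close>

lemma exp_flat_tendsto: "(exp_flat m \<longlongrightarrow> 0) (at 0)"
proof -
  have "((\<lambda>x. x ^ m / exp x) \<longlongrightarrow> (0::real)) at_top" by (rule tendsto_power_div_exp_0)
  then have "((\<lambda>t. (inverse t) ^ m / exp (inverse t)) \<longlongrightarrow> (0::real)) (at_right 0)"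
    by (rule filterlim_compose[OF _ filterlim_inverse_at_top_right])
  then have "(exp_flat m \<longlongrightarrow> 0) (at_right 0)"
    by (rule Lim_transform_eventually)
       (auto simp: eventually_at_filter exp_flat_def exp_minus divide_simps power_divide inverse_eq_divide)
  moreover have "(exp_flat m \<longlongrightarrow> 0) (at_left 0)"
    by (rule Lim_transform_eventually[OF tendsto_const]) (auto simp: eventually_at_filter exp_flat_def)
  ultimately show ?thesis by (simp add: filterlim_split_at_real)
qed

lemma DERIV_exp_flat:
  "(exp_flat m has_field_derivative (exp_flat (m + 2) t - m * exp_flat (m + 1) t)) (at t)"
proof (cases "t = 0")
  case True
  \<comment> \<open>At the origin the difference quotient of \<open>exp_flat m\<close> is
    \<open>exp_flat (Suc m)\<close> itself, so the previous limit gives the derivative 0.\<close>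
  have "((\<lambda>h. (exp_flat m (0 + h) - exp_flat m 0) / h) \<longlongrightarrow> 0) (at 0)"
    by (rule Lim_transform_eventually[OF exp_flat_tendsto[of "Suc m"]])
       (auto simp: eventually_at_filter exp_flat_def)
  then show ?thesis using True by (simp add: DERIV_def exp_flat_def)
next
  case False
  show ?thesis
  proof (cases "t < 0")
    case True
    have "((\<lambda>t. 0) has_field_derivative 0) (at t)" by simp
    then have "(exp_flat m has_field_derivative 0) (at t)"
      by (rule has_field_derivative_transform_within_open[of _ _ _ "{..<0}"])
         (use True in \<open>auto simp: exp_flat_def\<close>)
    with True show ?thesis by (simp add: exp_flat_def)
  next
    case f: False
    with False have t: "t > 0" by simp
    have "((\<lambda>t. exp (- 1 / t) / t ^ m) has_field_derivative
        (exp (- 1 / t) / t ^ (m + 2) - m * (exp (- 1 / t) / t ^ (m + 1)))) (at t)"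
    proof (cases m)
      case (Suc n)
      have 1: "((\<lambda>t. exp (- 1 / t)) has_field_derivative exp (- 1 / t) / t\<^sup>2) (at t)"
        using t by (auto intro!: derivative_eq_intros simp: power2_eq_square)
      have 2: "((\<lambda>t. t ^ Suc n) has_field_derivative real (Suc n) * t ^ n) (at t)"
        using DERIV_pow[of "Suc n" t] by simp
      show ?thesis
        using DERIV_divide[OF 1 2] t unfolding Suc
        by (rule_tac DERIV_cong, simp) (simp add: field_simps power2_eq_square)
    qed (use t in \<open>auto intro!: derivative_eq_intros simp: power2_eq_square\<close>)
    then have "(exp_flat m has_field_derivative
        (exp (- 1 / t) / t ^ (m + 2) - m * (exp (- 1 / t) / t ^ (m + 1)))) (at t)"
      by (rule has_field_derivative_transform_within_open[of _ _ _ "{0<..}"])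
         (use t in \<open>auto simp: exp_flat_def\<close>)
    with t show ?thesis by (simp add: exp_flat_def)
  qed
qed

lemma smooth_exp_flat:
  assumes "smooth p" shows "smooth (\<lambda>x. exp_flat m (p x))"
proof -
  note d = partial_deriv_DERIV_compose[OF DERIV_exp_flat smooth_differentiable[OF assms]]
  have e: "partial_deriv i (\<lambda>x. exp_flat m (p x)) =
      (\<lambda>x. (exp_flat (m + 2) (p x) + (- m) * exp_flat (m + 1) (p x)) * partial_deriv i p x)" for i m
    using d by auto
  have "Ck k (\<lambda>x. exp_flat m (p x))" for k
  proof (induction k arbitrary: m)
    case (Suc k)
    have "Ck k (partial_deriv i (\<lambda>x. exp_flat m (p x)))" for i
      unfolding e using assms smooth_partial_deriv smooth_const Suc
      by (intro Ck_mult Ck_add) (auto simp: smooth_iff_Ck)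
    then show ?case using d by simp
  qed simp
  then show ?thesis by (simp add: smooth_iff_Ck)
qed

lemma exp_flat_pos_iff: "exp_flat m t > 0 \<longleftrightarrow> t > 0"
  and exp_flat_nonneg: "exp_flat m t \<ge> 0"
  and exp_flat_eq_0: "t \<le> 0 \<Longrightarrow> exp_flat m t = 0"
  by (auto simp: exp_flat_def)


section \<open>Test functions\<close>

lemma test_function_smooth: "test_function \<phi> \<Longrightarrow> smooth \<phi>"
  by (simp add: test_function_def)

lemma bounded_support_iff: "compact (closure {x::real^3. \<phi> x \<noteq> (0::real)}) \<longleftrightarrow> (\<exists>r. \<forall>x. \<phi> x \<noteq> 0 \<longrightarrow> norm x \<le> r)"
  by (auto simp: compact_closure bounded_iff Ball_def)

lemma test_functionI: "smooth \<phi> \<Longrightarrow> (\<And>x. \<phi> x \<noteq> 0 \<Longrightarrow> norm x \<le> r) \<Longrightarrow> test_function \<phi>"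
  unfolding test_function_def bounded_support_iff by blast

lemma test_functionE:
  assumes "test_function \<phi>"
  obtains r where "smooth \<phi>" "\<And>x. \<phi> x \<noteq> 0 \<Longrightarrow> norm x \<le> r"
  using assms unfolding test_function_def bounded_support_iff by blast

lemma test_function_smooth_mult:
  assumes "smooth c" "test_function \<phi>" shows "test_function (\<lambda>x. c x * \<phi> x)"
  using assms(2) by (rule test_functionE) (use assms(1) in \<open>auto intro!: test_functionI smooth_mult\<close>)

lemma test_function_affine:
  assumes "test_function \<phi>" "c \<noteq> 0" shows "test_function (\<lambda>x. \<phi> (c *\<^sub>R x + v))"
proof (rule test_functionE[OF assms(1)])
  fix r assume "smooth \<phi>" and r: "\<And>x. \<phi> x \<noteq> 0 \<Longrightarrow> norm x \<le> r"
  show ?thesis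
  proof (rule test_functionI[OF smooth_affine[OF \<open>smooth \<phi>\<close>]])
    fix x assume "\<phi> (c *\<^sub>R x + v) \<noteq> 0"
    then have "norm (c *\<^sub>R x + v) \<le> r" by (rule r)
    then have "norm (c *\<^sub>R x) \<le> r + norm v" using norm_triangle_ineq4[of "c *\<^sub>R x + v" v] by simp
    with assms(2) show "norm x \<le> (r + norm v) / \<bar>c\<bar>" by (simp add: field_simps)
  qed
qed

lemma test_function_partial_deriv:
  assumes "test_function \<phi>" shows "test_function (partial_deriv i \<phi>)"
proof (rule test_functionE[OF assms(1)])
  fix r assume s: "smooth \<phi>" and r: "\<And>x. \<phi> x \<noteq> 0 \<Longrightarrow> norm x \<le> r"
  show ?thesis
  proof (rule test_functionI[OF smooth_partial_deriv[OF s]])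
    fix x assume *: "partial_deriv i \<phi> x \<noteq> 0"
    show "norm x \<le> r"
    proof (rule ccontr)
      assume "\<not> norm x \<le> r"
      then have x: "x \<in> - cball 0 r" by simp
      have "((\<lambda>x. 0) has_derivative (\<lambda>h. 0)) (at x)" by simp
      then have "(\<phi> has_derivative (\<lambda>h. 0)) (at x)"
        by (rule has_derivative_transform_within_open[OF _ _ x]) (use r in \<open>force simp: open_Compl\<close>)+
      from has_derivative_partial_deriv[OF this] * show False by simp
    qed
  qed
qed

lemma test_function_bounded:
  assumes "test_function \<phi>"
  obtains r C where "r > 0" "C > 0" "\<And>x. \<bar>\<phi> x\<bar> \<le> C * indicator (cball 0 r) x"
proof -
  obtain r where s: "smooth \<phi>" and r: "\<And>x. \<phi> x \<noteq> 0 \<Longrightarrow> norm x \<le> r"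
    using test_functionE[OF assms] by metis
  have "bounded (\<phi> ` cball 0 (\<bar>r\<bar> + 1))"
    by (intro compact_imp_bounded compact_continuous_image smooth_continuous_on s compact_cball)
  then obtain C where C: "\<And>x. norm x \<le> \<bar>r\<bar> + 1 \<Longrightarrow> \<bar>\<phi> x\<bar> \<le> C"
    unfolding bounded_iff by force
  have "\<bar>\<phi> x\<bar> \<le> (\<bar>C\<bar> + 1) * indicator (cball 0 (\<bar>r\<bar> + 1)) x" for x
    using C[of x] r[of x] by (cases "\<phi> x = 0") (auto simp: indicator_def)
  then show thesis by (intro that[of "\<bar>r\<bar> + 1" "\<bar>C\<bar> + 1"]) auto
qed

text \<open>\<open>1 - exp (- n \<beta>)\<close>, with \<open>\<beta>\<close> smooth and positive exactly on the box, increases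
  to the indicator function of the box.\<close>

lemma test_function_tendsto_indicator_box:
  fixes a b :: "real^3"
  obtains \<phi> :: "nat \<Rightarrow> real^3 \<Rightarrow> real"
  where "\<And>n. test_function (\<phi> n)" "\<And>n x. 0 \<le> \<phi> n x" "\<And>n x. \<phi> n x \<le> indicator (box a b) x"
    "\<And>x. (\<lambda>n. \<phi> n x) \<longlonglongrightarrow> indicator (box a b) x"
proof -
  define \<beta> where "\<beta> x = (\<Prod>i\<in>UNIV. exp_flat 0 (x $ i - a $ i) * exp_flat 0 (b $ i - x $ i))" for x
  define \<phi> where "\<phi> n x = 1 - exp (- real n * \<beta> x)" for n x
  have \<beta>_smooth: "smooth \<beta>"
    unfolding \<beta>_def by (intro smooth_prod smooth_mult smooth_exp_flat smooth_diff smooth_nth smooth_const)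
  have nn: "\<beta> x \<ge> 0" for x by (auto simp: \<beta>_def intro!: prod_nonneg mult_nonneg_nonneg exp_flat_nonneg)
  have pos: "\<beta> x > 0" if "x \<in> box a b" for x
    using that by (auto simp: \<beta>_def mem_box_cart exp_flat_pos_iff intro!: prod_pos)
  have z: "\<beta> x = 0" if "x \<notin> box a b" for x
  proof -
    from that obtain i where "x $ i \<le> a $ i \<or> b $ i \<le> x $ i" by (auto simp: mem_box_cart not_less)
    then have "exp_flat 0 (x $ i - a $ i) * exp_flat 0 (b $ i - x $ i) = 0"
      by (auto simp: exp_flat_eq_0)
    then show ?thesis unfolding \<beta>_def by (intro prod_zero) auto
  qed
  obtain r where r: "\<And>x. x \<in> box a b \<Longrightarrow> norm x \<le> r"
    using bounded_box[of a b] by (auto simp: bounded_iff)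
  have "test_function (\<phi> n)" for n
  proof (rule test_functionI)
    show "smooth (\<phi> n)" unfolding \<phi>_def
      by (intro smooth_diff smooth_const smooth_exp smooth_mult \<beta>_smooth)
    show "norm x \<le> r" if "\<phi> n x \<noteq> 0" for x
      using that z[of x] r[of x] by (auto simp: \<phi>_def)
  qed
  moreover have "0 \<le> \<phi> n x" for n x using nn[of x] by (simp add: \<phi>_def)
  moreover have "\<phi> n x \<le> indicator (box a b) x" for n x
    using z[of x] by (auto simp: \<phi>_def indicator_def)
  moreover have "(\<lambda>n. \<phi> n x) \<longlonglongrightarrow> indicator (box a b) x" for x
  proof (cases "x \<in> box a b")
    case True
    have "(\<lambda>n. exp (- \<beta> x) ^ n) \<longlonglongrightarrow> 0"
      using pos[OF True] LIMSEQ_power_zero[of "exp (- \<beta> x)"] by simp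
    then have "(\<lambda>n. 1 - exp (- \<beta> x) ^ n) \<longlonglongrightarrow> 1 - 0" by (rule tendsto_diff[OF tendsto_const])
    moreover have "\<phi> n x = 1 - exp (- \<beta> x) ^ n" for n
      using exp_of_nat_mult[of n "- \<beta> x"] by (simp add: \<phi>_def)
    ultimately show ?thesis using True by simp
  qed (simp add: \<phi>_def z)
  ultimately show thesis by (rule that)
qed

section \<open>Integration and affine maps\<close>

text \<open>The last three facts are read off from one identity: Lebesgue measure is its own image
  under the affine map with density \<open>\<bar>c\<bar> ^ 3\<close>, the Jacobian in dimension
  three. The auxiliary map \<open>T\<close> only rewrites the coordinatewise form of that
  identity.\<close>

lemma
  fixes f :: "real^3 \<Rightarrow> 'a::{banach, second_countable_topology}"
  assumes c: "c \<noteq> 0"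
  shows measurable_lebesgue_affine: "(\<lambda>x::real^3. c *\<^sub>R x + v) \<in> lebesgue \<rightarrow>\<^sub>M lebesgue"
    and AE_lebesgue_affine: "AE x in lebesgue. P x \<Longrightarrow> AE x in lebesgue. P (c *\<^sub>R (x::real^3) + v)"
    and integral_lebesgue_affine: "f \<in> borel_measurable lebesgue \<Longrightarrow>
      integral\<^sup>L lebesgue (\<lambda>x. f (c *\<^sub>R x + v)) = (1 / \<bar>c\<bar> ^ 3) *\<^sub>R integral\<^sup>L lebesgue f"
    and integrable_lebesgue_affine: "integrable lebesgue f \<Longrightarrow> integrable lebesgue (\<lambda>x. f (c *\<^sub>R x + v))"
proof -
  define T where "T x = v + (\<Sum>j\<in>Basis. (c * (x \<bullet> j)) *\<^sub>R j)" for x :: "real^3"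
  have T: "T = (\<lambda>x. c *\<^sub>R x + v)"
    by (auto simp: T_def scaleR_scaleR[symmetric] scaleR_sum_right[symmetric] euclidean_representation
        simp del: scaleR_scaleR)
  have TT: "(\<lambda>x. v + (\<Sum>j\<in>Basis. (c * (x \<bullet> j)) *\<^sub>R j)) = T" by (simp add: T_def fun_eq_iff)
  show m: "(\<lambda>x::real^3. c *\<^sub>R x + v) \<in> lebesgue \<rightarrow>\<^sub>M lebesgue"
    using lebesgue_affine_measurable[of "\<lambda>_. c" v] c unfolding TT T by simp
  have e: "lebesgue = density (distr lebesgue lebesgue (\<lambda>x. c *\<^sub>R x + v)) (\<lambda>_. ennreal (\<bar>c\<bar> ^ 3))"
    using lebesgue_affine_euclidean[of "\<lambda>_::real^3. c" v] c unfolding TT T by (simp add: ennreal_power)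
  show "AE x in lebesgue. P (c *\<^sub>R (x::real^3) + v)" if "AE x in lebesgue. P x"
  proof -
    have "AE x in density (distr lebesgue lebesgue (\<lambda>x. c *\<^sub>R x + v)) (\<lambda>_. ennreal (\<bar>c\<bar> ^ 3)). P x"
      unfolding e[symmetric] by (rule that)
    then have "AE x in distr lebesgue lebesgue (\<lambda>x. c *\<^sub>R x + v). P x"
      using c by (subst (asm) AE_density) auto
    from AE_distrD[OF m this] show ?thesis .
  qed
  show "integral\<^sup>L lebesgue (\<lambda>x. f (c *\<^sub>R x + v)) = (1 / \<bar>c\<bar> ^ 3) *\<^sub>R integral\<^sup>L lebesgue f"
    if f[measurable]: "f \<in> borel_measurable lebesgue"
  proof -
    note [measurable] = m
    have "integral\<^sup>L lebesgue f = \<bar>c\<bar> ^ 3 *\<^sub>R integral\<^sup>L lebesgue (\<lambda>x. f (c *\<^sub>R x + v))"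
      by (subst e, subst integral_density) (auto simp: integral_distr)
    then show ?thesis using c by simp
  qed
  show "integrable lebesgue (\<lambda>x. f (c *\<^sub>R x + v))" if f: "integrable lebesgue f"
  proof -
    note [measurable] = m borel_measurable_integrable[OF f]
    have "integrable (density (distr lebesgue lebesgue (\<lambda>x. c *\<^sub>R x + v)) (\<lambda>_. ennreal (\<bar>c\<bar> ^ 3))) f"
      unfolding e[symmetric] by (rule f)
    then have "integrable lebesgue (\<lambda>x. \<bar>c\<bar> ^ 3 *\<^sub>R f (c *\<^sub>R x + v))"
      by (subst (asm) integrable_density) (auto simp: integrable_distr_eq)
    from integrable_scaleR_right[OF this, of "1 / \<bar>c\<bar> ^ 3"] c show ?thesis by simp
  qed
qed

lemma measurable_lebesgue_affine_compose:
  "f \<in> borel_measurable lebesgue \<Longrightarrow> c \<noteq> 0 \<Longrightarrow> (\<lambda>x::real^3. f (c *\<^sub>R x + v)) \<in> borel_measurable lebesgue"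
  by (rule measurable_compose[OF measurable_lebesgue_affine])

text \<open>Fubini arguments below need functions of \<open>(s, x)\<close> such as
  \<open>w (flow \<kappa> v s x)\<close> to be measurable for the product of two Borel measures.
  Composing a merely Lebesgue measurable \<open>w\<close> does not provide this, so a Borel
  representative is taken first.\<close>

lemma ex_borel_AE_eq:
  fixes f :: "real^3 \<Rightarrow> 'b::euclidean_space"
  assumes [measurable]: "f \<in> borel_measurable lebesgue"
  obtains f' where "f' \<in> borel_measurable borel" "AE x in lebesgue. f x = f' x"
proof -
  have "\<exists>g. g \<in> borel_measurable borel \<and> (AE x in lborel. f x \<bullet> b = g x)" for b
    using completion_ex_borel_measurable_real[of "\<lambda>x. f x \<bullet> b" lborel] by auto
  then obtain g where g: "\<And>b. g b \<in> borel_measurable borel" "\<And>b. AE x in lborel. f x \<bullet> b = g b x"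
    by metis
  have "AE x in lborel. \<forall>b\<in>Basis. f x \<bullet> b = g b x" using g(2) by (intro AE_finite_allI) auto
  then have "AE x in lborel. f x = (\<Sum>b\<in>Basis. g b x *\<^sub>R b)"
    by eventually_elim (metis (no_types, lifting) euclidean_representation sum.cong)
  then have "AE x in lebesgue. f x = (\<Sum>b\<in>Basis. g b x *\<^sub>R b)" by (rule AE_completion)
  moreover have "(\<lambda>x. \<Sum>b\<in>Basis. g b x *\<^sub>R b) \<in> borel_measurable borel" using g(1) by measurable
  ultimately show thesis using that by blast
qed

lemma integral_lebesgue_lborel:
  fixes f :: "'a::euclidean_space \<Rightarrow> 'b::{banach, second_countable_topology}"
  assumes "f \<in> borel_measurable borel"
  shows "integral\<^sup>L lebesgue f = integral\<^sup>L lborel f"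
    and "integrable lebesgue f \<longleftrightarrow> integrable lborel f"
  using assms by (simp_all add: integral_completion integrable_completion)

subsection \<open>Square-integrable functions\<close>

lemma in_L2_iff: "in_Lp 2 f \<longleftrightarrow> f \<in> borel_measurable lebesgue \<and> integrable lebesgue (\<lambda>x. (norm (f x))\<^sup>2)"
  by (simp add: in_Lp_def)

lemma in_L2_measurable: "in_Lp 2 f \<Longrightarrow> f \<in> borel_measurable lebesgue"
  by (simp add: in_L2_iff)

lemma L2_nrm_nonneg: "L2_nrm f \<ge> 0"
  by (simp add: L2_nrm_def)

lemma L2_nrm_power2: "(L2_nrm f)\<^sup>2 = (LINT x|lebesgue. (norm (f x))\<^sup>2)"
  by (simp add: L2_nrm_def)

lemma L2_nrm_cong_AE:
  assumes "f \<in> borel_measurable lebesgue" "g \<in> borel_measurable lebesgue"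
    and "AE x in lebesgue. norm (f x) = norm (g x)"
  shows "L2_nrm f = L2_nrm g"
proof -
  have "(LINT x|lebesgue. (norm (f x))\<^sup>2) = (LINT x|lebesgue. (norm (g x))\<^sup>2)"
    using assms by (intro integral_cong_AE) (auto elim: eventually_mono)
  then show ?thesis by (simp add: L2_nrm_def)
qed

lemma in_L2_bound:
  assumes "in_Lp 2 f" and [measurable]: "g \<in> borel_measurable lebesgue"
    and "AE x in lebesgue. norm (g x) \<le> C * norm (f x)"
  shows "in_Lp 2 g" "C \<ge> 0 \<Longrightarrow> L2_nrm g \<le> C * L2_nrm f"
proof -
  have i: "integrable lebesgue (\<lambda>x. C\<^sup>2 * (norm (f x))\<^sup>2)" using assms(1) by (simp add: in_L2_iff)
  have b: "AE x in lebesgue. (norm (g x))\<^sup>2 \<le> C\<^sup>2 * (norm (f x))\<^sup>2"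
    using assms(3) by eventually_elim (metis norm_ge_zero power_mono power_mult_distrib)
  have ig: "integrable lebesgue (\<lambda>x. (norm (g x))\<^sup>2)"
    by (rule Bochner_Integration.integrable_bound[OF i]) (use b in \<open>auto elim: eventually_mono\<close>)
  then show "in_Lp 2 g" by (simp add: in_L2_iff)
  assume C: "C \<ge> 0"
  have "(LINT x|lebesgue. (norm (g x))\<^sup>2) \<le> (LINT x|lebesgue. C\<^sup>2 * (norm (f x))\<^sup>2)"
    by (rule integral_mono_AE[OF ig i b])
  also have "\<dots> = C\<^sup>2 * (LINT x|lebesgue. (norm (f x))\<^sup>2)" by simp
  finally show "L2_nrm g \<le> C * L2_nrm f"
    unfolding L2_nrm_def using C by (metis real_sqrt_le_mono real_sqrt_mult real_sqrt_abs abs_of_nonneg)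
qed

lemma in_L2_add:
  fixes f g :: "real^3 \<Rightarrow> 'a::{real_normed_vector, second_countable_topology}"
  assumes "in_Lp 2 f" "in_Lp 2 g" shows "in_Lp 2 (\<lambda>x. f x + g x)"
proof -
  have [measurable]: "f \<in> borel_measurable lebesgue" "g \<in> borel_measurable lebesgue"
    using assms by (auto simp: in_L2_iff)
  have i: "integrable lebesgue (\<lambda>x. 2 * (norm (f x))\<^sup>2 + 2 * (norm (g x))\<^sup>2)"
    using assms by (simp add: in_L2_iff)
  have "integrable lebesgue (\<lambda>x. (norm (f x + g x))\<^sup>2)"
  proof (rule Bochner_Integration.integrable_bound[OF i])
    have "(norm (f x + g x))\<^sup>2 \<le> 2 * (norm (f x))\<^sup>2 + 2 * (norm (g x))\<^sup>2" for x
    proof -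
      have "(norm (f x + g x))\<^sup>2 \<le> (norm (f x) + norm (g x))\<^sup>2"
        by (intro power_mono norm_triangle_ineq norm_ge_zero)
      also have "\<dots> \<le> 2 * (norm (f x))\<^sup>2 + 2 * (norm (g x))\<^sup>2"
        by (simp add: power2_sum) (smt (verit) sum_squares_bound)
      finally show ?thesis .
    qed
    then show "AE x in lebesgue. norm ((norm (f x + g x))\<^sup>2) \<le> norm (2 * (norm (f x))\<^sup>2 + 2 * (norm (g x))\<^sup>2)"
      by (intro AE_I2) (simp add: abs_of_nonneg)
  qed simp
  then show ?thesis by (simp add: in_L2_iff)
qed

lemma in_L2_scaleR: "in_Lp 2 f \<Longrightarrow> in_Lp 2 (\<lambda>x. c *\<^sub>R f x)"
  by (auto simp: in_L2_iff power_mult_distrib)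

lemma in_L2_diff:
  fixes f g :: "real^3 \<Rightarrow> 'a::{real_normed_vector, second_countable_topology}"
  assumes "in_Lp 2 f" "in_Lp 2 g" shows "in_Lp 2 (\<lambda>x. f x - g x)"
  using in_L2_add[OF assms(1) in_L2_scaleR[OF assms(2), of "-1"]] by simp

lemma in_L2_nth:
  fixes g :: "real^3 \<Rightarrow> complex^3"
  assumes "in_Lp 2 g" shows "in_Lp 2 (\<lambda>x. g x $ i)"
proof (rule in_L2_bound(1)[OF assms, of _ 1])
  have "(\<lambda>v::complex^3. v $ i) \<in> borel_measurable borel"
    by (intro borel_measurable_continuous_onI continuous_intros)
  then show "(\<lambda>x. g x $ i) \<in> borel_measurable lebesgue"
    by (rule measurable_compose[OF in_L2_measurable[OF assms]])
qed (simp add: Finite_Cartesian_Product.norm_nth_le)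

lemma Cauchy_Schwarz_integral:
  fixes f g :: "'x \<Rightarrow> real"
  assumes [measurable]: "f \<in> borel_measurable M" "g \<in> borel_measurable M"
    and f: "integrable M (\<lambda>x. (f x)\<^sup>2)" and g: "integrable M (\<lambda>x. (g x)\<^sup>2)"
  shows "integrable M (\<lambda>x. \<bar>f x\<bar> * \<bar>g x\<bar>)"
    and "(\<integral>x. \<bar>f x\<bar> * \<bar>g x\<bar> \<partial>M)\<^sup>2 \<le> (\<integral>x. (f x)\<^sup>2 \<partial>M) * (\<integral>x. (g x)\<^sup>2 \<partial>M)"
proof -
  have i: "integrable M (\<lambda>x. (f x)\<^sup>2 + (g x)\<^sup>2)" using f g by simp
  show p: "integrable M (\<lambda>x. \<bar>f x\<bar> * \<bar>g x\<bar>)"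
  proof (rule Bochner_Integration.integrable_bound[OF i])
    have "\<bar>f x\<bar> * \<bar>g x\<bar> \<le> (f x)\<^sup>2 + (g x)\<^sup>2" for x
      using sum_squares_bound[of "\<bar>f x\<bar>" "\<bar>g x\<bar>"] mult_nonneg_nonneg[of "\<bar>f x\<bar>" "\<bar>g x\<bar>"]
      unfolding power2_abs mult.assoc by linarith
    then show "AE x in M. norm (\<bar>f x\<bar> * \<bar>g x\<bar>) \<le> norm ((f x)\<^sup>2 + (g x)\<^sup>2)"
      by (intro AE_I2) (simp add: abs_mult)
  qed simp
  have "(\<integral>\<^sup>+x. ennreal \<bar>f x\<bar> * ennreal \<bar>g x\<bar> \<partial>M)\<^sup>2
      \<le> (\<integral>\<^sup>+x. (ennreal \<bar>f x\<bar>)\<^sup>2 \<partial>M) * (\<integral>\<^sup>+x. (ennreal \<bar>g x\<bar>)\<^sup>2 \<partial>M)"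
    by (rule Cauchy_Schwarz_nn_integral) auto
  also have "(\<integral>\<^sup>+x. ennreal \<bar>f x\<bar> * ennreal \<bar>g x\<bar> \<partial>M) = ennreal (\<integral>x. \<bar>f x\<bar> * \<bar>g x\<bar> \<partial>M)"
    using nn_integral_eq_integral[OF p] by (simp add: ennreal_mult)
  also have "(\<integral>\<^sup>+x. (ennreal \<bar>f x\<bar>)\<^sup>2 \<partial>M) = ennreal (\<integral>x. (f x)\<^sup>2 \<partial>M)"
    using nn_integral_eq_integral[OF f] by (simp add: ennreal_power)
  also have "(\<integral>\<^sup>+x. (ennreal \<bar>g x\<bar>)\<^sup>2 \<partial>M) = ennreal (\<integral>x. (g x)\<^sup>2 \<partial>M)"
    using nn_integral_eq_integral[OF g] by (simp add: ennreal_power)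
  finally show "(\<integral>x. \<bar>f x\<bar> * \<bar>g x\<bar> \<partial>M)\<^sup>2 \<le> (\<integral>x. (f x)\<^sup>2 \<partial>M) * (\<integral>x. (g x)\<^sup>2 \<partial>M)"
    by (simp add: ennreal_power ennreal_mult[symmetric])
qed

text \<open>The pointwise bound is asked only almost everywhere, so that weights singular at the
  origin can be shared between the two factors.\<close>

lemma L2_product:
  fixes h :: "real^3 \<Rightarrow> 'a::{banach, second_countable_topology}"
  assumes f: "in_Lp 2 f" and g: "in_Lp 2 g" and h[measurable]: "h \<in> borel_measurable lebesgue"
    and b: "AE x in lebesgue. norm (h x) \<le> norm (f x) * norm (g x)"
  shows "integrable lebesgue h" "(LINT x|lebesgue. norm (h x)) \<le> L2_nrm f * L2_nrm g"
    "norm (LINT x|lebesgue. h x) \<le> L2_nrm f * L2_nrm g"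
proof -
  have m: "(\<lambda>x. norm (f x)) \<in> borel_measurable lebesgue" "(\<lambda>x. norm (g x)) \<in> borel_measurable lebesgue"
    using f g by (auto simp: in_L2_iff)
  have p: "integrable lebesgue (\<lambda>x. norm (f x) * norm (g x))"
    and q: "(LINT x|lebesgue. norm (f x) * norm (g x))\<^sup>2 \<le> (L2_nrm f)\<^sup>2 * (L2_nrm g)\<^sup>2"
    using Cauchy_Schwarz_integral[OF m] f g by (auto simp: in_L2_iff L2_nrm_power2)
  show h': "integrable lebesgue h"
    by (rule Bochner_Integration.integrable_bound[OF p h]) (use b in simp)
  have "(LINT x|lebesgue. norm (f x) * norm (g x)) \<le> L2_nrm f * L2_nrm g"
    using q by - (rule power2_le_imp_le, auto simp: power_mult_distrib L2_nrm_nonneg)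
  moreover have "(LINT x|lebesgue. norm (h x)) \<le> (LINT x|lebesgue. norm (f x) * norm (g x))"
    by (rule integral_mono_AE) (use h' p b in auto)
  ultimately show "(LINT x|lebesgue. norm (h x)) \<le> L2_nrm f * L2_nrm g" by simp
  then show "norm (LINT x|lebesgue. h x) \<le> L2_nrm f * L2_nrm g"
    using integral_norm_bound[of lebesgue h] by linarith
qed

lemma L2_nrm_triangle:
  fixes f g :: "real^3 \<Rightarrow> 'a::{real_normed_vector, second_countable_topology}"
  assumes f: "in_Lp 2 f" and g: "in_Lp 2 g"
  shows "L2_nrm (\<lambda>x. f x + g x) \<le> L2_nrm f + L2_nrm g"
proof -
  have [measurable]: "f \<in> borel_measurable lebesgue" "g \<in> borel_measurable lebesgue"
    using assms by (auto simp: in_L2_iff)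
  have fg: "integrable lebesgue (\<lambda>x. norm (f x) * norm (g x))"
    and le: "(LINT x|lebesgue. norm (norm (f x) * norm (g x))) \<le> L2_nrm f * L2_nrm g"
    by (rule L2_product[OF f g]; simp add: norm_mult)+
  have i: "integrable lebesgue (\<lambda>x. (norm (f x))\<^sup>2)" "integrable lebesgue (\<lambda>x. (norm (g x))\<^sup>2)"
    using f g by (auto simp: in_L2_iff)
  have "(L2_nrm (\<lambda>x. f x + g x))\<^sup>2 = (LINT x|lebesgue. (norm (f x + g x))\<^sup>2)" by (rule L2_nrm_power2)
  also have "\<dots> \<le> (LINT x|lebesgue. (norm (f x))\<^sup>2 + (norm (g x))\<^sup>2 + 2 * (norm (f x) * norm (g x)))"
  proof (rule integral_mono)
    show "integrable lebesgue (\<lambda>x. (norm (f x + g x))\<^sup>2)" using in_L2_add[OF f g] by (simp add: in_L2_iff)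
    show "(norm (f x + g x))\<^sup>2 \<le> (norm (f x))\<^sup>2 + (norm (g x))\<^sup>2 + 2 * (norm (f x) * norm (g x))" for x
      using power_mono[OF norm_triangle_ineq[of "f x" "g x"], of 2] by (simp add: power2_sum mult.assoc)
  qed (use i fg in auto)
  also have "\<dots> \<le> (L2_nrm f + L2_nrm g)\<^sup>2"
    using i fg le by (simp add: power2_sum L2_nrm_power2 mult.assoc norm_mult)
  finally show ?thesis by (rule power2_le_imp_le) (simp add: L2_nrm_nonneg)
qed

lemma L2_nrm_scaleR: "L2_nrm (\<lambda>x. c *\<^sub>R f x) = \<bar>c\<bar> * L2_nrm f"
  by (simp add: L2_nrm_def power_mult_distrib real_sqrt_mult)

lemma L2_affine:
  assumes "in_Lp 2 f" "c \<noteq> 0"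
  shows "in_Lp 2 (\<lambda>x. f (c *\<^sub>R x + v))"
    and "L2_nrm (\<lambda>x. f (c *\<^sub>R x + v)) = L2_nrm f / sqrt (\<bar>c\<bar> ^ 3)"
proof -
  have m: "f \<in> borel_measurable lebesgue" and i: "integrable lebesgue (\<lambda>x. (norm (f x))\<^sup>2)"
    using assms(1) by (auto simp: in_L2_iff)
  show "in_Lp 2 (\<lambda>x. f (c *\<^sub>R x + v))"
    using integrable_lebesgue_affine[OF assms(2) i] measurable_lebesgue_affine_compose[OF m assms(2)]
    by (simp add: in_L2_iff)
  show "L2_nrm (\<lambda>x. f (c *\<^sub>R x + v)) = L2_nrm f / sqrt (\<bar>c\<bar> ^ 3)"
    using integral_lebesgue_affine[OF assms(2), of "\<lambda>x. (norm (f x))\<^sup>2" v] i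
    by (simp add: L2_nrm_def real_sqrt_divide borel_measurable_integrable)
qed

subsection \<open>Locally integrable functions and the fundamental lemma\<close>

text \<open>A common class for \<open>V\<close>, \<open>W\<close>, square-integrable functions and
  expressions such as x . \<nabla>f whose coefficients grow; integrability on balls is enough for
  pairing with compactly supported functions.\<close>

definition loc_int :: "(real^3 \<Rightarrow> 'a::{banach, second_countable_topology}) \<Rightarrow> bool" where
  "loc_int f \<longleftrightarrow> f \<in> borel_measurable lebesgue \<and> (\<forall>r. integrable lebesgue (\<lambda>x. indicator (cball 0 r) x *\<^sub>R f x))"

lemma cball_lebesgue [measurable]: "cball a r \<in> sets lebesgue" for a :: "real^3"
  by (simp add: sets_completionI_sets)

lemma loc_int_measurable: "loc_int f \<Longrightarrow> f \<in> borel_measurable lebesgue"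
  by (simp add: loc_int_def)

lemma integrable_indicator_cball: "integrable lebesgue (\<lambda>x::real^3. C * indicator (cball a r) x :: real)"
  by (intro integrable_mult_right)
     (simp add: integrable_indicator_iff emeasure_lborel_cball_finite[unfolded infinity_ennreal_def])

lemma loc_int_bound:
  fixes f :: "real^3 \<Rightarrow> 'a::{banach, second_countable_topology}"
  assumes f[measurable]: "f \<in> borel_measurable lebesgue" and h: "integrable lebesgue h"
    and b: "AE x in lebesgue. norm (f x) \<le> C + h x" "\<And>x. h x \<ge> 0" "C \<ge> 0"
  shows "loc_int f"
  unfolding loc_int_def
proof (intro conjI allI f)
  fix r
  have i: "integrable lebesgue (\<lambda>x. C * indicator (cball 0 r) x + h x)"
    by (intro Bochner_Integration.integrable_add h integrable_indicator_cball)
  show "integrable lebesgue (\<lambda>x. indicator (cball 0 r) x *\<^sub>R f x)"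
  proof (rule Bochner_Integration.integrable_bound[OF i])
    show "AE x in lebesgue. norm (indicator (cball 0 r) x *\<^sub>R f x)
        \<le> norm (C * indicator (cball 0 r) x + h x)"
      using b(1) by eventually_elim (use b(2,3) in \<open>auto simp: indicator_def\<close>)
  qed measurable
qed

lemma loc_int_L2:
  fixes f :: "real^3 \<Rightarrow> 'a::{banach, second_countable_topology}"
  assumes "in_Lp 2 f" shows "loc_int f"
proof (rule loc_int_bound)
  have "norm (f x) \<le> 1 + (norm (f x))\<^sup>2" for x
    using sum_squares_bound[of "norm (f x)" 1] by (simp add: power2_eq_square) (smt (verit) norm_ge_zero mult_nonneg_nonneg)
  then show "AE x in lebesgue. norm (f x) \<le> 1 + (norm (f x))\<^sup>2" by simp
qed (use assms in \<open>auto simp: in_L2_iff\<close>)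

lemma loc_int_Lp:
  fixes f :: "real^3 \<Rightarrow> 'a::{banach, second_countable_topology}"
  assumes "in_Lp p f" "p \<ge> 1" shows "loc_int f"
proof (rule loc_int_bound)
  have "norm (f x) \<le> 1 + norm (f x) powr p" for x
  proof (cases "norm (f x) \<le> 1")
    case False
    then have "norm (f x) powr 1 \<le> norm (f x) powr p" using assms(2) by (intro powr_mono) auto
    with False show ?thesis by simp
  qed (smt (verit) powr_ge_zero)
  then show "AE x in lebesgue. norm (f x) \<le> 1 + norm (f x) powr p" by simp
qed (use assms in \<open>auto simp: in_Lp_def\<close>)

lemma loc_int_cmult:
  assumes "loc_int f" and [measurable]: "h \<in> borel_measurable lebesgue"
    and "\<And>x. norm (h x) \<le> C x * norm (f x)" and "continuous_on UNIV C"
  shows "loc_int h"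
  unfolding loc_int_def
proof (intro conjI allI)
  fix r :: real
  have "bounded (C ` cball 0 r)"
    by (intro compact_imp_bounded compact_continuous_image compact_cball continuous_on_subset[OF assms(4)]) auto
  then obtain B where B: "\<And>x. norm x \<le> r \<Longrightarrow> \<bar>C x\<bar> \<le> B" unfolding bounded_iff by force
  have i: "integrable lebesgue (\<lambda>x. B *\<^sub>R norm (indicator (cball 0 r) x *\<^sub>R f x))"
    by (intro integrable_scaleR_right integrable_norm) (use assms(1) in \<open>simp add: loc_int_def\<close>)
  show "integrable lebesgue (\<lambda>x. indicator (cball 0 r) x *\<^sub>R h x)"
  proof (rule Bochner_Integration.integrable_bound[OF i], measurable, intro AE_I2)
    fix x
    show "norm (indicat_real (cball 0 r) x *\<^sub>R h x) \<le> norm (B *\<^sub>R norm (indicat_real (cball 0 r) x *\<^sub>R f x))"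
    proof (cases "norm x \<le> r")
      case True
      have "norm (h x) \<le> C x * norm (f x)" by (rule assms(3))
      also have "\<dots> \<le> \<bar>B\<bar> * norm (f x)" using B[OF True] by (intro mult_right_mono) auto
      finally show ?thesis using True by (simp add: abs_mult)
    qed simp
  qed
qed measurable

lemma loc_int_diff: "loc_int f \<Longrightarrow> loc_int g \<Longrightarrow> loc_int (\<lambda>x. f x - g x)"
  by (auto simp: loc_int_def scaleR_diff_right)

lemma smooth_measurable: "smooth c \<Longrightarrow> c \<in> borel_measurable borel"
  by (intro borel_measurable_continuous_onI smooth_continuous_on)

lemma measurable_lebesgue_borel: "f \<in> borel_measurable borel \<Longrightarrow> f \<in> borel_measurable lebesgue"
  by (rule measurable_completion) simp

lemma smooth_measurable_lebesgue: "smooth c \<Longrightarrow> c \<in> borel_measurable lebesgue"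
  by (intro measurable_lebesgue_borel smooth_measurable)

lemma integrable_test_function_scaleR:
  assumes \<phi>: "test_function \<phi>" and f: "loc_int f"
  shows "integrable lebesgue (\<lambda>x. \<phi> x *\<^sub>R f x)"
proof -
  note [measurable] = smooth_measurable_lebesgue[OF test_function_smooth[OF \<phi>]] loc_int_measurable[OF f]
  obtain r C where rC: "r > 0" "C > 0" "\<And>x. \<bar>\<phi> x\<bar> \<le> C * indicator (cball 0 r) x"
    using test_function_bounded[OF \<phi>] by metis
  have i: "integrable lebesgue (\<lambda>x. C *\<^sub>R norm (indicator (cball 0 r) x *\<^sub>R f x))"
    by (intro integrable_scaleR_right integrable_norm) (use f in \<open>simp add: loc_int_def\<close>)
  show ?thesis
  proof (rule Bochner_Integration.integrable_bound[OF i], measurable, intro AE_I2)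
    fix x show "norm (\<phi> x *\<^sub>R f x) \<le> norm (C *\<^sub>R norm (indicat_real (cball 0 r) x *\<^sub>R f x))"
      using mult_right_mono[OF rC(3)[of x], of "norm (f x)"] rC(2) by (simp add: abs_mult mult.assoc)
  qed
qed

lemma box_subset_cball:
  obtains r where "box a b \<subseteq> cball (0::real^3) r"
  using bounded_box[of a b] unfolding bounded_iff subset_iff mem_cball_0 by blast

text \<open>Test functions approximate the indicator of any box, so all box integrals vanish. Boxes
  are stable under intersection and generate the Borel sets, and the sets with vanishing integral
  form a Dynkin system.\<close>

lemma fundamental_lemma_borel:
  fixes f :: "real^3 \<Rightarrow> complex"
  assumes f: "loc_int f" and [measurable]: "f \<in> borel_measurable borel"
    and z: "\<And>\<phi>. test_function \<phi> \<Longrightarrow> (LINT x|lebesgue. \<phi> x *\<^sub>R f x) = 0"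
  shows "AE x in lebesgue. f x = 0"
proof -
  have loc: "integrable lborel (\<lambda>x. indicator (cball 0 r) x *\<^sub>R f x)" for r
  proof -
    have "(\<lambda>x. indicator (cball 0 r) x *\<^sub>R f x) \<in> borel_measurable borel"
      by (intro borel_measurable_scaleR borel_measurable_indicator assms(2)) simp
    from integral_lebesgue_lborel(2)[OF this] f show ?thesis by (simp add: loc_int_def)
  qed
  have box0: "(LINT x|lborel. indicator (box a b) x *\<^sub>R f x) = 0" for a b
  proof -
    obtain \<phi> :: "nat \<Rightarrow> real^3 \<Rightarrow> real" where \<phi>: "\<And>n. test_function (\<phi> n)" "\<And>n x. 0 \<le> \<phi> n x"
      "\<And>n x. \<phi> n x \<le> indicator (box a b) x" "\<And>x. (\<lambda>n. \<phi> n x) \<longlonglongrightarrow> indicator (box a b) x"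
      using test_function_tendsto_indicator_box by blast
    note [measurable] = smooth_measurable[OF test_function_smooth[OF \<phi>(1)]]
    obtain r where r: "box a b \<subseteq> cball 0 r" by (rule box_subset_cball)
    have "(\<lambda>n. LINT x|lborel. \<phi> n x *\<^sub>R f x) \<longlonglongrightarrow> (LINT x|lborel. indicator (box a b) x *\<^sub>R f x)"
    proof (rule integral_dominated_convergence[OF _ _ integrable_norm[OF loc[of r]]])
      show "AE x in lborel. (\<lambda>n. \<phi> n x *\<^sub>R f x) \<longlonglongrightarrow> indicator (box a b) x *\<^sub>R f x"
        by (intro AE_I2 tendsto_scaleR \<phi>(4) tendsto_const)
      show "AE x in lborel. norm (\<phi> n x *\<^sub>R f x) \<le> norm (indicator (cball 0 r) x *\<^sub>R f x)" for n
      proof (intro AE_I2)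
        fix x
        have "\<phi> n x \<le> indicator (cball 0 r) x"
          using \<phi>(3)[of n x] subsetD[OF r, of x] by (cases "x \<in> box a b") (auto simp: indicator_def)
        then show "norm (\<phi> n x *\<^sub>R f x) \<le> norm (indicator (cball 0 r) x *\<^sub>R f x)"
          using \<phi>(2)[of n x] by (simp add: mult_right_mono)
      qed
    qed measurable
    moreover have "(LINT x|lborel. \<phi> n x *\<^sub>R f x) = 0" for n
      using z[OF \<phi>(1)] by (subst (asm) integral_lebesgue_lborel) auto
    ultimately show ?thesis by (simp add: LIMSEQ_const_iff)
  qed
  have "AE x in lborel. indicator (box (- real n *\<^sub>R One) (real n *\<^sub>R One)) x *\<^sub>R f x = 0" for n
  proof -
    define B where "B = box (- real n *\<^sub>R One) (real n *\<^sub>R One :: real^3)"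
    \<comment> \<open>The cutoff makes the function integrable on the whole space, as the criterion
      for densities requires. Since two boxes intersect in a box, the box integrals of the cut-off
      function still vanish.\<close>
    define F where "F x = indicator B x *\<^sub>R f x" for x
    obtain r where r: "B \<subseteq> cball 0 r" unfolding B_def by (rule box_subset_cball)
    have [measurable]: "B \<in> sets borel" by (simp add: B_def)
    have [measurable]: "F \<in> borel_measurable borel" unfolding F_def by measurable
    have Fi: "integrable lborel F"
    proof (rule Bochner_Integration.integrable_bound[OF loc[of r]])
      have "norm (F x) \<le> norm (indicator (cball 0 r) x *\<^sub>R f x)" for x
        using subsetD[OF r, of x] by (cases "x \<in> B") (auto simp: F_def)
      then show "AE x in lborel. norm (F x) \<le> norm (indicator (cball 0 r) x *\<^sub>R f x)" by simp
    qed measurable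
    have F0: "(LINT x|lborel. indicator A x *\<^sub>R F x) = 0" if "A = box a b" for A and a b :: "real^3"
    proof -
      have "indicator A x *\<^sub>R F x = indicator (A \<inter> B) x *\<^sub>R f x" for x
        by (simp add: F_def indicator_inter_arith)
      then show ?thesis using box0 unfolding that B_def by (simp add: box_Int_box)
    qed
    have "AE x in lborel. F x = 0"
    proof (rule sigma_finite_measure.density_zero[OF lborel.sigma_finite_measure_axioms Fi])
      fix A :: "(real^3) set" assume "A \<in> sets lborel"
      then have A: "A \<in> sigma_sets UNIV (range (\<lambda>(a, b). box a b))"
        by (simp add: borel_eq_box sets_measure_of)
      have "Int_stable (range (\<lambda>(a, b). box a b::(real^3) set))"
        by (auto simp: Int_stable_def box_Int_box)
      from this subset_UNIV[of "range (\<lambda>(a, b). box a b::(real^3) set)", folded Pow_UNIV] A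
      have "A \<in> sets borel \<and> (LINT x|lborel. indicator A x *\<^sub>R F x) = 0"
      proof (induction rule: sigma_sets_induct_disjoint)
        case (basic A) then show ?case using F0 by auto
      next
        case empty then show ?case by simp
      next
        case (compl A)
        \<comment> \<open>\<open>F\<close> lives on \<open>B\<close>, so its total integral is
          itself a box integral; complements need this value.\<close>
        have "(LINT x|lborel. F x) = 0"
        proof -
          have "indicator B x *\<^sub>R F x = F x" for x by (cases "x \<in> B") (simp_all add: F_def)
          then show ?thesis using F0[OF B_def] by simp
        qed
        moreover have "(LINT x|lborel. indicator (UNIV - A) x *\<^sub>R F x)
            = (LINT x|lborel. F x - indicator A x *\<^sub>R F x)"
          by (intro Bochner_Integration.integral_cong) (auto simp: indicator_def)
        moreover have "integrable lborel (\<lambda>x. indicator A x *\<^sub>R F x)"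
          using compl Fi by (intro integrable_mult_indicator) auto
        ultimately show ?case using compl Fi by auto
      next
        case (union A)
        then have [measurable]: "\<And>i. A i \<in> sets borel" by auto
        have "set_integrable lborel (\<Union>i. A i) F"
          unfolding set_integrable_def using Fi by (intro integrable_mult_indicator) auto
        from lebesgue_integral_countable_add[OF _ _ this] union
        show ?case by (auto simp: set_lebesgue_integral_def disjoint_family_on_def)
      qed
      then show "set_lebesgue_integral lborel A F = 0" by (simp add: set_lebesgue_integral_def)
    qed
    then show ?thesis by (simp add: F_def B_def)
  qed
  then have "AE x in lborel. \<forall>n. indicator (box (- real n *\<^sub>R One) (real n *\<^sub>R One)) x *\<^sub>R f x = 0"
    by (subst AE_all_countable) blast
  then have "AE x in lborel. f x = 0"
  proof eventually_elim
    case (elim x)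
    obtain n where "norm x < real n" using reals_Archimedean2 by blast
    then have "x \<in> box (- real n *\<^sub>R One) (real n *\<^sub>R One)"
      by (auto simp: mem_box) (smt (verit) Basis_le_norm)+
    with spec[OF elim, of n] show ?case by simp
  qed
  then show ?thesis by (rule AE_completion)
qed

lemma loc_int_cong_AE:
  assumes "loc_int f" and [measurable]: "g \<in> borel_measurable lebesgue"
    and "AE x in lebesgue. f x = g x"
  shows "loc_int g"
proof -
  note [measurable] = loc_int_measurable[OF assms(1)]
  have "integrable lebesgue (\<lambda>x. indicator (cball 0 r) x *\<^sub>R g x)" for r
  proof (rule integrable_cong_AE_imp[of _ "\<lambda>x. indicator (cball 0 r) x *\<^sub>R f x"])
    show "integrable lebesgue (\<lambda>x. indicator (cball 0 r) x *\<^sub>R f x)"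
      using assms(1) by (simp add: loc_int_def)
    show "AE x in lebesgue. indicator (cball 0 r) x *\<^sub>R f x = indicator (cball 0 r) x *\<^sub>R g x"
      using assms(3) by eventually_elim simp
  qed measurable
  with assms show ?thesis by (simp add: loc_int_def)
qed

lemma fundamental_lemma:
  fixes f :: "real^3 \<Rightarrow> complex"
  assumes f: "loc_int f"
    and z: "\<And>\<phi>. test_function \<phi> \<Longrightarrow> (LINT x|lebesgue. \<phi> x *\<^sub>R f x) = 0"
  shows "AE x in lebesgue. f x = 0"
proof -
  obtain f' where f': "f' \<in> borel_measurable borel" "AE x in lebesgue. f x = f' x"
    using ex_borel_AE_eq[OF loc_int_measurable[OF f]] by blast
  note [measurable] = loc_int_measurable[OF f] measurable_lebesgue_borel[OF f'(1)]
  have "AE x in lebesgue. f' x = 0"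
  proof (rule fundamental_lemma_borel[OF loc_int_cong_AE[OF f _ f'(2)] f'(1)])
    fix \<phi> :: "real^3 \<Rightarrow> real" assume \<phi>: "test_function \<phi>"
    note [measurable] = smooth_measurable_lebesgue[OF test_function_smooth[OF \<phi>]]
    have "(LINT x|lebesgue. \<phi> x *\<^sub>R f' x) = (LINT x|lebesgue. \<phi> x *\<^sub>R f x)"
      by (rule integral_cong_AE) (use f'(2) in \<open>auto elim: eventually_mono\<close>)
    then show "(LINT x|lebesgue. \<phi> x *\<^sub>R f' x) = 0" using z[OF \<phi>] by simp
  qed measurable
  with f'(2) show ?thesis by eventually_elim simp
qed

section \<open>Weak gradients\<close>

text \<open>A relation instead of the choice made in \<open>grad\<close>: for products, dilations
  and differences an explicit gradient can be written down and carried along, and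
  \<open>grad_AE\<close> leads back to \<open>grad\<close> where a functional mentions it.\<close>

definition H1_grad :: "(real^3 \<Rightarrow> complex) \<Rightarrow> (real^3 \<Rightarrow> complex^3) \<Rightarrow> bool" where
  "H1_grad f g \<longleftrightarrow> in_Lp 2 f \<and> in_Lp 2 g \<and> weak_gradient f g"

lemma H1_gradD: "H1_grad f g \<Longrightarrow> in_Lp 2 f" "H1_grad f g \<Longrightarrow> in_Lp 2 g"
  by (auto simp: H1_grad_def)

lemma in_H1_grad: "in_H1 f \<Longrightarrow> H1_grad f (grad f)"
  unfolding in_H1_def H1_grad_def grad_def
  by (metis (mono_tags, lifting) someI_ex)

lemma H1_grad_in_H1: "H1_grad f g \<Longrightarrow> in_H1 f"
  by (auto simp: H1_grad_def in_H1_def)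

lemma in_H1_L2: "in_H1 f \<Longrightarrow> in_Lp 2 f" and in_H1_L2_grad: "in_H1 f \<Longrightarrow> in_Lp 2 (grad f)"
  using in_H1_grad H1_gradD by blast+

lemma measurable_vec_nth:
  fixes g :: "'x \<Rightarrow> complex^3"
  assumes "g \<in> borel_measurable M" shows "(\<lambda>x. g x $ i) \<in> borel_measurable M"
proof -
  have "(\<lambda>v::complex^3. v $ i) \<in> borel_measurable borel"
    by (intro borel_measurable_continuous_onI continuous_intros)
  from measurable_compose[OF assms this] show ?thesis .
qed

lemma measurable_real_vec_nth [measurable]: "(\<lambda>x::real^3. x $ i) \<in> borel_measurable borel"
  by (intro borel_measurable_continuous_onI continuous_intros)

lemma measurable_vecI:
  fixes g :: "'x \<Rightarrow> complex^3"
  assumes [measurable]: "\<And>i. (\<lambda>x. g x $ i) \<in> borel_measurable M"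
  shows "g \<in> borel_measurable M"
proof (subst borel_measurable_euclidean_space, intro ballI)
  fix b :: "complex^3" assume "b \<in> Basis"
  then obtain i c where b: "b = axis i c" by (auto simp: Basis_vec_def)
  show "(\<lambda>x. g x \<bullet> b) \<in> borel_measurable M" unfolding b inner_axis by measurable
qed

lemma weak_gradient_cong_AE:
  assumes "weak_gradient f g" "AE x in lebesgue. f x = f' x" "AE x in lebesgue. g x = g' x"
    and [measurable]: "f \<in> borel_measurable lebesgue" "f' \<in> borel_measurable lebesgue"
    and g: "g \<in> borel_measurable lebesgue" "g' \<in> borel_measurable lebesgue"
  shows "weak_gradient f' g'"
  unfolding weak_gradient_def
proof (intro allI impI)
  fix \<phi> i assume \<phi>: "test_function \<phi>"
  note [measurable] = smooth_measurable_lebesgue[OF test_function_smooth[OF \<phi>]]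
    smooth_measurable_lebesgue[OF smooth_partial_deriv[OF test_function_smooth[OF \<phi>]]]
    measurable_vec_nth[OF g(1)] measurable_vec_nth[OF g(2)]
  have "(LINT x|lebesgue. partial_deriv i \<phi> x *\<^sub>R f' x) = (LINT x|lebesgue. partial_deriv i \<phi> x *\<^sub>R f x)"
    by (rule integral_cong_AE) (use assms(2) in \<open>auto elim: eventually_mono\<close>)
  moreover have "(LINT x|lebesgue. \<phi> x *\<^sub>R (g' x $ i)) = (LINT x|lebesgue. \<phi> x *\<^sub>R (g x $ i))"
    by (rule integral_cong_AE) (use assms(3) in \<open>auto elim: eventually_mono\<close>)
  ultimately show "(LINT x|lebesgue. partial_deriv i \<phi> x *\<^sub>R f' x) = - (LINT x|lebesgue. \<phi> x *\<^sub>R (g' x $ i))"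
    using assms(1) \<phi> by (simp add: weak_gradient_def)
qed

text \<open>Every component of the difference annihilates all test functions. Through
  \<open>grad_AE\<close> this makes the choice in \<open>grad\<close> harmless inside
  integrals.\<close>

lemma H1_grad_unique:
  assumes 1: "H1_grad f g" and 2: "H1_grad f' g'" and e: "AE x in lebesgue. f x = f' x"
  shows "AE x in lebesgue. g x = g' x"
proof -
  have w: "weak_gradient f' g"
    by (rule weak_gradient_cong_AE[OF _ e]) (use 1 2 in \<open>auto simp: H1_grad_def in_L2_iff\<close>)
  have "AE x in lebesgue. g x $ i - g' x $ i = 0" for i
  proof (rule fundamental_lemma)
    have g: "loc_int (\<lambda>x. g x $ i)" "loc_int (\<lambda>x. g' x $ i)"
      by (intro loc_int_L2 in_L2_nth H1_gradD(2)[OF 1] H1_gradD(2)[OF 2])+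
    then show "loc_int (\<lambda>x. g x $ i - g' x $ i)" by (rule loc_int_diff)
    fix \<phi> assume \<phi>: "test_function \<phi>"
    note ii = integrable_test_function_scaleR[OF \<phi> g(1)] integrable_test_function_scaleR[OF \<phi> g(2)]
    show "(LINT x|lebesgue. \<phi> x *\<^sub>R (g x $ i - g' x $ i)) = 0"
      using w 2 \<phi> ii unfolding weak_gradient_def H1_grad_def
      by (simp add: scaleR_diff_right)
  qed
  then have "AE x in lebesgue. \<forall>i\<in>UNIV. g x $ i - g' x $ i = 0" by (intro AE_finite_allI) auto
  then show ?thesis by eventually_elim (simp add: vec_eq_iff)
qed

lemma grad_AE:
  assumes "H1_grad f g" shows "AE x in lebesgue. grad f x = g x"
  using H1_grad_unique[OF in_H1_grad[OF H1_grad_in_H1[OF assms]] assms] by simp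

lemma L2_nrm_grad: "H1_grad f g \<Longrightarrow> L2_nrm (grad f) = L2_nrm g"
  by (rule L2_nrm_cong_AE)
     (auto intro: in_L2_measurable H1_gradD in_H1_L2_grad H1_grad_in_H1 dest: grad_AE elim: eventually_mono)

lemma H1_nrm_eq: "H1_grad f g \<Longrightarrow> (H1_nrm f)\<^sup>2 = (L2_nrm f)\<^sup>2 + (L2_nrm g)\<^sup>2"
  by (simp add: H1_nrm_def L2_nrm_grad)

lemma H1_nrm_nonneg: "H1_nrm f \<ge> 0"
  by (simp add: H1_nrm_def)

lemma L2_nrm_le_H1_nrm: "L2_nrm f \<le> H1_nrm f" "L2_nrm (grad f) \<le> H1_nrm f"
  by (auto simp: H1_nrm_def intro: real_le_rsqrt)

lemma H1_nrm_le: "H1_grad f g \<Longrightarrow> H1_nrm f \<le> L2_nrm f + L2_nrm g"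
  using sqrt_sum_squares_le_sum[OF L2_nrm_nonneg[of f] L2_nrm_nonneg[of g]]
  by (simp add: H1_nrm_def L2_nrm_grad)

lemma H1_grad_scaleR:
  assumes "H1_grad f g" shows "H1_grad (\<lambda>x. a *\<^sub>R f x) (\<lambda>x. a *\<^sub>R g x)"
proof -
  have "(LINT x|lebesgue. partial_deriv i \<phi> x *\<^sub>R (a *\<^sub>R f x)) = - (LINT x|lebesgue. \<phi> x *\<^sub>R ((a *\<^sub>R g x) $ i))"
    if "test_function \<phi>" for \<phi> i
  proof -
    have *: "(LINT x|lebesgue. partial_deriv i \<phi> x *\<^sub>R f x) = - (LINT x|lebesgue. \<phi> x *\<^sub>R (g x $ i))"
      using assms that by (simp add: H1_grad_def weak_gradient_def)
    have "(LINT x|lebesgue. partial_deriv i \<phi> x *\<^sub>R (a *\<^sub>R f x))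
        = (LINT x|lebesgue. a *\<^sub>R (partial_deriv i \<phi> x *\<^sub>R f x))"
      and "(LINT x|lebesgue. \<phi> x *\<^sub>R ((a *\<^sub>R g x) $ i))
        = (LINT x|lebesgue. a *\<^sub>R (\<phi> x *\<^sub>R (g x $ i)))"
      by (simp_all add: mult.commute)
    with * show ?thesis by (simp del: scaleR_scaleR)
  qed
  with assms show ?thesis by (auto simp: H1_grad_def in_L2_scaleR weak_gradient_def)
qed

lemma H1_grad_add:
  assumes 1: "H1_grad f g" and 2: "H1_grad f' g'"
  shows "H1_grad (\<lambda>x. f x + f' x) (\<lambda>x. g x + g' x)"
proof -
  have "(LINT x|lebesgue. partial_deriv i \<phi> x *\<^sub>R (f x + f' x)) = - (LINT x|lebesgue. \<phi> x *\<^sub>R ((g x + g' x) $ i))"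
    if \<phi>: "test_function \<phi>" for \<phi> i
  proof -
    note i1 = integrable_test_function_scaleR[OF \<phi> loc_int_L2[OF in_L2_nth]]
    note i2 = integrable_test_function_scaleR[OF test_function_partial_deriv[OF \<phi>] loc_int_L2]
    show ?thesis
      using assms \<phi> i1[of g i] i1[of g' i] i2[of f i] i2[of f' i]
      by (simp add: H1_grad_def weak_gradient_def scaleR_add_right)
  qed
  with assms show ?thesis by (auto simp: H1_grad_def in_L2_add weak_gradient_def)
qed

lemma H1_grad_diff:
  assumes 1: "H1_grad f g" and 2: "H1_grad f' g'"
  shows "H1_grad (\<lambda>x. f x - f' x) (\<lambda>x. g x - g' x)"
  using H1_grad_add[OF 1 H1_grad_scaleR[OF 2, of "-1"]] by simp

text \<open>The product rule for the test function \<open>c x * \<phi> x\<close> moves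
  \<open>c\<close> from one side of the weak formulation to the other. The bounds on
  \<open>c\<close> and its derivatives keep both terms of the gradient square integrable.\<close>

lemma H1_grad_smooth_mult:
  assumes fg: "H1_grad f g" and c: "smooth c"
    and C: "\<And>x. \<bar>c x\<bar> \<le> C" "\<And>i x. \<bar>partial_deriv i c x\<bar> \<le> C"
  shows "H1_grad (\<lambda>x. c x *\<^sub>R f x) (\<lambda>x. c x *\<^sub>R g x + (\<chi> i. partial_deriv i c x *\<^sub>R f x))"
proof -
  have f: "in_Lp 2 f" and g: "in_Lp 2 g" and w: "weak_gradient f g" using fg by (auto simp: H1_grad_def)
  note [measurable] = smooth_measurable_lebesgue[OF c] in_L2_measurable[OF f] in_L2_measurable[OF g]
    smooth_measurable_lebesgue[OF smooth_partial_deriv[OF c]]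
  have cf: "in_Lp 2 (\<lambda>x. c x *\<^sub>R f x)"
    by (rule in_L2_bound(1)[OF f, of _ C]) (auto intro!: AE_I2 mult_right_mono C)
  have cg: "in_Lp 2 (\<lambda>x. c x *\<^sub>R g x)"
    by (rule in_L2_bound(1)[OF g, of _ C]) (auto intro!: AE_I2 mult_right_mono C)
  have pf: "in_Lp 2 (\<lambda>x. partial_deriv i c x *\<^sub>R f x)" for i
    by (rule in_L2_bound(1)[OF f, of _ C]) (auto intro!: AE_I2 mult_right_mono C)
  have pfv: "in_Lp 2 (\<lambda>x. \<chi> i. partial_deriv i c x *\<^sub>R f x)"
  proof (rule in_L2_bound(1)[OF f, of _ "3 * C"])
    show "(\<lambda>x. \<chi> i. partial_deriv i c x *\<^sub>R f x) \<in> borel_measurable lebesgue"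
      by (rule measurable_vecI) simp
    have "norm (\<chi> i. partial_deriv i c x *\<^sub>R f x) \<le> 3 * C * norm (f x)" for x
    proof -
      have "norm (\<chi> i. partial_deriv i c x *\<^sub>R f x) \<le> (\<Sum>i\<in>UNIV. norm (partial_deriv i c x *\<^sub>R f x))"
        by (simp add: norm_vec_def L2_set_le_sum)
      also have "\<dots> \<le> (\<Sum>i\<in>(UNIV::3 set). C * norm (f x))"
        by (intro sum_mono) (auto intro: mult_right_mono C)
      finally show ?thesis by simp
    qed
    then show "AE x in lebesgue. norm (\<chi> i. partial_deriv i c x *\<^sub>R f x) \<le> 3 * C * norm (f x)" by simp
  qed
  have "weak_gradient (\<lambda>x. c x *\<^sub>R f x) (\<lambda>x. c x *\<^sub>R g x + (\<chi> i. partial_deriv i c x *\<^sub>R f x))"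
    unfolding weak_gradient_def
  proof (intro allI impI)
    fix \<phi> i assume \<phi>: "test_function \<phi>"
    have c\<phi>: "test_function (\<lambda>x. c x * \<phi> x)" by (rule test_function_smooth_mult[OF c \<phi>])
    have d: "partial_deriv i (\<lambda>x. c x * \<phi> x) x = c x * partial_deriv i \<phi> x + partial_deriv i c x * \<phi> x" for x
      by (intro partial_deriv_mult smooth_differentiable c test_function_smooth[OF \<phi>])
    note i1 = integrable_test_function_scaleR[OF \<phi> loc_int_L2[OF pf]]
    note i2 = integrable_test_function_scaleR[OF test_function_partial_deriv[OF c\<phi>] loc_int_L2[OF f]]
    note i3 = integrable_test_function_scaleR[OF \<phi> loc_int_L2[OF in_L2_nth[OF cg]]]
    have "(LINT x|lebesgue. partial_deriv i \<phi> x *\<^sub>R (c x *\<^sub>R f x))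
        = (LINT x|lebesgue. partial_deriv i (\<lambda>x. c x * \<phi> x) x *\<^sub>R f x - \<phi> x *\<^sub>R (partial_deriv i c x *\<^sub>R f x))"
      by (simp add: d scaleR_add_left mult.commute[of "\<phi> _"] mult.commute[of "partial_deriv i \<phi> _"])
    also have "\<dots> = (LINT x|lebesgue. partial_deriv i (\<lambda>x. c x * \<phi> x) x *\<^sub>R f x)
        - (LINT x|lebesgue. \<phi> x *\<^sub>R (partial_deriv i c x *\<^sub>R f x))"
      by (intro Bochner_Integration.integral_diff i1 i2)
    also have "(LINT x|lebesgue. partial_deriv i (\<lambda>x. c x * \<phi> x) x *\<^sub>R f x)
        = - (LINT x|lebesgue. (c x * \<phi> x) *\<^sub>R (g x $ i))"
      using w c\<phi> by (simp add: weak_gradient_def)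
    also have "(LINT x|lebesgue. (c x * \<phi> x) *\<^sub>R (g x $ i)) = (LINT x|lebesgue. \<phi> x *\<^sub>R ((c x *\<^sub>R g x) $ i))"
      by (simp add: mult.commute)
    also have "- (LINT x|lebesgue. \<phi> x *\<^sub>R ((c x *\<^sub>R g x) $ i)) - (LINT x|lebesgue. \<phi> x *\<^sub>R (partial_deriv i c x *\<^sub>R f x))
      = - (LINT x|lebesgue. \<phi> x *\<^sub>R ((c x *\<^sub>R g x) $ i) + \<phi> x *\<^sub>R (partial_deriv i c x *\<^sub>R f x))"
      using Bochner_Integration.integral_add[OF i3[of i] i1[of i]] by simp
    finally show "(LINT x|lebesgue. partial_deriv i \<phi> x *\<^sub>R (c x *\<^sub>R f x))
        = - (LINT x|lebesgue. \<phi> x *\<^sub>R ((c x *\<^sub>R g x + (\<chi> i. partial_deriv i c x *\<^sub>R f x)) $ i))"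
      by (simp add: scaleR_add_right)
  qed
  with cf in_L2_add[OF cg pfv] show ?thesis by (simp add: H1_grad_def)
qed

text \<open>The test function is dilated inversely. The Jacobian \<open>1/a^3\<close> appears on
  both sides, and the chain rule for the test function leaves the factor \<open>a\<close>.\<close>

lemma H1_grad_dilate:
  assumes fg: "H1_grad f g" and a: "a > 0"
  shows "H1_grad (\<lambda>x. f (a *\<^sub>R x)) (\<lambda>x. a *\<^sub>R g (a *\<^sub>R x))"
proof -
  have f: "in_Lp 2 f" and g: "in_Lp 2 g" and w: "weak_gradient f g" using fg by (auto simp: H1_grad_def)
  have "weak_gradient (\<lambda>x. f (a *\<^sub>R x)) (\<lambda>x. a *\<^sub>R g (a *\<^sub>R x))"
    unfolding weak_gradient_def
  proof (intro allI impI)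
    fix \<phi> i assume \<phi>: "test_function \<phi>"
    have \<phi>a: "test_function (\<lambda>x. \<phi> ((1/a) *\<^sub>R x))"
      using test_function_affine[OF \<phi>, of "1/a" 0] a by simp
    have d: "partial_deriv i (\<lambda>x. \<phi> ((1/a) *\<^sub>R x)) x = (1/a) * partial_deriv i \<phi> ((1/a) *\<^sub>R x)" for x
      using affine_compose_differentiable(2)[of \<phi> "1/a" x 0 i] smooth_differentiable[OF test_function_smooth[OF \<phi>]]
      by simp
    have m1: "(\<lambda>x. partial_deriv i \<phi> ((1/a) *\<^sub>R x) *\<^sub>R f x) \<in> borel_measurable lebesgue"
      using borel_measurable_integrable[OF integrable_test_function_scaleR[OF
          test_function_affine[OF test_function_partial_deriv[OF \<phi>, of i], of "1/a" 0] loc_int_L2[OF f]]] a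
      by simp
    have m2: "(\<lambda>x. \<phi> ((1/a) *\<^sub>R x) *\<^sub>R (g x $ i)) \<in> borel_measurable lebesgue"
      using borel_measurable_integrable[OF integrable_test_function_scaleR[OF \<phi>a loc_int_L2[OF in_L2_nth[OF g]]]] .
    have "(LINT x|lebesgue. partial_deriv i \<phi> x *\<^sub>R f (a *\<^sub>R x))
        = (1/a^3) *\<^sub>R (LINT x|lebesgue. partial_deriv i \<phi> ((1/a) *\<^sub>R x) *\<^sub>R f x)"
      using integral_lebesgue_affine[OF _ m1, of a 0] a by simp
    also have "(LINT x|lebesgue. partial_deriv i \<phi> ((1/a) *\<^sub>R x) *\<^sub>R f x)
        = (LINT x|lebesgue. a *\<^sub>R (partial_deriv i (\<lambda>x. \<phi> ((1/a) *\<^sub>R x)) x *\<^sub>R f x))"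
      using a by (simp add: d)
    also have "\<dots> = - a *\<^sub>R (LINT x|lebesgue. \<phi> ((1/a) *\<^sub>R x) *\<^sub>R (g x $ i))"
      using w \<phi>a by (simp add: weak_gradient_def del: scaleR_scaleR)
    finally have "(LINT x|lebesgue. partial_deriv i \<phi> x *\<^sub>R f (a *\<^sub>R x))
        = - a *\<^sub>R ((1/a^3) *\<^sub>R (LINT x|lebesgue. \<phi> ((1/a) *\<^sub>R x) *\<^sub>R (g x $ i)))"
      by simp
    also have "(1/a^3) *\<^sub>R (LINT x|lebesgue. \<phi> ((1/a) *\<^sub>R x) *\<^sub>R (g x $ i))
        = (LINT x|lebesgue. \<phi> x *\<^sub>R (g (a *\<^sub>R x) $ i))"
      using integral_lebesgue_affine[OF _ m2, of a 0] a by simp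
    also have "- a *\<^sub>R (LINT x|lebesgue. \<phi> x *\<^sub>R (g (a *\<^sub>R x) $ i))
        = - (LINT x|lebesgue. a *\<^sub>R (\<phi> x *\<^sub>R (g (a *\<^sub>R x) $ i)))"
      by (simp del: scaleR_scaleR)
    finally show "(LINT x|lebesgue. partial_deriv i \<phi> x *\<^sub>R f (a *\<^sub>R x))
        = - (LINT x|lebesgue. \<phi> x *\<^sub>R ((a *\<^sub>R g (a *\<^sub>R x)) $ i))"
      by (simp add: mult.commute)
  qed
  with L2_affine(1)[OF f, of a 0] in_L2_scaleR[OF L2_affine(1)[OF g, of a 0]] a
  show ?thesis by (simp add: H1_grad_def)
qed

section \<open>Differentiation along affine flows\<close>

text \<open>\<open>w\<close> represents the distributional derivative of \<open>f\<close> along the vector field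
  \<open>y \<mapsto> \<kappa> y + v\<close>.\<close>

definition flow_deriv :: "real \<Rightarrow> real^3 \<Rightarrow> (real^3 \<Rightarrow> complex) \<Rightarrow> (real^3 \<Rightarrow> complex) \<Rightarrow> bool" where
  "flow_deriv \<kappa> v f w \<longleftrightarrow> (\<forall>\<phi>. test_function \<phi> \<longrightarrow>
     (LINT x|lebesgue. \<phi> x *\<^sub>R w x)
       = - (LINT x|lebesgue. (\<Sum>i\<in>UNIV. partial_deriv i (\<lambda>y. (\<kappa> * y $ i + v $ i) * \<phi> y) x) *\<^sub>R f x))"

lemma smooth_affine_nth: "smooth (\<lambda>y. \<kappa> * y $ i + a)"
  by (intro smooth_add smooth_mult smooth_const smooth_nth)

lemma test_function_affine_nth_mult: "test_function \<phi> \<Longrightarrow> test_function (\<lambda>y. (\<kappa> * y $ i + a) * \<phi> y)"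
  by (intro test_function_smooth_mult smooth_affine_nth)

text \<open>Component \<open>i\<close> of the weak gradient is tested with the \<open>i\<close>-th
  component of the vector field times \<open>\<phi>\<close>; this is why the field stands inside the
  derivative in \<open>flow_deriv\<close>.\<close>

lemma flow_deriv_weak_gradient:
  assumes "H1_grad f g"
  shows "flow_deriv \<kappa> v f (\<lambda>x. \<Sum>i\<in>UNIV. (\<kappa> * x $ i + v $ i) *\<^sub>R g x $ i)"
  unfolding flow_deriv_def
proof (intro allI impI)
  fix \<phi> assume \<phi>: "test_function \<phi>"
  note t = test_function_affine_nth_mult[OF \<phi>]
  have g: "loc_int (\<lambda>x. g x $ i)" for i using assms by (intro loc_int_L2 in_L2_nth H1_gradD)
  have f: "loc_int f" using assms by (intro loc_int_L2 H1_gradD)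
  have "(LINT x|lebesgue. \<phi> x *\<^sub>R (\<Sum>i\<in>UNIV. (\<kappa> * x $ i + v $ i) *\<^sub>R g x $ i))
      = (LINT x|lebesgue. (\<Sum>i\<in>UNIV. ((\<kappa> * x $ i + v $ i) * \<phi> x) *\<^sub>R g x $ i))"
    by (simp add: scaleR_sum_right mult.commute)
  also have "\<dots> = (\<Sum>i\<in>UNIV. LINT x|lebesgue. ((\<kappa> * x $ i + v $ i) * \<phi> x) *\<^sub>R g x $ i)"
    by (intro Bochner_Integration.integral_sum integrable_test_function_scaleR t g)
  also have "\<dots> = (\<Sum>i\<in>UNIV. - (LINT x|lebesgue. partial_deriv i (\<lambda>y. (\<kappa> * y $ i + v $ i) * \<phi> y) x *\<^sub>R f x))"
    using assms t by (simp add: H1_grad_def weak_gradient_def)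
  also have "\<dots> = - (LINT x|lebesgue. (\<Sum>i\<in>UNIV. partial_deriv i (\<lambda>y. (\<kappa> * y $ i + v $ i) * \<phi> y) x *\<^sub>R f x))"
    by (subst Bochner_Integration.integral_sum)
       (auto intro!: integrable_test_function_scaleR test_function_partial_deriv t f simp: sum_negf)
  finally show "(LINT x|lebesgue. \<phi> x *\<^sub>R (\<Sum>i\<in>UNIV. (\<kappa> * x $ i + v $ i) *\<^sub>R g x $ i))
      = - (LINT x|lebesgue. (\<Sum>i\<in>UNIV. partial_deriv i (\<lambda>y. (\<kappa> * y $ i + v $ i) * \<phi> y) x) *\<^sub>R f x)"
    by (simp add: scaleR_sum_left)
qed

text \<open>For \<open>\<kappa> = 1\<close> and \<open>v = 0\<close> the two pairings coincide. The
  complexification lets a single increment formula serve both the potential and the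
  solution.\<close>

lemma flow_deriv_x_dot_grad:
  assumes VW: "x_dot_grad V W" and V: "loc_int V"
  shows "flow_deriv 1 0 (\<lambda>x. complex_of_real (V x)) (\<lambda>x. complex_of_real (W x))"
  unfolding flow_deriv_def
proof (intro allI impI)
  fix \<phi> assume \<phi>: "test_function \<phi>"
  note t = test_function_affine_nth_mult[OF \<phi>, of 1 _ 0, simplified]
  have "integrable lebesgue (\<lambda>x. V x * partial_deriv i (\<lambda>y. y $ i * \<phi> y) x)" for i
    using integrable_test_function_scaleR[OF test_function_partial_deriv[OF t] V]
    by (simp add: mult.commute)
  then have "(LINT x|lebesgue. W x * \<phi> x)
      = - (LINT x|lebesgue. (\<Sum>i\<in>UNIV. V x * partial_deriv i (\<lambda>y. y $ i * \<phi> y) x))"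
    using VW \<phi> by (simp add: x_dot_grad_def)
  moreover have "(LINT x|lebesgue. \<phi> x *\<^sub>R complex_of_real (W x)) = complex_of_real (LINT x|lebesgue. W x * \<phi> x)"
    by (subst integral_complex_of_real[symmetric]) (simp add: scaleR_conv_of_real mult.commute)
  moreover have "(LINT x|lebesgue. (\<Sum>i\<in>UNIV. partial_deriv i (\<lambda>y. y $ i * \<phi> y) x) *\<^sub>R complex_of_real (V x))
      = complex_of_real (LINT x|lebesgue. (\<Sum>i\<in>UNIV. V x * partial_deriv i (\<lambda>y. y $ i * \<phi> y) x))"
    by (subst integral_complex_of_real[symmetric])
       (simp add: scaleR_conv_of_real sum_distrib_left mult.commute)
  ultimately show "(LINT x|lebesgue. \<phi> x *\<^sub>R complex_of_real (W x))
      = - (LINT x|lebesgue. (\<Sum>i\<in>UNIV. partial_deriv i (\<lambda>y. (1 * y $ i + 0 $ i) * \<phi> y) x) *\<^sub>R complex_of_real (V x))"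
    by simp
qed

text \<open>A time interval has finite length, so a bound on the slice integrals that is uniform in
  \<open>s\<close> already gives integrability over the strip, and Fubini follows.\<close>

lemma
  fixes F :: "real \<times> (real^3) \<Rightarrow> 'b::{banach, second_countable_topology}"
  assumes [measurable]: "F \<in> borel_measurable (lborel \<Otimes>\<^sub>M lborel)"
    and i: "\<And>s. s \<in> {a..b} \<Longrightarrow> integrable lborel (\<lambda>y. F (s, y))"
    and B: "\<And>s. s \<in> {a..b} \<Longrightarrow> (LINT y|lborel. norm (F (s, y))) \<le> B"
  shows integrable_strip: "integrable (lborel \<Otimes>\<^sub>M lborel) (\<lambda>(s, y). indicator {a..b} s *\<^sub>R F (s, y))"
    and Fubini_strip: "(LINT y|lborel. (LINT s:{a..b}|lborel. F (s, y))) = (LINT s:{a..b}|lborel. (LINT y|lborel. F (s, y)))"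
    and integrable_strip_snd: "integrable lborel (\<lambda>y. LINT s:{a..b}|lborel. F (s, y))"
    and AE_integrable_strip: "AE y in lborel. set_integrable lborel {a..b} (\<lambda>s. F (s, y))"
proof -
  show int: "integrable (lborel \<Otimes>\<^sub>M lborel) (\<lambda>(s, y). indicator {a..b} s *\<^sub>R F (s, y))"
  proof (rule lborel_pair.Fubini_integrable)
    have "integrable lborel (\<lambda>s. B * indicator {a..b} s :: real)"
      by (intro integrable_mult_right integrable_real_indicator) (auto simp: emeasure_lborel_Icc_eq)
    then show "integrable lborel (\<lambda>s. LINT y|lborel. norm (case (s, y) of (s, y) \<Rightarrow> indicator {a..b} s *\<^sub>R F (s, y)))"
    proof (rule Bochner_Integration.integrable_bound)
      show "AE s in lborel. norm (LINT y|lborel. norm (case (s, y) of (s, y) \<Rightarrow> indicator {a..b} s *\<^sub>R F (s, y)))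
          \<le> norm (B * indicator {a..b} s)"
      proof (intro AE_I2)
        fix s
        show "norm (LINT y|lborel. norm (case (s, y) of (s, y) \<Rightarrow> indicator {a..b} s *\<^sub>R F (s, y)))
          \<le> norm (B * indicator {a..b} s)"
        proof (cases "s \<in> {a..b}")
          case True
          then show ?thesis using order_trans[OF B[OF True] abs_ge_self] by simp
        qed simp
      qed
    qed measurable
    show "AE s in lborel. integrable lborel (\<lambda>y. case (s, y) of (s, y) \<Rightarrow> indicator {a..b} s *\<^sub>R F (s, y))"
    proof (intro AE_I2)
      fix s show "integrable lborel (\<lambda>y. case (s, y) of (s, y) \<Rightarrow> indicator {a..b} s *\<^sub>R F (s, y))"
        using i[of s] by (cases "s \<in> {a..b}") auto
    qed
  qed measurable
  have "(LINT y|lborel. (LINT s|lborel. indicator {a..b} s *\<^sub>R F (s, y)))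
      = (LINT s|lborel. (LINT y|lborel. indicator {a..b} s *\<^sub>R F (s, y)))"
    using lborel_pair.Fubini_integral[OF int] by simp
  then show "(LINT y|lborel. (LINT s:{a..b}|lborel. F (s, y))) = (LINT s:{a..b}|lborel. (LINT y|lborel. F (s, y)))"
    by (simp add: set_lebesgue_integral_def)
  show "integrable lborel (\<lambda>y. LINT s:{a..b}|lborel. F (s, y))"
    using lborel_pair.integrable_snd[OF int] by (simp add: set_lebesgue_integral_def)
  show "AE y in lborel. set_integrable lborel {a..b} (\<lambda>s. F (s, y))"
    using lborel_pair.AE_integrable_snd[OF int] by (simp add: set_integrable_def)
qed

text \<open>This is the flow of the field \<open>\<kappa> y + v\<close> only when
  \<open>\<kappa> = 0\<close> (translations) or \<open>v = 0\<close> (dilations), the two cases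
  used; one formula covers both, and the lemmas on increments assume this alternative.\<close>

definition flow :: "real \<Rightarrow> real^3 \<Rightarrow> real \<Rightarrow> real^3 \<Rightarrow> real^3" where
  "flow \<kappa> v s x = exp (\<kappa> * s) *\<^sub>R x + s *\<^sub>R v"

lemma measurable_flow [measurable]: "(\<lambda>(s, x). flow \<kappa> v s x) \<in> borel_measurable (lborel \<Otimes>\<^sub>M lborel)"
  unfolding flow_def by measurable

lemma measurable_flow_compose:
  assumes [measurable]: "w \<in> borel_measurable borel"
  shows "(\<lambda>(s, x). w (flow \<kappa> v s x)) \<in> borel_measurable (lborel \<Otimes>\<^sub>M lborel)"
  using measurable_compose[OF measurable_flow assms] by (simp add: case_prod_beta')

lemma flow_cball:
  fixes w :: "real^3 \<Rightarrow> 'b::{banach, second_countable_topology}"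
  assumes w: "loc_int w" and [measurable]: "w \<in> borel_measurable borel"
  obtains B where
    "\<And>s. s \<in> {0..h} \<Longrightarrow> integrable lborel (\<lambda>x. indicator (cball 0 r) x *\<^sub>R w (flow \<kappa> v s x))"
    "\<And>s. s \<in> {0..h} \<Longrightarrow> (LINT x|lborel. norm (indicator (cball 0 r) x *\<^sub>R w (flow \<kappa> v s x))) \<le> B"
proof -
  \<comment> \<open>The ball of this radius contains all points reached from
    \<open>cball 0 r\<close> within time \<open>h\<close>. The Jacobian of the inverse map is
    bounded by \<open>exp (\<bar>\<kappa>\<bar> * h) ^ 3\<close> on the same interval, so the final
    bound is uniform in \<open>s\<close>.\<close>
  define R where "R = exp (\<bar>\<kappa>\<bar> * h) * \<bar>r\<bar> + h * norm v"
  define I where "I = (LINT x|lborel. norm (indicator (cball 0 R) x *\<^sub>R w x))"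
  have "(\<lambda>x. indicator (cball 0 R) x *\<^sub>R w x) \<in> borel_measurable borel"
    by (intro borel_measurable_scaleR borel_measurable_indicator assms(2)) simp
  then have im: "(\<lambda>x. norm (indicator (cball 0 R) x *\<^sub>R w x)) \<in> borel_measurable borel"
    by (rule measurable_compose) simp
  have in1: "integrable lebesgue (\<lambda>x. norm (indicator (cball 0 R) x *\<^sub>R w x))"
    using w by (intro integrable_norm) (simp add: loc_int_def)
  { fix s assume s: "s \<in> {0..h}"
    have e: "exp (\<kappa> * s) \<le> exp (\<bar>\<kappa>\<bar> * h)" "exp (- (\<kappa> * s)) \<le> exp (\<bar>\<kappa>\<bar> * h)"
      using s mult_mono[of "\<bar>\<kappa>\<bar>" "\<bar>\<kappa>\<bar>" s h] abs_mult[of \<kappa> s] by (auto simp: abs_le_iff)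
    have m[measurable]: "(\<lambda>x. w (flow \<kappa> v s x)) \<in> borel_measurable borel"
      unfolding flow_def by measurable
    have m': "(\<lambda>x. indicator (cball 0 r) x *\<^sub>R w (flow \<kappa> v s x)) \<in> borel_measurable borel"
      by (intro borel_measurable_scaleR borel_measurable_indicator m) simp
    have le: "norm (indicator (cball 0 r) x *\<^sub>R w (flow \<kappa> v s x))
        \<le> norm (indicator (cball 0 R) (flow \<kappa> v s x) *\<^sub>R w (flow \<kappa> v s x))" for x
    proof (cases "norm x \<le> r")
      case True
      have "norm (flow \<kappa> v s x) \<le> exp (\<kappa> * s) * norm x + s * norm v"
        using norm_triangle_ineq[of "exp (\<kappa> * s) *\<^sub>R x" "s *\<^sub>R v"] s by (simp add: flow_def)
      also have "\<dots> \<le> R"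
        unfolding R_def using True s e by (intro add_mono mult_mono) auto
      finally show ?thesis using True by simp
    qed simp
    have in2: "integrable lebesgue (\<lambda>x. norm (indicator (cball 0 R) (flow \<kappa> v s x) *\<^sub>R w (flow \<kappa> v s x)))"
      using integrable_lebesgue_affine[OF _ in1, of "exp (\<kappa> * s)" "s *\<^sub>R v"] by (simp add: flow_def)
    have eq: "(LINT x|lebesgue. norm (indicator (cball 0 R) (flow \<kappa> v s x) *\<^sub>R w (flow \<kappa> v s x)))
        = 1 / exp (\<kappa> * s) ^ 3 * I"
      using integral_lebesgue_affine[OF _ borel_measurable_integrable[OF in1], of "exp (\<kappa> * s)" "s *\<^sub>R v"]
        integral_lebesgue_lborel(1)[OF im]
      by (simp add: flow_def I_def)
    have in3: "integrable lebesgue (\<lambda>x. indicator (cball 0 r) x *\<^sub>R w (flow \<kappa> v s x))"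
      by (rule Bochner_Integration.integrable_bound[OF in2 measurable_lebesgue_borel[OF m']]) (use le in simp)
    then have 1: "integrable lborel (\<lambda>x. indicator (cball 0 r) x *\<^sub>R w (flow \<kappa> v s x))"
      using integral_lebesgue_lborel(2)[OF m'] by simp
    have "(LINT x|lborel. norm (indicator (cball 0 r) x *\<^sub>R w (flow \<kappa> v s x)))
        = (LINT x|lebesgue. norm (indicator (cball 0 r) x *\<^sub>R w (flow \<kappa> v s x)))"
      by (rule integral_lebesgue_lborel(1)[symmetric], rule measurable_compose[OF m']) simp
    also have "\<dots> \<le> 1 / exp (\<kappa> * s) ^ 3 * I"
      unfolding eq[symmetric] using le by (intro integral_mono integrable_norm in3 in2)
    also have "\<dots> = exp (- (\<kappa> * s)) ^ 3 * I" by (simp add: exp_minus inverse_eq_divide power_divide)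
    also have "\<dots> \<le> exp (\<bar>\<kappa>\<bar> * h) ^ 3 * I"
      using e by (intro mult_right_mono power_mono) (auto simp: I_def)
    finally have "(LINT x|lborel. norm (indicator (cball 0 r) x *\<^sub>R w (flow \<kappa> v s x))) \<le> exp (\<bar>\<kappa>\<bar> * h) ^ 3 * I" .
    note 1 this
  }
  then show thesis by (rule that)
qed

text \<open>The push-forward of a test function under the flow solves the transport equation, so testing
  against it and integrating in time gives the increment of \<open>f\<close> along the flow.\<close>

lemma test_function_transport:
  assumes \<phi>: "test_function \<phi>" and \<kappa>v: "\<kappa> = 0 \<or> v = 0" and h: "h \<ge> 0"
  defines "\<psi> \<equiv> \<lambda>s y. exp (- 3 * \<kappa> * s) * \<phi> (exp (- \<kappa> * s) *\<^sub>R y + - s *\<^sub>R v)"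
    and "D \<equiv> \<lambda>(s, y). exp (- 3 * \<kappa> * s) * (3 * \<kappa> * \<phi> (exp (- \<kappa> * s) *\<^sub>R y + - s *\<^sub>R v)
        + (\<Sum>i\<in>UNIV. (\<kappa> * y $ i + v $ i) * (exp (- \<kappa> * s) * partial_deriv i \<phi> (exp (- \<kappa> * s) *\<^sub>R y + - s *\<^sub>R v))))"
  shows "test_function (\<psi> s)"
    and "(\<Sum>i\<in>UNIV. partial_deriv i (\<lambda>y. (\<kappa> * y $ i + v $ i) * \<psi> s y) y) = D (s, y)"
    and "(LINT s:{0..h}|lborel. D (s, y)) = \<psi> 0 y - \<psi> h y"
    and "continuous_on UNIV D"
    and "\<exists>C r. \<forall>s\<in>{0..h}. \<forall>y. \<bar>D (s, y)\<bar> \<le> C * indicator (cball 0 r) y"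
proof -
  note sm = test_function_smooth[OF \<phi>]
  show t: "test_function (\<psi> s)" for s
    unfolding \<psi>_def using test_function_smooth_mult[OF smooth_const test_function_affine[OF \<phi>, of "exp (- \<kappa> * s)" "- s *\<^sub>R v"]]
    by simp
  have pd: "partial_deriv i (\<psi> s) y = exp (- 3 * \<kappa> * s) * (exp (- \<kappa> * s) * partial_deriv i \<phi> (exp (- \<kappa> * s) *\<^sub>R y + - s *\<^sub>R v))" for i s y
    unfolding \<psi>_def
    by (subst partial_deriv_mult)
       (auto simp: affine_compose_differentiable[OF smooth_differentiable[OF sm]] simp del: scaleR_minus_left)
  have pa: "partial_deriv i (\<lambda>y. \<kappa> * y $ i + v $ i) y = \<kappa>" for i y
    by (subst partial_deriv_add) (auto simp: partial_deriv_mult partial_deriv_nth differentiable_nth)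
  have "(\<Sum>i\<in>UNIV. partial_deriv i (\<lambda>y. (\<kappa> * y $ i + v $ i) * \<psi> s y) y)
      = (\<Sum>i\<in>UNIV. (\<kappa> * y $ i + v $ i) * partial_deriv i (\<psi> s) y + \<kappa> * \<psi> s y)"
    by (intro sum.cong refl, subst partial_deriv_mult)
       (use smooth_differentiable[OF smooth_affine_nth] smooth_differentiable[OF test_function_smooth[OF t]] in \<open>auto simp: pa\<close>)
  also have "\<dots> = D (s, y)"
    unfolding pd D_def by (simp add: sum.distrib \<psi>_def sum_distrib_left algebra_simps)
  finally show "(\<Sum>i\<in>UNIV. partial_deriv i (\<lambda>y. (\<kappa> * y $ i + v $ i) * \<psi> s y) y) = D (s, y)" .
  have ct: "continuous_on UNIV (\<lambda>(s::real, y::real^3). exp (- \<kappa> * s) *\<^sub>R y + - s *\<^sub>R v)"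
    unfolding case_prod_beta by (intro continuous_intros)
  have c1: "continuous_on UNIV (\<lambda>(s, y). \<phi> (exp (- \<kappa> * s) *\<^sub>R y + - s *\<^sub>R v))"
    using continuous_on_compose2[OF smooth_continuous_on[OF sm, of UNIV] ct] by (simp add: case_prod_beta')
  have c2: "continuous_on UNIV (\<lambda>(s, y). partial_deriv i \<phi> (exp (- \<kappa> * s) *\<^sub>R y + - s *\<^sub>R v))" for i
    using continuous_on_compose2[OF smooth_continuous_on[OF smooth_partial_deriv[OF sm], of UNIV] ct] by (simp add: case_prod_beta')
  show cD: "continuous_on UNIV D"
    unfolding D_def case_prod_beta
    by (intro continuous_intros c1[unfolded case_prod_beta] c2[unfolded case_prod_beta])
  have cDs: "continuous_on A (\<lambda>s. D (s, y))" for y A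
    by (rule continuous_on_compose2[OF cD]) (auto intro!: continuous_intros)
  show "(LINT s:{0..h}|lborel. D (s, y)) = \<psi> 0 y - \<psi> h y"
  proof -
    have der: "((\<lambda>s. - \<psi> s y) has_vector_derivative D (s, y)) (at s within A)" for s A
    proof -
      let ?z = "\<lambda>s. exp (- \<kappa> * s) *\<^sub>R y + - s *\<^sub>R v"
      have z: "(?z has_derivative (\<lambda>t. t *\<^sub>R (- \<kappa> * exp (- \<kappa> * s)) *\<^sub>R y - t *\<^sub>R v)) (at s within A)"
        by (auto intro!: derivative_eq_intros simp: algebra_simps)
      have "((\<lambda>s. \<phi> (?z s)) has_derivative (\<lambda>t. frechet_derivative \<phi> (at (?z s)) (t *\<^sub>R (- \<kappa> * exp (- \<kappa> * s)) *\<^sub>R y - t *\<^sub>R v))) (at s within A)"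
        using has_derivative_compose[OF z smooth_has_derivative[OF sm]] .
      \<comment> \<open>Here \<open>\<kappa> = 0 \<or> v = 0\<close> enters: only then is the
        velocity of \<open>?z\<close>, with its unscaled term \<open>v\<close>, equal to minus the
        vector field at \<open>y\<close> times \<open>exp (- \<kappa> * s)\<close>.\<close>
      moreover have "frechet_derivative \<phi> (at (?z s)) (t *\<^sub>R (- \<kappa> * exp (- \<kappa> * s)) *\<^sub>R y - t *\<^sub>R v)
          = t * (- (\<Sum>i\<in>UNIV. (\<kappa> * y $ i + v $ i) * (exp (- \<kappa> * s) * partial_deriv i \<phi> (?z s))))" for t
        unfolding frechet_derivative_eq_sum_partial_deriv[OF smooth_differentiable[OF sm]]
          sum_negf[symmetric] sum_distrib_left
        by (intro sum.cong refl) (use \<kappa>v in \<open>auto simp: algebra_simps\<close>)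
      ultimately have "((\<lambda>s. \<phi> (?z s)) has_derivative (\<lambda>t. t * (- (\<Sum>i\<in>UNIV. (\<kappa> * y $ i + v $ i) * (exp (- \<kappa> * s) * partial_deriv i \<phi> (?z s)))))) (at s within A)"
        by simp
      then have d1: "((\<lambda>s. \<phi> (?z s)) has_field_derivative (- (\<Sum>i\<in>UNIV. (\<kappa> * y $ i + v $ i) * (exp (- \<kappa> * s) * partial_deriv i \<phi> (?z s))))) (at s within A)"
        unfolding has_field_derivative_def by (rule has_derivative_eq_rhs) (simp add: fun_eq_iff mult.commute)
      have d2: "((\<lambda>s. - exp (- 3 * \<kappa> * s)) has_field_derivative 3 * \<kappa> * exp (- 3 * \<kappa> * s)) (at s within A)"
        by (auto intro!: derivative_eq_intros)
      have "((\<lambda>s. - exp (- 3 * \<kappa> * s) * \<phi> (?z s)) has_field_derivative D (s, y)) (at s within A)"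
        by (rule DERIV_cong[OF DERIV_mult[OF d2 d1]]) (simp add: D_def algebra_simps)
      then show ?thesis by (simp add: \<psi>_def has_real_derivative_iff_has_vector_derivative)
    qed
    have "(LBINT s=ereal 0..ereal h. D (s, y)) = - \<psi> h y - (- \<psi> 0 y)"
      by (rule interval_integral_FTC_finite) (auto intro: cDs der)
    moreover have "(LBINT s=ereal 0..ereal h. D (s, y)) = (LINT s:{0..h}|lborel. D (s, y))"
      using interval_integral_Icc[of 0 h "\<lambda>s. D (s, y)"] h by simp
    ultimately show ?thesis by simp
  qed
  obtain r where r: "\<And>x. \<phi> x \<noteq> 0 \<Longrightarrow> norm x \<le> r" using test_functionE[OF \<phi>] by metis
  have "\<exists>r. \<forall>x. partial_deriv i \<phi> x \<noteq> 0 \<longrightarrow> norm x \<le> r" for i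
    using test_functionE[OF test_function_partial_deriv[OF \<phi>, of i]] by metis
  then obtain r' where r': "\<And>i x. partial_deriv i \<phi> x \<noteq> 0 \<Longrightarrow> norm x \<le> r' i" by metis
  define \<rho> where "\<rho> = \<bar>r\<bar> + (\<Sum>i\<in>UNIV. \<bar>r' i\<bar>)"
  have \<rho>: "r \<le> \<rho>" "r' i \<le> \<rho>" for i
    using member_le_sum[of i UNIV "\<lambda>i. \<bar>r' i\<bar>"] sum_nonneg[of UNIV "\<lambda>i. \<bar>r' i\<bar>"] by (auto simp: \<rho>_def)
  \<comment> \<open>The support of \<open>D (s, _)\<close> is that of \<open>\<phi>\<close> and its
    derivatives, carried along the flow for a time at most \<open>h\<close>; this radius bounds all
    of them at once.\<close>
  define R where "R = exp (\<bar>\<kappa>\<bar> * h) * (\<bar>\<rho>\<bar> + h * norm v)"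
  have supp: "norm y \<le> R" if "D (s, y) \<noteq> 0" "s \<in> {0..h}" for s y
  proof -
    let ?z = "exp (- \<kappa> * s) *\<^sub>R y + - s *\<^sub>R v"
    have "\<phi> ?z \<noteq> 0 \<or> (\<exists>i. partial_deriv i \<phi> ?z \<noteq> 0)"
      using that(1) unfolding D_def
      by (rule contrapos_np) (simp del: scaleR_minus_left mult_minus_left)
    then have "norm ?z \<le> \<rho>" using r r' \<rho> order_trans by metis
    then have "norm (exp (- \<kappa> * s) *\<^sub>R y) \<le> \<rho> + s * norm v"
      using norm_triangle_ineq4[of ?z "- s *\<^sub>R v"] that(2) by simp
    then have "norm y \<le> exp (\<kappa> * s) * (\<rho> + s * norm v)"
      by (simp add: exp_minus field_simps)
    also have "\<dots> \<le> R"
    proof -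
      have "\<kappa> * s \<le> \<bar>\<kappa>\<bar> * h" using that(2) mult_mono[of "\<bar>\<kappa>\<bar>" "\<bar>\<kappa>\<bar>" s h] abs_mult[of \<kappa> s] by auto
      moreover have "\<rho> \<ge> 0" by (simp add: \<rho>_def add_nonneg_nonneg sum_nonneg)
      ultimately show ?thesis unfolding R_def using that(2)
        by (intro mult_mono add_mono mult_right_mono) (auto intro!: add_nonneg_nonneg)
    qed
    finally show ?thesis .
  qed
  have "bounded (D ` ({0..h} \<times> cball 0 R))"
    by (intro compact_imp_bounded compact_continuous_image continuous_on_subset[OF cD] compact_Times) auto
  then obtain C where C: "\<And>s y. s \<in> {0..h} \<Longrightarrow> norm y \<le> R \<Longrightarrow> \<bar>D (s, y)\<bar> \<le> C"
    unfolding bounded_iff by force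
  have "\<bar>D (s, y)\<bar> \<le> C * indicator (cball 0 R) y" if "s \<in> {0..h}" for s y
    using supp[OF _ that, of y] C[OF that, of y] by (cases "norm y \<le> R") auto
  then show "\<exists>C r. \<forall>s\<in>{0..h}. \<forall>y. \<bar>D (s, y)\<bar> \<le> C * indicator (cball 0 r) y" by blast
qed

lemma integral_test_function_flow:
  fixes g :: "real^3 \<Rightarrow> 'b::{banach, second_countable_topology}"
  assumes \<phi>: "test_function \<phi>" and \<kappa>v: "\<kappa> = 0 \<or> v = 0" and g: "loc_int g"
  shows "(LINT x|lebesgue. \<phi> x *\<^sub>R g (flow \<kappa> v s x))
    = (LINT y|lebesgue. (exp (- 3 * \<kappa> * s) * \<phi> (exp (- \<kappa> * s) *\<^sub>R y + - s *\<^sub>R v)) *\<^sub>R g y)"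
proof -
  let ?F = "\<lambda>y. \<phi> (exp (- \<kappa> * s) *\<^sub>R y + - s *\<^sub>R v) *\<^sub>R g y"
  have m: "?F \<in> borel_measurable lebesgue"
    by (intro borel_measurable_integrable integrable_test_function_scaleR test_function_affine \<phi> g) simp
  have "exp (- \<kappa> * s) *\<^sub>R (exp (\<kappa> * s) *\<^sub>R x + s *\<^sub>R v) + - s *\<^sub>R v = x" for x
    using \<kappa>v by (auto simp: scaleR_add_right exp_add[symmetric])
  then have "(LINT x|lebesgue. \<phi> x *\<^sub>R g (flow \<kappa> v s x)) = (1 / exp (\<kappa> * s) ^ 3) *\<^sub>R (LINT y|lebesgue. ?F y)"
    using integral_lebesgue_affine[OF _ m, of "exp (\<kappa> * s)" "s *\<^sub>R v"] by (simp add: flow_def)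
  moreover have "1 / exp (\<kappa> * s) ^ 3 = exp (- 3 * \<kappa> * s)"
    by (simp add: exp_of_nat_mult[of 3, symmetric, simplified] exp_minus inverse_eq_divide mult.assoc)
  moreover have "exp (- 3 * \<kappa> * s) *\<^sub>R (LINT y|lebesgue. ?F y) = (LINT y|lebesgue. exp (- 3 * \<kappa> * s) *\<^sub>R ?F y)"
    by (simp del: scaleR_scaleR)
  ultimately show ?thesis by simp
qed

text \<open>A distributional derivative becomes the fundamental theorem of calculus along almost
  every trajectory. After pairing with a test function, a change of variables moves the flow from
  \<open>f\<close> to the test function, \<open>flow_deriv\<close> replaces \<open>f\<close> by
  \<open>w\<close>, and the inverse change with Fubini puts the flow on \<open>w\<close>. The
  exceptional null set may depend on \<open>h\<close>.\<close>

lemma flow_increment: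
  fixes f w :: "real^3 \<Rightarrow> complex"
  assumes fb[measurable]: "f \<in> borel_measurable borel" and wb[measurable]: "w \<in> borel_measurable borel"
    and f: "loc_int f" and w: "loc_int w" and fw: "flow_deriv \<kappa> v f w"
    and \<kappa>v: "\<kappa> = 0 \<or> v = 0" and h: "h \<ge> 0"
  shows "AE x in lebesgue. f (flow \<kappa> v h x) - f x = (LINT s:{0..h}|lborel. w (flow \<kappa> v s x))"
proof -
  define P where "P x = (LINT s:{0..h}|lborel. w (flow \<kappa> v s x))" for x
  note mw[measurable] = measurable_flow_compose[OF wb, of \<kappa> v]
  have mw'[measurable]: "(\<lambda>x. w (flow \<kappa> v s x)) \<in> borel_measurable borel"
    and mf'[measurable]: "(\<lambda>x. f (flow \<kappa> v s x)) \<in> borel_measurable borel" for s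
    unfolding flow_def by measurable
  have "(\<lambda>(s, x). indicator {0..h} s *\<^sub>R w (flow \<kappa> v s x)) \<in> borel_measurable (lborel \<Otimes>\<^sub>M lborel)"
    using mw by measurable
  then have "(\<lambda>(x, s). indicator {0..h} s *\<^sub>R w (flow \<kappa> v s x)) \<in> borel_measurable (lborel \<Otimes>\<^sub>M lborel)"
    by (subst measurable_pair_swap_iff) (simp add: case_prod_beta')
  from lborel.borel_measurable_lebesgue_integral[OF this]
  have mP[measurable]: "P \<in> borel_measurable borel"
    unfolding P_def set_lebesgue_integral_def by simp
  have lf: "loc_int (\<lambda>x. f (flow \<kappa> v h x))"
    unfolding loc_int_def
  proof (intro conjI allI)
    fix r
    obtain B where "\<And>s. s \<in> {0..h} \<Longrightarrow> integrable lborel (\<lambda>x. indicator (cball 0 r) x *\<^sub>R f (flow \<kappa> v s x))"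
      using flow_cball[OF f fb, where h = h and r = r and \<kappa> = \<kappa> and v = v] by blast
    from this[of h] show "integrable lebesgue (\<lambda>x. indicator (cball 0 r) x *\<^sub>R f (flow \<kappa> v h x))"
      using h borel_measurable_integrable by (subst integral_lebesgue_lborel(2)) fastforce+
  qed (rule measurable_lebesgue_borel[OF mf'])
  \<comment> \<open>The weight \<open>c\<close> is used twice: as the indicator of a ball, for local
    integrability of \<open>P\<close>, and as the test function, for exchanging the
    integrals.\<close>
  have strip: "(\<lambda>(s, x). c x *\<^sub>R w (flow \<kappa> v s x)) \<in> borel_measurable (lborel \<Otimes>\<^sub>M lborel)"
    "s \<in> {0..h} \<Longrightarrow> integrable lborel (\<lambda>x. c x *\<^sub>R w (flow \<kappa> v s x))"
    "\<exists>B. \<forall>s\<in>{0..h}. (LINT x|lborel. norm (c x *\<^sub>R w (flow \<kappa> v s x))) \<le> B"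
    if [measurable]: "c \<in> borel_measurable borel" and c: "\<And>x. \<bar>c x\<bar> \<le> C * indicator (cball 0 r) x" "C \<ge> 0" for c C r s
  proof -
    show "(\<lambda>(s, x). c x *\<^sub>R w (flow \<kappa> v s x)) \<in> borel_measurable (lborel \<Otimes>\<^sub>M lborel)"
      using mw by measurable
    obtain B where B: "\<And>s. s \<in> {0..h} \<Longrightarrow> integrable lborel (\<lambda>x. indicator (cball 0 r) x *\<^sub>R w (flow \<kappa> v s x))"
     "\<And>s. s \<in> {0..h} \<Longrightarrow> (LINT x|lborel. norm (indicator (cball 0 r) x *\<^sub>R w (flow \<kappa> v s x))) \<le> B"
      using flow_cball[OF w wb, where h = h and r = r and \<kappa> = \<kappa> and v = v] by blast
    have le: "norm (c x *\<^sub>R w (flow \<kappa> v s x)) \<le> C * norm (indicator (cball 0 r) x *\<^sub>R w (flow \<kappa> v s x))" for x s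
      using mult_right_mono[OF c(1)[of x], of "norm (w (flow \<kappa> v s x))"] by (simp add: mult.assoc)
    have i: "integrable lborel (\<lambda>x. c x *\<^sub>R w (flow \<kappa> v s x))" if s: "s \<in> {0..h}" for s
    proof (rule Bochner_Integration.integrable_bound[OF integrable_mult_right[OF integrable_norm[OF B(1)[OF s]], of C]])
      show "AE x in lborel. norm (c x *\<^sub>R w (flow \<kappa> v s x)) \<le> norm (C * norm (indicator (cball 0 r) x *\<^sub>R w (flow \<kappa> v s x)))"
        using order_trans[OF le abs_ge_self] by simp
    qed measurable
    then show "s \<in> {0..h} \<Longrightarrow> integrable lborel (\<lambda>x. c x *\<^sub>R w (flow \<kappa> v s x))" by simp
    have "(LINT x|lborel. norm (c x *\<^sub>R w (flow \<kappa> v s x))) \<le> C * B" if s: "s \<in> {0..h}" for s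
    proof -
      have "(LINT x|lborel. norm (c x *\<^sub>R w (flow \<kappa> v s x)))
          \<le> (LINT x|lborel. C * norm (indicator (cball 0 r) x *\<^sub>R w (flow \<kappa> v s x)))"
        using le by (intro integral_mono integrable_mult_right integrable_norm i s B(1))
      also have "\<dots> \<le> C * B" using B(2)[OF s] c(2) by (simp add: mult_left_mono)
      finally show ?thesis .
    qed
    then show "\<exists>B. \<forall>s\<in>{0..h}. (LINT x|lborel. norm (c x *\<^sub>R w (flow \<kappa> v s x))) \<le> B" by blast
  qed
  have strip_swap: "integrable lborel (\<lambda>x. c x *\<^sub>R P x)"
     "(LINT x|lborel. c x *\<^sub>R P x) = (LINT s:{0..h}|lborel. (LINT x|lborel. c x *\<^sub>R w (flow \<kappa> v s x)))"
    if c: "c \<in> borel_measurable borel" "\<And>x. \<bar>c x\<bar> \<le> C * indicator (cball 0 r) x" "C \<ge> 0" for c C r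
  proof -
    obtain B where B: "\<forall>s\<in>{0..h}. (LINT x|lborel. norm (c x *\<^sub>R w (flow \<kappa> v s x))) \<le> B"
      using strip(3)[OF c] by blast

    note S = integrable_strip_snd[OF strip(1)[OF c], of 0 h B] Fubini_strip[OF strip(1)[OF c], of 0 h B]
    show "integrable lborel (\<lambda>x. c x *\<^sub>R P x)"
      using S(1) strip(2)[OF c] B by (simp add: P_def)
    show "(LINT x|lborel. c x *\<^sub>R P x) = (LINT s:{0..h}|lborel. (LINT x|lborel. c x *\<^sub>R w (flow \<kappa> v s x)))"
      using S(2) strip(2)[OF c] B by (simp add: P_def)
  qed
  have lP: "loc_int P"
    unfolding loc_int_def
  proof (intro conjI allI)
    fix r
    have "integrable lborel (\<lambda>x. indicator (cball 0 r) x *\<^sub>R P x)"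
      by (rule strip_swap(1)[OF borel_measurable_indicator, of _ 1 r]) auto
    then show "integrable lebesgue (\<lambda>x. indicator (cball 0 r) x *\<^sub>R P x)"
      using borel_measurable_integrable by (subst integral_lebesgue_lborel(2)) fastforce+
  qed (rule measurable_lebesgue_borel[OF mP])
  have "AE x in lebesgue. (f (flow \<kappa> v h x) - f x) - P x = 0"
  proof (rule fundamental_lemma)
    show l: "loc_int (\<lambda>x. (f (flow \<kappa> v h x) - f x) - P x)" by (intro loc_int_diff lf f lP)
    fix \<phi> assume \<phi>: "test_function \<phi>"
    define \<psi> where "\<psi> s y = exp (- 3 * \<kappa> * s) * \<phi> (exp (- \<kappa> * s) *\<^sub>R y + - s *\<^sub>R v)" for s y
    define D where "D = (\<lambda>(s, y). exp (- 3 * \<kappa> * s) * (3 * \<kappa> * \<phi> (exp (- \<kappa> * s) *\<^sub>R y + - s *\<^sub>R v)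
        + (\<Sum>i\<in>UNIV. (\<kappa> * y $ i + v $ i) * (exp (- \<kappa> * s) * partial_deriv i \<phi> (exp (- \<kappa> * s) *\<^sub>R y + - s *\<^sub>R v)))))"
    note T = test_function_transport[OF \<phi> \<kappa>v h, folded D_def, folded \<psi>_def]
    have mD[measurable]: "D \<in> borel_measurable (lborel \<Otimes>\<^sub>M lborel)"
      using borel_measurable_continuous_onI[OF T(4)] by (simp add: lborel_prod)
    obtain C r where Cr: "\<And>s y. s \<in> {0..h} \<Longrightarrow> \<bar>D (s, y)\<bar> \<le> C * indicator (cball 0 r) y"
      using T(5) by metis
    have Df_meas: "(\<lambda>(s, y). D (s, y) *\<^sub>R f y) \<in> borel_measurable (lborel \<Otimes>\<^sub>M lborel)"
      by measurable
    have lfi: "integrable lborel (\<lambda>y. indicator (cball 0 r) y *\<^sub>R f y)"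
    proof -
      have "(\<lambda>y. indicator (cball 0 r) y *\<^sub>R f y) \<in> borel_measurable borel"
        by (intro borel_measurable_scaleR borel_measurable_indicator fb) simp
      from integral_lebesgue_lborel(2)[OF this] f show ?thesis by (simp add: loc_int_def)
    qed
    have mDs[measurable]: "(\<lambda>y. D (s, y)) \<in> borel_measurable borel" for s
      by (intro borel_measurable_continuous_onI continuous_on_compose2[OF T(4)]) (auto intro!: continuous_intros)
    have le: "norm (D (s, y) *\<^sub>R f y) \<le> C * norm (indicator (cball 0 r) y *\<^sub>R f y)" if "s \<in> {0..h}" for s y
      using mult_right_mono[OF Cr[OF that, of y], of "norm (f y)"] by (simp add: mult.assoc)
    have Df_int: "integrable lborel (\<lambda>y. D (s, y) *\<^sub>R f y)" if s: "s \<in> {0..h}" for s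
    proof (rule Bochner_Integration.integrable_bound[OF integrable_mult_right[OF integrable_norm[OF lfi], of C]])
      show "AE y in lborel. norm (D (s, y) *\<^sub>R f y) \<le> norm (C * norm (indicator (cball 0 r) y *\<^sub>R f y))"
        using order_trans[OF le[OF s] abs_ge_self] by simp
    qed measurable
    have Df_B: "(LINT y|lborel. norm (D (s, y) *\<^sub>R f y)) \<le> (LINT y|lborel. C * norm (indicator (cball 0 r) y *\<^sub>R f y))"
      if s: "s \<in> {0..h}" for s
      using le[OF s] by (intro integral_mono integrable_mult_right integrable_norm lfi Df_int s)
    have \<psi>0: "\<psi> 0 = \<phi>" by (simp add: \<psi>_def fun_eq_iff)
    obtain r' C' where \<phi>b: "C' > 0" "\<And>x. \<bar>\<phi> x\<bar> \<le> C' * indicator (cball 0 r') x"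
      using test_function_bounded[OF \<phi>] by metis
    have m\<phi>[measurable]: "\<phi> \<in> borel_measurable borel" by (intro smooth_measurable test_function_smooth \<phi>)
    have m\<psi>[measurable]: "\<psi> s \<in> borel_measurable borel" for s by (intro smooth_measurable test_function_smooth T(1))
    have "(LINT x|lebesgue. \<phi> x *\<^sub>R f x) - (LINT x|lebesgue. \<phi> x *\<^sub>R f (flow \<kappa> v h x))
        = (LINT y|lebesgue. \<psi> 0 y *\<^sub>R f y) - (LINT y|lebesgue. \<psi> h y *\<^sub>R f y)"
      using integral_test_function_flow[OF \<phi> \<kappa>v f, of h] by (simp add: \<psi>0 \<psi>_def[of h])
    also have "\<dots> = (LINT y|lebesgue. (\<psi> 0 y - \<psi> h y) *\<^sub>R f y)"
      unfolding scaleR_diff_left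
      by (intro Bochner_Integration.integral_diff[symmetric] integrable_test_function_scaleR T(1) f)
    also have "\<dots> = (LINT y|lborel. (\<psi> 0 y - \<psi> h y) *\<^sub>R f y)"
      by (intro integral_lebesgue_lborel) measurable
    also have "\<dots> = (LINT y|lborel. (LINT s:{0..h}|lborel. D (s, y) *\<^sub>R f y))"
    proof (rule Bochner_Integration.integral_cong[OF refl])
      fix y
      have "set_integrable lborel {0..h} (\<lambda>s. D (s, y))"
        by (intro borel_integrable_atLeastAtMost' continuous_on_compose2[OF T(4)])
           (auto intro!: continuous_intros)
      then show "(\<psi> 0 y - \<psi> h y) *\<^sub>R f y = (LINT s:{0..h}|lborel. D (s, y) *\<^sub>R f y)"
        unfolding T(3)[symmetric] set_lebesgue_integral_def set_integrable_def
        by (simp flip: integral_scaleR_left)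
    qed
    also have "\<dots> = (LINT s:{0..h}|lborel. (LINT y|lborel. D (s, y) *\<^sub>R f y))"
      by (rule Fubini_strip[OF Df_meas, unfolded prod.case, OF Df_int Df_B])
    also have "\<dots> = (LINT s:{0..h}|lborel. - (LINT x|lborel. \<phi> x *\<^sub>R w (flow \<kappa> v s x)))"
    proof (rule set_lebesgue_integral_cong)
      show "\<forall>s. s \<in> {0..h} \<longrightarrow> (LINT y|lborel. D (s, y) *\<^sub>R f y) = - (LINT x|lborel. \<phi> x *\<^sub>R w (flow \<kappa> v s x))"
      proof (intro allI impI)
        fix s
        have "(LINT y|lborel. D (s, y) *\<^sub>R f y) = (LINT y|lebesgue. D (s, y) *\<^sub>R f y)"
          by (intro integral_lebesgue_lborel(1)[symmetric]) measurable
        also have "\<dots> = - (LINT y|lebesgue. \<psi> s y *\<^sub>R w y)"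
          using fw T(1)[of s] unfolding flow_deriv_def by (simp add: T(2))
        also have "(LINT y|lebesgue. \<psi> s y *\<^sub>R w y) = (LINT x|lebesgue. \<phi> x *\<^sub>R w (flow \<kappa> v s x))"
          using integral_test_function_flow[OF \<phi> \<kappa>v w, of s] by (simp add: \<psi>_def)
        also have "\<dots> = (LINT x|lborel. \<phi> x *\<^sub>R w (flow \<kappa> v s x))"
          by (intro integral_lebesgue_lborel(1)) measurable
        finally show "(LINT y|lborel. D (s, y) *\<^sub>R f y) = - (LINT x|lborel. \<phi> x *\<^sub>R w (flow \<kappa> v s x))" .
      qed
    qed simp
    also have "\<dots> = - (LINT s:{0..h}|lborel. (LINT x|lborel. \<phi> x *\<^sub>R w (flow \<kappa> v s x)))"
      by (simp add: set_lebesgue_integral_def)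
    also have "\<dots> = - (LINT x|lborel. \<phi> x *\<^sub>R P x)"
      using strip_swap(2)[OF m\<phi> \<phi>b(2)] \<phi>b(1) by simp
    also have "(LINT x|lborel. \<phi> x *\<^sub>R P x) = (LINT x|lebesgue. \<phi> x *\<^sub>R P x)"
      by (intro integral_lebesgue_lborel(1)[symmetric]) measurable
    finally have e: "(LINT x|lebesgue. \<phi> x *\<^sub>R f x) - (LINT x|lebesgue. \<phi> x *\<^sub>R f (flow \<kappa> v h x))
      = - (LINT x|lebesgue. \<phi> x *\<^sub>R P x)" .
    have "(LINT x|lebesgue. \<phi> x *\<^sub>R ((f (flow \<kappa> v h x) - f x) - P x))
      = ((LINT x|lebesgue. \<phi> x *\<^sub>R f (flow \<kappa> v h x)) - (LINT x|lebesgue. \<phi> x *\<^sub>R f x)) - (LINT x|lebesgue. \<phi> x *\<^sub>R P x)"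
      using integrable_test_function_scaleR[OF \<phi> lf] integrable_test_function_scaleR[OF \<phi> f]
        integrable_test_function_scaleR[OF \<phi> lP]
      by (simp add: scaleR_diff_right)
    with e show "(LINT x|lebesgue. \<phi> x *\<^sub>R ((f (flow \<kappa> v h x) - f x) - P x)) = 0"
      by (simp add: algebra_simps)
  qed
  then show ?thesis by (simp add: P_def)
qed

section \<open>The Sobolev inequality\<close>

text \<open>\<open>N\<close> need not be differentiable; the estimate is local, so it can be glued with
  Bolzano's bisection principle.\<close>

lemma power4_decrement_le:
  fixes N \<gamma> :: "real \<Rightarrow> real"
  assumes ab: "a \<le> b" and cont: "continuous_on {a..b} N" and N0: "\<And>t. N t \<ge> 0" and \<gamma>0: "\<And>t. \<gamma> t \<ge> 0"
    and \<gamma>: "set_integrable lborel {a..b} \<gamma>" and [measurable]: "\<gamma> \<in> borel_measurable borel" "N \<in> borel_measurable borel"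
    and le: "\<And>x y. a \<le> x \<Longrightarrow> x \<le> y \<Longrightarrow> y \<le> b \<Longrightarrow> N x - N y \<le> (LINT t:{x..y}|lborel. \<gamma> t)"
  shows "ennreal (N a ^ 4) \<le> ennreal (N b ^ 4) + (\<integral>\<^sup>+t. ennreal (4 * N t ^ 3 * \<gamma> t) * indicator {a..b} t \<partial>lborel)"
proof -
  have "bounded (N ` {a..b})" by (intro compact_imp_bounded compact_continuous_image cont compact_Icc)
  then obtain M where "\<forall>x\<in>N ` {a..b}. norm x \<le> M" unfolding bounded_iff by blast
  then have M: "\<And>t. t \<in> {a..b} \<Longrightarrow> N t \<le> M" by (auto simp: abs_le_iff)
  have M0: "M \<ge> 0" using M[of a] N0[of a] ab by auto
  \<comment> \<open>The slack \<open>\<epsilon>\<close> makes the inequality true on short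
    intervals: near a point \<open>N\<close> oscillates by less than \<open>\<epsilon>\<close>, so
    the value at the left end is dominated by \<open>N t + \<epsilon>\<close> throughout. Additivity
    of the integral then makes the estimate transitive.\<close>
  define G where "G \<epsilon> t = 4 * (N t + \<epsilon>) ^ 3 * \<gamma> t" for \<epsilon> t
  have mG[measurable]: "G \<epsilon> \<in> borel_measurable borel" for \<epsilon> unfolding G_def by measurable
  have Gi: "set_integrable lborel {x..y} (G \<epsilon>)" if "a \<le> x" "y \<le> b" "0 \<le> \<epsilon>" for x y \<epsilon>
  proof (rule set_integrable_bound)
    show "set_integrable lborel {x..y} (\<lambda>t. 4 * (M + \<epsilon>) ^ 3 * \<gamma> t)"
      using set_integrable_subset[OF \<gamma>, of "{x..y}"] that by auto
    show "set_borel_measurable lborel {x..y} (G \<epsilon>)" unfolding set_borel_measurable_def by measurable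
    show "AE t in lborel. t \<in> {x..y} \<longrightarrow> norm (G \<epsilon> t) \<le> norm (4 * (M + \<epsilon>) ^ 3 * \<gamma> t)"
    proof (intro AE_I2 impI)
      fix t assume "t \<in> {x..y}"
      then have "N t \<le> M" using M that by auto
      then show "norm (G \<epsilon> t) \<le> norm (4 * (M + \<epsilon>) ^ 3 * \<gamma> t)"
        unfolding G_def using N0[of t] \<gamma>0[of t] that M0
        by (simp add: abs_mult) (intro mult_right_mono power_mono; simp)
    qed
  qed
  have eps: "N a ^ 4 - N b ^ 4 \<le> (LINT t:{a..b}|lborel. G \<epsilon> t)" if \<epsilon>: "\<epsilon> > 0" for \<epsilon>
  proof -
    define P where "P x y \<longleftrightarrow> (a \<le> x \<longrightarrow> x \<le> y \<longrightarrow> y \<le> b \<longrightarrow> N x ^ 4 - N y ^ 4 \<le> integral {x..y} (G \<epsilon>))" for x y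
    have "P a b" using ab
    proof (induction rule: Bolzano)
      case (trans p q r)
      show ?case unfolding P_def
      proof (intro impI)
        assume "a \<le> p" "r \<le> b"
        with trans have "N p ^ 4 - N q ^ 4 \<le> integral {p..q} (G \<epsilon>)" "N q ^ 4 - N r ^ 4 \<le> integral {q..r} (G \<epsilon>)"
          by (auto simp: P_def)
        moreover have "integral {p..q} (G \<epsilon>) + integral {q..r} (G \<epsilon>) = integral {p..r} (G \<epsilon>)"
          using trans \<open>a \<le> p\<close> \<open>r \<le> b\<close> \<epsilon>
          by (intro Henstock_Kurzweil_Integration.integral_combine set_borel_integral_eq_integral(1) Gi) auto
        ultimately show "N p ^ 4 - N r ^ 4 \<le> integral {p..r} (G \<epsilon>)" by linarith
      qed
    next
      case (local x)
      then have x: "x \<in> {a..b}" by simp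
      obtain d where d: "d > 0" "\<And>t. t \<in> {a..b} \<Longrightarrow> dist t x < d \<Longrightarrow> dist (N t) (N x) < \<epsilon> / 2"
        using cont[unfolded continuous_on_iff] x \<epsilon> by (metis half_gt_zero)
      show ?case
      proof (intro exI conjI allI impI)
        show "d > 0" by (rule d)
        fix p q assume pq: "p \<le> x \<and> x \<le> q \<and> q - p < d"
        show "P p q" unfolding P_def
        proof (intro impI)
          assume apq: "a \<le> p" "p \<le> q" "q \<le> b"
          have near: "N p \<le> N t + \<epsilon>" if "t \<in> {p..q}" for t
          proof -
            have "\<bar>t - x\<bar> < d" "\<bar>p - x\<bar> < d" "t \<in> {a..b}" "p \<in> {a..b}" using that pq apq by auto
            then have "\<bar>N t - N x\<bar> < \<epsilon> / 2" "\<bar>N p - N x\<bar> < \<epsilon> / 2"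
              using d(2) by (auto simp: dist_real_def)
            then show ?thesis by linarith
          qed
          have Gpq: "set_integrable lborel {p..q} (G \<epsilon>)" using apq \<epsilon> by (intro Gi) auto
          have "N p ^ 4 - N q ^ 4 \<le> (LINT t:{p..q}|lborel. G \<epsilon> t)"
          proof (cases "N p \<le> N q")
            case True
            have "0 \<le> (LINT t:{p..q}|lborel. G \<epsilon> t)"
              unfolding set_lebesgue_integral_def G_def using N0 \<gamma>0 \<epsilon>
              by (intro integral_nonneg_AE AE_I2) (auto intro!: mult_nonneg_nonneg zero_le_power add_nonneg_nonneg)
            moreover have "N p ^ 4 \<le> N q ^ 4" using True N0 by (intro power_mono) auto
            ultimately show ?thesis by linarith
          next
            case False
            \<comment> \<open>Convexity of the fourth power, from the factorisation of a difference
              of fourth powers.\<close>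
            have p4: "N p ^ 4 - N q ^ 4 \<le> 4 * N p ^ 3 * (N p - N q)"
            proof -
              have "N p ^ 4 - N q ^ 4 = (N p - N q) * (N p ^ 3 + N p ^ 2 * N q + N p * N q ^ 2 + N q ^ 3)"
                by (simp add: algebra_simps power2_eq_square power3_eq_cube power4_eq_xxxx)
              also have "\<dots> \<le> (N p - N q) * (N p ^ 3 + N p ^ 2 * N p + N p * N p ^ 2 + N p ^ 3)"
                using False N0[of p] N0[of q]
                by (intro mult_left_mono add_mono mult_mono power_mono) auto
              also have "\<dots> = 4 * N p ^ 3 * (N p - N q)"
                by (simp add: algebra_simps power2_eq_square power3_eq_cube)
              finally show ?thesis .
            qed
            also have "\<dots> \<le> 4 * N p ^ 3 * (LINT t:{p..q}|lborel. \<gamma> t)"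
              using N0[of p] apq le by (intro mult_left_mono) auto
            also have "\<dots> = (LINT t:{p..q}|lborel. 4 * N p ^ 3 * \<gamma> t)" by simp
            also have "\<dots> \<le> (LINT t:{p..q}|lborel. G \<epsilon> t)"
            proof (rule set_integral_mono[OF _ Gpq])
              show "set_integrable lborel {p..q} (\<lambda>t. 4 * N p ^ 3 * \<gamma> t)"
                using set_integrable_subset[OF \<gamma>, of "{p..q}"] apq by auto
              fix t assume t: "t \<in> {p..q}"
              show "4 * N p ^ 3 * \<gamma> t \<le> G \<epsilon> t"
                unfolding G_def using near[OF t] N0[of p] \<gamma>0[of t] by (intro mult_mono mult_left_mono power_mono) auto
            qed
            finally show ?thesis .
          qed
          then show "N p ^ 4 - N q ^ 4 \<le> integral {p..q} (G \<epsilon>)"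
            using set_borel_integral_eq_integral(2)[OF Gpq] by simp
        qed
      qed
    qed
    then show ?thesis
      using ab set_borel_integral_eq_integral(2)[OF Gi, of a b \<epsilon>] \<epsilon> by (simp add: P_def)
  qed
  have I0: "N a ^ 4 - N b ^ 4 \<le> (LINT t:{a..b}|lborel. G 0 t)"
  proof (rule field_le_epsilon)
    fix e :: real assume e: "e > 0"
    \<comment> \<open>For \<open>\<epsilon> \<le> 1\<close> the cube of
      \<open>N t + \<epsilon>\<close> exceeds that of \<open>N t\<close> by at most
      \<open>3 * \<epsilon> * (M + 1) ^ 2\<close>; the factor 4 in \<open>G\<close> turns 3 into 12.
      Thus \<open>\<epsilon> * C\<close> bounds the price of the slack.\<close>
    define C where "C = 12 * (M + 1) ^ 2 * (LINT t:{a..b}|lborel. \<gamma> t)"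
    have C0: "C \<ge> 0" unfolding C_def set_lebesgue_integral_def using \<gamma>0
      by (intro mult_nonneg_nonneg integral_nonneg_AE AE_I2) auto
    define \<epsilon> where "\<epsilon> = min 1 (e / (C + 1))"
    have \<epsilon>: "\<epsilon> > 0" "\<epsilon> \<le> 1" using e C0 by (auto simp: \<epsilon>_def)
    have "\<epsilon> * C \<le> e / (C + 1) * C" using C0 by (intro mult_right_mono) (auto simp: \<epsilon>_def)
    also have "\<dots> \<le> e" using C0 e by (simp add: field_simps)
    finally have \<epsilon>C: "\<epsilon> * C \<le> e" .
    have i2: "set_integrable lborel {a..b} (\<lambda>t. \<epsilon> * (12 * (M + 1) ^ 2) * \<gamma> t)" using \<gamma> by auto
    have "(LINT t:{a..b}|lborel. G \<epsilon> t) \<le> (LINT t:{a..b}|lborel. G 0 t + \<epsilon> * (12 * (M + 1) ^ 2) * \<gamma> t)"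
    proof (rule set_integral_mono)
      show "set_integrable lborel {a..b} (G \<epsilon>)" using \<epsilon> by (intro Gi) auto
      show "set_integrable lborel {a..b} (\<lambda>t. G 0 t + \<epsilon> * (12 * (M + 1) ^ 2) * \<gamma> t)"
        by (intro set_integral_add(1) Gi i2) auto
      fix t assume t: "t \<in> {a..b}"
      have "(N t + \<epsilon>) ^ 3 = N t ^ 3 + \<epsilon> * (3 * N t ^ 2 + 3 * N t * \<epsilon> + \<epsilon> ^ 2)"
        by (simp add: algebra_simps power2_eq_square power3_eq_cube)
      also have "\<dots> \<le> N t ^ 3 + \<epsilon> * (3 * (M + 1) ^ 2)"
      proof -
        have "3 * N t ^ 2 + 3 * N t * \<epsilon> + \<epsilon> ^ 2 \<le> 3 * M ^ 2 + 3 * M * 1 + 1 ^ 2"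
          using M[OF t] N0[of t] \<epsilon> M0 by (intro add_mono mult_mono power_mono) auto
        also have "\<dots> \<le> 3 * (M + 1) ^ 2" using M0 by (simp add: power2_eq_square algebra_simps)
        finally show ?thesis using \<epsilon> by (intro add_left_mono mult_left_mono) auto
      qed
      finally have "4 * (N t + \<epsilon>) ^ 3 * \<gamma> t \<le> 4 * (N t ^ 3 + \<epsilon> * (3 * (M + 1) ^ 2)) * \<gamma> t"
        using \<gamma>0 by (intro mult_right_mono) auto
      then show "G \<epsilon> t \<le> G 0 t + \<epsilon> * (12 * (M + 1) ^ 2) * \<gamma> t"
        by (simp add: G_def algebra_simps)
    qed
    also have "\<dots> = (LINT t:{a..b}|lborel. G 0 t) + \<epsilon> * C"
      by (subst set_integral_add(2)) (use Gi[of a b 0] i2 in \<open>auto simp: C_def\<close>)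
    finally show "N a ^ 4 - N b ^ 4 \<le> (LINT t:{a..b}|lborel. G 0 t) + e"
      using eps[OF \<epsilon>(1)] \<epsilon>C by linarith
  qed
  have nn: "indicat_real {a..b} t *\<^sub>R G 0 t \<ge> 0" for t
    using N0[of t] \<gamma>0[of t] by (simp add: G_def)
  have "(\<integral>\<^sup>+t. ennreal (4 * N t ^ 3 * \<gamma> t) * indicator {a..b} t \<partial>lborel)
      = (\<integral>\<^sup>+t. ennreal (indicator {a..b} t *\<^sub>R G 0 t) \<partial>lborel)"
    by (intro nn_integral_cong) (simp add: G_def indicator_def)
  also have "\<dots> = ennreal (LINT t:{a..b}|lborel. G 0 t)"
    unfolding set_lebesgue_integral_def
    by (intro nn_integral_eq_integral AE_I2 nn) (use Gi[of a b 0] in \<open>simp add: set_integrable_def\<close>)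
  finally have e: "(\<integral>\<^sup>+t. ennreal (4 * N t ^ 3 * \<gamma> t) * indicator {a..b} t \<partial>lborel)
      = ennreal (LINT t:{a..b}|lborel. G 0 t)" .
  have J0: "0 \<le> (LINT t:{a..b}|lborel. G 0 t)"
    unfolding set_lebesgue_integral_def by (intro integral_nonneg_AE AE_I2 nn)
  have "ennreal (N a ^ 4) \<le> ennreal (N b ^ 4 + (LINT t:{a..b}|lborel. G 0 t))"
    using I0 by (intro ennreal_leI) simp
  then show ?thesis using J0 N0 by (simp add: e)
qed

section \<open>Integration along coordinate lines\<close>

lemma nn_integral_translate:
  fixes v :: "real^3"
  assumes [measurable]: "F \<in> borel_measurable borel"
  shows "(\<integral>\<^sup>+x. F (x + v) \<partial>lborel) = (\<integral>\<^sup>+x. F x \<partial>lborel)"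
proof -
  have "(\<integral>\<^sup>+x. F x \<partial>lborel) = (\<integral>\<^sup>+x. F x \<partial>distr lborel borel ((+) v))"
    by (simp add: lborel_distr_plus)
  also have "\<dots> = (\<integral>\<^sup>+x. F (v + x) \<partial>lborel)" by (subst nn_integral_distr) auto
  finally show ?thesis by (simp add: add.commute)
qed

text \<open>Integrate the line integral over a ball of radius \<open>n\<close> and exchange the
  order: a given point \<open>y\<close> is reached from the ball only for \<open>t\<close> in an
  interval of length \<open>2 * n\<close>. So the double integral is at most \<open>2 * n\<close>
  times the total integral; balls exhaust the space.\<close>

lemma AE_line_nn_integral_finite:
  fixes F :: "real^3 \<Rightarrow> ennreal"
  assumes [measurable]: "F \<in> borel_measurable borel" and fin: "(\<integral>\<^sup>+x. F x \<partial>lborel) < \<infinity>"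
  shows "AE x in lborel. (\<integral>\<^sup>+t. F (x + t *\<^sub>R axis i 1) \<partial>lborel) < \<infinity>"
proof -
  let ?e = "axis i (1::real) :: real^3"
  have mF: "(\<lambda>(x, t). F (x + t *\<^sub>R ?e)) \<in> borel_measurable (lborel \<Otimes>\<^sub>M lborel)" by measurable
  have "AE x in lborel. indicator (cball 0 (real n)) x * (\<integral>\<^sup>+t. F (x + t *\<^sub>R ?e) \<partial>lborel) \<noteq> \<infinity>" for n
  proof (rule nn_integral_PInf_AE[of "\<lambda>x. indicator (cball 0 (real n)) x * (\<integral>\<^sup>+t. F (x + t *\<^sub>R ?e) \<partial>lborel)"])
    have [measurable]: "cball (0::real^3) (real n) \<in> sets borel" by simp
    show "(\<lambda>x. indicator (cball 0 (real n)) x * (\<integral>\<^sup>+t. F (x + t *\<^sub>R ?e) \<partial>lborel)) \<in> borel_measurable lborel"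
      using mF by measurable
    have "(\<integral>\<^sup>+x. indicator (cball 0 (real n)) x * (\<integral>\<^sup>+t. F (x + t *\<^sub>R ?e) \<partial>lborel) \<partial>lborel)
        = (\<integral>\<^sup>+x. (\<integral>\<^sup>+t. indicator (cball 0 (real n)) x * F (x + t *\<^sub>R ?e) \<partial>lborel) \<partial>lborel)"
      by (intro nn_integral_cong nn_integral_cmult[symmetric]) measurable
    also have "\<dots> = (\<integral>\<^sup>+t. (\<integral>\<^sup>+x. indicator (cball 0 (real n)) x * F (x + t *\<^sub>R ?e) \<partial>lborel) \<partial>lborel)"
      by (rule lborel_pair.Fubini'[symmetric]) measurable
    also have "\<dots> = (\<integral>\<^sup>+t. (\<integral>\<^sup>+y. indicator (cball 0 (real n)) (y - t *\<^sub>R ?e) * F y \<partial>lborel) \<partial>lborel)"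
    proof (rule nn_integral_cong)
      fix t
      show "(\<integral>\<^sup>+x. indicator (cball 0 (real n)) x * F (x + t *\<^sub>R ?e) \<partial>lborel)
          = (\<integral>\<^sup>+y. indicator (cball 0 (real n)) (y - t *\<^sub>R ?e) * F y \<partial>lborel)"
        using nn_integral_translate[of "\<lambda>y. indicator (cball 0 (real n)) (y - t *\<^sub>R ?e) * F y" "t *\<^sub>R ?e"]
        by simp
    qed
    also have "\<dots> = (\<integral>\<^sup>+y. (\<integral>\<^sup>+t. indicator (cball 0 (real n)) (y - t *\<^sub>R ?e) * F y \<partial>lborel) \<partial>lborel)"
      by (rule lborel_pair.Fubini') measurable
    also have "\<dots> \<le> (\<integral>\<^sup>+y. ennreal (2 * n) * F y \<partial>lborel)"
    proof (rule nn_integral_mono)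
      fix y
      have "(\<integral>\<^sup>+t. indicator (cball 0 (real n)) (y - t *\<^sub>R ?e) * F y \<partial>lborel)
          \<le> (\<integral>\<^sup>+t. F y * indicator {y $ i - n .. y $ i + n} t \<partial>lborel)"
      proof (intro nn_integral_mono)
        fix t
        have "t \<in> {y $ i - n .. y $ i + n}" if "y - t *\<^sub>R ?e \<in> cball 0 (real n)"
          using order_trans[OF component_le_norm_cart[of "y - t *\<^sub>R ?e" i], of "real n"] that
          by (auto simp: axis_def)
        then show "indicator (cball 0 (real n)) (y - t *\<^sub>R ?e) * F y \<le> F y * indicator {y $ i - n .. y $ i + n} t"
          by (auto simp: indicator_def)
      qed
      also have "\<dots> = ennreal (2 * n) * F y"
        by (subst nn_integral_cmult_indicator) (auto simp: mult.commute)
      finally show "(\<integral>\<^sup>+t. indicator (cball 0 (real n)) (y - t *\<^sub>R ?e) * F y \<partial>lborel) \<le> ennreal (2 * n) * F y" .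
    qed
    also have "\<dots> < \<infinity>" using fin by (subst nn_integral_cmult) (auto simp: ennreal_mult_less_top)
    finally show "(\<integral>\<^sup>+x. indicator (cball 0 (real n)) x * (\<integral>\<^sup>+t. F (x + t *\<^sub>R ?e) \<partial>lborel) \<partial>lborel) \<noteq> \<infinity>"
      by simp
  qed
  then have "AE x in lborel. \<forall>n. indicator (cball 0 (real n)) x * (\<integral>\<^sup>+t. F (x + t *\<^sub>R ?e) \<partial>lborel) \<noteq> \<infinity>"
    by (subst AE_all_countable) blast
  then show ?thesis
  proof eventually_elim
    case (elim x)
    obtain n where "norm x \<le> real n" using real_arch_simple by blast
    with spec[OF elim, of n] show ?case by (auto simp: top.not_eq_extremum)
  qed
qed

lemma emeasure_lborel_atLeast_real: "emeasure lborel {a::real..} = \<infinity>"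
proof (rule ccontr)
  assume "emeasure lborel {a..} \<noteq> \<infinity>"
  then obtain c where c: "emeasure lborel {a..} = ennreal c" "c \<ge> 0"
    by (cases "emeasure lborel {a..}") auto
  moreover have "emeasure lborel {a .. a + (c + 1)} \<le> emeasure lborel {a..}"
    by (intro emeasure_mono) auto
  ultimately have "ennreal (c + 1) \<le> ennreal c" by simp
  with c(2) show False by (simp add: ennreal_le_iff)
qed

lemma min_norm_lipschitz: "min (norm x) M - min (norm y) M \<le> norm (y - x :: complex)"
  using norm_triangle_ineq3[of x y] by (auto simp: min_def norm_minus_commute)

text \<open>On almost every half-line \<open>f\<close> agrees almost everywhere with a continuous
  primitive of \<open>g\<close>, and square integrability forces that primitive to be arbitrarily
  small somewhere. The decrement of the fourth power from the starting point to such a place gives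
  the bound. Truncation at \<open>M\<close> is 1-Lipschitz, hence preserves the argument, and keeps
  the sixth power integrable later.\<close>

lemma truncated_power4_le_line_integral:
  fixes f :: "real^3 \<Rightarrow> complex" and g :: "real^3 \<Rightarrow> complex"
  assumes fb[measurable]: "f \<in> borel_measurable borel" and gb[measurable]: "g \<in> borel_measurable borel"
    and f: "in_Lp 2 f" and g: "in_Lp 2 g" and fg: "flow_deriv 0 (axis i 1) f g" and M: "M \<ge> 0"
  shows "AE x in lborel. ennreal (min (norm (f x)) M ^ 4) \<le>
    (\<integral>\<^sup>+t. ennreal (4 * min (norm (f (x + t *\<^sub>R axis i 1))) M ^ 3 * norm (g (x + t *\<^sub>R axis i 1))) \<partial>lborel)"
proof -
  let ?e = "axis i (1::real) :: real^3"
  have lf: "loc_int f" and lg: "loc_int g" using f g by (auto intro: loc_int_L2)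
  have fl: "flow 0 ?e s x = x + s *\<^sub>R ?e" for s x by (simp add: flow_def)
  have fin: "AE x in lborel. (\<integral>\<^sup>+t. ennreal ((norm (u (x + t *\<^sub>R ?e)))\<^sup>2) \<partial>lborel) < \<infinity>"
    if [measurable]: "u \<in> borel_measurable borel" and u: "in_Lp 2 u" for u :: "real^3 \<Rightarrow> complex"
  proof (rule AE_line_nn_integral_finite[of "\<lambda>x. ennreal ((norm (u x))\<^sup>2)"])
    have "integrable lborel (\<lambda>x. (norm (u x))\<^sup>2)"
      using u by (subst integral_lebesgue_lborel(2)[symmetric]) (auto simp: in_L2_iff)
    then show "(\<integral>\<^sup>+x. ennreal ((norm (u x))\<^sup>2) \<partial>lborel) < \<infinity>"
      by (simp add: nn_integral_eq_integral)
  qed measurable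
  have inc: "AE x in lborel. f (x + h *\<^sub>R ?e) - f x = (LINT s:{0..h}|lborel. g (x + s *\<^sub>R ?e))" if "h \<ge> 0" for h
    using flow_increment[OF fb gb lf lg fg _ that] unfolding fl
    by (metis (no_types, lifting) AE_completion_iff)
  \<comment> \<open>In \<open>inc\<close> the null set depends on \<open>h\<close>. Joint
    measurability permits exchanging the two quantifiers, after which almost every line satisfies
    the identity for almost every \<open>h\<close> at once.\<close>
  have "AE h in lborel. AE x in lborel. h \<ge> 0 \<longrightarrow> f (x + h *\<^sub>R ?e) - f x = (LINT s:{0..h}|lborel. g (x + s *\<^sub>R ?e))"
  proof (rule AE_I2)
    fix h :: real
    show "AE x in lborel. h \<ge> 0 \<longrightarrow> f (x + h *\<^sub>R ?e) - f x = (LINT s:{0..h}|lborel. g (x + s *\<^sub>R ?e))"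
      using inc[of h] by (cases "h \<ge> 0") auto
  qed
  moreover have "{z \<in> space (lborel \<Otimes>\<^sub>M lborel). fst z \<ge> (0::real) \<longrightarrow>
      f (snd z + fst z *\<^sub>R ?e) - f (snd z) = (LINT s:{0..fst z}|lborel. g (snd z + s *\<^sub>R ?e))} \<in> sets (lborel \<Otimes>\<^sub>M lborel)"
  proof -
    have "(\<lambda>(z, s). indicator {0..fst z} s *\<^sub>R g (snd z + s *\<^sub>R ?e))
        = (\<lambda>(z, s). (if 0 \<le> s \<and> s \<le> fst z then g (snd z + s *\<^sub>R ?e) else 0))"
      by (auto simp: fun_eq_iff indicator_def)
    moreover have "(\<lambda>(z::real \<times> (real^3), s). (if 0 \<le> s \<and> s \<le> fst z then g (snd z + s *\<^sub>R ?e) else 0))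
        \<in> borel_measurable ((lborel \<Otimes>\<^sub>M lborel) \<Otimes>\<^sub>M lborel)"
      by measurable
    ultimately have "(\<lambda>(z::real \<times> (real^3), s). indicator {0..fst z} s *\<^sub>R g (snd z + s *\<^sub>R ?e))
        \<in> borel_measurable ((lborel \<Otimes>\<^sub>M lborel) \<Otimes>\<^sub>M lborel)" by simp
    from lborel.borel_measurable_lebesgue_integral[OF this]
    have [measurable]: "(\<lambda>z::real \<times> (real^3). LINT s:{0..fst z}|lborel. g (snd z + s *\<^sub>R ?e)) \<in> borel_measurable (lborel \<Otimes>\<^sub>M lborel)"
      unfolding set_lebesgue_integral_def by simp
    show ?thesis by measurable
  qed
  ultimately have "AE x in lborel. AE h in lborel. h \<ge> 0 \<longrightarrow> f (x + h *\<^sub>R ?e) - f x = (LINT s:{0..h}|lborel. g (x + s *\<^sub>R ?e))"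
    using lborel_pair.AE_commute[of "\<lambda>h x. h \<ge> 0 \<longrightarrow> f (x + h *\<^sub>R ?e) - f x = (LINT s:{0..h}|lborel. g (x + s *\<^sub>R ?e))"] by blast
  from this fin[OF fb f] fin[OF gb g] show ?thesis
  proof eventually_elim
    case (elim x)
    let ?f = "\<lambda>t. f (x + t *\<^sub>R ?e)" and ?g = "\<lambda>t. g (x + t *\<^sub>R ?e)"
    have [measurable]: "?f \<in> borel_measurable borel" "?g \<in> borel_measurable borel" by measurable
    have g2: "integrable lborel (\<lambda>t. (norm (?g t))\<^sup>2)"
      using elim(3) by (intro integrableI_bounded) auto
    have gi: "set_integrable lborel {a..b} (\<lambda>t. norm (?g t))" for a b
      unfolding set_integrable_def
    proof (rule Bochner_Integration.integrable_bound)
      show "integrable lborel (\<lambda>t. indicator {a..b} t + (norm (?g t))\<^sup>2)"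
        by (intro Bochner_Integration.integrable_add g2 integrable_real_indicator) (auto simp: emeasure_lborel_Icc_eq)
      have "c \<le> 1 + c\<^sup>2" if "c \<ge> 0" for c :: real
        using sum_squares_bound[of c 1] that by (simp add: power2_eq_square) 
      then show "AE t in lborel. norm (indicator {a..b} t *\<^sub>R norm (?g t)) \<le> norm (indicator {a..b} t + (norm (?g t))\<^sup>2)"
        by (auto simp: indicator_def)
    qed measurable
    have gi': "set_integrable lborel {a..b} ?g" for a b
      unfolding set_integrable_def
      by (rule Bochner_Integration.integrable_bound[OF gi[of a b, unfolded set_integrable_def]]) auto
    \<comment> \<open>The continuous representative of \<open>f\<close> on the half-line through
      \<open>x\<close>; it agrees with \<open>f\<close> at \<open>t = 0\<close> exactly and at
      almost every later time.\<close>
    define F where "F t = f x + integral {0..t} ?g" for t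
    have Fdiff: "F q - F p = (LINT s:{p..q}|lborel. ?g s)" if "0 \<le> p" "p \<le> q" for p q
      using Henstock_Kurzweil_Integration.integral_combine[OF that set_borel_integral_eq_integral(1)[OF gi'[of 0 q]]]
        set_borel_integral_eq_integral(2)[OF gi'[of p q]]
      by (simp add: F_def algebra_simps)
    have Fcont: "continuous_on {0..b} F" for b
      unfolding F_def
      by (intro continuous_intros indefinite_integral_continuous_1 set_borel_integral_eq_integral(1) gi')
    have FAE: "AE t in lborel. t \<ge> 0 \<longrightarrow> F t = ?f t"
      using elim(1) by eventually_elim (use Fdiff[of 0] in \<open>auto simp: F_def algebra_simps\<close>)
    define N where "N t = (if t \<ge> 0 then min (norm (F t)) M else 0)" for t
    have mN[measurable]: "N \<in> borel_measurable borel"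
    proof -
      have "continuous_on {0..} F"
      proof (rule continuous_on_subset[of "\<Union>n. {0..real n}"])
        show "{0..} \<subseteq> (\<Union>n. {0..real n})" using real_arch_simple by auto
        show "continuous_on (\<Union>n. {0..real n}) F"
          unfolding continuous_on_eq_continuous_within
        proof
          fix t assume "t \<in> (\<Union>n. {0..real n})"
          then have t: "t \<ge> 0" by auto
          have "continuous (at t within {0..t+1}) F"
            using Fcont[of "t+1"] t by (auto simp: continuous_on_eq_continuous_within)
          moreover have "at t within (\<Union>n. {0..real n}) = at t within {0..t+1}"
            by (rule at_within_nhd[of _ "{..<t+1}"]) (use real_arch_simple in \<open>auto intro: order_trans\<close>)
          ultimately show "continuous (at t within (\<Union>n. {0..real n})) F" by (simp add: continuous_within)
        qed
      qed
      then have "(\<lambda>t. if t \<in> {0..} then min (norm (F t)) M else 0) \<in> borel_measurable borel"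
        by (intro borel_measurable_continuous_on_if) (auto intro!: continuous_intros)
      then show ?thesis by (simp add: N_def[abs_def])
    qed
    have N0: "N t \<ge> 0" for t using M by (simp add: N_def)
    have NAE: "AE t in lborel. t \<ge> 0 \<longrightarrow> N t = min (norm (?f t)) M"
      using FAE by eventually_elim (simp add: N_def)
    let ?G = "\<integral>\<^sup>+t. ennreal (4 * min (norm (?f t)) M ^ 3 * norm (?g t)) \<partial>lborel"
    have step: "ennreal (N 0 ^ 4) \<le> ennreal (N b ^ 4) + ?G" if b: "b \<ge> 0" for b
    proof -
      have "ennreal (N 0 ^ 4) \<le> ennreal (N b ^ 4) + (\<integral>\<^sup>+t. ennreal (4 * N t ^ 3 * norm (?g t)) * indicator {0..b} t \<partial>lborel)"
      proof (rule power4_decrement_le[OF b])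
        have "continuous_on {0..b} (\<lambda>t. min (norm (F t)) M)"
          by (intro continuous_on_min continuous_on_norm Fcont continuous_on_const)
        then show "continuous_on {0..b} N" by (rule continuous_on_eq) (simp add: N_def)
        show "N p - N q \<le> (LINT t:{p..q}|lborel. norm (?g t))" if "0 \<le> p" "p \<le> q" for p q
        proof -
          have "N p - N q \<le> norm (F q - F p)" using that min_norm_lipschitz by (simp add: N_def)
          also have "\<dots> \<le> (LINT t:{p..q}|lborel. norm (?g t))"
            unfolding Fdiff[OF that] set_lebesgue_integral_def
            using integral_norm_bound[of lborel "\<lambda>t. indicator {p..q} t *\<^sub>R ?g t"] by simp
          finally show ?thesis .
        qed
      qed (use gi mN N0 in \<open>simp_all\<close>)
      also have "(\<integral>\<^sup>+t. ennreal (4 * N t ^ 3 * norm (?g t)) * indicator {0..b} t \<partial>lborel) \<le> ?G"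
      proof (rule nn_integral_mono_AE)
        show "AE t in lborel. ennreal (4 * N t ^ 3 * norm (?g t)) * indicator {0..b} t
            \<le> ennreal (4 * min (norm (?f t)) M ^ 3 * norm (?g t))"
          using NAE by eventually_elim (auto simp: indicator_def)
      qed
      finally show ?thesis by (simp add: add_left_mono)
    qed
    \<comment> \<open>Otherwise the square of \<open>f\<close> would have a positive lower bound
      almost everywhere on a half-line of infinite length.\<close>
    have small: "\<exists>b\<ge>0. norm (F b) < \<epsilon>" if \<epsilon>: "\<epsilon> > 0" for \<epsilon>
    proof (rule ccontr)
      assume "\<not> ?thesis"
      then have *: "\<And>b. b \<ge> 0 \<Longrightarrow> norm (F b) \<ge> \<epsilon>" by force
      have "(\<integral>\<^sup>+t. ennreal (\<epsilon>\<^sup>2) * indicator {0::real..} t \<partial>lborel) \<le> (\<integral>\<^sup>+t. ennreal ((norm (?f t))\<^sup>2) \<partial>lborel)"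
      proof (rule nn_integral_mono_AE)
        show "AE t in lborel. ennreal (\<epsilon>\<^sup>2) * indicator {0..} t \<le> ennreal ((norm (?f t))\<^sup>2)"
          using FAE
        proof eventually_elim
          case (elim t)
          then show ?case using *[of t] \<epsilon> by (auto simp: indicator_def intro!: ennreal_leI power_mono)
        qed
      qed
      moreover have "(\<integral>\<^sup>+t. ennreal (\<epsilon>\<^sup>2) * indicator {0::real..} t \<partial>lborel) = \<infinity>"
        using \<epsilon> by (subst nn_integral_cmult_indicator) (auto simp: emeasure_lborel_atLeast_real ennreal_mult_eq_top_iff)
      ultimately show False using elim(2) by simp
    qed
    have "ennreal (N 0 ^ 4) \<le> ?G"
    proof (rule ennreal_le_epsilon)
      fix e :: real assume e: "e > 0"
      \<comment> \<open>Below 1 a fourth power does not exceed the number itself, which explains the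
        minimum with 1.\<close>
      obtain b where b: "b \<ge> 0" "norm (F b) < min 1 e" using small[of "min 1 e"] e by auto
      have "N b ^ 4 \<le> min 1 e ^ 4" using b M by (intro power_mono) (auto simp: N_def min_def)
      also have "min 1 e ^ 4 \<le> min 1 e ^ 1" using e by (intro power_decreasing) auto
      finally have "N b ^ 4 \<le> e" by simp
      then have "ennreal (N b ^ 4) + ?G \<le> ennreal e + ?G" by (intro add_right_mono ennreal_leI)
      with step[OF b(1)] have "ennreal (N 0 ^ 4) \<le> ennreal e + ?G" by (rule order_trans)
      then show "ennreal (N 0 ^ 4) \<le> ?G + ennreal e" by (simp add: add.commute)
    qed
    then show ?case by (simp add: N_def F_def)
  qed
qed

section \<open>The Loomis-Whitney inequality\<close>

definition ennsqrt :: "ennreal \<Rightarrow> ennreal" where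
  "ennsqrt x = (if x = \<infinity> then \<infinity> else ennreal (sqrt (enn2real x)))"

lemma ennsqrt_power2: "(ennsqrt x)\<^sup>2 = x"
  by (cases x) (auto simp: ennsqrt_def power2_eq_square ennreal_mult[symmetric] ennreal_mult_top)

lemma measurable_ennsqrt [measurable]: "ennsqrt \<in> borel_measurable borel"
  unfolding ennsqrt_def[abs_def] by measurable

lemma ennreal_power2_le_imp_le: "(x::ennreal)\<^sup>2 \<le> y\<^sup>2 \<Longrightarrow> x \<le> y"
proof (cases y)
  case (real s)
  assume le: "x\<^sup>2 \<le> y\<^sup>2"
  then have "x\<^sup>2 \<le> ennreal (s\<^sup>2)" using real by (simp add: ennreal_power)
  then have "x \<noteq> top" by (auto simp: power2_eq_square ennreal_mult_top top_unique)
  then obtain r where r: "x = ennreal r" "r \<ge> 0" by (cases x) auto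
  then have "r\<^sup>2 \<le> s\<^sup>2" using le real by (simp add: ennreal_power ennreal_le_iff)
  then have "r \<le> s" using real(1) by (rule power2_le_imp_le)
  with r real show ?thesis by (simp add: ennreal_leI)
qed simp

lemma le_ennsqrtI: "x\<^sup>2 \<le> y \<Longrightarrow> x \<le> ennsqrt y"
  by (rule ennreal_power2_le_imp_le) (simp add: ennsqrt_power2)

text \<open>Cauchy-Schwarz is applied three times, in z, then in y, then in x; each time one of the
  three factors is constant in the variable of integration.\<close>

lemma Loomis_Whitney:
  fixes a b c :: "real \<Rightarrow> real \<Rightarrow> ennreal"
  assumes ma: "case_prod a \<in> borel_measurable (lborel \<Otimes>\<^sub>M lborel)"
    and mb: "case_prod b \<in> borel_measurable (lborel \<Otimes>\<^sub>M lborel)"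
    and mc: "case_prod c \<in> borel_measurable (lborel \<Otimes>\<^sub>M lborel)"
  shows "(\<integral>\<^sup>+x. (\<integral>\<^sup>+y. (\<integral>\<^sup>+z. a y z * b x z * c x y \<partial>lborel) \<partial>lborel) \<partial>lborel)\<^sup>2
    \<le> (\<integral>\<^sup>+y. (\<integral>\<^sup>+z. (a y z)\<^sup>2 \<partial>lborel) \<partial>lborel) * (\<integral>\<^sup>+x. (\<integral>\<^sup>+z. (b x z)\<^sup>2 \<partial>lborel) \<partial>lborel)
      * (\<integral>\<^sup>+x. (\<integral>\<^sup>+y. (c x y)\<^sup>2 \<partial>lborel) \<partial>lborel)"
proof -
  note [measurable (raw)] = measurable_compose_Pair1[OF _ ma] measurable_compose_Pair1[OF _ mb] measurable_compose_Pair1[OF _ mc]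
  have [measurable]: "a y \<in> borel_measurable borel" "b y \<in> borel_measurable borel" "c y \<in> borel_measurable borel" for y
    using measurable_compose_Pair1[OF _ ma, of y] measurable_compose_Pair1[OF _ mb, of y]
      measurable_compose_Pair1[OF _ mc, of y] by auto
  define \<alpha> where "\<alpha> y = (\<integral>\<^sup>+z. (a y z)\<^sup>2 \<partial>lborel)" for y
  define \<beta> where "\<beta> x = (\<integral>\<^sup>+z. (b x z)\<^sup>2 \<partial>lborel)" for x
  define \<kappa> where "\<kappa> x = (\<integral>\<^sup>+y. (c x y)\<^sup>2 \<partial>lborel)" for x
  have m\<alpha>[measurable]: "\<alpha> \<in> borel_measurable borel" and m\<beta>[measurable]: "\<beta> \<in> borel_measurable borel"
    and m\<kappa>[measurable]: "\<kappa> \<in> borel_measurable borel"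
    using lborel.borel_measurable_nn_integral[of "\<lambda>y z. (a y z)\<^sup>2" lborel] ma
      lborel.borel_measurable_nn_integral[of "\<lambda>y z. (b y z)\<^sup>2" lborel] mb
      lborel.borel_measurable_nn_integral[of "\<lambda>y z. (c y z)\<^sup>2" lborel] mc
    by (auto simp: \<alpha>_def[abs_def] \<beta>_def[abs_def] \<kappa>_def[abs_def] case_prod_beta')
  define K where "K x = (\<integral>\<^sup>+y. c x y * ennsqrt (\<alpha> y) \<partial>lborel)" for x
  have mK[measurable]: "K \<in> borel_measurable borel"
    using lborel.borel_measurable_nn_integral[of "\<lambda>x y. c x y * ennsqrt (\<alpha> y)" lborel] mc
    by (auto simp: K_def[abs_def] case_prod_beta')
  have inner: "(\<integral>\<^sup>+z. a y z * b x z * c x y \<partial>lborel) \<le> c x y * ennsqrt (\<alpha> y) * ennsqrt (\<beta> x)" for x y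
  proof -
    have e: "(\<integral>\<^sup>+z. a y z * b x z * c x y \<partial>lborel) = (\<integral>\<^sup>+z. a y z * b x z \<partial>lborel) * c x y"
      by (rule nn_integral_multc) measurable
    have t: "(\<integral>\<^sup>+z. a y z * b x z \<partial>lborel) \<le> ennsqrt (\<alpha> y) * ennsqrt (\<beta> x)"
    proof (rule ennreal_power2_le_imp_le)
      have "(\<integral>\<^sup>+z. a y z * b x z \<partial>lborel)\<^sup>2 \<le> \<alpha> y * \<beta> x"
        unfolding \<alpha>_def \<beta>_def by (rule Cauchy_Schwarz_nn_integral) measurable
      then show "(\<integral>\<^sup>+z. a y z * b x z \<partial>lborel)\<^sup>2 \<le> (ennsqrt (\<alpha> y) * ennsqrt (\<beta> x))\<^sup>2"
        by (simp add: power_mult_distrib ennsqrt_power2)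
    qed
    show ?thesis
      unfolding e using mult_right_mono[OF t, of "c x y"] by (simp add: mult_ac)
  qed
  have K2: "(K x)\<^sup>2 \<le> \<kappa> x * (\<integral>\<^sup>+y. \<alpha> y \<partial>lborel)" for x
  proof -
    have "(K x)\<^sup>2 \<le> (\<integral>\<^sup>+y. (c x y)\<^sup>2 \<partial>lborel) * (\<integral>\<^sup>+y. (ennsqrt (\<alpha> y))\<^sup>2 \<partial>lborel)"
      unfolding K_def by (rule Cauchy_Schwarz_nn_integral) measurable
    then show ?thesis by (simp add: ennsqrt_power2 \<kappa>_def)
  qed
  have "(\<integral>\<^sup>+x. (\<integral>\<^sup>+y. (\<integral>\<^sup>+z. a y z * b x z * c x y \<partial>lborel) \<partial>lborel) \<partial>lborel)
      \<le> (\<integral>\<^sup>+x. (\<integral>\<^sup>+y. c x y * ennsqrt (\<alpha> y) * ennsqrt (\<beta> x) \<partial>lborel) \<partial>lborel)"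
    by (intro nn_integral_mono inner)
  also have "\<dots> = (\<integral>\<^sup>+x. K x * ennsqrt (\<beta> x) \<partial>lborel)"
    unfolding K_def by (intro nn_integral_cong nn_integral_multc) measurable
  finally have "(\<integral>\<^sup>+x. (\<integral>\<^sup>+y. (\<integral>\<^sup>+z. a y z * b x z * c x y \<partial>lborel) \<partial>lborel) \<partial>lborel)\<^sup>2
      \<le> (\<integral>\<^sup>+x. K x * ennsqrt (\<beta> x) \<partial>lborel)\<^sup>2" by (intro power_mono) auto
  also have "\<dots> \<le> (\<integral>\<^sup>+x. (K x)\<^sup>2 \<partial>lborel) * (\<integral>\<^sup>+x. (ennsqrt (\<beta> x))\<^sup>2 \<partial>lborel)"
    by (rule Cauchy_Schwarz_nn_integral) measurable
  also have "\<dots> \<le> (\<integral>\<^sup>+x. \<kappa> x * (\<integral>\<^sup>+y. \<alpha> y \<partial>lborel) \<partial>lborel) * (\<integral>\<^sup>+x. \<beta> x \<partial>lborel)"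
    unfolding ennsqrt_power2 by (intro mult_right_mono nn_integral_mono K2) auto
  also have "(\<integral>\<^sup>+x. \<kappa> x * (\<integral>\<^sup>+y. \<alpha> y \<partial>lborel) \<partial>lborel) = (\<integral>\<^sup>+x. \<kappa> x \<partial>lborel) * (\<integral>\<^sup>+y. \<alpha> y \<partial>lborel)"
    by (rule nn_integral_multc) measurable
  finally show ?thesis by (simp add: \<alpha>_def \<beta>_def \<kappa>_def mult.commute mult.left_commute)
qed

definition vec3 :: "real \<Rightarrow> real \<Rightarrow> real \<Rightarrow> real^3" where
  "vec3 x y z = x *\<^sub>R axis 1 1 + y *\<^sub>R axis 2 1 + z *\<^sub>R axis 3 1"

lemma vec3_nth [simp]: "vec3 x y z $ 1 = x" "vec3 x y z $ 2 = y" "vec3 x y z $ 3 = z"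
  by (simp_all add: vec3_def axis_def)

lemma vec3_add_axis: "vec3 x y z + t *\<^sub>R axis 1 1 = vec3 (x + t) y z"
  "vec3 x y z + t *\<^sub>R axis 2 1 = vec3 x (y + t) z" "vec3 x y z + t *\<^sub>R axis 3 1 = vec3 x y (z + t)"
  by (simp_all add: vec3_def algebra_simps)

lemma measurable_vec3 [measurable (raw)]:
  "f \<in> borel_measurable M \<Longrightarrow> g \<in> borel_measurable M \<Longrightarrow> h \<in> borel_measurable M \<Longrightarrow>
   (\<lambda>w. vec3 (f w) (g w) (h w)) \<in> borel_measurable M"
  unfolding vec3_def by (intro borel_measurable_add borel_measurable_scaleR) auto

lemma lborel_eq_distr_vec3:
  "(lborel :: (real^3) measure) = distr (lborel \<Otimes>\<^sub>M (lborel \<Otimes>\<^sub>M lborel)) borel (\<lambda>(x, y, z). vec3 x y z)"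
proof (rule lborel_eqI)
  fix l u :: "real^3" assume le: "\<And>b. b \<in> Basis \<Longrightarrow> l \<bullet> b \<le> u \<bullet> b"
  have lu: "l $ i \<le> u $ i" for i using le[of "axis i 1"] by (auto simp: inner_axis Basis_vec_def)
  have m: "(\<lambda>(x, y, z). vec3 x y z) \<in> lborel \<Otimes>\<^sub>M (lborel \<Otimes>\<^sub>M lborel) \<rightarrow>\<^sub>M borel" by measurable
  have "emeasure (distr (lborel \<Otimes>\<^sub>M (lborel \<Otimes>\<^sub>M lborel)) borel (\<lambda>(x, y, z). vec3 x y z)) (box l u)
      = emeasure (lborel \<Otimes>\<^sub>M (lborel \<Otimes>\<^sub>M lborel)) ({l$1<..<u$1} \<times> ({l$2<..<u$2} \<times> {l$3<..<u$3}))"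
    by (subst emeasure_distr[OF m])
       (auto intro!: arg_cong2[of _ _ _ _ emeasure] simp: mem_box_cart forall_3 space_pair_measure)
  also have "\<dots> = ennreal (u$1 - l$1) * (ennreal (u$2 - l$2) * ennreal (u$3 - l$3))"
    using lu by (subst sigma_finite_measure.emeasure_pair_measure_Times[OF sigma_finite_pair_measure[OF
            lborel.sigma_finite_measure_axioms lborel.sigma_finite_measure_axioms]])
      (auto simp: lborel.emeasure_pair_measure_Times)
  also have "\<dots> = ennreal (\<Prod>i\<in>UNIV. u $ i - l $ i)"
  proof -
    have "(\<Prod>i\<in>UNIV. u $ i - l $ i) = (u$1 - l$1) * ((u$2 - l$2) * (u$3 - l$3))"
      unfolding UNIV_3 by simp
    then show ?thesis using lu[of 1] lu[of 2] lu[of 3]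
      by (simp only: ennreal_mult mult_nonneg_nonneg diff_ge_0_iff_ge)
  qed
  also have "(\<Prod>i\<in>UNIV. u $ i - l $ i) = (\<Prod>b\<in>Basis. (u - l) \<bullet> b)"
  proof -
    have B: "(Basis :: (real^3) set) = (\<lambda>i. axis i 1) ` UNIV" by (auto simp: Basis_vec_def)
    show ?thesis unfolding B by (subst prod.reindex) (auto simp: inj_on_def axis_eq_axis inner_axis)
  qed
  finally show "emeasure (distr (lborel \<Otimes>\<^sub>M (lborel \<Otimes>\<^sub>M lborel)) borel (\<lambda>(x, y, z). vec3 x y z)) (box l u)
      = ennreal (\<Prod>b\<in>Basis. (u - l) \<bullet> b)" .
qed simp

lemma nn_integral_vec3:
  assumes [measurable]: "h \<in> borel_measurable borel"
  shows "(\<integral>\<^sup>+x. h x \<partial>lborel) = (\<integral>\<^sup>+x. (\<integral>\<^sup>+y. (\<integral>\<^sup>+z. h (vec3 x y z) \<partial>lborel) \<partial>lborel) \<partial>lborel)"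
proof -
  have "(\<integral>\<^sup>+x. h x \<partial>lborel) = (\<integral>\<^sup>+p. h (case p of (x, y, z) \<Rightarrow> vec3 x y z) \<partial>(lborel \<Otimes>\<^sub>M (lborel \<Otimes>\<^sub>M lborel)))"
    by (subst lborel_eq_distr_vec3, subst nn_integral_distr) auto
  also have "\<dots> = (\<integral>\<^sup>+x. (\<integral>\<^sup>+q. h (case q of (y, z) \<Rightarrow> vec3 x y z) \<partial>(lborel \<Otimes>\<^sub>M lborel)) \<partial>lborel)"
    using sigma_finite_measure.nn_integral_fst[OF sigma_finite_pair_measure[OF lborel.sigma_finite_measure_axioms lborel.sigma_finite_measure_axioms],
        of "\<lambda>p. h (case p of (x, y, z) \<Rightarrow> vec3 x y z)" lborel]
    by (simp add: case_prod_beta')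
  also have "\<dots> = (\<integral>\<^sup>+x. (\<integral>\<^sup>+y. (\<integral>\<^sup>+z. h (vec3 x y z) \<partial>lborel) \<partial>lborel) \<partial>lborel)"
    by (intro nn_integral_cong) (subst lborel.nn_integral_fst[symmetric], auto simp: case_prod_beta')
  finally show ?thesis .
qed

lemma nn_integral_real_translate:
  assumes [measurable]: "f \<in> borel_measurable borel"
  shows "(\<integral>\<^sup>+t. f (a + t) \<partial>lborel) = (\<integral>\<^sup>+t. f (t::real) \<partial>lborel)"
  using nn_integral_real_affine[OF assms, of 1 a] by simp

text \<open>The integral of \<open>h i\<close> along direction \<open>i\<close> no longer depends on
  coordinate \<open>i\<close>, so its square root is a function of the two others. The cube of
  \<open>p\<close> is bounded by the product of the three roots, and squaring them again restores
  the integrals of the \<open>h i\<close>.\<close>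

lemma Loomis_Whitney_lines:
  fixes p :: "real^3 \<Rightarrow> ennreal" and h :: "3 \<Rightarrow> real^3 \<Rightarrow> ennreal"
  assumes mp[measurable]: "p \<in> borel_measurable borel" and mh[measurable]: "\<And>i. h i \<in> borel_measurable borel"
    and le: "\<And>i. AE x in lborel. (p x)\<^sup>2 \<le> (\<integral>\<^sup>+t. h i (x + t *\<^sub>R axis i 1) \<partial>lborel)"
  shows "(\<integral>\<^sup>+x. (p x) ^ 3 \<partial>lborel)\<^sup>2 \<le> (\<integral>\<^sup>+x. h 1 x \<partial>lborel) * (\<integral>\<^sup>+x. h 2 x \<partial>lborel) * (\<integral>\<^sup>+x. h 3 x \<partial>lborel)"
proof -
  define a where "a y z = ennsqrt (\<integral>\<^sup>+t. h 1 (vec3 t y z) \<partial>lborel)" for y z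
  define b where "b x z = ennsqrt (\<integral>\<^sup>+t. h 2 (vec3 x t z) \<partial>lborel)" for x z
  define c where "c x y = ennsqrt (\<integral>\<^sup>+t. h 3 (vec3 x y t) \<partial>lborel)" for x y
  have m: "case_prod a \<in> borel_measurable (lborel \<Otimes>\<^sub>M lborel)" "case_prod b \<in> borel_measurable (lborel \<Otimes>\<^sub>M lborel)"
    "case_prod c \<in> borel_measurable (lborel \<Otimes>\<^sub>M lborel)"
    unfolding a_def b_def c_def by measurable
  have "AE x in lborel. p x \<le> ennsqrt (\<integral>\<^sup>+t. h i (x + t *\<^sub>R axis i 1) \<partial>lborel)" for i
    using le[of i] by eventually_elim (rule le_ennsqrtI)
  then have AE: "AE w in lborel. \<forall>i\<in>UNIV. p w \<le> ennsqrt (\<integral>\<^sup>+t. h i (w + t *\<^sub>R axis i 1) \<partial>lborel)"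
    by (intro AE_finite_allI) auto
  have "(\<integral>\<^sup>+x. (p x) ^ 3 \<partial>lborel) \<le> (\<integral>\<^sup>+w. ennsqrt (\<integral>\<^sup>+t. h 1 (w + t *\<^sub>R axis 1 1) \<partial>lborel)
      * ennsqrt (\<integral>\<^sup>+t. h 2 (w + t *\<^sub>R axis 2 1) \<partial>lborel) * ennsqrt (\<integral>\<^sup>+t. h 3 (w + t *\<^sub>R axis 3 1) \<partial>lborel) \<partial>lborel)"
  proof (rule nn_integral_mono_AE)
    show "AE w in lborel. p w ^ 3 \<le> ennsqrt (\<integral>\<^sup>+t. h 1 (w + t *\<^sub>R axis 1 1) \<partial>lborel)
      * ennsqrt (\<integral>\<^sup>+t. h 2 (w + t *\<^sub>R axis 2 1) \<partial>lborel) * ennsqrt (\<integral>\<^sup>+t. h 3 (w + t *\<^sub>R axis 3 1) \<partial>lborel)"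
      using AE by eventually_elim (unfold power3_eq_cube, intro mult_mono, auto)
  qed
  also have "\<dots> = (\<integral>\<^sup>+x. (\<integral>\<^sup>+y. (\<integral>\<^sup>+z. a y z * b x z * c x y \<partial>lborel) \<partial>lborel) \<partial>lborel)"
  proof (subst nn_integral_vec3)
    have "(\<integral>\<^sup>+t. h 1 (vec3 (x + t) y z) \<partial>lborel) = (\<integral>\<^sup>+t. h 1 (vec3 t y z) \<partial>lborel)"
      "(\<integral>\<^sup>+t. h 2 (vec3 x (y + t) z) \<partial>lborel) = (\<integral>\<^sup>+t. h 2 (vec3 x t z) \<partial>lborel)"
      "(\<integral>\<^sup>+t. h 3 (vec3 x y (z + t)) \<partial>lborel) = (\<integral>\<^sup>+t. h 3 (vec3 x y t) \<partial>lborel)" for x y z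
      using nn_integral_real_translate[of "\<lambda>t. h 1 (vec3 t y z)" x] nn_integral_real_translate[of "\<lambda>t. h 2 (vec3 x t z)" y]
        nn_integral_real_translate[of "\<lambda>t. h 3 (vec3 x y t)" z] by auto
    then show "(\<integral>\<^sup>+x. \<integral>\<^sup>+y. \<integral>\<^sup>+z. ennsqrt (\<integral>\<^sup>+t. h 1 (vec3 x y z + t *\<^sub>R axis 1 1) \<partial>lborel)
      * ennsqrt (\<integral>\<^sup>+t. h 2 (vec3 x y z + t *\<^sub>R axis 2 1) \<partial>lborel) * ennsqrt (\<integral>\<^sup>+t. h 3 (vec3 x y z + t *\<^sub>R axis 3 1) \<partial>lborel)
       \<partial>lborel \<partial>lborel \<partial>lborel) = (\<integral>\<^sup>+x. (\<integral>\<^sup>+y. (\<integral>\<^sup>+z. a y z * b x z * c x y \<partial>lborel) \<partial>lborel) \<partial>lborel)"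
      by (simp add: vec3_add_axis a_def b_def c_def)
  qed measurable
  finally have "(\<integral>\<^sup>+x. (p x) ^ 3 \<partial>lborel)\<^sup>2 \<le> (\<integral>\<^sup>+x. (\<integral>\<^sup>+y. (\<integral>\<^sup>+z. a y z * b x z * c x y \<partial>lborel) \<partial>lborel) \<partial>lborel)\<^sup>2"
    by (intro power_mono) auto
  also have "\<dots> \<le> (\<integral>\<^sup>+y. (\<integral>\<^sup>+z. (a y z)\<^sup>2 \<partial>lborel) \<partial>lborel) * (\<integral>\<^sup>+x. (\<integral>\<^sup>+z. (b x z)\<^sup>2 \<partial>lborel) \<partial>lborel)
      * (\<integral>\<^sup>+x. (\<integral>\<^sup>+y. (c x y)\<^sup>2 \<partial>lborel) \<partial>lborel)"
    by (rule Loomis_Whitney[OF m])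
  also have "(\<integral>\<^sup>+y. (\<integral>\<^sup>+z. (a y z)\<^sup>2 \<partial>lborel) \<partial>lborel) = (\<integral>\<^sup>+x. h 1 x \<partial>lborel)"
  proof -
    have "(\<integral>\<^sup>+x. h 1 x \<partial>lborel) = (\<integral>\<^sup>+y. (\<integral>\<^sup>+x. (\<integral>\<^sup>+z. h 1 (vec3 x y z) \<partial>lborel) \<partial>lborel) \<partial>lborel)"
      by (subst nn_integral_vec3, measurable, rule lborel_pair.Fubini'[symmetric], measurable)
    also have "\<dots> = (\<integral>\<^sup>+y. (\<integral>\<^sup>+z. (\<integral>\<^sup>+x. h 1 (vec3 x y z) \<partial>lborel) \<partial>lborel) \<partial>lborel)"
      by (rule nn_integral_cong, rule lborel_pair.Fubini'[symmetric], measurable)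
    finally show ?thesis by (simp add: a_def ennsqrt_power2)
  qed
  also have "(\<integral>\<^sup>+x. (\<integral>\<^sup>+z. (b x z)\<^sup>2 \<partial>lborel) \<partial>lborel) = (\<integral>\<^sup>+x. h 2 x \<partial>lborel)"
  proof -
    have "(\<integral>\<^sup>+x. h 2 x \<partial>lborel) = (\<integral>\<^sup>+x. (\<integral>\<^sup>+z. (\<integral>\<^sup>+y. h 2 (vec3 x y z) \<partial>lborel) \<partial>lborel) \<partial>lborel)"
      by (subst nn_integral_vec3, measurable, rule nn_integral_cong, rule lborel_pair.Fubini'[symmetric], measurable)
    then show ?thesis by (simp add: b_def ennsqrt_power2)
  qed
  also have "(\<integral>\<^sup>+x. (\<integral>\<^sup>+y. (c x y)\<^sup>2 \<partial>lborel) \<partial>lborel) = (\<integral>\<^sup>+x. h 3 x \<partial>lborel)"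
    using nn_integral_vec3[OF mh[of 3]] by (simp add: c_def ennsqrt_power2)
  finally show ?thesis .
qed

text \<open>Gagliardo's argument. With N the truncated modulus, take \<open>p\<close> to be N^2 and
  \<open>h i\<close> to be 4 N^3 times the modulus of the \<open>i\<close>-th derivative. Writing I
  for the integral of N^6 and Z for that of the squared gradient, Loomis-Whitney gives I^2 at most
  J1 J2 J3, and Cauchy-Schwarz gives each J^2 at most 16 I Z. Hence I^4 is at most 16^3 I^3 Z^3, and
  4096 is 16^3. Fatou's lemma removes the truncation.\<close>

lemma Sobolev_inequality:
  assumes fg: "H1_grad f g"
  shows "integrable lebesgue (\<lambda>x. norm (f x) ^ 6)"
    and "(LINT x|lebesgue. norm (f x) ^ 6) \<le> 4096 * (L2_nrm g) ^ 6"
proof -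
  obtain f' where f'[measurable]: "f' \<in> borel_measurable borel" and ff': "AE x in lebesgue. f x = f' x"
    using ex_borel_AE_eq[OF in_L2_measurable[OF H1_gradD(1)[OF fg]]] by metis
  obtain g' where g': "g' \<in> borel_measurable borel" and gg': "AE x in lebesgue. g x = g' x"
    using ex_borel_AE_eq[OF in_L2_measurable[OF H1_gradD(2)[OF fg]]] by metis
  note [measurable] = measurable_vec_nth[OF g']
  note m = in_L2_measurable[OF H1_gradD(1)[OF fg]] in_L2_measurable[OF H1_gradD(2)[OF fg]]
    measurable_lebesgue_borel[OF f'] measurable_lebesgue_borel[OF g']
  have f'2: "in_Lp 2 f'" by (rule in_L2_bound(1)[OF H1_gradD(1)[OF fg] m(3), of 1]) (use ff' in \<open>auto elim: eventually_mono\<close>)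
  have g'2: "in_Lp 2 g'" by (rule in_L2_bound(1)[OF H1_gradD(2)[OF fg] m(4), of 1]) (use gg' in \<open>auto elim: eventually_mono\<close>)
  have f'g': "H1_grad f' g'"
    using weak_gradient_cong_AE[OF _ ff' gg'] m fg f'2 g'2 by (simp add: H1_grad_def)
  have fl: "flow_deriv 0 (axis i 1) f' (\<lambda>x. g' x $ i)" for i
  proof -
    have "(\<Sum>j\<in>UNIV. (axis i 1 $ j) *\<^sub>R g' x $ j) = g' x $ i" for x
      by (subst sum.remove[of _ i]) (auto simp: axis_def intro!: sum.neutral)
    with flow_deriv_weak_gradient[OF f'g', of 0 "axis i 1"] show ?thesis by simp
  qed
  define Z where "Z = (LINT x|lebesgue. (norm (g' x))\<^sup>2)"
  have Z0: "Z \<ge> 0" by (simp add: Z_def)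
  have g'm: "(\<lambda>x. (norm (g' x))\<^sup>2) \<in> borel_measurable borel" using g' by measurable
  have Zn: "(\<integral>\<^sup>+x. ennreal ((norm (g' x))\<^sup>2) \<partial>lborel) = ennreal Z"
    unfolding Z_def integral_lebesgue_lborel(1)[OF g'm]
    using g'2 integral_lebesgue_lborel(2)[OF g'm] by (intro nn_integral_eq_integral) (auto simp: in_L2_iff)
  have trunc: "(\<integral>\<^sup>+x. ennreal (min (norm (f' x)) M ^ 6) \<partial>lborel) \<le> ennreal (4096 * Z ^ 3)" if M: "M \<ge> 0" for M
  proof -
    let ?N = "\<lambda>x. min (norm (f' x)) M"
    define J where "J i = (\<integral>\<^sup>+x. ennreal (4 * ?N x ^ 3 * norm (g' x $ i)) \<partial>lborel)" for i
    define I where "I = (\<integral>\<^sup>+x. ennreal (?N x ^ 6) \<partial>lborel)"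
    have "(\<integral>\<^sup>+x. (ennreal (?N x ^ 2)) ^ 3 \<partial>lborel)\<^sup>2 \<le> J 1 * J 2 * J 3"
      unfolding J_def
    proof (rule Loomis_Whitney_lines[of "\<lambda>x. ennreal (?N x ^ 2)" "\<lambda>i x. ennreal (4 * ?N x ^ 3 * norm (g' x $ i))"])
      fix i
      show "AE x in lborel. (ennreal (?N x ^ 2))\<^sup>2 \<le> (\<integral>\<^sup>+t. ennreal (4 * ?N (x + t *\<^sub>R axis i 1) ^ 3 * norm (g' (x + t *\<^sub>R axis i 1) $ i)) \<partial>lborel)"
        using truncated_power4_le_line_integral[OF f' _ f'2 in_L2_nth[OF g'2] fl M, of i]
        by (simp add: ennreal_power power_mult[symmetric])
    qed measurable
    then have LW: "I\<^sup>2 \<le> J 1 * J 2 * J 3"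
      by (simp add: I_def ennreal_power M power_mult[symmetric])
    have J: "(J i)\<^sup>2 \<le> ennreal 16 * I * ennreal Z" for i
    proof -
      have "(J i)\<^sup>2 = (\<integral>\<^sup>+x. ennreal (4 * ?N x ^ 3) * ennreal (norm (g' x $ i)) \<partial>lborel)\<^sup>2"
        by (simp add: J_def ennreal_mult M)
      also have "\<dots> \<le> (\<integral>\<^sup>+x. (ennreal (4 * ?N x ^ 3))\<^sup>2 \<partial>lborel) * (\<integral>\<^sup>+x. (ennreal (norm (g' x $ i)))\<^sup>2 \<partial>lborel)"
        by (rule Cauchy_Schwarz_nn_integral) measurable
      also have "(\<integral>\<^sup>+x. (ennreal (4 * ?N x ^ 3))\<^sup>2 \<partial>lborel) = (\<integral>\<^sup>+x. ennreal 16 * ennreal (?N x ^ 6) \<partial>lborel)"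
        using M by (intro nn_integral_cong) (simp add: ennreal_power power_mult_distrib power_mult[symmetric] ennreal_mult[symmetric]
              del: ennreal_numeral)
      also have "\<dots> = ennreal 16 * I" unfolding I_def by (rule nn_integral_cmult) measurable
      also have "(\<integral>\<^sup>+x. (ennreal (norm (g' x $ i)))\<^sup>2 \<partial>lborel) \<le> ennreal Z"
        unfolding Zn[symmetric]
        by (intro nn_integral_mono) (simp add: ennreal_power power_mono Finite_Cartesian_Product.norm_nth_le)
      finally show ?thesis by (simp add: mult_left_mono)
    qed
    \<comment> \<open>The point of truncating: the sixth power is at most \<open>M ^ 4\<close> times
      the square, so \<open>I\<close> is finite and its cube may be cancelled.\<close>
    have Ifin: "I < \<infinity>"
    proof -
      have "I \<le> (\<integral>\<^sup>+x. ennreal (M ^ 4) * ennreal ((norm (f' x))\<^sup>2) \<partial>lborel)"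
        unfolding I_def
      proof (rule nn_integral_mono)
        fix x
        have "?N x ^ 6 = ?N x ^ 4 * (?N x)\<^sup>2" by (simp add: power_add[symmetric])
        also have "\<dots> \<le> M ^ 4 * (norm (f' x))\<^sup>2" using M by (intro mult_mono power_mono) auto
        finally show "ennreal (?N x ^ 6) \<le> ennreal (M ^ 4) * ennreal ((norm (f' x))\<^sup>2)"
          using M by (simp add: ennreal_mult[symmetric] ennreal_leI)
      qed
      also have "\<dots> = ennreal (M ^ 4) * (\<integral>\<^sup>+x. ennreal ((norm (f' x))\<^sup>2) \<partial>lborel)"
        by (rule nn_integral_cmult) measurable
      also have "\<dots> < \<infinity>"
      proof -
        have "integrable lborel (\<lambda>x. (norm (f' x))\<^sup>2)"
          using f'2 by (subst integral_lebesgue_lborel(2)[symmetric]) (auto simp: in_L2_iff)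
        then show ?thesis by (simp add: nn_integral_eq_integral ennreal_mult_less_top)
      qed
      finally show ?thesis .
    qed
    then obtain i where i: "I = ennreal i" "i \<ge> 0" by (cases I) auto
    have "(I\<^sup>2)\<^sup>2 \<le> (J 1 * J 2 * J 3)\<^sup>2" by (intro power_mono LW) auto
    also have "\<dots> = (J 1)\<^sup>2 * (J 2)\<^sup>2 * (J 3)\<^sup>2" by (simp add: power_mult_distrib)
    also have "\<dots> \<le> (ennreal 16 * I * ennreal Z) * (ennreal 16 * I * ennreal Z) * (ennreal 16 * I * ennreal Z)"
      by (intro mult_mono J) auto
    finally have "(i\<^sup>2)\<^sup>2 \<le> (16 * i * Z) * (16 * i * Z) * (16 * i * Z)"
      using i(2) Z0 unfolding i(1) ennreal_power[OF i(2)] by (simp add: ennreal_power ennreal_mult[symmetric] del: ennreal_numeral)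
    then have "i ^ 3 * i \<le> i ^ 3 * (4096 * Z ^ 3)"
      by (simp add: power2_eq_square power3_eq_cube algebra_simps)
    then have "i \<le> 4096 * Z ^ 3"
      using i(2) Z0 by (cases "i = 0") (auto simp: mult_le_cancel_left)
    then show ?thesis using i by (simp add: I_def ennreal_leI)
  qed
  have "(\<integral>\<^sup>+x. ennreal (norm (f' x) ^ 6) \<partial>lborel) \<le> ennreal (4096 * Z ^ 3)"
  proof -
    have "ennreal (norm (f' x) ^ 6) = liminf (\<lambda>n. ennreal (min (norm (f' x)) (real n) ^ 6))" for x
    proof -
      have "eventually (\<lambda>n. norm (f' x) \<le> real n) sequentially"
        using real_arch_simple eventually_sequentially by (metis of_nat_le_iff order_trans)
      then have "(\<lambda>n. ennreal (min (norm (f' x)) (real n) ^ 6)) \<longlonglongrightarrow> ennreal (norm (f' x) ^ 6)"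
        by (intro tendsto_eventually) (auto elim: eventually_mono)
      from lim_imp_Liminf[OF _ this] show ?thesis by simp
    qed
    then have "(\<integral>\<^sup>+x. ennreal (norm (f' x) ^ 6) \<partial>lborel) = (\<integral>\<^sup>+x. liminf (\<lambda>n. ennreal (min (norm (f' x)) (real n) ^ 6)) \<partial>lborel)"
      by simp
    also have "\<dots> \<le> liminf (\<lambda>n. \<integral>\<^sup>+x. ennreal (min (norm (f' x)) (real n) ^ 6) \<partial>lborel)"
      by (rule nn_integral_liminf) measurable
    also have "\<dots> \<le> liminf (\<lambda>n::nat. ennreal (4096 * Z ^ 3))"
      by (intro Liminf_mono always_eventually allI trunc) auto
    finally show ?thesis by (simp add: Liminf_const)
  qed
  note bound = this
  have m6: "(\<lambda>x. norm (f' x) ^ 6) \<in> borel_measurable borel" by measurable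
  have i': "integrable lborel (\<lambda>x. norm (f' x) ^ 6)"
    by (rule integrableI_bounded) (use m6 order.strict_trans1[OF bound ennreal_less_top] in auto)
  have l': "(LINT x|lborel. norm (f' x) ^ 6) \<le> 4096 * Z ^ 3"
    by (rule integral_real_bounded) (use bound Z0 in auto)
  have i'': "integrable lebesgue (\<lambda>x. norm (f' x) ^ 6)" using i' integral_lebesgue_lborel(2)[OF m6] by simp
  have e6: "AE x in lebesgue. norm (f' x) ^ 6 = norm (f x) ^ 6" using ff' by eventually_elim simp
  show "integrable lebesgue (\<lambda>x. norm (f x) ^ 6)"
    by (rule integrable_cong_AE_imp[OF i'']) (use m e6 in auto)
  have "(LINT x|lebesgue. norm (f x) ^ 6) = (LINT x|lebesgue. norm (f' x) ^ 6)"
    by (rule integral_cong_AE) (use m e6 in \<open>auto elim: eventually_mono\<close>)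
  also have "\<dots> \<le> 4096 * Z ^ 3" using l' integral_lebesgue_lborel(1)[OF m6] by simp
  also have "Z = (L2_nrm g)\<^sup>2"
    unfolding Z_def L2_nrm_power2[symmetric]
    by (rule arg_cong[of _ _ "\<lambda>z. z\<^sup>2"], rule L2_nrm_cong_AE[OF m(4) m(2)])
       (use gg' in \<open>auto elim: eventually_mono\<close>)
  finally show "(LINT x|lebesgue. norm (f x) ^ 6) \<le> 4096 * (L2_nrm g) ^ 6" by (simp add: power_mult[symmetric])
qed

section \<open>Bounds for the potential and the nonlinearity\<close>

text \<open>Young's inequality without sharp constants: comparing \<open>s\<close> with
  \<open>a powr (\<delta> - 1)\<close> shows that one of the two powers alone dominates the
  product.\<close>

lemma mult_le_powr_sum:
  fixes a s :: real
  assumes a: "a \<ge> 0" and s: "s \<ge> 0" and \<delta>: "\<delta> > 1"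
  shows "a * s \<le> a powr \<delta> + s powr (\<delta> / (\<delta> - 1))"
proof (cases "a = 0 \<or> s = 0")
  case False
  then have pos: "a > 0" "s > 0" using a s by auto
  show ?thesis
  proof (cases "s \<le> a powr (\<delta> - 1)")
    case True
    have "a * s \<le> a * a powr (\<delta> - 1)" using True a by (rule mult_left_mono)
    also have "\<dots> = a powr \<delta>" using pos powr_add[of a 1 "\<delta> - 1"] by simp
    finally show ?thesis by (smt (verit) powr_ge_zero)
  next
    case False
    then have "(a powr (\<delta> - 1)) powr (1 / (\<delta> - 1)) \<le> s powr (1 / (\<delta> - 1))"
      using \<delta> by (intro powr_mono2) auto
    then have "a \<le> s powr (1 / (\<delta> - 1))" using pos \<delta> by (simp add: powr_powr)
    then have "a * s \<le> s powr (1 / (\<delta> - 1)) * s" using s by (rule mult_right_mono)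
    also have "\<dots> = s powr (\<delta> / (\<delta> - 1))"
    proof -
      have "1 / (\<delta> - 1) + 1 = \<delta> / (\<delta> - 1)" using \<delta> by (simp add: field_simps)
      then show ?thesis using pos powr_add[of s "1 / (\<delta> - 1)" 1] by simp
    qed
    finally show ?thesis by (smt (verit) powr_ge_zero)
  qed
qed (auto simp: add_nonneg_nonneg)

text \<open>Intended for \<open>s = r\<^sup>2\<close> and for \<open>p\<close> the exponent
  conjugate to \<open>\<delta>\<close>, which is below 3 precisely when
  \<open>\<delta> > 3/2\<close>. The right side then consists of the second and sixth powers that
  L^2 and the Sobolev inequality control.\<close>

lemma powr_le_add_cube:
  fixes s :: real
  assumes "s \<ge> 0" "1 \<le> p" "p \<le> 3" shows "s powr p \<le> s + s ^ 3"
proof (cases "s \<le> 1")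
  case True
  then have "s powr p \<le> s powr 1" using assms powr_mono'[of 1 p s] by (cases "s = 0") auto
  then show ?thesis using assms by (auto intro: add_increasing2)
next
  case False
  then have "s powr p \<le> s powr 3" using assms by (intro powr_mono) auto
  then show ?thesis using assms False by (simp add: powr_numeral)
qed

lemma power4_le: "r ^ 4 \<le> r\<^sup>2 + r ^ 6" for r :: real
proof -
  \<comment> \<open>Expanding gives r^6 - r^4 + r^2.\<close>
  have "0 \<le> r\<^sup>2 * ((r\<^sup>2 - 1)\<^sup>2 + r\<^sup>2)" by simp
  then show ?thesis by (simp add: power2_eq_square algebra_simps eval_nat_numeral)
qed

text \<open>The pointwise hypothesis is inhomogeneous, but integrated over functions with
  \<open>H1_nrm f \<le> 1\<close> it yields a constant: the integral of \<open>h\<close>, plus 1 for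
  the L^2 part, plus 4096 for the sixth power. As the left side is homogeneous of degree
  \<open>p\<close>, scaling extends the bound to all of H^1.\<close>

lemma homogeneous_bound:
  fixes w :: "real^3 \<Rightarrow> real"
  assumes w[measurable]: "w \<in> borel_measurable lebesgue" and w0: "\<And>x. w x \<ge> 0" and p: "p > 0"
    and h: "integrable lebesgue h" "\<And>x. h x \<ge> 0"
    and le: "\<And>x r. r \<ge> 0 \<Longrightarrow> w x * r ^ p \<le> h x + r\<^sup>2 + r ^ 6"
  obtains C where "C \<ge> 0" "\<And>f g. H1_grad f g \<Longrightarrow> integrable lebesgue (\<lambda>x. w x * norm (f x) ^ p)"
    "\<And>f g. H1_grad f g \<Longrightarrow> (LINT x|lebesgue. w x * norm (f x) ^ p) \<le> C * H1_nrm f ^ p"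
proof -
  define C where "C = (LINT x|lebesgue. h x) + 1 + 4096"
  have C0: "C \<ge> 0" using h by (simp add: C_def)
  have int: "integrable lebesgue (\<lambda>x. w x * norm (f x) ^ p)" if fg: "H1_grad f g" for f g
  proof (rule Bochner_Integration.integrable_bound)
    note [measurable] = in_L2_measurable[OF H1_gradD(1)[OF fg]]
    show "integrable lebesgue (\<lambda>x. h x + (norm (f x))\<^sup>2 + norm (f x) ^ 6)"
      using H1_gradD(1)[OF fg] Sobolev_inequality(1)[OF fg] h by (simp add: in_L2_iff)
    show "AE x in lebesgue. norm (w x * norm (f x) ^ p) \<le> norm (h x + (norm (f x))\<^sup>2 + norm (f x) ^ 6)"
      using le w0 h by (auto simp: abs_of_nonneg)
  qed (use H1_gradD(1)[OF fg] in \<open>auto simp: in_L2_iff\<close>)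
  have unit: "(LINT x|lebesgue. w x * norm (f x) ^ p) \<le> C" if fg: "H1_grad f g" and 1: "H1_nrm f \<le> 1" for f g
  proof -
    have i: "integrable lebesgue (\<lambda>x. (norm (f x))\<^sup>2)" "integrable lebesgue (\<lambda>x. norm (f x) ^ 6)"
      using H1_gradD(1)[OF fg] Sobolev_inequality(1)[OF fg] by (auto simp: in_L2_iff)
    have "(LINT x|lebesgue. w x * norm (f x) ^ p) \<le> (LINT x|lebesgue. h x + (norm (f x))\<^sup>2 + norm (f x) ^ 6)"
      using le i h by (intro integral_mono int[OF fg]) auto
    also have "\<dots> = (LINT x|lebesgue. h x) + (L2_nrm f)\<^sup>2 + (LINT x|lebesgue. norm (f x) ^ 6)"
      using i h by (simp add: L2_nrm_power2)
    also have "\<dots> \<le> C"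
    proof -
      have "L2_nrm f \<le> 1" "L2_nrm g \<le> 1"
        using L2_nrm_le_H1_nrm[of f] 1 L2_nrm_grad[OF fg] by auto
      then have "(L2_nrm f)\<^sup>2 \<le> 1" "4096 * L2_nrm g ^ 6 \<le> 4096"
        by (auto intro!: power_le_one L2_nrm_nonneg)
      then show ?thesis using Sobolev_inequality(2)[OF fg] by (simp add: C_def)
    qed
    finally show ?thesis .
  qed
  have "(LINT x|lebesgue. w x * norm (f x) ^ p) \<le> C * H1_nrm f ^ p" if fg: "H1_grad f g" for f g
  proof -
    have nrm: "H1_nrm (\<lambda>x. a *\<^sub>R f x) = \<bar>a\<bar> * H1_nrm f" for a
      using L2_nrm_grad[OF H1_grad_scaleR[OF fg, of a]] L2_nrm_grad[OF fg]
      by (simp add: H1_nrm_def L2_nrm_scaleR power_mult_distrib distrib_left[symmetric] real_sqrt_mult)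
    \<comment> \<open>Normalising by \<open>H1_nrm f + \<eta>\<close> avoids dividing by a norm that
      may vanish; \<open>\<eta>\<close> tends to 0 afterwards.\<close>
    have eta: "(LINT x|lebesgue. w x * norm (f x) ^ p) \<le> C * (H1_nrm f + \<eta>) ^ p" if \<eta>: "\<eta> > 0" for \<eta>
    proof -
      define \<nu> where "\<nu> = H1_nrm f + \<eta>"
      have \<nu>: "\<nu> > 0" using \<eta> H1_nrm_nonneg[of f] by (simp add: \<nu>_def)
      have "H1_nrm (\<lambda>x. (1 / \<nu>) *\<^sub>R f x) \<le> 1" using \<nu> \<eta> unfolding nrm by (simp add: \<nu>_def)
      from unit[OF H1_grad_scaleR[OF fg] this]
      have "(LINT x|lebesgue. w x * norm (f x) ^ p / \<nu> ^ p) \<le> C"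
        using \<nu> by (simp add: power_divide)
      then have "(LINT x|lebesgue. w x * norm (f x) ^ p) / \<nu> ^ p \<le> C" by simp
      then show ?thesis using \<nu> by (simp add: field_simps \<nu>_def)
    qed
    have "((\<lambda>\<eta>. C * (H1_nrm f + \<eta>) ^ p) \<longlongrightarrow> C * (H1_nrm f + 0) ^ p) (at_right 0)"
      by (intro tendsto_intros)
    then show ?thesis
      by (intro tendsto_lowerbound[of _ "C * H1_nrm f ^ p" "at_right (0::real)"])
         (use eta in \<open>auto simp: eventually_at_filter\<close>)
  qed
  with C0 int that show thesis by blast
qed

lemma potential_bound:
  assumes \<delta>: "\<delta> > 3/2" and V: "in_Lp \<delta> (V :: real^3 \<Rightarrow> real)"
  obtains C where "C \<ge> 0" "\<And>f g. H1_grad f g \<Longrightarrow> integrable lebesgue (\<lambda>x. \<bar>V x\<bar> * (norm (f x))\<^sup>2)"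
    "\<And>f g. H1_grad f g \<Longrightarrow> (LINT x|lebesgue. \<bar>V x\<bar> * (norm (f x))\<^sup>2) \<le> C * (H1_nrm f)\<^sup>2"
proof (rule homogeneous_bound[of "\<lambda>x. \<bar>V x\<bar>" 2 "\<lambda>x. \<bar>V x\<bar> powr \<delta>"])
  show "(\<lambda>x. \<bar>V x\<bar>) \<in> borel_measurable lebesgue" "integrable lebesgue (\<lambda>x. \<bar>V x\<bar> powr \<delta>)"
    using V by (auto simp: in_Lp_def)
  fix x and r :: real assume "r \<ge> 0"
  have "\<bar>V x\<bar> * r\<^sup>2 \<le> \<bar>V x\<bar> powr \<delta> + (r\<^sup>2) powr (\<delta> / (\<delta> - 1))"
    using \<delta> by (intro mult_le_powr_sum) auto
  also have "(r\<^sup>2) powr (\<delta> / (\<delta> - 1)) \<le> r\<^sup>2 + (r\<^sup>2) ^ 3"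
    using \<delta> by (intro powr_le_add_cube) (auto simp: field_simps)
  finally show "\<bar>V x\<bar> * r\<^sup>2 \<le> \<bar>V x\<bar> powr \<delta> + r\<^sup>2 + r ^ 6" by (simp add: power_mult[symmetric])
qed (use that in auto)

lemma nn_integral_powr_unit_interval:
  fixes b :: real
  assumes "b < 1"
  shows "(\<integral>\<^sup>+t. ennreal (\<bar>t\<bar> powr (- b)) * indicator {-1..1} t \<partial>lborel) < \<infinity>"
proof -
  define P where "P t = ennreal (t powr (- b)) * indicator {0..1} t" for t :: real
  have [measurable]: "P \<in> borel_measurable borel" unfolding P_def by measurable
  have "((\<lambda>t. t powr (- b)) has_integral (1 / (- b + 1))) {0..1::real}"
    using has_integral_powr_from_0[of "- b" 1] assms by simp
  then have fin: "(\<integral>\<^sup>+t. P t \<partial>lborel) < \<infinity>"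
    using nn_integral_has_integral_lebesgue[of "{0..1}" "\<lambda>t. t powr (- b)"]
    by (simp add: P_def mult.commute[of _ "indicator _ _"] ennreal_mult''[symmetric] ennreal_indicator[symmetric])
  have "(\<integral>\<^sup>+t. ennreal (\<bar>t\<bar> powr (- b)) * indicator {-1..1} t \<partial>lborel) \<le> (\<integral>\<^sup>+t. P t + P (- t) \<partial>lborel)"
    by (intro nn_integral_mono) (auto simp: P_def indicator_def)
  also have "\<dots> = (\<integral>\<^sup>+t. P t \<partial>lborel) + (\<integral>\<^sup>+t. P (- t) \<partial>lborel)" by (rule nn_integral_add) measurable
  also have "(\<integral>\<^sup>+t. P (- t) \<partial>lborel) = (\<integral>\<^sup>+t. P t \<partial>lborel)"
    using nn_integral_real_affine[of P "-1" 0] by simp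
  finally show ?thesis using fin by (simp add: order.strict_trans1)
qed

text \<open>\<open>|x|\<^sup>3 \<ge> |x\<^sub>1 x\<^sub>2 x\<^sub>3|\<close> reduces the integral to one dimension.\<close>

lemma integrable_norm_powr_cball:
  assumes b: "0 < b" "b < 1"
  shows "integrable lebesgue (\<lambda>x::real^3. indicator (cball 0 1) x * norm x powr (- 3 * b))"
proof -
  define q where "q t = ennreal (\<bar>t\<bar> powr (- b)) * indicator {-1..1} t" for t :: real
  have mq[measurable]: "q \<in> borel_measurable borel" unfolding q_def by measurable
  have [measurable]: "cball (0::real^3) 1 \<in> sets borel" by simp
  have m: "(\<lambda>x::real^3. indicator (cball 0 1) x * norm x powr (- 3 * b)) \<in> borel_measurable borel"
  proof (intro borel_measurable_times borel_measurable_indicator)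
    show "(\<lambda>x::real^3. norm x powr (- 3 * b)) \<in> borel_measurable borel" by measurable
  qed simp
  have le: "ennreal (indicator (cball 0 1) (vec3 x y z) * norm (vec3 x y z) powr (- 3 * b)) \<le> q x * q y * q z"
    if "x \<noteq> 0" "y \<noteq> 0" "z \<noteq> 0" for x y z
  proof (cases "norm (vec3 x y z) \<le> 1")
    case True
    let ?n = "norm (vec3 x y z)"
    have c: "\<bar>x\<bar> \<le> ?n" "\<bar>y\<bar> \<le> ?n" "\<bar>z\<bar> \<le> ?n"
      using component_le_norm_cart[of "vec3 x y z" 1] component_le_norm_cart[of "vec3 x y z" 2]
        component_le_norm_cart[of "vec3 x y z" 3] by auto
    have n0: "?n > 0" using c(1) that by auto
    have "?n powr (- 3 * b) = ?n powr (- b) * ?n powr (- b) * ?n powr (- b)"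
      using n0 by (simp add: powr_add[symmetric])
    also have "\<dots> \<le> \<bar>x\<bar> powr (- b) * \<bar>y\<bar> powr (- b) * \<bar>z\<bar> powr (- b)"
      using c that b by (intro mult_mono powr_mono2') auto
    finally have "ennreal (?n powr (- 3 * b)) \<le> ennreal (\<bar>x\<bar> powr (- b) * \<bar>y\<bar> powr (- b) * \<bar>z\<bar> powr (- b))"
      by (rule ennreal_leI)
    moreover have "x \<in> {-1..1}" "y \<in> {-1..1}" "z \<in> {-1..1}" using c True by auto
    ultimately show ?thesis using True by (simp add: q_def ennreal_mult)
  qed simp
  have "(\<integral>\<^sup>+x. ennreal (indicator (cball 0 1) x * norm x powr (- 3 * b)) \<partial>(lborel::(real^3) measure))
     = (\<integral>\<^sup>+x. (\<integral>\<^sup>+y. (\<integral>\<^sup>+z. ennreal (indicator (cball 0 1) (vec3 x y z) * norm (vec3 x y z) powr (- 3 * b)) \<partial>lborel) \<partial>lborel) \<partial>lborel)"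
    by (rule nn_integral_vec3) (use m in measurable)
  also have "\<dots> \<le> (\<integral>\<^sup>+x. (\<integral>\<^sup>+y. (\<integral>\<^sup>+z. q x * q y * q z \<partial>lborel) \<partial>lborel) \<partial>lborel)"
  proof (rule nn_integral_mono_AE, use AE_lborel_singleton[of 0] in eventually_elim)
    fix x :: real assume x: "x \<noteq> 0"
    show "(\<integral>\<^sup>+y. (\<integral>\<^sup>+z. ennreal (indicator (cball 0 1) (vec3 x y z) * norm (vec3 x y z) powr (- 3 * b)) \<partial>lborel) \<partial>lborel)
      \<le> (\<integral>\<^sup>+y. (\<integral>\<^sup>+z. q x * q y * q z \<partial>lborel) \<partial>lborel)"
    proof (rule nn_integral_mono_AE, use AE_lborel_singleton[of 0] in eventually_elim)
      fix y :: real assume y: "y \<noteq> 0"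
      show "(\<integral>\<^sup>+z. ennreal (indicator (cball 0 1) (vec3 x y z) * norm (vec3 x y z) powr (- 3 * b)) \<partial>lborel)
        \<le> (\<integral>\<^sup>+z. q x * q y * q z \<partial>lborel)"
        by (rule nn_integral_mono_AE, use AE_lborel_singleton[of 0] in eventually_elim) (use le x y in auto)
    qed
  qed
  also have "\<dots> = (\<integral>\<^sup>+x. q x \<partial>lborel) * (\<integral>\<^sup>+x. q x \<partial>lborel) * (\<integral>\<^sup>+x. q x \<partial>lborel)"
    by (simp add: nn_integral_cmult nn_integral_multc mult.assoc)
  also have "\<dots> < \<infinity>"
    using nn_integral_powr_unit_interval[OF b(2)] by (simp add: q_def ennreal_mult_less_top)
  finally have "integrable lborel (\<lambda>x::real^3. indicator (cball 0 1) x * norm x powr (- 3 * b))"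
    using m by (intro integrableI_bounded) (auto simp: abs_mult)
  with integral_lebesgue_lborel(2)[OF m] show ?thesis by simp
qed

lemma measurable_norm_powr: "(\<lambda>x::real^3. norm x powr a) \<in> borel_measurable lebesgue"
  by (rule measurable_lebesgue_borel) measurable

text \<open>In the unit ball Young's inequality with exponents 3 and 3/2 splits the term into
  |x|^(-3b), integrable there because b < 1, and r^6. Outside, the weight is at most 1 and
  \<open>power4_le\<close> suffices.\<close>

lemma nonlinearity_bound:
  assumes b: "0 < b" "b < 1"
  obtains C where "C \<ge> 0" "\<And>f g. H1_grad f g \<Longrightarrow> integrable lebesgue (\<lambda>x. norm x powr (- b) * norm (f x) ^ 4)"
    "\<And>f g. H1_grad f g \<Longrightarrow> (LINT x|lebesgue. norm x powr (- b) * norm (f x) ^ 4) \<le> C * H1_nrm f ^ 4"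
proof (rule homogeneous_bound[OF measurable_norm_powr, of "- b" 4 "\<lambda>x. indicator (cball 0 1) x * norm x powr (- 3 * b)"])
  show "integrable lebesgue (\<lambda>x::real^3. indicator (cball 0 1) x * norm x powr (- 3 * b))"
    by (rule integrable_norm_powr_cball[OF b])
  fix x :: "real^3" and r :: real assume r: "r \<ge> 0"
  show "norm x powr (- b) * r ^ 4 \<le> indicator (cball 0 1) x * norm x powr (- 3 * b) + r\<^sup>2 + r ^ 6"
  proof (cases "norm x \<le> 1")
    case True
    have "norm x powr (- b) * r ^ 4 \<le> (norm x powr (- b)) powr 3 + (r ^ 4) powr (3 / (3 - 1))"
      by (intro mult_le_powr_sum) auto
    also have "(norm x powr (- b)) powr 3 = norm x powr (- 3 * b)" by (simp add: powr_powr mult.commute)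
    also have "(r ^ 4) powr (3 / (3 - 1)) = r ^ 6"
    proof (cases "r = 0")
      case False
      with r have "(r ^ 4) powr (3 / (3 - 1)) = (r powr 4) powr (3/2)" by (simp add: powr_numeral)
      also have "\<dots> = r powr 6" by (simp add: powr_powr)
      also have "\<dots> = r ^ 6" using r False by (simp add: powr_numeral)
      finally show ?thesis .
    qed simp
    finally show ?thesis using True by simp (smt (verit) zero_le_power2)
  next
    case False
    have "norm x powr (- b) \<le> 1 powr (- b)" using False b by (intro powr_mono2') auto
    then have "norm x powr (- b) * r ^ 4 \<le> 1 * r ^ 4" by (intro mult_right_mono) auto
    then show ?thesis using False power4_le[of r] by simp
  qed
qed (use that in auto)

lemma L4_bound:
  obtains C where "C \<ge> 0" "\<And>f g. H1_grad f g \<Longrightarrow> integrable lebesgue (\<lambda>x. norm (f x) ^ 4)"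
    "\<And>f g. H1_grad f g \<Longrightarrow> (LINT x|lebesgue. norm (f x) ^ 4) \<le> C * H1_nrm f ^ 4"
  by (rule homogeneous_bound[of "\<lambda>x. 1" 4 "\<lambda>x. 0"]) (use power4_le that in auto)

section \<open>Forms associated with the potential and the nonlinearity\<close>

lemma weighted_product_bound:
  fixes w p q :: "real^3 \<Rightarrow> real"
  assumes [measurable]: "w \<in> borel_measurable lebesgue" "p \<in> borel_measurable lebesgue" "q \<in> borel_measurable lebesgue"
    and w0: "\<And>x. w x \<ge> 0"
    and p: "integrable lebesgue (\<lambda>x. w x * (p x)\<^sup>2)" and q: "integrable lebesgue (\<lambda>x. w x * (q x)\<^sup>2)"
  shows "integrable lebesgue (\<lambda>x. w x * \<bar>p x\<bar> * \<bar>q x\<bar>)"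
    "(LINT x|lebesgue. w x * \<bar>p x\<bar> * \<bar>q x\<bar>)\<^sup>2 \<le> (LINT x|lebesgue. w x * (p x)\<^sup>2) * (LINT x|lebesgue. w x * (q x)\<^sup>2)"
proof -
  have e: "(sqrt (w x) * r)\<^sup>2 = w x * r\<^sup>2" "\<bar>sqrt (w x) * r\<bar> * \<bar>sqrt (w x) * s\<bar> = w x * \<bar>r\<bar> * \<bar>s\<bar>" for x r s
    using w0[of x] by (auto simp: power_mult_distrib abs_mult)
  show "integrable lebesgue (\<lambda>x. w x * \<bar>p x\<bar> * \<bar>q x\<bar>)"
    "(LINT x|lebesgue. w x * \<bar>p x\<bar> * \<bar>q x\<bar>)\<^sup>2 \<le> (LINT x|lebesgue. w x * (p x)\<^sup>2) * (LINT x|lebesgue. w x * (q x)\<^sup>2)"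
    using Cauchy_Schwarz_integral[of "\<lambda>x. sqrt (w x) * p x" lebesgue "\<lambda>x. sqrt (w x) * q x"] p q
    unfolding e by auto
qed

lemma potential_form_bound:
  assumes \<delta>: "\<delta> > 3/2" and V: "in_Lp \<delta> (V :: real^3 \<Rightarrow> real)"
  obtains C where "C \<ge> 0"
    "\<And>f g f' g'. H1_grad f g \<Longrightarrow> H1_grad f' g' \<Longrightarrow> integrable lebesgue (\<lambda>x. \<bar>V x\<bar> * norm (f x) * norm (f' x))"
    "\<And>f g f' g'. H1_grad f g \<Longrightarrow> H1_grad f' g' \<Longrightarrow>
       (LINT x|lebesgue. \<bar>V x\<bar> * norm (f x) * norm (f' x)) \<le> C * H1_nrm f * H1_nrm f'"
proof -
  obtain C where C: "C \<ge> 0" "\<And>f g. H1_grad f g \<Longrightarrow> integrable lebesgue (\<lambda>x. \<bar>V x\<bar> * (norm (f x))\<^sup>2)"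
    "\<And>f g. H1_grad f g \<Longrightarrow> (LINT x|lebesgue. \<bar>V x\<bar> * (norm (f x))\<^sup>2) \<le> C * (H1_nrm f)\<^sup>2"
    by (rule potential_bound[OF \<delta> V], rule that)
  show thesis
  proof (rule that[OF C(1)])
    fix f f' :: "real^3 \<Rightarrow> complex" and g g' assume fg: "H1_grad f g" and fg': "H1_grad f' g'"
    note [measurable] = in_L2_measurable[OF H1_gradD(1)[OF fg]] in_L2_measurable[OF H1_gradD(1)[OF fg']]
    have [measurable]: "V \<in> borel_measurable lebesgue" using V by (simp add: in_Lp_def)
    note W = weighted_product_bound[of "\<lambda>x. \<bar>V x\<bar>" "\<lambda>x. norm (f x)" "\<lambda>x. norm (f' x)"]
    show "integrable lebesgue (\<lambda>x. \<bar>V x\<bar> * norm (f x) * norm (f' x))"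
      using W(1) C(2)[OF fg] C(2)[OF fg'] by simp
    have "(LINT x|lebesgue. \<bar>V x\<bar> * norm (f x) * norm (f' x))\<^sup>2
        \<le> (LINT x|lebesgue. \<bar>V x\<bar> * (norm (f x))\<^sup>2) * (LINT x|lebesgue. \<bar>V x\<bar> * (norm (f' x))\<^sup>2)"
      using W(2) C(2)[OF fg] C(2)[OF fg'] by simp
    also have "\<dots> \<le> (C * (H1_nrm f)\<^sup>2) * (C * (H1_nrm f')\<^sup>2)"
      by (intro mult_mono C(3)[OF fg] C(3)[OF fg']) (use C(1) in auto)
    also have "\<dots> = (C * H1_nrm f * H1_nrm f')\<^sup>2" by (simp add: power_mult_distrib power2_eq_square)
    finally show "(LINT x|lebesgue. \<bar>V x\<bar> * norm (f x) * norm (f' x)) \<le> C * H1_nrm f * H1_nrm f'"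
      by (rule power2_le_imp_le) (use C(1) in \<open>auto simp: H1_nrm_nonneg\<close>)
  qed
qed

text \<open>Cauchy-Schwarz twice, with |x|^-b as part of the measure: the triple power is split as
  f^2 times f f', and the resulting f^2 f'^2 again. This is Hoelder with exponents 4/3 and 4, kept
  in the form of fourth powers to avoid roots.\<close>

lemma nonlinearity_form_bound:
  assumes b: "0 < b" "b < 1"
  obtains C where "C \<ge> 0"
    "\<And>f g f' g'. H1_grad f g \<Longrightarrow> H1_grad f' g' \<Longrightarrow> integrable lebesgue (\<lambda>x. norm x powr (- b) * norm (f x) ^ 3 * norm (f' x))"
    "\<And>f g f' g'. H1_grad f g \<Longrightarrow> H1_grad f' g' \<Longrightarrow>
       (LINT x|lebesgue. norm x powr (- b) * norm (f x) ^ 3 * norm (f' x)) \<le> C * H1_nrm f ^ 3 * H1_nrm f'"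
proof -
  obtain C where C: "C \<ge> 0" "\<And>f g. H1_grad f g \<Longrightarrow> integrable lebesgue (\<lambda>x. norm x powr (- b) * norm (f x) ^ 4)"
    "\<And>f g. H1_grad f g \<Longrightarrow> (LINT x|lebesgue. norm x powr (- b) * norm (f x) ^ 4) \<le> C * H1_nrm f ^ 4"
    by (rule nonlinearity_bound[OF b], rule that)
  show thesis
  proof (rule that[OF C(1)])
    fix f f' :: "real^3 \<Rightarrow> complex" and g g' assume fg: "H1_grad f g" and fg': "H1_grad f' g'"
    note [measurable] = in_L2_measurable[OF H1_gradD(1)[OF fg]] in_L2_measurable[OF H1_gradD(1)[OF fg']]
      measurable_norm_powr
    let ?w = "\<lambda>x::real^3. norm x powr (- b)"
    let ?F = "LINT x|lebesgue. ?w x * norm (f x) ^ 4" and ?G = "LINT x|lebesgue. ?w x * norm (f' x) ^ 4"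
    have p4: "(r\<^sup>2)\<^sup>2 = r ^ 4" for r :: real by (simp add: power_mult[symmetric])
    have A: "integrable lebesgue (\<lambda>x. ?w x * (norm (f x))\<^sup>2 * (norm (f' x))\<^sup>2)"
      "(LINT x|lebesgue. ?w x * (norm (f x))\<^sup>2 * (norm (f' x))\<^sup>2)\<^sup>2 \<le> ?F * ?G"
      using weighted_product_bound[of ?w "\<lambda>x. (norm (f x))\<^sup>2" "\<lambda>x. (norm (f' x))\<^sup>2"] C(2)[OF fg] C(2)[OF fg']
      by (auto simp: p4)
    have A': "integrable lebesgue (\<lambda>x. ?w x * (norm (f x) * norm (f' x))\<^sup>2)"
      using A(1) by (simp add: power_mult_distrib mult.assoc)
    have e: "?w x * (norm (f x))\<^sup>2 * norm (f x) * norm (f' x) = ?w x * norm (f x) ^ 3 * norm (f' x)" for x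
      by (simp add: power2_eq_square power3_eq_cube)
    have B: "integrable lebesgue (\<lambda>x. ?w x * norm (f x) ^ 3 * norm (f' x))"
      "(LINT x|lebesgue. ?w x * norm (f x) ^ 3 * norm (f' x))\<^sup>2 \<le> ?F * (LINT x|lebesgue. ?w x * (norm (f x))\<^sup>2 * (norm (f' x))\<^sup>2)"
      using weighted_product_bound[of ?w "\<lambda>x. (norm (f x))\<^sup>2" "\<lambda>x. norm (f x) * norm (f' x)"] C(2)[OF fg] A'
      by (auto simp: p4 e abs_mult power_mult_distrib mult.assoc[symmetric])
    then show "integrable lebesgue (\<lambda>x. ?w x * norm (f x) ^ 3 * norm (f' x))" by blast
    have FG0: "?F \<ge> 0" "?G \<ge> 0" by (auto intro!: integral_nonneg_AE)
    have "((LINT x|lebesgue. ?w x * norm (f x) ^ 3 * norm (f' x))\<^sup>2)\<^sup>2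
        \<le> (?F * (LINT x|lebesgue. ?w x * (norm (f x))\<^sup>2 * (norm (f' x))\<^sup>2))\<^sup>2"
      by (intro power_mono B) auto
    also have "\<dots> \<le> ?F\<^sup>2 * (?F * ?G)" unfolding power_mult_distrib by (intro mult_left_mono A) auto
    also have "\<dots> \<le> (C * H1_nrm f ^ 4)\<^sup>2 * ((C * H1_nrm f ^ 4) * (C * H1_nrm f' ^ 4))"
      using C(3)[OF fg] C(3)[OF fg'] FG0 C(1)
      by (intro mult_mono power_mono) auto
    also have "\<dots> = ((C * H1_nrm f ^ 3 * H1_nrm f')\<^sup>2)\<^sup>2"
      by (simp add: power_mult_distrib power_mult[symmetric] power_add[symmetric])
         (simp add: power_mult_distrib eval_nat_numeral)
    finally have "(LINT x|lebesgue. ?w x * norm (f x) ^ 3 * norm (f' x))\<^sup>2 \<le> (C * H1_nrm f ^ 3 * H1_nrm f')\<^sup>2"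
      by (rule power2_le_imp_le) auto
    then show "(LINT x|lebesgue. ?w x * norm (f x) ^ 3 * norm (f' x)) \<le> C * H1_nrm f ^ 3 * H1_nrm f'"
      by (rule power2_le_imp_le) (use C(1) in \<open>auto simp: H1_nrm_nonneg\<close>)
  qed
qed

section \<open>Dilations\<close>

text \<open>The projection onto a ball serves as a continuous truncation of vector values.\<close>

lemma closest_point_cball_0:
  fixes x :: "'a::euclidean_space"
  assumes "k \<ge> 0"
  shows "norm (closest_point (cball 0 k) x) \<le> norm x" "norm (closest_point (cball 0 k) x) \<le> k"
    "norm x \<le> k \<Longrightarrow> closest_point (cball 0 k) x = x"
proof -
  have ne: "cball (0::'a) k \<noteq> {}" using assms by auto
  have "closest_point (cball 0 k) (0::'a) = 0" using assms by (intro closest_point_self) auto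
  then show "norm (closest_point (cball 0 k) x) \<le> norm x"
    using closest_point_lipschitz[OF convex_cball closed_cball ne, of x 0] by (simp add: dist_norm)
  show "norm (closest_point (cball 0 k) x) \<le> k"
    using closest_point_in_set[OF closed_cball ne, of x] by simp
  show "norm x \<le> k \<Longrightarrow> closest_point (cball 0 k) x = x" by (intro closest_point_self) auto
qed

lemma L2_nrm_tendsto_0:
  fixes F :: "nat \<Rightarrow> real^3 \<Rightarrow> 'a::euclidean_space"
  assumes [measurable]: "\<And>n. F n \<in> borel_measurable lebesgue"
    and lim: "AE x in lebesgue. (\<lambda>n. F n x) \<longlonglongrightarrow> 0"
    and G: "in_Lp 2 G" and dom: "\<And>n. AE x in lebesgue. norm (F n x) \<le> norm (G x)"
  shows "(\<lambda>n. L2_nrm (F n)) \<longlonglongrightarrow> 0"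
proof -
  have "(\<lambda>n. LINT x|lebesgue. (norm (F n x))\<^sup>2) \<longlonglongrightarrow> (LINT x|(lebesgue::(real^3) measure). 0)"
  proof (rule integral_dominated_convergence[where w = "\<lambda>x. (norm (G x))\<^sup>2"])
    show "integrable lebesgue (\<lambda>x. (norm (G x))\<^sup>2)" using G by (simp add: in_L2_iff)
    show "AE x in lebesgue. (\<lambda>n. (norm (F n x))\<^sup>2) \<longlonglongrightarrow> 0"
      using lim
    proof eventually_elim
      case (elim x)
      from tendsto_power[OF tendsto_norm[OF elim], of 2] show ?case by simp
    qed
    show "AE x in lebesgue. norm ((norm (F n x))\<^sup>2) \<le> (norm (G x))\<^sup>2" for n
      using dom[of n] by eventually_elim (simp add: power_mono)
  qed auto
  from tendsto_real_sqrt[OF this] show ?thesis by (simp add: L2_nrm_def)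
qed

text \<open>Two dominated limits. First \<open>f\<close> is cut off in size and support, giving
  \<open>T k\<close>. Then continuous functions converging to \<open>f\<close> almost everywhere are
  cut off in the same way, giving \<open>A k n\<close>; the common cutoff supplies the dominating
  function that mere pointwise convergence lacks.\<close>

lemma L2_approx_continuous:
  fixes f :: "real^3 \<Rightarrow> 'a::euclidean_space"
  assumes f: "in_Lp 2 f" and \<epsilon>: "\<epsilon> > 0"
  obtains \<phi> R where "continuous_on UNIV \<phi>" "\<And>x. norm x > R \<Longrightarrow> \<phi> x = 0" "R > 0"
    "in_Lp 2 \<phi>" "L2_nrm (\<lambda>x. f x - \<phi> x) < \<epsilon>"
proof -
  note mf[measurable] = in_L2_measurable[OF f]
  have "f measurable_on UNIV"
    using lebesgue_measurable_imp_measurable_on[of f UNIV] mf by simp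
  then obtain Z g where Z: "negligible Z" and g: "\<And>n. continuous_on UNIV (g n)"
    "\<And>x. x \<notin> Z \<Longrightarrow> (\<lambda>n. g n x) \<longlonglongrightarrow> f x"
    unfolding measurable_on_def by auto
  have gAE: "AE x in lebesgue. (\<lambda>n. g n x) \<longlonglongrightarrow> f x"
    using Z g(2) by (intro AE_I'[of Z]) (auto simp: negligible_iff_null_sets)
  define ct where "ct k x = max 0 (min 1 (real k + 1 - norm x))" for k :: nat and x :: "real^3"
  have ct: "0 \<le> ct k x" "ct k x \<le> 1" "norm x \<le> k \<Longrightarrow> ct k x = 1" "norm x > k + 1 \<Longrightarrow> ct k x = 0" for k x
    by (auto simp: ct_def)
  have cct: "continuous_on UNIV (ct k)" for k unfolding ct_def by (intro continuous_intros)
  define cp where "cp k = closest_point (cball (0::'a) (real k))" for k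
  have ccp: "continuous_on UNIV (cp k)" for k
    unfolding cp_def by (intro continuous_on_closest_point) auto
  define T where "T k x = ct k x *\<^sub>R cp k (f x)" for k x
  define A where "A k n x = ct k x *\<^sub>R cp k (g n x)" for k n x
  have mct[measurable]: "ct k \<in> borel_measurable lebesgue" for k
    by (intro measurable_lebesgue_borel borel_measurable_continuous_onI cct)
  have mcp[measurable]: "cp k \<in> borel_measurable borel" for k
    by (intro borel_measurable_continuous_onI ccp)
  have mT[measurable]: "T k \<in> borel_measurable lebesgue" for k unfolding T_def by measurable
  have cA: "continuous_on UNIV (A k n)" for k n
    unfolding A_def by (intro continuous_intros cct continuous_on_compose2[OF ccp g(1)]) auto
  have mA[measurable]: "A k n \<in> borel_measurable lebesgue" for k n
    by (intro measurable_lebesgue_borel borel_measurable_continuous_onI cA)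
  have nT: "norm (T k x) \<le> norm (f x)" for k x
  proof -
    have "norm (T k x) \<le> 1 * norm (cp k (f x))"
      unfolding T_def using ct(1)[of k x] mult_right_mono[OF ct(2)[of k x] norm_ge_zero[of "cp k (f x)"]] by simp
    then show ?thesis using closest_point_cball_0(1)[of "real k" "f x"] by (simp add: cp_def)
  qed
  have b1: "norm (A k n x) \<le> real k * indicat_real (cball 0 (real k + 1)) x" "norm (T k x) \<le> real k * indicat_real (cball 0 (real k + 1)) x" for k n x
  proof -
    have *: "norm (ct k x *\<^sub>R cp k y) \<le> real k * indicat_real (cball 0 (real k + 1)) x" for y
    proof (cases "norm x \<le> k + 1")
      case True
      have "norm (ct k x *\<^sub>R cp k y) \<le> 1 * norm (cp k y)"
        using ct(1)[of k x] mult_right_mono[OF ct(2)[of k x] norm_ge_zero[of "cp k y"]] by simp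
      then show ?thesis using True closest_point_cball_0(2)[of "real k" y] by (simp add: cp_def)
    qed (use ct(4)[of k x] in simp)
    show "norm (A k n x) \<le> real k * indicat_real (cball 0 (real k + 1)) x" "norm (T k x) \<le> real k * indicat_real (cball 0 (real k + 1)) x"
      unfolding A_def T_def by (rule *)+
  qed
  have "(\<lambda>k. L2_nrm (\<lambda>x. f x - T k x)) \<longlonglongrightarrow> 0"
  proof (rule L2_nrm_tendsto_0[where G = "\<lambda>x. 2 *\<^sub>R f x"])
    show "AE x in lebesgue. (\<lambda>k. f x - T k x) \<longlonglongrightarrow> 0"
    proof (intro AE_I2 tendsto_eventually)
      fix x
      obtain K where K: "max (norm x) (norm (f x)) \<le> real K" using real_arch_simple by blast
      have "f x - T k x = 0" if "k \<ge> K" for k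
      proof -
        have "norm x \<le> real k" "norm (f x) \<le> real k" using K that by auto
        then show ?thesis using ct(3)[of x k] closest_point_cball_0(3)[of "real k" "f x"] by (simp add: T_def cp_def)
      qed
      then show "eventually (\<lambda>k. f x - T k x = 0) sequentially" using eventually_sequentially by blast
    qed
    show "AE x in lebesgue. norm (f x - T k x) \<le> norm (2 *\<^sub>R f x)" for k
    proof (intro AE_I2)
      fix x show "norm (f x - T k x) \<le> norm (2 *\<^sub>R f x)"
        using norm_triangle_ineq4[of "f x" "T k x"] nT[of k x] by simp
    qed
  qed (use in_L2_scaleR[OF f] in auto)
  from LIMSEQ_D[OF this, of "\<epsilon> / 2"] \<epsilon>
  obtain k where "norm (L2_nrm (\<lambda>x. f x - T k x) - 0) < \<epsilon> / 2" by auto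
  then have k: "L2_nrm (\<lambda>x. f x - T k x) < \<epsilon> / 2" by simp
  define G where "G x = 2 * (real k * indicat_real (cball 0 (real k + 1)) x)" for x :: "real^3"
  have G2: "in_Lp 2 (\<lambda>x. C * indicator (cball 0 r) x :: real)" for C r
  proof -
    have "integrable lebesgue (\<lambda>x::real^3. C\<^sup>2 * indicator (cball 0 r) x :: real)" by (rule integrable_indicator_cball)
    moreover have "(norm (C * indicator (cball 0 r) x :: real))\<^sup>2 = C\<^sup>2 * indicator (cball 0 r) x" for x :: "real^3"
      by (simp add: indicator_def power_mult_distrib)
    ultimately show ?thesis unfolding in_L2_iff by (auto simp: borel_measurable_indicator)
  qed
  have "(\<lambda>n. L2_nrm (\<lambda>x. T k x - A k n x)) \<longlonglongrightarrow> 0"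
  proof (rule L2_nrm_tendsto_0[where G = G])
    show "AE x in lebesgue. (\<lambda>n. T k x - A k n x) \<longlonglongrightarrow> 0"
      using gAE
    proof eventually_elim
      case (elim x)
      have "isCont (cp k) (f x)" using ccp by (simp add: continuous_on_eq_continuous_at)
      from isCont_tendsto_compose[OF this elim]
      have "(\<lambda>n. A k n x) \<longlonglongrightarrow> T k x" unfolding A_def T_def by (intro tendsto_intros)
      from tendsto_diff[OF tendsto_const[of "T k x"] this] show ?case by simp
    qed
    show "in_Lp 2 G" using G2[of "2 * real k"] by (simp add: G_def[abs_def] mult.assoc)
    show "AE x in lebesgue. norm (T k x - A k n x) \<le> norm (G x)" for n
    proof (intro AE_I2)
      fix x
      show "norm (T k x - A k n x) \<le> norm (G x)"
        using norm_triangle_ineq4[of "T k x" "A k n x"] b1(1)[where k = k and n = n and x = x] b1(2)[where k = k and x = x] by (simp add: G_def)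
    qed
  qed measurable
  from LIMSEQ_D[OF this, of "\<epsilon> / 2"] \<epsilon>
  obtain n where "norm (L2_nrm (\<lambda>x. T k x - A k n x) - 0) < \<epsilon> / 2" by auto
  then have n: "L2_nrm (\<lambda>x. T k x - A k n x) < \<epsilon> / 2" by simp
  have T2: "in_Lp 2 (T k)" by (rule in_L2_bound(1)[OF f mT, of _ 1]) (use nT in auto)
  have A2: "in_Lp 2 (A k n)"
    by (rule in_L2_bound(1)[OF G2[of "real k" "real k + 1"] mA, where C = 1]) (use b1 in \<open>auto simp: abs_mult add.commute\<close>)
  show thesis
  proof (rule that[of "A k n" "real k + 1"])
    show "L2_nrm (\<lambda>x. f x - A k n x) < \<epsilon>"
      using L2_nrm_triangle[OF in_L2_diff[OF f T2] in_L2_diff[OF T2 A2]] k n by simp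
    show "A k n x = 0" if "norm x > real k + 1" for x using ct(4)[of k x] that by (simp add: A_def)
  qed (use cA A2 in auto)
qed

lemma dilation_continuous_L2_test:
  fixes \<phi> :: "real^3 \<Rightarrow> 'a::euclidean_space"
  assumes c: "continuous_on UNIV \<phi>" and R: "\<And>x. norm x > R \<Longrightarrow> \<phi> x = 0" "R > 0" and \<epsilon>: "\<epsilon> > 0"
  shows "\<exists>d>0. \<forall>s. \<bar>s\<bar> < d \<longrightarrow> L2_nrm (\<lambda>x. \<phi> (exp s *\<^sub>R x) - \<phi> x) \<le> \<epsilon>"
proof -
  \<comment> \<open>For \<open>\<bar>s\<bar> < 1\<close> both terms vanish outside radius
    \<open>exp 1 * R\<close>; inside it the dilated point has norm at most
    \<open>exp 1 * (exp 1 * R)\<close>, so uniform continuity is needed on the ball of radius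
    \<open>K\<close>.\<close>
  define K where "K = exp 1 * exp 1 * R"
  define vol where "vol = (LINT x|lebesgue. indicator (cball (0::real^3) (exp 1 * R)) x :: real)"
  have vol0: "vol \<ge> 0" by (simp add: vol_def)
  define \<eta> where "\<eta> = \<epsilon> / (sqrt vol + 1)"
  have \<eta>: "\<eta> > 0" using \<epsilon> vol0 by (auto simp: \<eta>_def intro!: divide_pos_pos add_nonneg_pos)
  have "uniformly_continuous_on (cball 0 K) \<phi>"
    by (intro compact_uniformly_continuous compact_cball continuous_on_subset[OF c]) auto
  then obtain e where e: "e > 0" "\<And>x y. norm x \<le> K \<Longrightarrow> norm y \<le> K \<Longrightarrow> dist y x < e \<Longrightarrow> dist (\<phi> y) (\<phi> x) < \<eta>"
    unfolding uniformly_continuous_on_def using \<eta> by (metis mem_cball_0)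
  have "((\<lambda>s. \<bar>exp s - 1\<bar> * (exp 1 * R)) \<longlongrightarrow> \<bar>exp 0 - 1\<bar> * (exp 1 * R)) (at (0::real))"
    by (intro tendsto_intros)
  then have "eventually (\<lambda>s. \<bar>exp s - 1\<bar> * (exp 1 * R) < e) (at (0::real))"
    using e(1) by (intro order_tendstoD(2)[of _ 0]) auto
  then obtain d where d: "d > 0" "\<And>s. s \<noteq> 0 \<Longrightarrow> \<bar>s\<bar> < d \<Longrightarrow> \<bar>exp s - 1\<bar> * (exp 1 * R) < e"
    by (auto simp: eventually_at dist_real_def)
  have d': "\<bar>exp s - 1\<bar> * (exp 1 * R) < e" if "\<bar>s\<bar> < d" for s using d(2)[of s] that e(1) by (cases "s = 0") auto
  have "L2_nrm (\<lambda>x. \<phi> (exp s *\<^sub>R x) - \<phi> x) \<le> \<epsilon>" if s: "\<bar>s\<bar> < min 1 d" for s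
  proof -
    have es: "exp s \<le> exp 1" "exp (- s) \<le> exp 1" using s by auto
    have le: "norm (\<phi> (exp s *\<^sub>R x) - \<phi> x) \<le> \<eta> * indicator (cball 0 (exp 1 * R)) x" for x
    proof (cases "norm x \<le> exp 1 * R")
      case True
      have "norm (exp s *\<^sub>R x) \<le> exp 1 * (exp 1 * R)" using True es by (auto intro!: mult_mono)
      moreover have "norm x \<le> K"
      proof -
        have "1 * (exp 1 * R) \<le> exp 1 * (exp 1 * R)" using R(2) by (intro mult_right_mono) auto
        then show ?thesis using True unfolding K_def mult_1 mult.assoc by linarith
      qed
      moreover have "dist (exp s *\<^sub>R x) x < e"
      proof -
        have "exp s *\<^sub>R x - x = (exp s - 1) *\<^sub>R x" by (simp add: algebra_simps)
        then have "dist (exp s *\<^sub>R x) x = \<bar>exp s - 1\<bar> * norm x" by (simp add: dist_norm)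
        also have "\<dots> \<le> \<bar>exp s - 1\<bar> * (exp 1 * R)" using True by (intro mult_left_mono) auto
        finally show ?thesis using d'[of s] s by simp
      qed
      ultimately have "dist (\<phi> (exp s *\<^sub>R x)) (\<phi> x) < \<eta>" by (intro e(2)) (auto simp: K_def mult.assoc)
      then show ?thesis using True by (simp add: dist_norm)
    next
      case False
      then have "norm x > exp 1 * R" by simp
      moreover have "exp 1 * R \<ge> R" using R(2) by simp
      moreover have "norm (exp s *\<^sub>R x) > R"
      proof -
        have "R = exp s * (exp (- s) * R)" by (simp add: exp_minus)
        also have "\<dots> \<le> exp s * (exp 1 * R)" using es R(2) by (intro mult_left_mono mult_right_mono) auto
        also have "\<dots> < exp s * norm x" using False by simp
        finally show ?thesis by simp
      qed
      ultimately show ?thesis using R(1)[of x] R(1)[of "exp s *\<^sub>R x"] False by simp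
    qed
    have m: "(\<lambda>x. \<phi> (exp s *\<^sub>R x) - \<phi> x) \<in> borel_measurable lebesgue"
      by (intro measurable_lebesgue_borel borel_measurable_continuous_onI continuous_intros continuous_on_compose2[OF c]) auto
    have "(L2_nrm (\<lambda>x. \<phi> (exp s *\<^sub>R x) - \<phi> x))\<^sup>2 \<le> (LINT x|lebesgue. \<eta>\<^sup>2 * indicator (cball (0::real^3) (exp 1 * R)) x)"
      unfolding L2_nrm_power2
    proof (rule integral_mono')
      show "(norm (\<phi> (exp s *\<^sub>R x) - \<phi> x))\<^sup>2 \<le> \<eta>\<^sup>2 * indicator (cball 0 (exp 1 * R)) x" for x
        using power_mono[OF le[of x] norm_ge_zero, of 2] by (cases "norm x \<le> exp 1 * R") simp_all
    qed (use \<eta> integrable_indicator_cball[of 1] in auto)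
    also have "\<dots> = (\<eta> * sqrt vol)\<^sup>2" using vol0 by (simp add: vol_def power_mult_distrib)
    finally have "L2_nrm (\<lambda>x. \<phi> (exp s *\<^sub>R x) - \<phi> x) \<le> \<eta> * sqrt vol"
      by (rule power2_le_imp_le) (use \<eta> vol0 in auto)
    also have "\<dots> \<le> \<epsilon>"
    proof -
      have "sqrt vol + 1 > 0" using vol0 by (simp add: add_nonneg_pos)
      then show ?thesis using \<epsilon> by (simp add: \<eta>_def pos_divide_le_eq algebra_simps)
    qed
    finally show ?thesis .
  qed
  then show ?thesis using d(1) by (intro exI[of _ "min 1 d"]) auto
qed

text \<open>A three-term approximation by a continuous compactly supported function. For
  \<open>\<bar>s\<bar> < 1\<close> one has \<open>exp s \<ge> 1/4\<close>, so composing with the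
  dilation enlarges the L^2 norm at most by 8, the root of 4^3; hence the error is 8/16 + 1/16 +
  1/16 of \<open>\<epsilon>\<close>.\<close>

lemma dilation_continuous_L2:
  fixes f :: "real^3 \<Rightarrow> 'a::euclidean_space"
  assumes f: "in_Lp 2 f"
  shows "((\<lambda>s. L2_nrm (\<lambda>x. f (exp s *\<^sub>R x) - f x)) \<longlongrightarrow> 0) (at 0)"
proof (rule tendstoI)
  fix \<epsilon> :: real assume \<epsilon>: "\<epsilon> > 0"
  obtain \<phi> R where \<phi>: "continuous_on UNIV \<phi>" "\<And>x. norm x > R \<Longrightarrow> \<phi> x = 0" "R > 0"
    "in_Lp 2 \<phi>" "L2_nrm (\<lambda>x. f x - \<phi> x) < \<epsilon> / 16"
    by (rule L2_approx_continuous[OF f, of "\<epsilon> / 16"]) (use \<epsilon> in simp, rule that)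
  obtain d where d: "d > 0" "\<And>s. \<bar>s\<bar> < d \<Longrightarrow> L2_nrm (\<lambda>x. \<phi> (exp s *\<^sub>R x) - \<phi> x) \<le> \<epsilon> / 16"
    using dilation_continuous_L2_test[OF \<phi>(1-3), of "\<epsilon> / 16"] \<epsilon> by auto
  have "L2_nrm (\<lambda>x. f (exp s *\<^sub>R x) - f x) < \<epsilon>" if s: "\<bar>s\<bar> < min 1 d" for s
  proof -
    have d1: "in_Lp 2 (\<lambda>x. f x - \<phi> x)" by (rule in_L2_diff[OF f \<phi>(4)])
    have d2: "in_Lp 2 (\<lambda>x. f (exp s *\<^sub>R x) - \<phi> (exp s *\<^sub>R x))"
      and n2: "L2_nrm (\<lambda>x. f (exp s *\<^sub>R x) - \<phi> (exp s *\<^sub>R x)) = L2_nrm (\<lambda>x. f x - \<phi> x) / sqrt (exp s ^ 3)"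
      using L2_affine[OF d1, of "exp s" 0] by auto
    have d3: "in_Lp 2 (\<lambda>x. \<phi> (exp s *\<^sub>R x) - \<phi> x)"
      using in_L2_diff[OF L2_affine(1)[OF \<phi>(4), of "exp s" 0] \<phi>(4)] by simp
    have "1 / 64 \<le> exp s ^ 3"
    proof -
      have "exp (- s) \<le> exp 1" using s by (simp add: abs_less_iff)
      also have "exp (1::real) \<le> 4" using exp_le by simp
      finally have "1 / 4 \<le> exp s" by (simp add: exp_minus field_simps)
      then have "(1 / 4) ^ 3 \<le> exp s ^ 3" by (intro power_mono) auto
      then show ?thesis by (simp add: power3_eq_cube)
    qed
    then have "sqrt (1 / 64) \<le> sqrt (exp s ^ 3)" by (rule real_sqrt_le_mono)
    moreover have "sqrt (1 / 64) = 1 / (8::real)" by (rule real_sqrt_unique) (auto simp: power2_eq_square)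
    ultimately have q: "1 / 8 \<le> sqrt (exp s ^ 3)" by simp
    have "L2_nrm (\<lambda>x. f x - \<phi> x) / sqrt (exp s ^ 3) \<le> L2_nrm (\<lambda>x. f x - \<phi> x) / (1 / 8)"
      using q by (intro divide_left_mono L2_nrm_nonneg) auto
    then have n2': "L2_nrm (\<lambda>x. f (exp s *\<^sub>R x) - \<phi> (exp s *\<^sub>R x)) \<le> 8 * (\<epsilon> / 16)"
      unfolding n2 using \<phi>(5) by (elim order_trans) simp
    have "L2_nrm (\<lambda>x. f (exp s *\<^sub>R x) - f x) = L2_nrm (\<lambda>x. ((f (exp s *\<^sub>R x) - \<phi> (exp s *\<^sub>R x))
        + (\<phi> (exp s *\<^sub>R x) - \<phi> x)) + (-1) *\<^sub>R (f x - \<phi> x))" by simp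
    also have "\<dots> \<le> L2_nrm (\<lambda>x. (f (exp s *\<^sub>R x) - \<phi> (exp s *\<^sub>R x)) + (\<phi> (exp s *\<^sub>R x) - \<phi> x))
        + L2_nrm (\<lambda>x. (-1) *\<^sub>R (f x - \<phi> x))"
      by (intro L2_nrm_triangle in_L2_add d2 d3 in_L2_scaleR d1)
    also have "\<dots> \<le> (L2_nrm (\<lambda>x. f (exp s *\<^sub>R x) - \<phi> (exp s *\<^sub>R x)) + L2_nrm (\<lambda>x. \<phi> (exp s *\<^sub>R x) - \<phi> x))
        + L2_nrm (\<lambda>x. f x - \<phi> x)"
      using L2_nrm_triangle[OF d2 d3] L2_nrm_scaleR[of "-1" "\<lambda>x. f x - \<phi> x"] by simp
    also have "\<dots> \<le> 8 * (\<epsilon> / 16) + \<epsilon> / 16 + \<epsilon> / 16" using n2' d(2)[of s] s \<phi>(5) by simp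
    also have "\<dots> < \<epsilon>" using \<epsilon> by simp
    finally show ?thesis .
  qed
  then show "eventually (\<lambda>s. dist (L2_nrm (\<lambda>x. f (exp s *\<^sub>R x) - f x)) 0 < \<epsilon>) (at 0)"
    using d(1) by (auto simp: eventually_at dist_real_def abs_of_nonneg[OF L2_nrm_nonneg] intro!: exI[of _ "min 1 d"])
qed

section \<open>Time derivatives of quadratic quantities\<close>

lemma norm_sum_cnj_le:
  fixes a c :: "complex^3"
  shows "norm (\<Sum>i\<in>UNIV. a $ i * cnj (c $ i)) \<le> norm a * norm c"
proof -
  have "norm (\<Sum>i\<in>UNIV. a $ i * cnj (c $ i)) \<le> (\<Sum>i\<in>UNIV. \<bar>norm (a $ i)\<bar> * \<bar>norm (c $ i)\<bar>)"
    by (rule order_trans[OF norm_sum]) (simp add: norm_mult)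
  also have "\<dots> \<le> L2_set (\<lambda>i. norm (a $ i)) UNIV * L2_set (\<lambda>i. norm (c $ i)) UNIV" by (rule L2_set_mult_ineq)
  finally show ?thesis by (simp add: norm_vec_def)
qed

lemma measurable_cnj [measurable (raw)]:
  "f \<in> borel_measurable M \<Longrightarrow> (\<lambda>x. cnj (f x)) \<in> borel_measurable M"
proof -
  have "cnj \<in> borel_measurable borel"
    by (intro borel_measurable_continuous_onI continuous_on_cnj continuous_on_id)
  then show "f \<in> borel_measurable M \<Longrightarrow> (\<lambda>x. cnj (f x)) \<in> borel_measurable M"
    using measurable_compose by blast
qed

lemma mult_cnj_eq_cmod_power2: "z * cnj z = complex_of_real ((cmod z)\<^sup>2)"
  using complex_norm_square[of z] by simp

lemma measurable_sum_cnj: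
  fixes g k :: "real^3 \<Rightarrow> complex^3"
  assumes "g \<in> borel_measurable lebesgue" "k \<in> borel_measurable lebesgue"
  shows "(\<lambda>x. \<Sum>i\<in>UNIV. g x $ i * cnj (k x $ i)) \<in> borel_measurable lebesgue"
  using measurable_vec_nth[OF assms(1)] measurable_vec_nth[OF assms(2)] by measurable

lemma integrable_sum_cnj:
  assumes "in_Lp 2 g" "in_Lp 2 (k :: real^3 \<Rightarrow> complex^3)"
  shows "integrable lebesgue (\<lambda>x. \<Sum>i\<in>UNIV. g x $ i * cnj (k x $ i))"
    and "norm (LINT x|lebesgue. (\<Sum>i\<in>UNIV. g x $ i * cnj (k x $ i))) \<le> L2_nrm g * L2_nrm k"
  by (rule L2_product[OF assms measurable_sum_cnj]; use assms norm_sum_cnj_le in \<open>auto simp: in_L2_iff\<close>)+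

lemma integrable_mult_cnj:
  assumes "in_Lp 2 f" "in_Lp 2 (g :: real^3 \<Rightarrow> complex)"
  shows "integrable lebesgue (\<lambda>x. f x * cnj (g x))" and "norm (pair_L2 f g) \<le> L2_nrm f * L2_nrm g"
proof -
  note [measurable] = in_L2_measurable[OF assms(1)] in_L2_measurable[OF assms(2)]
  note L = L2_product[OF assms, of "\<lambda>x. f x * cnj (g x)"]
  show "integrable lebesgue (\<lambda>x. f x * cnj (g x))" by (rule L(1)) (auto simp: norm_mult)
  show "norm (pair_L2 f g) \<le> L2_nrm f * L2_nrm g" unfolding pair_L2_def by (rule L(3)) (auto simp: norm_mult)
qed

lemma pair_L2_cnj: "cnj (pair_L2 f g) = pair_L2 g f"
  unfolding pair_L2_def Bochner_Integration.integral_cnj[symmetric] by (simp add: mult.commute)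

lemma pair_L2_diff_left:
  assumes "in_Lp 2 f" "in_Lp 2 f'" "in_Lp 2 g"
  shows "pair_L2 (\<lambda>x. f x - f' x) g = pair_L2 f g - pair_L2 f' g"
  using integrable_mult_cnj(1)[OF assms(1,3)] integrable_mult_cnj(1)[OF assms(2,3)]
  by (simp add: pair_L2_def left_diff_distrib)

lemma H1_nrm_triangle:
  assumes 1: "H1_grad f g" and 2: "H1_grad f' g'"
  shows "H1_nrm (\<lambda>x. f x + f' x) \<le> H1_nrm f + H1_nrm f'"
proof -
  have "H1_nrm (\<lambda>x. f x + f' x) = sqrt ((L2_nrm (\<lambda>x. f x + f' x))\<^sup>2 + (L2_nrm (\<lambda>x. g x + g' x))\<^sup>2)"
    using L2_nrm_grad[OF H1_grad_add[OF 1 2]] by (simp add: H1_nrm_def)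
  also have "\<dots> \<le> sqrt ((L2_nrm f + L2_nrm f')\<^sup>2 + (L2_nrm g + L2_nrm g')\<^sup>2)"
    using L2_nrm_triangle[OF H1_gradD(1)[OF 1] H1_gradD(1)[OF 2]] L2_nrm_triangle[OF H1_gradD(2)[OF 1] H1_gradD(2)[OF 2]]
    by (intro real_sqrt_le_mono add_mono power_mono) (auto simp: L2_nrm_nonneg)
  also have "\<dots> \<le> sqrt ((L2_nrm f)\<^sup>2 + (L2_nrm g)\<^sup>2) + sqrt ((L2_nrm f')\<^sup>2 + (L2_nrm g')\<^sup>2)"
    by (rule real_sqrt_sum_squares_triangle_ineq)
  finally show ?thesis using L2_nrm_grad[OF 1] L2_nrm_grad[OF 2] by (simp add: H1_nrm_def)
qed

section \<open>The equation as a functional on H^1\<close>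

definition nls_rhs :: "real \<Rightarrow> (real^3 \<Rightarrow> real) \<Rightarrow> (real^3 \<Rightarrow> complex) \<Rightarrow> (real^3 \<Rightarrow> complex) \<Rightarrow> complex" where
  "nls_rhs b V f \<phi> = - \<i> * (pair_H V f \<phi> - pair_N b f \<phi>)"

lemma integrable_potential_form:
  assumes "\<delta> > 3/2" "in_Lp \<delta> (V :: real^3 \<Rightarrow> real)" "H1_grad f g" "H1_grad \<phi> k"
  shows "integrable lebesgue (\<lambda>x. complex_of_real (V x) * f x * cnj (\<phi> x))"
proof -
  obtain C where "\<And>f g f' g'. H1_grad f g \<Longrightarrow> H1_grad f' g' \<Longrightarrow> integrable lebesgue (\<lambda>x. \<bar>V x\<bar> * norm (f x) * norm (f' x))"
    by (rule potential_form_bound[OF assms(1,2)], rule that)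
  note [measurable] = in_L2_measurable[OF H1_gradD(1)[OF assms(3)]] in_L2_measurable[OF H1_gradD(1)[OF assms(4)]]
  have [measurable]: "V \<in> borel_measurable lebesgue" using assms by (simp add: in_Lp_def)
  show ?thesis
    by (rule Bochner_Integration.integrable_bound[OF \<open>\<And>f g f' g'. H1_grad f g \<Longrightarrow> H1_grad f' g' \<Longrightarrow> integrable lebesgue (\<lambda>x. \<bar>V x\<bar> * norm (f x) * norm (f' x))\<close>[OF assms(3,4)]])
       (auto simp: norm_mult)
qed

text \<open>On bounded sets of H^1 the right side of the equation is bounded in the dual of H^1.
  This yields Lipschitz dependence on time of the pairings, with a constant proportional to the H^1
  norm of the test function.\<close>

lemma nls_rhs_bound:
  assumes b: "0 < b" "b < 1" and \<delta>: "\<delta> > 3/2" and V: "in_Lp \<delta> V"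
  obtains C where "C \<ge> 0"
    "\<And>f \<phi>. in_H1 f \<Longrightarrow> in_H1 \<phi> \<Longrightarrow> norm (nls_rhs b V f \<phi>) \<le> C * (H1_nrm f + H1_nrm f ^ 3) * H1_nrm \<phi>"
proof -
  obtain C1 where C1: "C1 \<ge> 0"
    "\<And>f g f' g'. H1_grad f g \<Longrightarrow> H1_grad f' g' \<Longrightarrow> integrable lebesgue (\<lambda>x. \<bar>V x\<bar> * norm (f x) * norm (f' x))"
    "\<And>f g f' g'. H1_grad f g \<Longrightarrow> H1_grad f' g' \<Longrightarrow>
       (LINT x|lebesgue. \<bar>V x\<bar> * norm (f x) * norm (f' x)) \<le> C1 * H1_nrm f * H1_nrm f'"
    by (rule potential_form_bound[OF \<delta> V], rule that)
  obtain C2 where C2: "C2 \<ge> 0"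
    "\<And>f g f' g'. H1_grad f g \<Longrightarrow> H1_grad f' g' \<Longrightarrow> integrable lebesgue (\<lambda>x. norm x powr (- b) * norm (f x) ^ 3 * norm (f' x))"
    "\<And>f g f' g'. H1_grad f g \<Longrightarrow> H1_grad f' g' \<Longrightarrow>
       (LINT x|lebesgue. norm x powr (- b) * norm (f x) ^ 3 * norm (f' x)) \<le> C2 * H1_nrm f ^ 3 * H1_nrm f'"
    by (rule nonlinearity_form_bound[OF b], rule that)
  show thesis
  proof (rule that)
    show "1 + C1 + C2 \<ge> 0" using C1 C2 by simp
    fix f \<phi> assume "in_H1 f" "in_H1 \<phi>"
    then have f: "H1_grad f (grad f)" and \<phi>: "H1_grad \<phi> (grad \<phi>)" by (auto intro: in_H1_grad)
    have "norm (LINT x|lebesgue. (\<Sum>i\<in>UNIV. grad f x $ i * cnj (grad \<phi> x $ i))) \<le> L2_nrm (grad f) * L2_nrm (grad \<phi>)"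
      by (intro integrable_sum_cnj H1_gradD(2)[OF f] H1_gradD(2)[OF \<phi>])
    also have "\<dots> \<le> H1_nrm f * H1_nrm \<phi>"
      by (intro mult_mono L2_nrm_le_H1_nrm H1_nrm_nonneg L2_nrm_nonneg)
    finally have a: "norm (LINT x|lebesgue. (\<Sum>i\<in>UNIV. grad f x $ i * cnj (grad \<phi> x $ i))) \<le> H1_nrm f * H1_nrm \<phi>" .
    have c: "norm (LINT x|lebesgue. complex_of_real (V x) * f x * cnj (\<phi> x)) \<le> C1 * H1_nrm f * H1_nrm \<phi>"
      using C1(3)[OF f \<phi>] integral_norm_bound[of lebesgue "\<lambda>x. complex_of_real (V x) * f x * cnj (\<phi> x)"]
      by (simp add: norm_mult)
    have d: "norm (pair_N b f \<phi>) \<le> C2 * H1_nrm f ^ 3 * H1_nrm \<phi>"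
    proof -
      have "norm (complex_of_real (norm x powr (-b) * (cmod (f x))\<^sup>2) * f x * cnj (\<phi> x))
        = norm x powr (- b) * norm (f x) ^ 3 * norm (\<phi> x)" for x
        by (simp add: norm_mult power2_eq_square power3_eq_cube)
      then show ?thesis
        using C2(3)[OF f \<phi>] integral_norm_bound[of lebesgue "\<lambda>x. complex_of_real (norm x powr (-b) * (cmod (f x))\<^sup>2) * f x * cnj (\<phi> x)"]
        unfolding pair_N_def by simp
    qed
    have "norm (nls_rhs b V f \<phi>) \<le> norm (pair_H V f \<phi>) + norm (pair_N b f \<phi>)"
      unfolding nls_rhs_def by (simp add: norm_mult norm_triangle_ineq4)
    also have "norm (pair_H V f \<phi>) \<le> H1_nrm f * H1_nrm \<phi> + C1 * H1_nrm f * H1_nrm \<phi>"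
      unfolding pair_H_def by (rule order_trans[OF norm_triangle_ineq add_mono[OF a c]])
    finally have "norm (nls_rhs b V f \<phi>) \<le> ((1 + C1) * H1_nrm f + C2 * H1_nrm f ^ 3) * H1_nrm \<phi>"
      using d by (simp add: algebra_simps)
    also have "\<dots> \<le> ((1 + C1 + C2) * H1_nrm f + (1 + C1 + C2) * H1_nrm f ^ 3) * H1_nrm \<phi>"
    proof -
      have "(1 + C1) * H1_nrm f \<le> (1 + C1 + C2) * H1_nrm f" "C2 * H1_nrm f ^ 3 \<le> (1 + C1 + C2) * H1_nrm f ^ 3"
        using C1(1) C2(1) H1_nrm_nonneg[of f] by (auto intro!: mult_right_mono)
      from mult_right_mono[OF add_mono[OF this] H1_nrm_nonneg[of \<phi>]] show ?thesis .
    qed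
    finally show "norm (nls_rhs b V f \<phi>) \<le> (1 + C1 + C2) * (H1_nrm f + H1_nrm f ^ 3) * H1_nrm \<phi>"
      by (simp add: algebra_simps)
  qed
qed

lemma has_vector_derivative_zeroI:
  fixes e :: "real \<Rightarrow> complex"
  assumes "eventually (\<lambda>s. norm (e s) \<le> \<bar>s - t\<bar> * \<eta> s) (at t within S)" and "(\<eta> \<longlongrightarrow> 0) (at t within S)" and "e t = 0"
  shows "(e has_vector_derivative 0) (at t within S)"
  unfolding has_vector_derivative_def has_derivative_within
proof (intro conjI)
  show "((\<lambda>y. (1 / norm (y - t)) *\<^sub>R (e y - (e t + (y - t) *\<^sub>R 0))) \<longlongrightarrow> 0) (at t within S)"
  proof (rule Lim_null_comparison[OF _ assms(2)])
    have "eventually (\<lambda>s. s \<noteq> t) (at t within S)" by (simp add: eventually_at_filter)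
    with assms(1) show "eventually (\<lambda>y. norm ((1 / norm (y - t)) *\<^sub>R (e y - (e t + (y - t) *\<^sub>R 0))) \<le> \<eta> y) (at t within S)"
      by eventually_elim (simp add: assms(3) field_simps)
  qed
qed (simp add: bounded_linear_zero)

text \<open>The solution is differentiable in time only in the dual of H^1, so the product rule is
  not immediate. With w = u(s) - u(t), bilinearity leaves one second-order term, the pairing of w
  with \<open>L' w\<close>. Pairing with w costs a factor |s - t| by Lipschitz continuity in the
  dual norm, and \<open>H1_nrm (L' w)\<close> tends to 0 by continuity in H^1; so this term is o(|s
  - t|). Boundedness of \<open>L'\<close> on H^1 is what makes this work.\<close>

lemma pair_L2_operator_derivative:
  fixes u :: "real \<Rightarrow> real^3 \<Rightarrow> complex" and L L' :: "(real^3 \<Rightarrow> complex) \<Rightarrow> real^3 \<Rightarrow> complex"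
  assumes b: "0 < b" "b < 1" and \<delta>: "\<delta> > 3/2" and V: "in_Lp \<delta> V"
    and u: "\<And>t. t \<ge> 0 \<Longrightarrow> in_H1 (u t)"
    and cont: "\<And>t. t \<ge> 0 \<Longrightarrow> ((\<lambda>s. H1_nrm (\<lambda>x. u s x - u t x)) \<longlongrightarrow> 0) (at t within {0..})"
    and der: "\<And>t \<phi>. t \<ge> 0 \<Longrightarrow> in_H1 \<phi> \<Longrightarrow>
      ((\<lambda>s. pair_L2 (u s) \<phi>) has_vector_derivative nls_rhs b V (u t) \<phi>) (at t within {0..})"
    and L: "\<And>f. in_H1 f \<Longrightarrow> in_H1 (L f)" "\<And>f. in_H1 f \<Longrightarrow> in_H1 (L' f)"
    and LK: "\<And>f. in_H1 f \<Longrightarrow> H1_nrm (L' f) \<le> K * H1_nrm f"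
    and lin: "\<And>f g. L (\<lambda>x. f x - g x) = (\<lambda>x. L f x - L g x)" "\<And>f g. L' (\<lambda>x. f x - g x) = (\<lambda>x. L' f x - L' g x)"
    and adj: "\<And>f g. in_H1 f \<Longrightarrow> in_H1 g \<Longrightarrow> pair_L2 f (L g) = pair_L2 (L' f) g"
    and t: "t \<ge> 0"
  shows "((\<lambda>s. pair_L2 (u s) (L (u s))) has_vector_derivative
    (nls_rhs b V (u t) (L (u t)) + cnj (nls_rhs b V (u t) (L' (u t))))) (at t within {0..})"
proof -
  obtain C where C: "C \<ge> 0"
    "\<And>f \<phi>. in_H1 f \<Longrightarrow> in_H1 \<phi> \<Longrightarrow> norm (nls_rhs b V f \<phi>) \<le> C * (H1_nrm f + H1_nrm f ^ 3) * H1_nrm \<phi>"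
    by (rule nls_rhs_bound[OF b \<delta> V], rule that)
  have H1d: "in_H1 (\<lambda>x. f x - g x)" if "in_H1 f" "in_H1 g" for f g
    using H1_grad_diff[OF in_H1_grad[OF that(1)] in_H1_grad[OF that(2)]] by (rule H1_grad_in_H1)
  define w where "w s = (\<lambda>x. u s x - u t x)" for s
  have wH1: "in_H1 (w s)" if "s \<ge> 0" for s unfolding w_def by (intro H1d u that t)
  have "eventually (\<lambda>s. H1_nrm (w s) < 1) (at t within {0..})"
    unfolding w_def using order_tendstoD(2)[OF cont[OF t], of 1] by simp
  then obtain d where d: "d > 0" "\<And>s. s \<ge> 0 \<Longrightarrow> s \<noteq> t \<Longrightarrow> \<bar>s - t\<bar> < d \<Longrightarrow> H1_nrm (w s) < 1"
    by (auto simp: eventually_at dist_real_def)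
  define A where "A = H1_nrm (u t) + 1"
  have A: "H1_nrm (u s) \<le> A" if s: "s \<ge> 0" "\<bar>s - t\<bar> < d" for s
  proof (cases "s = t")
    case False
    have "H1_nrm (\<lambda>x. u t x + w s x) \<le> H1_nrm (u t) + H1_nrm (w s)"
      by (rule H1_nrm_triangle[OF in_H1_grad[OF u[OF t]] in_H1_grad[OF wH1[OF s(1)]]])
    with d(2)[OF s(1) False s(2)] show ?thesis by (simp add: w_def A_def)
  qed (simp add: A_def)
  define C' where "C' = C * (A + A ^ 3)"
  have A0: "A \<ge> 0" using H1_nrm_nonneg[of "u t"] by (simp add: A_def)
  have C'0: "C' \<ge> 0" using C A0 by (simp add: C'_def)
  \<comment> \<open>The mean value inequality on a neighbourhood of \<open>t\<close> in which
    \<open>A\<close> bounds the H^1 norm, so that \<open>nls_rhs_bound\<close> gives one constant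
    for all intermediate times.\<close>
  have lip: "norm (pair_L2 (w s) \<phi>) \<le> C' * H1_nrm \<phi> * \<bar>s - t\<bar>" if s: "s \<ge> 0" "\<bar>s - t\<bar> < d" and \<phi>: "in_H1 \<phi>" for s \<phi>
  proof -
    let ?S = "{0..} \<inter> {t - d<..<t + d}"
    have "norm (pair_L2 (u s) \<phi> - pair_L2 (u t) \<phi>) \<le> (C' * H1_nrm \<phi>) * norm (s - t)"
    proof (rule differentiable_bound[where S = ?S and f' = "\<lambda>r h. h *\<^sub>R nls_rhs b V (u r) \<phi>"])
      show "convex ?S" by (intro convex_Int) auto
      fix r assume r: "r \<in> ?S"
      show "((\<lambda>s. pair_L2 (u s) \<phi>) has_derivative (\<lambda>h. h *\<^sub>R nls_rhs b V (u r) \<phi>)) (at r within ?S)"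
        using der[of r \<phi>] r \<phi> has_derivative_subset unfolding has_vector_derivative_def by fastforce
      have rr: "r \<ge> 0" "\<bar>r - t\<bar> < d" using r by auto
      have "norm (nls_rhs b V (u r) \<phi>) \<le> C * (H1_nrm (u r) + H1_nrm (u r) ^ 3) * H1_nrm \<phi>"
        by (rule C(2)[OF u[OF rr(1)] \<phi>])
      also have "\<dots> \<le> C' * H1_nrm \<phi>" unfolding C'_def
        using A[OF rr] C(1) by (intro mult_right_mono mult_left_mono add_mono power_mono) (auto simp: H1_nrm_nonneg)
      finally have n: "norm (nls_rhs b V (u r) \<phi>) \<le> C' * H1_nrm \<phi>" .
      show "onorm (\<lambda>h. h *\<^sub>R nls_rhs b V (u r) \<phi>) \<le> C' * H1_nrm \<phi>"
      proof (rule onorm_le)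
        fix h :: real show "norm (h *\<^sub>R nls_rhs b V (u r) \<phi>) \<le> C' * H1_nrm \<phi> * norm h"
          using mult_left_mono[OF n, of "\<bar>h\<bar>"] by (simp add: mult.commute)
      qed
    qed (use s t d(1) in auto)
    then show ?thesis
      using pair_L2_diff_left[OF in_H1_L2[OF u[OF s(1)]] in_H1_L2[OF u[OF t]] in_H1_L2[OF \<phi>]] by (simp add: w_def)
  qed
  define e where "e s = pair_L2 (w s) (L' (w s))" for s
  have e0: "e t = 0" by (simp add: e_def w_def pair_L2_def)
  have de: "(e has_vector_derivative 0) (at t within {0..})"
  proof (rule has_vector_derivative_zeroI[where \<eta> = "\<lambda>s. C' * (K * H1_nrm (w s))"])
    show "eventually (\<lambda>s. norm (e s) \<le> \<bar>s - t\<bar> * (C' * (K * H1_nrm (w s)))) (at t within {0..})"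
      unfolding eventually_at
    proof (intro exI[of _ d] conjI ballI impI d(1))
      fix s assume s: "s \<in> {0..}" "s \<noteq> t \<and> dist s t < d"
      then have s': "s \<ge> 0" "\<bar>s - t\<bar> < d" by (auto simp: dist_real_def)
      have "norm (e s) \<le> C' * H1_nrm (L' (w s)) * \<bar>s - t\<bar>"
        unfolding e_def by (rule lip[OF s' L(2)[OF wH1[OF s'(1)]]])
      also have "\<dots> \<le> C' * (K * H1_nrm (w s)) * \<bar>s - t\<bar>"
        by (intro mult_right_mono mult_left_mono LK wH1 s'(1) C'0) auto
      finally show "norm (e s) \<le> \<bar>s - t\<bar> * (C' * (K * H1_nrm (w s)))" by (simp add: mult.commute)
    qed
    have "((\<lambda>s. C' * (K * H1_nrm (w s))) \<longlongrightarrow> C' * (K * 0)) (at t within {0..})"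
      unfolding w_def by (intro tendsto_intros cont t)
    then show "((\<lambda>s. C' * (K * H1_nrm (w s))) \<longlongrightarrow> 0) (at t within {0..})" by simp
  qed (rule e0)
  \<comment> \<open>Two terms linear in \<open>u s\<close>, whose derivatives the equation provides,
    and the negligible remainder \<open>e\<close>. The adjoint turns an increment in the second slot
    into a conjugated increment in the first.\<close>
  define G where "G s = pair_L2 (u s) (L (u t)) + cnj (pair_L2 (u s) (L' (u t)) - pair_L2 (u t) (L' (u t))) + cnj (e s)" for s
  have "(G has_vector_derivative (nls_rhs b V (u t) (L (u t)) + cnj (nls_rhs b V (u t) (L' (u t)) - 0) + cnj 0)) (at t within {0..})"
    unfolding G_def
    by (intro has_vector_derivative_add has_vector_derivative_cnj has_vector_derivative_diff der L u t de
        has_vector_derivative_const)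
  then have "(G has_vector_derivative (nls_rhs b V (u t) (L (u t)) + cnj (nls_rhs b V (u t) (L' (u t))))) (at t within {0..})"
    by simp
  note dG = this
  have eG: "pair_L2 (u s) (L (u s)) = G s" if s: "s \<ge> 0" for s
  proof -
    note h = u[OF s] u[OF t] wH1[OF s]
    have us: "u s = (\<lambda>x. u t x - (- 1) *\<^sub>R w s x)" by (simp add: w_def)
    have 1: "pair_L2 (u s) (L (u s)) = pair_L2 (u s) (L (u t)) + pair_L2 (u s) (L (w s))"
    proof -
      have "L (w s) = (\<lambda>x. L (u s) x - L (u t) x)" unfolding w_def by (rule lin)
      then have "pair_L2 (L (w s)) (u s) = pair_L2 (L (u s)) (u s) - pair_L2 (L (u t)) (u s)"
        by (simp add: pair_L2_diff_left in_H1_L2 L h)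
      then have "cnj (pair_L2 (L (w s)) (u s)) = cnj (pair_L2 (L (u s)) (u s)) - cnj (pair_L2 (L (u t)) (u s))" by simp
      then show ?thesis unfolding pair_L2_cnj by simp
    qed
    have 2: "pair_L2 (u s) (L (w s)) = cnj (pair_L2 (w s) (L' (u s)))"
      unfolding pair_L2_cnj by (rule adj) (use h in auto)
    have 3: "pair_L2 (w s) (L' (u s)) = pair_L2 (w s) (L' (u t)) + e s"
    proof -
      have "L' (w s) = (\<lambda>x. L' (u s) x - L' (u t) x)" unfolding w_def by (rule lin)
      then have "pair_L2 (L' (w s)) (w s) = pair_L2 (L' (u s)) (w s) - pair_L2 (L' (u t)) (w s)"
        by (simp add: pair_L2_diff_left in_H1_L2 L h)
      then have "cnj (pair_L2 (L' (w s)) (w s)) = cnj (pair_L2 (L' (u s)) (w s)) - cnj (pair_L2 (L' (u t)) (w s))" by simp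
      then show ?thesis unfolding pair_L2_cnj e_def by simp
    qed
    have 4: "pair_L2 (w s) (L' (u t)) = pair_L2 (u s) (L' (u t)) - pair_L2 (u t) (L' (u t))"
      unfolding w_def by (intro pair_L2_diff_left in_H1_L2 L h)
    show ?thesis unfolding 1 2 3 4 G_def by simp
  qed
  show ?thesis by (rule has_vector_derivative_transform[OF _ _ dG]) (use t eG in auto)
qed

text \<open>The identity is self-adjoint and preserves H^1, so the previous lemma applies. Both
  pairings of \<open>f\<close> with itself are real, hence \<open>nls_rhs b V f f\<close> is purely
  imaginary and cancels against its conjugate.\<close>

lemma mass_conservation:
  fixes u :: "real \<Rightarrow> real^3 \<Rightarrow> complex"
  assumes b: "0 < b" "b < 1" and \<delta>: "\<delta> > 3/2" and V: "in_Lp \<delta> V"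
    and u: "\<And>t. t \<ge> 0 \<Longrightarrow> in_H1 (u t)"
    and cont: "\<And>t. t \<ge> 0 \<Longrightarrow> ((\<lambda>s. H1_nrm (\<lambda>x. u s x - u t x)) \<longlongrightarrow> 0) (at t within {0..})"
    and der: "\<And>t \<phi>. t \<ge> 0 \<Longrightarrow> in_H1 \<phi> \<Longrightarrow>
      ((\<lambda>s. pair_L2 (u s) \<phi>) has_vector_derivative nls_rhs b V (u t) \<phi>) (at t within {0..})"
    and t: "t \<ge> 0"
  shows "L2_nrm (u t) = L2_nrm (u 0)"
proof -
  have real: "nls_rhs b V f f + cnj (nls_rhs b V f f) = 0" for f
  proof -
    have "pair_H V f f = complex_of_real ((LINT x|lebesgue. (\<Sum>i\<in>UNIV. (cmod (grad f x $ i))\<^sup>2))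
        + (LINT x|lebesgue. V x * (cmod (f x))\<^sup>2))"
      unfolding pair_H_def of_real_add
      by (intro arg_cong2[of _ _ _ _ "(+)"])
         (simp_all add: mult_cnj_eq_cmod_power2 mult.assoc flip: integral_complex_of_real)
    moreover have "pair_N b f f = complex_of_real (LINT x|lebesgue. norm x powr (-b) * (cmod (f x))\<^sup>2 * (cmod (f x))\<^sup>2)"
      unfolding pair_N_def
      by (simp add: mult_cnj_eq_cmod_power2 mult.assoc flip: integral_complex_of_real)
    ultimately show ?thesis by (simp add: nls_rhs_def)
  qed
  have "((\<lambda>s. pair_L2 (u s) (u s)) has_vector_derivative 0) (at t within {0..})" if "t \<ge> 0" for t
  proof -
    have "((\<lambda>s. pair_L2 (u s) (u s)) has_vector_derivative nls_rhs b V (u t) (u t) + cnj (nls_rhs b V (u t) (u t)))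
        (at t within {0..})"
      by (rule pair_L2_operator_derivative[where u = u and \<delta> = \<delta> and L = "\<lambda>f. f" and L' = "\<lambda>f. f" and K = 1])
         (assumption | rule b \<delta> V u cont der that refl eq_refl mult_1[symmetric])+
    then show ?thesis unfolding real .
  qed
  note d0 = this
  obtain c where c: "\<And>s. s \<in> {0..} \<Longrightarrow> pair_L2 (u s) (u s) = c"
  proof (rule has_vector_derivative_zero_constant[of "{0..}" "\<lambda>s. pair_L2 (u s) (u s)"])
    show "((\<lambda>s. pair_L2 (u s) (u s)) has_vector_derivative 0) (at x within {0..})" if "x \<in> {0..}" for x
      using d0[of x] that by simp
  qed (use that in auto)
  have "pair_L2 (u t) (u t) = pair_L2 (u 0) (u 0)" using t c[of t] c[of 0] by simp
  moreover have "pair_L2 f f = complex_of_real ((L2_nrm f)\<^sup>2)" for f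
    unfolding L2_nrm_power2 pair_L2_def by (simp add: mult_cnj_eq_cmod_power2 flip: integral_complex_of_real)
  ultimately have "(L2_nrm (u t))\<^sup>2 = (L2_nrm (u 0))\<^sup>2" by (metis of_real_eq_iff)
  then show ?thesis by (simp add: L2_nrm_nonneg)
qed

section \<open>The localized generator of dilations\<close>

text \<open>The factor \<open>exp (3 * s / 2)\<close> makes the dilations unitary on L^2 in
  dimension three.\<close>

definition dil :: "real \<Rightarrow> (real^3 \<Rightarrow> 'a::real_vector) \<Rightarrow> real^3 \<Rightarrow> 'a" where
  "dil s f x = exp (3 * s / 2) *\<^sub>R f (exp s *\<^sub>R x)"

text \<open>The 2 in the denominator makes the gradient -x/R^2 times the function, and the square
  equal to \<open>exp (- (norm x)\<^sup>2 / R\<^sup>2)\<close>; the quantity |x|^2/R^2 recurs in all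
  error terms.\<close>

definition gauss :: "real \<Rightarrow> real^3 \<Rightarrow> real" where
  "gauss R x = exp (- (norm x)\<^sup>2 / (2 * R\<^sup>2))"

text \<open>The symmetric difference quotient \<open>dil_diff h\<close> approximates the generator
  \<open>x \<cdot> \<nabla> + 3/2\<close> of the unitary dilations. It maps \<open>H\<^sup>1\<close> to itself, so that
  it may be paired with the equation.\<close>

definition dil_diff :: "real \<Rightarrow> (real^3 \<Rightarrow> complex) \<Rightarrow> real^3 \<Rightarrow> complex" where
  "dil_diff h f x = (1 / (2 * h)) *\<^sub>R (dil h f x - dil (- h) f x)"

definition loc_gen :: "real \<Rightarrow> real \<Rightarrow> (real^3 \<Rightarrow> complex) \<Rightarrow> real^3 \<Rightarrow> complex" where
  "loc_gen R h f x = gauss R x *\<^sub>R dil_diff h (\<lambda>y. gauss R y *\<^sub>R f y) x"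

lemma in_L2_dil:
  assumes "in_Lp 2 f" shows "in_Lp 2 (dil s f)" and "L2_nrm (dil s f) = L2_nrm f"
proof -
  have a: "in_Lp 2 (\<lambda>x. f (exp s *\<^sub>R x))" and n: "L2_nrm (\<lambda>x. f (exp s *\<^sub>R x)) = L2_nrm f / sqrt (exp s ^ 3)"
    using L2_affine[OF assms, of "exp s" 0] by auto
  show "in_Lp 2 (dil s f)" unfolding dil_def[abs_def] by (rule in_L2_scaleR[OF a])
  have "exp s ^ 3 = (exp (3 * s / 2))\<^sup>2" by (simp add: exp_of_nat_mult[symmetric])
  then have "sqrt (exp s ^ 3) = exp (3 * s / 2)" by simp
  then show "L2_nrm (dil s f) = L2_nrm f"
    unfolding dil_def[abs_def] L2_nrm_scaleR n by simp
qed

lemma H1_grad_dil: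
  assumes "H1_grad f g" shows "H1_grad (dil s f) (\<lambda>x. exp s *\<^sub>R dil s g x)"
  using H1_grad_scaleR[OF H1_grad_dilate[OF assms, of "exp s"], of "exp (3 * s / 2)"]
  unfolding dil_def[abs_def] by (simp add: mult.commute)

lemma dil_diff_linear: "dil_diff h (\<lambda>x. f x - g x) x = dil_diff h f x - dil_diff h g x"
  by (simp add: dil_diff_def dil_def algebra_simps)

lemma loc_gen_linear: "loc_gen R h (\<lambda>x. f x - g x) = (\<lambda>x. loc_gen R h f x - loc_gen R h g x)"
  unfolding loc_gen_def scaleR_diff_right dil_diff_linear ..

lemma H1_grad_dil_diff:
  assumes "H1_grad f g"
  shows "H1_grad (dil_diff h f) (\<lambda>x. (1 / (2 * h)) *\<^sub>R (exp h *\<^sub>R dil h g x - exp (- h) *\<^sub>R dil (- h) g x))"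
  unfolding dil_diff_def[abs_def]
  by (intro H1_grad_scaleR H1_grad_diff H1_grad_dil assms)

lemma in_L2_dil_diff: "in_Lp 2 f \<Longrightarrow> in_Lp 2 (dil_diff h f)"
  unfolding dil_diff_def[abs_def] by (intro in_L2_scaleR in_L2_diff in_L2_dil(1))

section \<open>The Gaussian weight\<close>

lemma smooth_gauss: "smooth (gauss R)"
  and partial_deriv_gauss: "partial_deriv i (gauss R) x = - (x $ i / R\<^sup>2) * gauss R x"
proof -
  have e: "gauss R = (\<lambda>x. exp (- 1 / (2 * R\<^sup>2) * (\<Sum>i\<in>UNIV. x $ i * x $ i)))"
    by (simp add: gauss_def fun_eq_iff power2_norm_eq_inner inner_vec_def)
  have s: "smooth (\<lambda>x. - 1 / (2 * R\<^sup>2) * (\<Sum>i\<in>UNIV. x $ i * x $ i))"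
    by (intro smooth_mult smooth_const smooth_sum smooth_nth)
  show "smooth (gauss R)" unfolding e by (rule smooth_exp(1)[OF s])
  have "((\<lambda>x::real^3. - 1 / (2 * R\<^sup>2) * (\<Sum>i\<in>UNIV. x $ i * x $ i)) has_derivative
      (\<lambda>h. - 1 / (2 * R\<^sup>2) * (\<Sum>i\<in>UNIV. x $ i * h $ i + h $ i * x $ i))) (at x)"
    by (intro has_derivative_mult_right has_derivative_sum has_derivative_mult
        bounded_linear_imp_has_derivative bounded_linear_vec_nth)
  then have "partial_deriv i (\<lambda>x. - 1 / (2 * R\<^sup>2) * (\<Sum>i\<in>UNIV. x $ i * x $ i)) x
      = - 1 / (2 * R\<^sup>2) * (\<Sum>j\<in>UNIV. x $ j * axis i 1 $ j + axis i 1 $ j * x $ j)"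
    by (rule has_derivative_partial_deriv)
  also have "(\<Sum>j\<in>UNIV. x $ j * axis i 1 $ j + axis i 1 $ j * x $ j) = 2 * x $ i"
  proof -
    have "(\<Sum>j\<in>UNIV. x $ j * axis i 1 $ j + axis i 1 $ j * x $ j) = (\<Sum>j\<in>UNIV. if j = i then 2 * x $ i else 0)"
      by (rule sum.cong) (simp_all add: axis_def)
    also have "\<dots> = 2 * x $ i" by (subst sum.delta) simp_all
    finally show ?thesis .
  qed
  finally show "partial_deriv i (gauss R) x = - (x $ i / R\<^sup>2) * gauss R x"
    unfolding e smooth_exp(2)[OF s] by simp
qed

lemma gauss_pos: "gauss R x > 0" and gauss_le_1: "gauss R x \<le> 1"
  by (simp_all add: gauss_def)

lemma gauss_neq_0 [simp]: "gauss R x \<noteq> 0"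
  using gauss_pos[of R x] by simp

lemma gauss_measurable [measurable]: "gauss R \<in> borel_measurable lebesgue"
  by (rule smooth_measurable_lebesgue[OF smooth_gauss])

text \<open>With \<rho> = |x|^2/(2 R^2) everything follows from 1 + \<rho> \<le> exp \<rho>; for the
  first bound it is squared and combined with 2 \<rho> \<le> (1 + \<rho>)^2.\<close>

lemma norm_gauss_le:
  assumes R: "R > 0" shows "norm x * gauss R x \<le> R" "(norm x)\<^sup>2 * gauss R x \<le> 2 * R\<^sup>2"
    "((norm x)\<^sup>2 / R\<^sup>2) * gauss R x \<le> 2"
proof -
  define \<rho> where "\<rho> = (norm x)\<^sup>2 / (2 * R\<^sup>2)"
  have \<rho>: "\<rho> \<ge> 0" and g: "gauss R x = exp (- \<rho>)" by (auto simp: \<rho>_def gauss_def)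
  have e: "1 + \<rho> \<le> exp \<rho>" by (rule exp_ge_add_one_self)
  have n2: "(norm x)\<^sup>2 = 2 * R\<^sup>2 * \<rho>" using R by (simp add: \<rho>_def)
  have "\<rho> \<le> exp \<rho>" using e by linarith
  then have "\<rho> * exp (- \<rho>) \<le> exp \<rho> * exp (- \<rho>)" by (rule mult_right_mono) simp
  also have "exp \<rho> * exp (- \<rho>) = 1" by (simp only: exp_minus_inverse)
  finally have "\<rho> * exp (- \<rho>) \<le> 1" .
  from mult_left_mono[OF this, of "2 * R\<^sup>2"] show 2: "(norm x)\<^sup>2 * gauss R x \<le> 2 * R\<^sup>2"
    by (simp add: n2 g mult.assoc)
  then show "((norm x)\<^sup>2 / R\<^sup>2) * gauss R x \<le> 2" using R by (simp add: field_simps)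
  have "2 * \<rho> \<le> (1 + \<rho>)\<^sup>2" using \<rho> by (simp add: power2_eq_square algebra_simps)
  also have "\<dots> \<le> (exp \<rho>)\<^sup>2" using e \<rho> by (intro power_mono) auto
  finally have "2 * R\<^sup>2 * \<rho> * (exp (- \<rho>))\<^sup>2 \<le> R\<^sup>2"
    using R by (simp add: exp_minus field_simps)
  then have "(norm x * gauss R x)\<^sup>2 \<le> R\<^sup>2" by (simp add: power_mult_distrib n2 g)
  then show "norm x * gauss R x \<le> R" by (rule power2_le_imp_le) (use R in auto)
qed

lemma H1_grad_gauss:
  assumes fg: "H1_grad f g" and R: "R > 0"
  shows "H1_grad (\<lambda>x. gauss R x *\<^sub>R f x) (\<lambda>x. gauss R x *\<^sub>R g x + (\<chi> i. (- (x $ i / R\<^sup>2) * gauss R x) *\<^sub>R f x))"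
proof -
  have 1: "\<bar>gauss R x\<bar> \<le> max 1 (1 / R)" for x using gauss_pos[of R x] gauss_le_1[of R x] by auto
  have 2: "\<bar>partial_deriv i (gauss R) x\<bar> \<le> max 1 (1 / R)" for i x
  proof -
    have "\<bar>x $ i\<bar> * gauss R x \<le> norm x * gauss R x"
      using gauss_pos[of R x] component_le_norm_cart[of x i] by (intro mult_right_mono) auto
    also have "\<dots> \<le> R" by (rule norm_gauss_le(1)[OF R])
    finally have "\<bar>x $ i\<bar> * gauss R x / R\<^sup>2 \<le> R / R\<^sup>2" using R by (intro divide_right_mono) auto
    also have "R / R\<^sup>2 = 1 / R" using R by (simp add: power2_eq_square)
    finally show ?thesis using gauss_pos[of R x] unfolding partial_deriv_gauss by (simp add: abs_mult)
  qed
  from H1_grad_smooth_mult[OF fg smooth_gauss 1 2] show ?thesis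
    unfolding partial_deriv_gauss .
qed

lemma in_L2_gauss: "in_Lp 2 f \<Longrightarrow> in_Lp 2 (\<lambda>x. gauss R x *\<^sub>R f x)" "in_Lp 2 f \<Longrightarrow> L2_nrm (\<lambda>x. gauss R x *\<^sub>R f x) \<le> L2_nrm f"
  for f :: "real^3 \<Rightarrow> 'a::{real_normed_vector, second_countable_topology}"
proof -
  assume f: "in_Lp 2 f"
  have [measurable]: "f \<in> borel_measurable lebesgue" using f by (rule in_L2_measurable)
  have le: "norm (gauss R x *\<^sub>R f x) \<le> 1 * norm (f x)" for x
    using mult_right_mono[OF gauss_le_1[of R x] norm_ge_zero[of "f x"]] gauss_pos[of R x] by simp
  show "in_Lp 2 (\<lambda>x. gauss R x *\<^sub>R f x)" "L2_nrm (\<lambda>x. gauss R x *\<^sub>R f x) \<le> L2_nrm f"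
    using in_L2_bound[OF f, of "\<lambda>x. gauss R x *\<^sub>R f x" 1] le by auto
qed

text \<open>The adjoint of a dilation is its inverse. The statement is for measurable functions
  because it is also applied to \<open>V\<close> times an H^1 function, which need not be square
  integrable.\<close>

lemma integral_dil_swap:
  fixes f g :: "real^3 \<Rightarrow> complex"
  assumes [measurable]: "f \<in> borel_measurable lebesgue" "g \<in> borel_measurable lebesgue"
  shows "(LINT x|lebesgue. f x * cnj (dil s g x)) = (LINT x|lebesgue. dil (- s) f x * cnj (g x))"
proof -
  have 2: "(\<lambda>x. f (exp (- s) *\<^sub>R x)) \<in> borel_measurable lebesgue"
    using measurable_lebesgue_affine_compose[OF assms(1), of "exp (- s)" 0] by simp
  have m: "(\<lambda>x. dil (- s) f x * cnj (g x)) \<in> borel_measurable lebesgue"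
    unfolding dil_def using 2 by measurable
  have "(LINT x|lebesgue. dil (- s) f (exp s *\<^sub>R x) * cnj (g (exp s *\<^sub>R x)))
      = (1 / exp s ^ 3) *\<^sub>R (LINT x|lebesgue. dil (- s) f x * cnj (g x))"
    using integral_lebesgue_affine[OF _ m, of "exp s" 0] by simp
  then have "(LINT x|lebesgue. dil (- s) f x * cnj (g x))
      = (LINT x|lebesgue. exp s ^ 3 *\<^sub>R (dil (- s) f (exp s *\<^sub>R x) * cnj (g (exp s *\<^sub>R x))))"
    by simp
  also have "(\<lambda>x. exp s ^ 3 *\<^sub>R (dil (- s) f (exp s *\<^sub>R x) * cnj (g (exp s *\<^sub>R x)))) = (\<lambda>x. f x * cnj (dil s g x))"
  proof
    fix x :: "real^3"
    have "exp s ^ 3 * exp (3 * (- s) / 2) = exp (3 * s / 2)"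
      by (simp add: exp_of_nat_mult[symmetric] exp_add[symmetric])
    then show "exp s ^ 3 *\<^sub>R (dil (- s) f (exp s *\<^sub>R x) * cnj (g (exp s *\<^sub>R x))) = f x * cnj (dil s g x)"
      by (simp add: dil_def exp_minus_inverse mult.commute exp_add[symmetric])
  qed
  finally show ?thesis by simp
qed

lemma pair_L2_dil: "in_Lp 2 f \<Longrightarrow> in_Lp 2 g \<Longrightarrow> pair_L2 f (dil s g) = pair_L2 (dil (- s) f) g"
  unfolding pair_L2_def by (intro integral_dil_swap in_L2_measurable)

text \<open>Passing to the adjoint exchanges \<open>dil h\<close> and \<open>dil (- h)\<close>; the
  symmetric quotient changes sign under this exchange, which a one-sided quotient would not.\<close>

lemma pair_L2_dil_diff:
  assumes "in_Lp 2 f" "in_Lp 2 g"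
  shows "pair_L2 f (dil_diff h g) = - pair_L2 (dil_diff h f) g"
proof -
  note i = integrable_mult_cnj(1)[OF assms(1) in_L2_dil(1)[OF assms(2)]]
    integrable_mult_cnj(1)[OF in_L2_dil(1)[OF assms(1)] assms(2)]
  have "pair_L2 f (dil_diff h g) = (LINT x|lebesgue. (1 / (2 * h)) *\<^sub>R (f x * cnj (dil h g x) - f x * cnj (dil (- h) g x)))"
    by (simp add: pair_L2_def dil_diff_def right_diff_distrib)
  also have "\<dots> = (1 / (2 * h)) *\<^sub>R (pair_L2 f (dil h g) - pair_L2 f (dil (- h) g))"
    using i by (simp add: pair_L2_def)
  also have "\<dots> = (1 / (2 * h)) *\<^sub>R (pair_L2 (dil (- h) f) g - pair_L2 (dil h f) g)"
    using pair_L2_dil[OF assms, of h] pair_L2_dil[OF assms, of "- h"] by simp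
  also have "\<dots> = - (LINT x|lebesgue. (1 / (2 * h)) *\<^sub>R (dil h f x * cnj (g x) - dil (- h) f x * cnj (g x)))"
    using i by (simp add: pair_L2_def algebra_simps)
  also have "\<dots> = - pair_L2 (dil_diff h f) g"
    by (simp add: pair_L2_def dil_diff_def left_diff_distrib)
  finally show ?thesis .
qed

lemma pair_L2_gauss: "pair_L2 f (\<lambda>x. gauss R x *\<^sub>R g x) = pair_L2 (\<lambda>x. gauss R x *\<^sub>R f x) g"
  by (simp add: pair_L2_def)

lemma pair_L2_loc_gen:
  assumes "in_Lp 2 f" "in_Lp 2 g"
  shows "pair_L2 f (loc_gen R h g) = - pair_L2 (loc_gen R h f) g"
  unfolding loc_gen_def[abs_def] pair_L2_gauss
  by (subst pair_L2_dil_diff) (auto intro: in_L2_gauss assms simp flip: pair_L2_gauss simp: pair_L2_def)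

lemma loc_gen_H1:
  assumes f: "in_H1 f" and R: "R > 0"
  shows "in_H1 (loc_gen R h f)"
  unfolding loc_gen_def[abs_def]
  by (rule H1_grad_in_H1[OF H1_grad_gauss[OF H1_grad_dil_diff[OF H1_grad_gauss[OF in_H1_grad[OF f] R]] R]])

text \<open>The gradient of the weight has modulus |x| \<chi> / R^2, at most 1/R by
  \<open>norm_gauss_le\<close>. This is one origin of the errors of order 1/R.\<close>

lemma L2_nrm_gauss_gradient_le:
  assumes fg: "H1_grad f g" and R: "R > 0"
  shows "L2_nrm (\<lambda>x. gauss R x *\<^sub>R g x + (\<chi> i. (- (x $ i / R\<^sup>2) * gauss R x) *\<^sub>R f x)) \<le> L2_nrm g + L2_nrm f / R"
proof -
  have f: "in_Lp 2 f" and g: "in_Lp 2 g" using fg by (auto simp: H1_grad_def)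
  note [measurable] = in_L2_measurable[OF f]
  let ?v = "\<lambda>x. \<chi> i. (- (x $ i / R\<^sup>2) * gauss R x) *\<^sub>R f x"
  have mn: "(\<lambda>x::real^3. x $ i) \<in> borel_measurable lebesgue" for i by (rule measurable_lebesgue_borel) measurable
  have m: "?v \<in> borel_measurable lebesgue" using mn by (intro measurable_vecI) simp
  have le: "norm (?v x) \<le> 1 / R * norm (f x)" for x
  proof -
    have "norm (?v x) = norm ((gauss R x / R\<^sup>2 * norm (f x)) *\<^sub>R x)"
      unfolding norm_vec_def by (intro L2_set_cong) (auto simp: abs_mult mult_ac)
    also have "\<dots> = norm x * gauss R x / R\<^sup>2 * norm (f x)" using gauss_pos[of R x] by simp
    also have "\<dots> \<le> R / R\<^sup>2 * norm (f x)"
      using norm_gauss_le(1)[OF R, of x] R by (intro mult_right_mono divide_right_mono) auto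
    finally show ?thesis using R by (simp add: power2_eq_square)
  qed
  have v: "in_Lp 2 ?v" "L2_nrm ?v \<le> 1 / R * L2_nrm f"
    using in_L2_bound[OF f m, of "1 / R"] le R by auto
  then show ?thesis
    using in_L2_gauss(2)[OF g, of R] L2_nrm_triangle[OF in_L2_gauss(1)[OF g] v(1), of R] by simp
qed

lemma H1_nrm_gauss_le:
  assumes fg: "H1_grad f g" and R: "R > 0"
  shows "H1_nrm (\<lambda>x. gauss R x *\<^sub>R f x) \<le> (2 + 1 / R) * H1_nrm f"
proof -
  have "L2_nrm f / R \<le> H1_nrm f / R" using L2_nrm_le_H1_nrm[of f] R by (intro divide_right_mono) auto
  then have "H1_nrm (\<lambda>x. gauss R x *\<^sub>R f x) \<le> H1_nrm f + (H1_nrm f + H1_nrm f / R)"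
    using H1_nrm_le[OF H1_grad_gauss[OF fg R]] in_L2_gauss(2)[OF H1_gradD(1)[OF fg], of R]
      L2_nrm_gauss_gradient_le[OF fg R] L2_nrm_le_H1_nrm[of f] L2_nrm_grad[OF fg] by linarith
  then show ?thesis by (simp add: algebra_simps)
qed

text \<open>The constant blows up as \<open>h\<close> tends to 0. It is used at fixed
  \<open>h\<close> only, to make the quadratic pairing differentiable in time; bounds uniform in
  \<open>h\<close> are obtained for pairings instead of norms.\<close>

lemma H1_nrm_dil_diff_le:
  assumes fg: "H1_grad f g" and h: "h > 0"
  shows "H1_nrm (dil_diff h f) \<le> (1 + exp h) / h * H1_nrm f"
proof -
  have f: "in_Lp 2 f" and g: "in_Lp 2 g" using fg by (auto simp: H1_grad_def)
  have d: "L2_nrm (\<lambda>x. (1 / (2 * h)) *\<^sub>R (a *\<^sub>R dil h p x - b *\<^sub>R dil (- h) p x)) \<le> 1 / (2 * h) * ((a + b) * L2_nrm p)"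
    if p: "in_Lp 2 p" and ab: "a \<ge> 0" "b \<ge> 0" for a b and p :: "real^3 \<Rightarrow> 'b::{real_normed_vector, second_countable_topology}"
  proof -
    have "L2_nrm (\<lambda>x. a *\<^sub>R dil h p x + (- b) *\<^sub>R dil (- h) p x) \<le> a * L2_nrm p + b * L2_nrm p"
      using L2_nrm_triangle[OF in_L2_scaleR[OF in_L2_dil(1)[OF p, of h], of a] in_L2_scaleR[OF in_L2_dil(1)[OF p, of "- h"], of "- b"]]
        ab by (simp only: L2_nrm_scaleR in_L2_dil(2)[OF p]) simp
    then have "1 / (2 * h) * L2_nrm (\<lambda>x. a *\<^sub>R dil h p x + (- b) *\<^sub>R dil (- h) p x) \<le> 1 / (2 * h) * ((a + b) * L2_nrm p)"
      using h by (intro mult_left_mono) (auto simp: algebra_simps)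
    then show ?thesis using h by (simp add: L2_nrm_scaleR)
  qed
  have "H1_nrm (dil_diff h f) \<le> L2_nrm (dil_diff h f)
      + L2_nrm (\<lambda>x. (1 / (2 * h)) *\<^sub>R (exp h *\<^sub>R dil h g x - exp (- h) *\<^sub>R dil (- h) g x))"
    by (rule H1_nrm_le[OF H1_grad_dil_diff[OF fg]])
  also have "\<dots> \<le> 1 / (2 * h) * ((1 + 1) * L2_nrm f) + 1 / (2 * h) * ((exp h + exp (- h)) * L2_nrm g)"
    using d[OF f, of 1 1] d[OF g, of "exp h" "exp (- h)"] unfolding dil_diff_def[abs_def] by simp
  also have "\<dots> \<le> 1 / (2 * h) * (2 * H1_nrm f) + 1 / (2 * h) * ((exp h + exp h) * H1_nrm f)"
    using L2_nrm_le_H1_nrm[of f] L2_nrm_grad[OF fg] h L2_nrm_nonneg[of g] L2_nrm_nonneg[of f]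
    by (intro add_mono mult_left_mono mult_mono) auto
  also have "\<dots> = (1 + exp h) / h * H1_nrm f" using h by (simp add: field_simps)
  finally show ?thesis .
qed

lemma H1_nrm_loc_gen_le:
  assumes f: "in_H1 f" and R: "R > 0" and h: "h > 0"
  shows "H1_nrm (loc_gen R h f) \<le> (2 + 1 / R) * ((1 + exp h) / h * (2 + 1 / R)) * H1_nrm f"
proof -
  note g1 = H1_grad_gauss[OF in_H1_grad[OF f] R]
  have "H1_nrm (loc_gen R h f) \<le> (2 + 1 / R) * H1_nrm (dil_diff h (\<lambda>y. gauss R y *\<^sub>R f y))"
    unfolding loc_gen_def[abs_def] by (rule H1_nrm_gauss_le[OF H1_grad_dil_diff[OF g1] R])
  also have "\<dots> \<le> (2 + 1 / R) * ((1 + exp h) / h * H1_nrm (\<lambda>y. gauss R y *\<^sub>R f y))"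
    using R by (intro mult_left_mono H1_nrm_dil_diff_le[OF g1 h]) auto
  also have "\<dots> \<le> (2 + 1 / R) * ((1 + exp h) / h * ((2 + 1 / R) * H1_nrm f))"
    using R h by (intro mult_left_mono H1_nrm_gauss_le[OF in_H1_grad[OF f] R]) (auto intro!: divide_nonneg_pos add_nonneg_nonneg)
  finally show ?thesis by (simp add: mult.assoc)
qed

text \<open>The operator is skew-symmetric, hence the derivative of the pairing is purely imaginary.\<close>

lemma loc_gen_derivative:
  fixes u :: "real \<Rightarrow> real^3 \<Rightarrow> complex"
  assumes b: "0 < b" "b < 1" and \<delta>: "\<delta> > 3/2" and V: "in_Lp \<delta> V"
    and u: "\<And>t. t \<ge> 0 \<Longrightarrow> in_H1 (u t)"
    and cont: "\<And>t. t \<ge> 0 \<Longrightarrow> ((\<lambda>s. H1_nrm (\<lambda>x. u s x - u t x)) \<longlongrightarrow> 0) (at t within {0..})"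
    and der: "\<And>t \<phi>. t \<ge> 0 \<Longrightarrow> in_H1 \<phi> \<Longrightarrow>
      ((\<lambda>s. pair_L2 (u s) \<phi>) has_vector_derivative nls_rhs b V (u t) \<phi>) (at t within {0..})"
    and R: "R > 0" and h: "h > 0" and t: "t \<ge> 0"
  shows "((\<lambda>s. Im (pair_L2 (u s) (loc_gen R h (u s)))) has_real_derivative
    - 2 * Re (pair_H V (u t) (loc_gen R h (u t)) - pair_N b (u t) (loc_gen R h (u t)))) (at t within {0..})"
proof -
  let ?L = "loc_gen R h" and ?L' = "\<lambda>f x. - loc_gen R h f x"
  have neg: "H1_grad (\<lambda>x. - f x) (\<lambda>x. - g x)" if "H1_grad f g" for f g
    using H1_grad_scaleR[OF that, of "-1"] by simp
  have nneg: "H1_nrm (\<lambda>x. - f x) = H1_nrm f" if f: "in_H1 f" for f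
    using L2_nrm_grad[OF neg[OF in_H1_grad[OF f]]] by (simp add: H1_nrm_def L2_nrm_def)
  note LH = loc_gen_H1[OF _ R, of _ h]
  have "((\<lambda>s. pair_L2 (u s) (?L (u s))) has_vector_derivative
    (nls_rhs b V (u t) (?L (u t)) + cnj (nls_rhs b V (u t) (?L' (u t))))) (at t within {0..})"
  proof (rule pair_L2_operator_derivative[where u = u and \<delta> = \<delta> and L = ?L and L' = ?L' and K = "(2 + 1 / R) * ((1 + exp h) / h * (2 + 1 / R))"])
    fix f g assume f: "in_H1 f" and g: "in_H1 g"
    show "pair_L2 f (?L g) = pair_L2 (?L' f) g"
      using pair_L2_loc_gen[OF in_H1_L2[OF f] in_H1_L2[OF g], of R h] by (simp add: pair_L2_def)
  next
    fix f assume f: "in_H1 f"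
    show "in_H1 (?L f)" by (rule LH[OF f])
    show "in_H1 (?L' f)" by (rule H1_grad_in_H1[OF neg[OF in_H1_grad[OF LH[OF f]]]])
    show "H1_nrm (?L' f) \<le> (2 + 1 / R) * ((1 + exp h) / h * (2 + 1 / R)) * H1_nrm f"
      unfolding nneg[OF LH[OF f]] by (rule H1_nrm_loc_gen_le[OF f R h])
  next
    fix f g :: "real^3 \<Rightarrow> complex"
    show "?L (\<lambda>x. f x - g x) = (\<lambda>x. ?L f x - ?L g x)" by (rule loc_gen_linear)
    show "?L' (\<lambda>x. f x - g x) = (\<lambda>x. ?L' f x - ?L' g x)" unfolding loc_gen_linear by simp
  qed (assumption | rule b \<delta> V u cont der t)+
  moreover have "nls_rhs b V (u t) (?L' (u t)) = - nls_rhs b V (u t) (?L (u t))"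
  proof -
    define \<phi> where "\<phi> = ?L (u t)"
    have \<phi>: "in_H1 \<phi>" unfolding \<phi>_def by (rule LH[OF u[OF t]])
    have ge: "AE x in lebesgue. grad (\<lambda>x. - \<phi> x) x = - grad \<phi> x" by (rule grad_AE[OF neg[OF in_H1_grad[OF \<phi>]]])
    have m: "grad (u t) \<in> borel_measurable lebesgue" "grad \<phi> \<in> borel_measurable lebesgue"
      "grad (\<lambda>x. - \<phi> x) \<in> borel_measurable lebesgue"
      by (intro in_L2_measurable in_H1_L2_grad u t \<phi> H1_grad_in_H1[OF neg[OF in_H1_grad[OF \<phi>]]])+
    have "(LINT x|lebesgue. (\<Sum>i\<in>UNIV. grad (u t) x $ i * cnj (grad (\<lambda>x. - \<phi> x) x $ i)))
        = (LINT x|lebesgue. - (\<Sum>i\<in>UNIV. grad (u t) x $ i * cnj (grad \<phi> x $ i)))"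
      by (intro integral_cong_AE borel_measurable_uminus measurable_sum_cnj m)
         (use ge in eventually_elim, simp add: sum_negf)
    then show ?thesis unfolding \<phi>_def[symmetric]
      by (simp add: nls_rhs_def pair_H_def pair_N_def algebra_simps)
  qed
  \<comment> \<open>With z = \<open>nls_rhs b V (u t) (?L (u t))\<close> the derivative is z minus
    its conjugate, of imaginary part 2 Im z; and z is -i times the difference of the two pairings,
    so Im z is minus its real part. This gives the factor -2.\<close>
  ultimately have "((\<lambda>s. pair_L2 (u s) (?L (u s))) has_vector_derivative
    (nls_rhs b V (u t) (?L (u t)) - cnj (nls_rhs b V (u t) (?L (u t))))) (at t within {0..})" by simp
  then have "((\<lambda>s. Im (pair_L2 (u s) (?L (u s)))) has_vector_derivative
    Im (nls_rhs b V (u t) (?L (u t)) - cnj (nls_rhs b V (u t) (?L (u t))))) (at t within {0..})"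
    by (rule bounded_linear.has_vector_derivative[OF bounded_linear_Im])
  then show ?thesis
    unfolding has_real_derivative_iff_has_vector_derivative by (simp add: nls_rhs_def)
qed

section \<open>Weak convergence of the difference quotients\<close>

lemma flow_deriv_cong_AE:
  assumes fw: "flow_deriv \<kappa> v f w" and e: "AE x in lebesgue. f x = f' x" "AE x in lebesgue. w x = w' x"
    and [measurable]: "f \<in> borel_measurable lebesgue" "f' \<in> borel_measurable lebesgue"
      "w \<in> borel_measurable lebesgue" "w' \<in> borel_measurable lebesgue"
  shows "flow_deriv \<kappa> v f' w'"
  unfolding flow_deriv_def
proof (intro allI impI)
  fix \<phi> assume \<phi>: "test_function \<phi>"
  let ?d = "\<lambda>x. \<Sum>i\<in>UNIV. partial_deriv i (\<lambda>y. (\<kappa> * y $ i + v $ i) * \<phi> y) x"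
  have md: "?d \<in> borel_measurable lebesgue"
    by (intro borel_measurable_sum smooth_measurable_lebesgue smooth_partial_deriv test_function_smooth
        test_function_affine_nth_mult[OF \<phi>])
  have m\<phi>: "\<phi> \<in> borel_measurable lebesgue" by (intro smooth_measurable_lebesgue test_function_smooth \<phi>)
  have "(LINT x|lebesgue. \<phi> x *\<^sub>R w' x) = (LINT x|lebesgue. \<phi> x *\<^sub>R w x)"
  proof (rule integral_cong_AE)
    show "AE x in lebesgue. \<phi> x *\<^sub>R w' x = \<phi> x *\<^sub>R w x" using e(2) by eventually_elim simp
  qed (use m\<phi> in measurable)
  moreover have "(LINT x|lebesgue. ?d x *\<^sub>R f' x) = (LINT x|lebesgue. ?d x *\<^sub>R f x)"
  proof (rule integral_cong_AE)
    show "AE x in lebesgue. ?d x *\<^sub>R f' x = ?d x *\<^sub>R f x" using e(1) by eventually_elim simp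
  qed (use md in measurable)
  ultimately show "(LINT x|lebesgue. \<phi> x *\<^sub>R w' x) = - (LINT x|lebesgue. ?d x *\<^sub>R f' x)"
    using fw \<phi> unfolding flow_deriv_def by simp
qed

lemma AE_lebesgue_dilate:
  "AE x in lebesgue. P x \<Longrightarrow> AE x in lebesgue. P (exp s *\<^sub>R (x::real^3))"
  using AE_lebesgue_affine[of "exp s" P 0] by simp

lemma measurable_lebesgue_dilate:
  "f \<in> borel_measurable lebesgue \<Longrightarrow> (\<lambda>x::real^3. f (exp s *\<^sub>R x)) \<in> borel_measurable lebesgue"
  using measurable_lebesgue_affine_compose[of f "exp s" 0] by simp

text \<open>The increment formula integrated against a fixed \<open>\<Psi>\<close>. Only the
  products of \<open>\<Psi>\<close> with the flowed \<open>w\<close> are required to be integrable,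
  since in the applications a weight makes up for what the single factors lack.\<close>

lemma averaging:
  fixes f w \<Psi> :: "real^3 \<Rightarrow> complex"
  assumes f: "loc_int f" and w: "loc_int w" and fw: "flow_deriv \<kappa> 0 f w" and h: "h \<ge> 0"
    and \<Psi>[measurable]: "\<Psi> \<in> borel_measurable lebesgue"
    and i: "\<And>s. s \<in> {0..h} \<Longrightarrow> integrable lebesgue (\<lambda>x. \<Psi> x * cnj (w (exp (\<kappa> * s) *\<^sub>R x)))"
    and B: "\<And>s. s \<in> {0..h} \<Longrightarrow> (LINT x|lebesgue. norm (\<Psi> x * cnj (w (exp (\<kappa> * s) *\<^sub>R x)))) \<le> B"
  shows "integrable lebesgue (\<lambda>x. \<Psi> x * cnj (f (exp (\<kappa> * h) *\<^sub>R x) - f x))"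
    and "(LINT x|lebesgue. \<Psi> x * cnj (f (exp (\<kappa> * h) *\<^sub>R x) - f x))
      = (LINT s:{0..h}|lborel. (LINT x|lebesgue. \<Psi> x * cnj (w (exp (\<kappa> * s) *\<^sub>R x))))"
    and "set_integrable lborel {0..h} (\<lambda>s. LINT x|lebesgue. \<Psi> x * cnj (w (exp (\<kappa> * s) *\<^sub>R x)))"
proof -
  obtain f' where f'[measurable]: "f' \<in> borel_measurable borel" and ff': "AE x in lebesgue. f x = f' x"
    by (rule ex_borel_AE_eq[OF loc_int_measurable[OF f]], rule that)
  obtain w' where w'[measurable]: "w' \<in> borel_measurable borel" and ww': "AE x in lebesgue. w x = w' x"
    by (rule ex_borel_AE_eq[OF loc_int_measurable[OF w]], rule that)
  obtain \<Psi>' where \<Psi>'[measurable]: "\<Psi>' \<in> borel_measurable borel" and \<Psi>\<Psi>': "AE x in lebesgue. \<Psi> x = \<Psi>' x"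
    by (rule ex_borel_AE_eq[OF \<Psi>], rule that)
  note mf = loc_int_measurable[OF f] and mw = loc_int_measurable[OF w]
  note mf' = measurable_lebesgue_borel[OF f'] and mw' = measurable_lebesgue_borel[OF w']
    and m\<Psi>' = measurable_lebesgue_borel[OF \<Psi>']
  note lf' = loc_int_cong_AE[OF f mf' ff'] and lw' = loc_int_cong_AE[OF w mw' ww']
  note fw' = flow_deriv_cong_AE[OF fw ff' ww' mf mf' mw mw']
  have fl: "flow \<kappa> 0 s x = exp (\<kappa> * s) *\<^sub>R x" for s x by (simp add: flow_def)
  have inc: "AE x in lebesgue. f' (exp (\<kappa> * h) *\<^sub>R x) - f' x = (LINT s:{0..h}|lborel. w' (exp (\<kappa> * s) *\<^sub>R x))"
    using flow_increment[OF f' w' lf' lw' fw' _ h] by (simp add: fl)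
  define F where "F = (\<lambda>(s, x). \<Psi>' x * cnj (w' (exp (\<kappa> * s) *\<^sub>R x)))"
  have mF: "F \<in> borel_measurable (lborel \<Otimes>\<^sub>M lborel)" unfolding F_def by measurable
  have mFs: "(\<lambda>x. F (s, x)) \<in> borel_measurable borel" for s unfolding F_def prod.case by measurable
  have eF: "AE x in lebesgue. \<Psi> x * cnj (w (exp (\<kappa> * s) *\<^sub>R x)) = F (s, x)" for s
    using \<Psi>\<Psi>' AE_lebesgue_dilate[OF ww', of "\<kappa> * s"] by eventually_elim (simp add: F_def)
  have mG: "(\<lambda>x. \<Psi> x * cnj (w (exp (\<kappa> * s) *\<^sub>R x))) \<in> borel_measurable lebesgue" for s
    using measurable_lebesgue_dilate[OF mw, of "\<kappa> * s"] by measurable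
  have mFl: "(\<lambda>x. F (s, x)) \<in> borel_measurable lebesgue" for s by (rule measurable_lebesgue_borel[OF mFs])
  have iF: "integrable lborel (\<lambda>x. F (s, x))" if "s \<in> {0..h}" for s
    using integrable_cong_AE_imp[OF i[OF that] mFl] eF[of s] integral_lebesgue_lborel(2)[OF mFs]
    by (auto elim: eventually_mono)
  have jF: "(LINT x|lebesgue. \<Psi> x * cnj (w (exp (\<kappa> * s) *\<^sub>R x))) = (LINT x|lborel. F (s, x))" for s
    using integral_cong_AE[OF mG mFl eF, of s] integral_lebesgue_lborel(1)[OF mFs] by simp
  have BF: "(LINT x|lborel. norm (F (s, x))) \<le> B" if "s \<in> {0..h}" for s
  proof -
    have "(LINT x|lborel. norm (F (s, x))) = (LINT x|lebesgue. norm (F (s, x)))"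
      by (rule integral_lebesgue_lborel(1)[symmetric], rule measurable_compose[OF mFs]) simp
    also have "\<dots> = (LINT x|lebesgue. norm (\<Psi> x * cnj (w (exp (\<kappa> * s) *\<^sub>R x))))"
    proof (rule integral_cong_AE)
      show "AE x in lebesgue. norm (F (s, x)) = norm (\<Psi> x * cnj (w (exp (\<kappa> * s) *\<^sub>R x)))"
        using eF[of s] by eventually_elim simp
    qed (use mFl mG in measurable)
    finally show ?thesis using B[OF that] by simp
  qed
  note int = integrable_strip[OF mF iF BF] and swap = Fubini_strip[OF mF iF BF] and snd = integrable_strip_snd[OF mF iF BF]
  have "integrable lborel (\<lambda>s. LINT x|lborel. indicator {0..h} s *\<^sub>R F (s, x))"
    using lborel_pair.integrable_fst[OF int] by simp
  then show "set_integrable lborel {0..h} (\<lambda>s. LINT x|lebesgue. \<Psi> x * cnj (w (exp (\<kappa> * s) *\<^sub>R x)))"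
    unfolding jF set_integrable_def by simp
  have Q: "(LINT s:{0..h}|lborel. F (s, x)) = \<Psi>' x * cnj (LINT s:{0..h}|lborel. w' (exp (\<kappa> * s) *\<^sub>R x))" for x
  proof -
    have "(LINT s:{0..h}|lborel. F (s, x)) = (LINT s|lborel. \<Psi>' x * cnj (indicator {0..h} s *\<^sub>R w' (exp (\<kappa> * s) *\<^sub>R x)))"
      unfolding set_lebesgue_integral_def F_def by (intro Bochner_Integration.integral_cong) auto
    then show ?thesis unfolding set_lebesgue_integral_def
      by (simp only: integral_mult_right_zero Bochner_Integration.integral_cnj)
  qed
  have mQ: "(\<lambda>x. LINT s:{0..h}|lborel. F (s, x)) \<in> borel_measurable borel"
    using borel_measurable_integrable[OF snd] by simp
  have eQ: "AE x in lebesgue. (LINT s:{0..h}|lborel. F (s, x)) = \<Psi> x * cnj (f (exp (\<kappa> * h) *\<^sub>R x) - f x)"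
    using inc ff' AE_lebesgue_dilate[OF ff', of "\<kappa> * h"] \<Psi>\<Psi>' by eventually_elim (simp add: Q)
  have mL: "(\<lambda>x. \<Psi> x * cnj (f (exp (\<kappa> * h) *\<^sub>R x) - f x)) \<in> borel_measurable lebesgue"
    using measurable_lebesgue_dilate[OF mf, of "\<kappa> * h"] mf by measurable
  have iQ: "integrable lebesgue (\<lambda>x. LINT s:{0..h}|lborel. F (s, x))"
    using snd integral_lebesgue_lborel(2)[OF mQ] by simp
  show "integrable lebesgue (\<lambda>x. \<Psi> x * cnj (f (exp (\<kappa> * h) *\<^sub>R x) - f x))"
    by (rule integrable_cong_AE_imp[OF iQ mL]) (use eQ in \<open>auto elim: eventually_mono\<close>)
  have "(LINT x|lebesgue. \<Psi> x * cnj (f (exp (\<kappa> * h) *\<^sub>R x) - f x)) = (LINT x|lebesgue. (LINT s:{0..h}|lborel. F (s, x)))"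
    by (rule integral_cong_AE[OF mL measurable_lebesgue_borel[OF mQ]]) (use eQ in \<open>auto elim: eventually_mono\<close>)
  also have "\<dots> = (LINT x|lborel. (LINT s:{0..h}|lborel. F (s, x)))" by (rule integral_lebesgue_lborel(1)[OF mQ])
  finally show "(LINT x|lebesgue. \<Psi> x * cnj (f (exp (\<kappa> * h) *\<^sub>R x) - f x))
      = (LINT s:{0..h}|lborel. (LINT x|lebesgue. \<Psi> x * cnj (w (exp (\<kappa> * s) *\<^sub>R x))))"
    using swap by (simp only: jF)
qed

lemma norm_set_integral_le:
  fixes j :: "real \<Rightarrow> complex"
  assumes "set_integrable lborel {0..h} j" "h \<ge> 0" "\<And>s. s \<in> {0..h} \<Longrightarrow> norm (j s) \<le> B"
  shows "norm (LINT s:{0..h}|lborel. j s) \<le> h * B"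
proof -
  have "norm (LINT s:{0..h}|lborel. j s) \<le> (LINT s:{0..h}|lborel. norm (j s))"
    by (rule set_integral_norm_bound[OF assms(1)])
  also have "\<dots> \<le> (LINT s:{0..h}|lborel. B)"
    using assms by (intro set_integral_mono set_integrable_norm) (auto simp: set_integrable_def)
  also have "\<dots> = h * B" using assms(2) by (simp add: set_lebesgue_integral_def mult.commute)
  finally show ?thesis .
qed

lemma average_tendsto:
  fixes j :: "real \<Rightarrow> complex"
  assumes int: "\<And>h. 0 < h \<Longrightarrow> h \<le> 1 \<Longrightarrow> set_integrable lborel {0..h} j"
    and lim: "(j \<longlongrightarrow> j 0) (at 0)"
  shows "((\<lambda>h. (1 / h) *\<^sub>R (LINT s:{0..h}|lborel. j s)) \<longlongrightarrow> j 0) (at_right 0)"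
proof (rule tendstoI)
  fix \<epsilon> :: real assume \<epsilon>: "\<epsilon> > 0"
  obtain d where d: "d > 0" "\<And>s. s \<noteq> 0 \<Longrightarrow> \<bar>s\<bar> < d \<Longrightarrow> dist (j s) (j 0) < \<epsilon> / 2"
    using tendstoD[OF lim, of "\<epsilon> / 2"] \<epsilon> by (auto simp: eventually_at dist_real_def)
  have "dist ((1 / h) *\<^sub>R (LINT s:{0..h}|lborel. j s)) (j 0) < \<epsilon>" if h: "0 < h" "h < min 1 d" for h
  proof -
    note i = int[of h]
    have c: "set_integrable lborel {0..h} (\<lambda>s. j 0)"
      unfolding set_integrable_def
      by (rule integrable_scaleR_left) (simp add: integrable_indicator_iff emeasure_lborel_Icc_eq)
    have "(LINT s:{0..h}|lborel. j s - j 0) = (LINT s:{0..h}|lborel. j s) - h *\<^sub>R j 0"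
      using h i by (subst set_integral_diff(2)[OF _ c]) (auto simp: set_lebesgue_integral_def)
    then have "(1 / h) *\<^sub>R (LINT s:{0..h}|lborel. j s) - j 0 = (1 / h) *\<^sub>R (LINT s:{0..h}|lborel. j s - j 0)"
      using h by (simp only: scaleR_diff_right) simp
    also have "norm \<dots> \<le> (1 / h) * (h * (\<epsilon> / 2))"
    proof -
      have "norm (LINT s:{0..h}|lborel. j s - j 0) \<le> h * (\<epsilon> / 2)"
      proof (rule norm_set_integral_le)
        show "set_integrable lborel {0..h} (\<lambda>s. j s - j 0)" using h i c by (intro set_integral_diff(1)) auto
        show "norm (j s - j 0) \<le> \<epsilon> / 2" if "s \<in> {0..h}" for s
          using d(2)[of s] that h \<epsilon> by (cases "s = 0") (auto simp: dist_norm less_imp_le)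
      qed (use h in simp)
      then show ?thesis using h by (simp add: divide_simps mult.commute)
    qed
    finally show ?thesis using h \<epsilon> by (simp add: dist_norm)
  qed
  then show "eventually (\<lambda>h. dist ((1 / h) *\<^sub>R (LINT s:{0..h}|lborel. j s)) (j 0) < \<epsilon>) (at_right 0)"
    unfolding eventually_at_right_field using d(1) by (intro exI[of _ "min 1 d"]) auto
qed

text \<open>The weights \<open>|x|\<^sup>a\<close> are homogeneous, so they commute with dilations up to a factor.\<close>

lemma flow_quotient_weak_limit:
  fixes f w \<Psi> :: "real^3 \<Rightarrow> complex"
  assumes f: "loc_int f" and w: "loc_int w" and fw: "flow_deriv \<kappa> 0 f w" and \<kappa>: "\<bar>\<kappa>\<bar> = 1"
    and a: "0 \<le> a" "a \<le> 1" and \<Psi>[measurable]: "\<Psi> \<in> borel_measurable lebesgue"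
    and \<Psi>a: "in_Lp 2 (\<lambda>x. norm x powr a *\<^sub>R \<Psi> x)" and wa: "in_Lp 2 (\<lambda>x. norm x powr (- a) *\<^sub>R w x)"
  shows "0 \<le> h \<Longrightarrow> h \<le> 1 \<Longrightarrow> integrable lebesgue (\<lambda>x. \<Psi> x * cnj (f (exp (\<kappa> * h) *\<^sub>R x) - f x))"
    and "((\<lambda>h. (1 / h) *\<^sub>R (LINT x|lebesgue. \<Psi> x * cnj (f (exp (\<kappa> * h) *\<^sub>R x) - f x)))
      \<longlongrightarrow> (LINT x|lebesgue. \<Psi> x * cnj (w x))) (at_right 0)"
    and "0 < h \<Longrightarrow> h \<le> 1 \<Longrightarrow> norm (LINT x|lebesgue. \<Psi> x * cnj (f (exp (\<kappa> * h) *\<^sub>R x) - f x))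
      \<le> h * (exp 2 * (L2_nrm (\<lambda>x. norm x powr a *\<^sub>R \<Psi> x) * L2_nrm (\<lambda>x. norm x powr (- a) *\<^sub>R w x)))"
proof -
  define \<Phi> where "\<Phi> x = norm x powr a *\<^sub>R \<Psi> x" for x
  define v where "v x = norm x powr (- a) *\<^sub>R w x" for x
  have \<Phi>2: "in_Lp 2 \<Phi>" and v2: "in_Lp 2 v" using \<Psi>a wa by (auto simp: \<Phi>_def[abs_def] v_def[abs_def])
  define j where "j s = (LINT x|lebesgue. \<Psi> x * cnj (w (exp (\<kappa> * s) *\<^sub>R x)))" for s
  have nz: "AE x in lebesgue. x \<noteq> (0::real^3)"
    by (rule AE_completion) (rule AE_lborel_singleton)
  have prod: "\<Psi> x * cnj (w (exp s *\<^sub>R x)) = exp (a * s) *\<^sub>R (\<Phi> x * cnj (v (exp s *\<^sub>R x)))" if "x \<noteq> 0" for x s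
  proof -
    have "norm (exp s *\<^sub>R x) powr (- a) = exp (- (a * s)) * norm x powr (- a)"
      using that by (simp add: powr_mult exp_powr_real mult.commute)
    then have "exp (a * s) * (norm x powr a * norm (exp s *\<^sub>R x) powr (- a))
        = (exp (a * s) * exp (- (a * s))) * (norm x powr a * norm x powr (- a))"
      by (simp only: mult_ac)
    also have "norm x powr a * norm x powr (- a) = 1" using that by (simp add: powr_add[symmetric])
    finally have "exp (a * s) * (norm x powr a * norm (exp s *\<^sub>R x) powr (- a)) = 1"
      by (simp only: exp_minus_inverse mult_1)
    then have "\<Psi> x * cnj (w (exp s *\<^sub>R x))
        = (exp (a * s) * (norm x powr a * norm (exp s *\<^sub>R x) powr (- a))) *\<^sub>R (\<Psi> x * cnj (w (exp s *\<^sub>R x)))"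
      by simp
    moreover have "\<Phi> x * cnj (v (exp s *\<^sub>R x))
        = (norm x powr a * norm (exp s *\<^sub>R x) powr (- a)) *\<^sub>R (\<Psi> x * cnj (w (exp s *\<^sub>R x)))"
      unfolding \<Phi>_def v_def complex_cnj_scaleR by (simp only: mult_scaleR_left mult_scaleR_right scaleR_scaleR mult.commute)
    ultimately show ?thesis by (simp only: scaleR_scaleR)
  qed
  have vs: "in_Lp 2 (\<lambda>x. v (exp s *\<^sub>R x))" "L2_nrm (\<lambda>x. v (exp s *\<^sub>R x)) = L2_nrm v * exp (- 3 * s / 2)" for s
  proof -
    show "in_Lp 2 (\<lambda>x. v (exp s *\<^sub>R x))" using L2_affine(1)[OF v2, of "exp s" 0] by simp
    have "exp s ^ 3 = (exp (3 * s / 2))\<^sup>2" by (simp add: exp_of_nat_mult[symmetric])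
    then have q: "sqrt (exp s ^ 3) = exp (3 * s / 2)" by simp
    have "L2_nrm (\<lambda>x. v (exp s *\<^sub>R x)) = L2_nrm v / sqrt (\<bar>exp s\<bar> ^ 3)"
      using L2_affine(2)[OF v2, of "exp s" 0] by simp
    moreover have "exp (- 3 * s / 2) = inverse (exp (3 * s / 2))" using exp_minus[of "3 * s / 2"] by simp
    ultimately show "L2_nrm (\<lambda>x. v (exp s *\<^sub>R x)) = L2_nrm v * exp (- 3 * s / 2)"
      by (simp only: abs_exp_cancel q divide_inverse)
  qed
  have mj: "(\<lambda>x. \<Psi> x * cnj (w (exp s *\<^sub>R x))) \<in> borel_measurable lebesgue" for s
    using measurable_lebesgue_dilate[OF loc_int_measurable[OF w], of s] by measurable
  have ES: "in_Lp 2 (\<lambda>x. exp (a * s) *\<^sub>R v (exp s *\<^sub>R x))" for s by (intro in_L2_scaleR vs)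
  have prodAE: "AE x in lebesgue. norm (\<Psi> x * cnj (w (exp s *\<^sub>R x))) \<le> norm (\<Phi> x) * norm (exp (a * s) *\<^sub>R v (exp s *\<^sub>R x))" for s
    using nz by eventually_elim (simp add: prod norm_mult)
  note P = L2_product[OF \<Phi>2 ES mj prodAE]
  \<comment> \<open>The exponent is (a - 3/2) s, with modulus at most 3/2 for a in [0,1]; the bound
    2 is a convenient integer.\<close>
  have expb: "exp (a * s) * exp (- 3 * s / 2) \<le> exp 2" if "\<bar>s\<bar> \<le> 1" for s
  proof -
    have "\<bar>a - 3 / 2\<bar> * \<bar>s\<bar> \<le> 2 * 1" using a that by (intro mult_mono) auto
    moreover have "(a - 3/2) * s \<le> \<bar>a - 3/2\<bar> * \<bar>s\<bar>" using abs_ge_self[of "(a - 3/2) * s"] by (simp only: abs_mult)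
    moreover have "(a - 3/2) * s = a * s + - 3 * s / 2" by (simp add: left_diff_distrib)
    ultimately have "a * s + - 3 * s / 2 \<le> 2" by linarith
    then show ?thesis by (simp add: exp_add[symmetric])
  qed
  have bnd: "L2_nrm \<Phi> * L2_nrm (\<lambda>x. exp (a * s) *\<^sub>R v (exp s *\<^sub>R x)) \<le> exp 2 * (L2_nrm \<Phi> * L2_nrm v)" if "\<bar>s\<bar> \<le> 1" for s
  proof -
    have "L2_nrm (\<lambda>x. exp (a * s) *\<^sub>R v (exp s *\<^sub>R x)) = (exp (a * s) * exp (- 3 * s / 2)) * L2_nrm v"
      unfolding L2_nrm_scaleR vs(2) by simp
    also have "\<dots> \<le> exp 2 * L2_nrm v" by (intro mult_right_mono expb that L2_nrm_nonneg)
    finally have "L2_nrm \<Phi> * L2_nrm (\<lambda>x. exp (a * s) *\<^sub>R v (exp s *\<^sub>R x)) \<le> L2_nrm \<Phi> * (exp 2 * L2_nrm v)"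
      by (rule mult_left_mono[OF _ L2_nrm_nonneg])
    then show ?thesis by (simp only: mult.left_commute)
  qed
  have ks: "\<bar>\<kappa> * s\<bar> \<le> 1" if "s \<in> {0..h}" "h \<le> 1" for s h using that \<kappa> by (simp add: abs_mult)
  have Bs: "(LINT x|lebesgue. norm (\<Psi> x * cnj (w (exp (\<kappa> * s) *\<^sub>R x)))) \<le> exp 2 * (L2_nrm \<Phi> * L2_nrm v)"
    if "s \<in> {0..h}" "h \<le> 1" for s h
    using P(2)[of "\<kappa> * s"] bnd[OF ks[OF that]] by linarith
  note AV = averaging[OF f w fw _ \<Psi> P(1) Bs]
  show "0 \<le> h \<Longrightarrow> h \<le> 1 \<Longrightarrow> integrable lebesgue (\<lambda>x. \<Psi> x * cnj (f (exp (\<kappa> * h) *\<^sub>R x) - f x))"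
    by (rule AV(1)) auto
  have ji: "set_integrable lborel {0..h} j" if "0 \<le> h" "h \<le> 1" for h
    unfolding j_def by (rule AV(3)) (use that in auto)
  have je: "(LINT x|lebesgue. \<Psi> x * cnj (f (exp (\<kappa> * h) *\<^sub>R x) - f x)) = (LINT s:{0..h}|lborel. j s)" if "0 \<le> h" "h \<le> 1" for h
    unfolding j_def by (rule AV(2)) (use that in auto)
  show "0 < h \<Longrightarrow> h \<le> 1 \<Longrightarrow> norm (LINT x|lebesgue. \<Psi> x * cnj (f (exp (\<kappa> * h) *\<^sub>R x) - f x))
      \<le> h * (exp 2 * (L2_nrm (\<lambda>x. norm x powr a *\<^sub>R \<Psi> x) * L2_nrm (\<lambda>x. norm x powr (- a) *\<^sub>R w x)))"
  proof -
    assume h: "0 < h" "h \<le> 1"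
    have "norm (j s) \<le> exp 2 * (L2_nrm \<Phi> * L2_nrm v)" if "s \<in> {0..h}" for s
      unfolding j_def using P(3)[of "\<kappa> * s"] bnd[OF ks[OF that h(2)]] by linarith
    then have "norm (LINT s:{0..h}|lborel. j s) \<le> h * (exp 2 * (L2_nrm \<Phi> * L2_nrm v))"
      using h by (intro norm_set_integral_le ji) auto
    then show ?thesis using je[of h] h by (simp add: \<Phi>_def[abs_def] v_def[abs_def])
  qed
  have j0: "j 0 = (LINT x|lebesgue. \<Psi> x * cnj (w x))" by (simp add: j_def)
  have jlim: "(j \<longlongrightarrow> j 0) (at 0)"
  proof -
    \<comment> \<open>A modulus of continuity for \<open>j\<close> at 0: the first summand accounts
      for the scalar factor \<open>exp (a * s)\<close>, the second is the L^2 continuity of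
      dilations.\<close>
    define r where "r s = L2_nrm \<Phi> * (\<bar>exp (a * s) - 1\<bar> * (L2_nrm v * exp (- 3 * s / 2)) + L2_nrm (\<lambda>x. v (exp s *\<^sub>R x) - v x))" for s
    have jr: "norm (j s - j 0) \<le> r (\<kappa> * s)" for s
    proof -
      let ?t = "\<kappa> * s"
      let ?d = "\<lambda>x. (exp (a * ?t) - 1) *\<^sub>R v (exp ?t *\<^sub>R x) + (v (exp ?t *\<^sub>R x) - v x)"
      have vd: "in_Lp 2 (\<lambda>x. v (exp ?t *\<^sub>R x) - v x)" by (intro in_L2_diff vs v2)
      have d2: "in_Lp 2 ?d" by (intro in_L2_add in_L2_scaleR vs vd)
      have "j s - j 0 = (LINT x|lebesgue. \<Psi> x * cnj (w (exp ?t *\<^sub>R x)) - \<Psi> x * cnj (w x))"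
        using P(1)[of ?t] P(1)[of 0] by (simp add: j_def)
      also have "norm \<dots> \<le> L2_nrm \<Phi> * L2_nrm ?d"
      proof (rule L2_product(3)[OF \<Phi>2 d2])
        show "(\<lambda>x. \<Psi> x * cnj (w (exp ?t *\<^sub>R x)) - \<Psi> x * cnj (w x)) \<in> borel_measurable lebesgue"
          using mj[of ?t] mj[of 0] by simp
        show "AE x in lebesgue. norm (\<Psi> x * cnj (w (exp ?t *\<^sub>R x)) - \<Psi> x * cnj (w x)) \<le> norm (\<Phi> x) * norm (?d x)"
          using nz
        proof eventually_elim
          case (elim x)
          have "\<Psi> x * cnj (w (exp ?t *\<^sub>R x)) - \<Psi> x * cnj (w x) = \<Phi> x * cnj (?d x)"
            using prod[OF elim, of ?t] prod[OF elim, of 0] by (simp add: algebra_simps)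
          then show ?case by (simp only: norm_mult complex_mod_cnj order_refl)
        qed
      qed
      also have "L2_nrm ?d \<le> \<bar>exp (a * ?t) - 1\<bar> * (L2_nrm v * exp (- 3 * ?t / 2)) + L2_nrm (\<lambda>x. v (exp ?t *\<^sub>R x) - v x)"
        using L2_nrm_triangle[OF in_L2_scaleR[OF vs(1)[of ?t]] vd, of "exp (a * ?t) - 1"]
        unfolding L2_nrm_scaleR vs(2) .
      finally show ?thesis by (simp add: r_def mult_left_mono L2_nrm_nonneg)
    qed
    have "(r \<longlongrightarrow> L2_nrm \<Phi> * (\<bar>exp (a * 0) - 1\<bar> * (L2_nrm v * exp (- 3 * 0 / 2)) + 0)) (at 0)"
      unfolding r_def by (intro tendsto_intros dilation_continuous_L2 v2) auto
    then have r0: "(r \<longlongrightarrow> 0) (at 0)" by simp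
    have "filterlim (\<lambda>s. \<kappa> * s) (at 0) (at 0)"
    proof -
      have "((\<lambda>s. \<kappa> * s) \<longlongrightarrow> \<kappa> * 0) (at 0)" by (intro tendsto_intros)
      then show ?thesis using \<kappa> by (auto simp: filterlim_at eventually_at_filter)
    qed
    from filterlim_compose[OF r0 this] have "((\<lambda>s. r (\<kappa> * s)) \<longlongrightarrow> 0) (at 0)" .
    then have "((\<lambda>s. j s - j 0) \<longlongrightarrow> 0) (at 0)"
      by (rule Lim_null_comparison[rotated]) (use jr in auto)
    then show ?thesis by (rule LIM_zero_cancel)
  qed
  have "((\<lambda>h. (1 / h) *\<^sub>R (LINT s:{0..h}|lborel. j s)) \<longlongrightarrow> j 0) (at_right 0)"
    by (rule average_tendsto[OF ji jlim]) auto
  then show "((\<lambda>h. (1 / h) *\<^sub>R (LINT x|lebesgue. \<Psi> x * cnj (f (exp (\<kappa> * h) *\<^sub>R x) - f x)))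
      \<longlongrightarrow> (LINT x|lebesgue. \<Psi> x * cnj (w x))) (at_right 0)"
    unfolding j0[symmetric]
  proof (rule Lim_transform_eventually)
    show "eventually (\<lambda>h. (1 / h) *\<^sub>R (LINT s:{0..h}|lborel. j s)
        = (1 / h) *\<^sub>R (LINT x|lebesgue. \<Psi> x * cnj (f (exp (\<kappa> * h) *\<^sub>R x) - f x))) (at_right 0)"
      unfolding eventually_at_right_field using je by (intro exI[of _ 1]) auto
  qed
qed

lemma exp_quotient_tendsto: "((\<lambda>h. (exp (3 * h / 2) - exp (- 3 * h / 2)) / (2 * h)) \<longlongrightarrow> 3 / 2) (at_right (0::real))"
proof -
  have "((\<lambda>h. exp (3 * h / 2) - exp (- 3 * h / 2)) has_real_derivative 3) (at (0::real))"
    by (auto intro!: derivative_eq_intros)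
  then have "((\<lambda>h. (exp (3 * h / 2) - exp (- 3 * h / 2)) / h) \<longlongrightarrow> 3) (at (0::real))"
    by (simp add: DERIV_def)
  then have "((\<lambda>h. (exp (3 * h / 2) - exp (- 3 * h / 2)) / h) \<longlongrightarrow> 3) (at_right (0::real))"
    by (rule filterlim_mono) (auto simp: at_le)
  then have "((\<lambda>h. (exp (3 * h / 2) - exp (- 3 * h / 2)) / h / 2) \<longlongrightarrow> 3 / 2) (at_right (0::real))"
    by (intro tendsto_intros) auto
  then show ?thesis by (simp add: mult.commute)
qed

text \<open>For \<open>k\<close> the gradient of \<open>f\<close> this is x . \<nabla>f.\<close>

definition radial :: "(real^3 \<Rightarrow> complex^3) \<Rightarrow> real^3 \<Rightarrow> complex" where
  "radial k x = (\<Sum>i\<in>UNIV. x $ i *\<^sub>R k x $ i)"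

lemma measurable_radial:
  assumes "k \<in> borel_measurable lebesgue" shows "radial k \<in> borel_measurable lebesgue"
proof -
  have [measurable]: "(\<lambda>x::real^3. x $ i) \<in> borel_measurable lebesgue" for i by (rule measurable_lebesgue_borel) measurable
  note [measurable] = measurable_vec_nth[OF assms]
  show ?thesis unfolding radial_def[abs_def] by measurable
qed

lemma norm_radial_le: "norm (radial k x) \<le> norm x * norm (k x)"
proof -
  have "norm (radial k x) \<le> (\<Sum>i\<in>UNIV. \<bar>x $ i\<bar> * \<bar>norm (k x $ i)\<bar>)"
    unfolding radial_def by (rule order_trans[OF norm_sum]) simp
  also have "\<dots> \<le> L2_set (\<lambda>i. x $ i) UNIV * L2_set (\<lambda>i. norm (k x $ i)) UNIV" by (rule L2_set_mult_ineq)
  also have "L2_set (\<lambda>i. x $ i) UNIV = norm x" by (simp add: norm_vec_def L2_set_def)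
  finally show ?thesis by (simp add: norm_vec_def)
qed

lemma loc_int_radial: "in_Lp 2 k \<Longrightarrow> loc_int (radial k)"
  by (rule loc_int_cmult[OF loc_int_L2 measurable_radial[OF in_L2_measurable] norm_radial_le])
     (auto intro: continuous_on_norm continuous_on_id)

lemma flow_deriv_radial:
  assumes "H1_grad f k" shows "flow_deriv \<kappa> 0 f (\<lambda>x. \<kappa> *\<^sub>R radial k x)"
  using flow_deriv_weak_gradient[OF assms, of \<kappa> 0] by (simp add: radial_def scaleR_sum_right)

text \<open>The symmetric quotient splits into a forward quotient (\<open>\<kappa> = 1\<close>) and
  a backward one (\<open>\<kappa> = - 1\<close>), each contributing half of x . \<nabla>f, and a
  scalar quotient of the unitarity factors tending to 3/2. The weight exponent \<open>a\<close> is 0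
  when both sides are square integrable and 1 for the nonlinearity.\<close>

lemma dil_diff_weak_limit:
  fixes \<Psi> :: "real^3 \<Rightarrow> complex"
  assumes fk: "H1_grad f k" and a: "0 \<le> a" "a \<le> 1" and \<Psi>[measurable]: "\<Psi> \<in> borel_measurable lebesgue"
    and \<Psi>a: "in_Lp 2 (\<lambda>x. norm x powr a *\<^sub>R \<Psi> x)" and qa: "in_Lp 2 (\<lambda>x. norm x powr (- a) *\<^sub>R radial k x)"
    and \<Psi>f: "integrable lebesgue (\<lambda>x. \<Psi> x * cnj (f x))"
  shows "((\<lambda>h. LINT x|lebesgue. \<Psi> x * cnj (dil_diff h f x))
      \<longlongrightarrow> (LINT x|lebesgue. \<Psi> x * cnj (radial k x)) + (3 / 2) *\<^sub>R (LINT x|lebesgue. \<Psi> x * cnj (f x))) (at_right 0)"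
    and "0 < h \<Longrightarrow> h \<le> 1 \<Longrightarrow> norm (LINT x|lebesgue. \<Psi> x * cnj (dil_diff h f x))
      \<le> exp 4 * (L2_nrm (\<lambda>x. norm x powr a *\<^sub>R \<Psi> x) * L2_nrm (\<lambda>x. norm x powr (- a) *\<^sub>R radial k x)
        + norm (LINT x|lebesgue. \<Psi> x * cnj (f x)))"
    and "0 < h \<Longrightarrow> h \<le> 1 \<Longrightarrow> integrable lebesgue (\<lambda>x. \<Psi> x * cnj (dil_diff h f x))"
proof -
  have f: "loc_int f" and k: "loc_int (radial k)" using fk by (auto intro: loc_int_L2 loc_int_radial H1_gradD)
  define I where "I \<kappa> h = (LINT x|lebesgue. \<Psi> x * cnj (f (exp (\<kappa> * h) *\<^sub>R x) - f x))" for \<kappa> h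
  define F where "F = (LINT x|lebesgue. \<Psi> x * cnj (f x))"
  define J where "J = L2_nrm (\<lambda>x. norm x powr a *\<^sub>R \<Psi> x) * L2_nrm (\<lambda>x. norm x powr (- a) *\<^sub>R radial k x)"
  have J0: "J \<ge> 0" by (simp add: J_def L2_nrm_nonneg)
  define c where "c h = (exp (3 * h / 2) - exp (- 3 * h / 2)) / (2 * h)" for h :: real
  have q: "\<And>h. 0 \<le> h \<Longrightarrow> h \<le> 1 \<Longrightarrow> integrable lebesgue (\<lambda>x. \<Psi> x * cnj (f (exp (\<kappa> * h) *\<^sub>R x) - f x))"
    and ql: "((\<lambda>h. (1 / h) *\<^sub>R I \<kappa> h) \<longlongrightarrow> \<kappa> *\<^sub>R (LINT x|lebesgue. \<Psi> x * cnj (radial k x))) (at_right 0)"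
    and qb: "\<And>h. 0 < h \<Longrightarrow> h \<le> 1 \<Longrightarrow> norm (I \<kappa> h) \<le> h * (exp 2 * J)"
    if \<kappa>: "\<bar>\<kappa>\<bar> = 1" for \<kappa>
  proof -
    have lk: "loc_int (\<lambda>x. \<kappa> *\<^sub>R radial k x)"
      by (rule loc_int_cmult[OF k, of _ "\<lambda>x. \<bar>\<kappa>\<bar>"]) (use measurable_radial[OF in_L2_measurable[OF H1_gradD(2)[OF fk]]] in auto)
    have e: "(\<lambda>x. norm x powr (- a) *\<^sub>R \<kappa> *\<^sub>R radial k x) = (\<lambda>x. \<kappa> *\<^sub>R (norm x powr (- a) *\<^sub>R radial k x))"
      by (simp add: mult.commute)
    have wa: "in_Lp 2 (\<lambda>x. norm x powr (- a) *\<^sub>R \<kappa> *\<^sub>R radial k x)"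
      unfolding e by (rule in_L2_scaleR[OF qa])
    have n: "L2_nrm (\<lambda>x. norm x powr (- a) *\<^sub>R \<kappa> *\<^sub>R radial k x) = L2_nrm (\<lambda>x. norm x powr (- a) *\<^sub>R radial k x)"
      unfolding e L2_nrm_scaleR \<kappa> by simp
    note L = flow_quotient_weak_limit[OF f lk flow_deriv_radial[OF fk] \<kappa> a \<Psi> \<Psi>a wa]
    show "integrable lebesgue (\<lambda>x. \<Psi> x * cnj (f (exp (\<kappa> * h) *\<^sub>R x) - f x))" if "0 \<le> h" "h \<le> 1" for h
      by (rule L(1)[OF that])
    have "(LINT x|lebesgue. \<Psi> x * cnj (\<kappa> *\<^sub>R radial k x)) = \<kappa> *\<^sub>R (LINT x|lebesgue. \<Psi> x * cnj (radial k x))"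
      by simp
    with L(2) show "((\<lambda>h. (1 / h) *\<^sub>R I \<kappa> h) \<longlongrightarrow> \<kappa> *\<^sub>R (LINT x|lebesgue. \<Psi> x * cnj (radial k x))) (at_right 0)"
      by (simp only: I_def)
    show "norm (I \<kappa> h) \<le> h * (exp 2 * J)" if "0 < h" "h \<le> 1" for h
      using L(3)[OF that] unfolding I_def J_def n .
  qed
  have dd: "\<Psi> x * cnj (dil_diff h f x) = (exp (3 * h / 2) / (2 * h)) *\<^sub>R (\<Psi> x * cnj (f (exp (1 * h) *\<^sub>R x) - f x))
      - (exp (- 3 * h / 2) / (2 * h)) *\<^sub>R (\<Psi> x * cnj (f (exp (- 1 * h) *\<^sub>R x) - f x)) + c h *\<^sub>R (\<Psi> x * cnj (f x))" for h x
  proof -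
    have "dil_diff h f x = (exp (3 * h / 2) / (2 * h)) *\<^sub>R (f (exp (1 * h) *\<^sub>R x) - f x)
      - (exp (- 3 * h / 2) / (2 * h)) *\<^sub>R (f (exp (- 1 * h) *\<^sub>R x) - f x) + c h *\<^sub>R f x"
      unfolding dil_diff_def dil_def c_def
      by (simp add: scaleR_diff_right scaleR_diff_left diff_divide_distrib)
    then show ?thesis
      by (simp only: complex_cnj_add complex_cnj_diff complex_cnj_scaleR distrib_left right_diff_distrib mult_scaleR_right)
  qed
  note i1 = q[of 1, simplified abs_one, OF refl] and i2 = q[of "- 1", simplified abs_minus abs_one, OF refl]
  show "integrable lebesgue (\<lambda>x. \<Psi> x * cnj (dil_diff h f x))" if "0 < h" "h \<le> 1"
    unfolding dd using that
    by (intro Bochner_Integration.integrable_add Bochner_Integration.integrable_diff integrable_scaleR_right i1 i2 \<Psi>f) auto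
  have eq: "(LINT x|lebesgue. \<Psi> x * cnj (dil_diff h f x)) = (exp (3 * h / 2) / 2) *\<^sub>R ((1 / h) *\<^sub>R I 1 h)
      - (exp (- 3 * h / 2) / 2) *\<^sub>R ((1 / h) *\<^sub>R I (- 1) h) + c h *\<^sub>R F" if h: "0 < h" "h \<le> 1" for h
    unfolding dd using i1[of h] i2[of h] h \<Psi>f
    by (simp add: I_def F_def mult.commute)
  have "((\<lambda>h. (exp (3 * h / 2) / 2) *\<^sub>R ((1 / h) *\<^sub>R I 1 h) - (exp (- 3 * h / 2) / 2) *\<^sub>R ((1 / h) *\<^sub>R I (- 1) h) + c h *\<^sub>R F)
    \<longlongrightarrow> (exp (3 * 0 / 2) / 2) *\<^sub>R (1 *\<^sub>R (LINT x|lebesgue. \<Psi> x * cnj (radial k x)))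
      - (exp (- 3 * 0 / 2) / 2) *\<^sub>R ((- 1) *\<^sub>R (LINT x|lebesgue. \<Psi> x * cnj (radial k x))) + (3 / 2) *\<^sub>R F) (at_right 0)"
    unfolding c_def by (intro tendsto_intros ql exp_quotient_tendsto) auto
  then have "((\<lambda>h. (exp (3 * h / 2) / 2) *\<^sub>R ((1 / h) *\<^sub>R I 1 h) - (exp (- 3 * h / 2) / 2) *\<^sub>R ((1 / h) *\<^sub>R I (- 1) h) + c h *\<^sub>R F)
    \<longlongrightarrow> (LINT x|lebesgue. \<Psi> x * cnj (radial k x)) + (3 / 2) *\<^sub>R F) (at_right 0)"
    by (simp add: scaleR_conv_of_real)
  then show "((\<lambda>h. LINT x|lebesgue. \<Psi> x * cnj (dil_diff h f x))
      \<longlongrightarrow> (LINT x|lebesgue. \<Psi> x * cnj (radial k x)) + (3 / 2) *\<^sub>R (LINT x|lebesgue. \<Psi> x * cnj (f x))) (at_right 0)"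
    unfolding F_def[symmetric]
  proof (rule Lim_transform_eventually)
    show "eventually (\<lambda>h. (exp (3 * h / 2) / 2) *\<^sub>R ((1 / h) *\<^sub>R I 1 h) - (exp (- 3 * h / 2) / 2) *\<^sub>R ((1 / h) *\<^sub>R I (- 1) h) + c h *\<^sub>R F
        = (LINT x|lebesgue. \<Psi> x * cnj (dil_diff h f x))) (at_right 0)"
      unfolding eventually_at_right_field using eq by (intro exI[of _ 1]) auto
  qed
  show "norm (LINT x|lebesgue. \<Psi> x * cnj (dil_diff h f x))
      \<le> exp 4 * (L2_nrm (\<lambda>x. norm x powr a *\<^sub>R \<Psi> x) * L2_nrm (\<lambda>x. norm x powr (- a) *\<^sub>R radial k x)
        + norm (LINT x|lebesgue. \<Psi> x * cnj (f x)))" if h: "0 < h" "h \<le> 1"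
  proof -
    have b: "norm ((1 / h) *\<^sub>R I \<kappa> h) \<le> exp 2 * J" if "\<bar>\<kappa>\<bar> = 1" for \<kappa>
      using qb[OF that h] h by (simp add: field_simps)
    have e1: "exp (3 * h / 2) \<le> exp 2" "exp (- 3 * h / 2) \<le> exp 2" using h by auto
    have t1: "norm ((exp (3 * h / 2) / 2) *\<^sub>R ((1 / h) *\<^sub>R I 1 h)) \<le> exp 2 / 2 * (exp 2 * J)"
      using b[of 1] e1 unfolding norm_scaleR[of "exp (3 * h / 2) / 2"] by (intro mult_mono) auto
    have t2: "norm ((exp (- 3 * h / 2) / 2) *\<^sub>R ((1 / h) *\<^sub>R I (- 1) h)) \<le> exp 2 / 2 * (exp 2 * J)"
      using b[of "- 1"] e1 unfolding norm_scaleR[of "exp (- 3 * h / 2) / 2"] by (intro mult_mono) auto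
    have ch: "\<bar>c h\<bar> \<le> exp 4"
    proof -
      have "1 - exp (- 3 * h) \<le> 3 * h" using exp_ge_add_one_self[of "- 3 * h"] by simp
      then have "exp (3 * h / 2) * (1 - exp (- 3 * h)) \<le> exp 2 * (3 * h)"
        using e1 h by (intro mult_mono) auto
      moreover have "exp (3 * h / 2) * (1 - exp (- 3 * h)) = exp (3 * h / 2) - exp (- 3 * h / 2)"
        by (simp add: right_diff_distrib exp_add[symmetric])
      ultimately have "c h \<le> exp 2 * (3 / 2)" using h by (simp add: c_def field_simps)
      also have "\<dots> \<le> exp 2 * exp 2" using exp_ge_add_one_self[of "2::real"] by (intro mult_left_mono) auto
      also have "\<dots> = exp 4" by (simp add: exp_add[symmetric])
      finally have "c h \<le> exp 4" .
      moreover have "c h \<ge> 0" using h by (auto simp: c_def intro!: divide_nonneg_pos)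
      ultimately show ?thesis by simp
    qed
    have t3: "norm (c h *\<^sub>R F) \<le> exp 4 * norm F" using ch by (simp add: mult_right_mono)
    have "norm (LINT x|lebesgue. \<Psi> x * cnj (dil_diff h f x)) \<le> exp 2 / 2 * (exp 2 * J) + exp 2 / 2 * (exp 2 * J) + exp 4 * norm F"
      unfolding eq[OF h] by (intro order_trans[OF norm_triangle_ineq] add_mono order_trans[OF norm_triangle_ineq4] t1 t2 t3)
    also have "\<dots> = exp 4 * (J + norm F)" by (simp add: algebra_simps exp_add[symmetric])
    finally show ?thesis by (simp add: J_def F_def)
  qed
qed

section \<open>The kinetic and the potential contributions\<close>

text \<open>Unitarity, componentwise. It makes the forward and backward parts of the kinetic main
  term conjugate, so that they have the same real part.\<close>

lemma pair_vec_dil: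
  fixes k :: "real^3 \<Rightarrow> complex^3"
  assumes k: "in_Lp 2 k"
  shows "(LINT x|lebesgue. (\<Sum>i\<in>UNIV. k x $ i * cnj (dil (- s) k x $ i)))
    = cnj (LINT x|lebesgue. (\<Sum>i\<in>UNIV. k x $ i * cnj (dil s k x $ i)))"
proof -
  have d: "dil s k x $ i = dil s (\<lambda>x. k x $ i) x" for s x i by (simp add: dil_def)
  note i = integrable_mult_cnj(1)[OF in_L2_nth[OF k] in_L2_dil(1)[OF in_L2_nth[OF k]]]
  have S: "(LINT x|lebesgue. (\<Sum>i\<in>UNIV. k x $ i * cnj (dil s k x $ i))) = (\<Sum>i\<in>UNIV. pair_L2 (\<lambda>x. k x $ i) (dil s (\<lambda>x. k x $ i)))" for s
    unfolding d pair_L2_def by (rule Bochner_Integration.integral_sum) (rule i)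
  have "pair_L2 (\<lambda>x. k x $ i) (dil (- s) (\<lambda>x. k x $ i)) = cnj (pair_L2 (\<lambda>x. k x $ i) (dil s (\<lambda>x. k x $ i)))" for i
    unfolding pair_L2_cnj using pair_L2_dil[OF in_L2_nth[OF k] in_L2_nth[OF k], of i "- s" i] by simp
  then show ?thesis unfolding S by simp
qed

text \<open>Write f = \<chi>u, k = \<nabla>f and P for the gradient of the quotient of f. The
  pairing of k with P involves \<open>exp h\<close> times the dilated k minus
  \<open>exp (- h)\<close> times the inversely dilated k; the two have the same real part, so it
  equals sinh(h)/h times the real part of the pairing of k with its dilation, at most the squared
  norm of k by Cauchy-Schwarz. All other terms come from the gradient of \<chi> and carry
  1/R^2.\<close>

lemma kinetic_bound:
  assumes ug: "H1_grad u g" and R: "R > 0" and h: "h > 0"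
  defines "f \<equiv> \<lambda>x. gauss R x *\<^sub>R u x"
    and "k \<equiv> \<lambda>x. gauss R x *\<^sub>R g x + (\<chi> i. (- (x $ i / R\<^sup>2) * gauss R x) *\<^sub>R u x)"
  assumes \<Psi>2: "in_Lp 2 (\<lambda>x. 2 *\<^sub>R radial k x + ((norm x)\<^sup>2 / R\<^sup>2) *\<^sub>R f x)" and q2: "in_Lp 2 (radial k)"
  shows "Re (LINT x|lebesgue. (\<Sum>i\<in>UNIV. grad u x $ i * cnj (grad (loc_gen R h u) x $ i)))
    \<le> (exp h - exp (- h)) / (2 * h) * (L2_nrm k)\<^sup>2
      - 1 / R\<^sup>2 * Re (LINT x|lebesgue. (2 *\<^sub>R radial k x + ((norm x)\<^sup>2 / R\<^sup>2) *\<^sub>R f x) * cnj (dil_diff h f x))"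
proof -
  have fk: "H1_grad f k" unfolding f_def k_def by (rule H1_grad_gauss[OF ug R])
  have f2: "in_Lp 2 f" and k2: "in_Lp 2 k" using fk by (auto intro: H1_gradD)
  define \<psi> where "\<psi> = dil_diff h f"
  define P where "P x = (1 / (2 * h)) *\<^sub>R (exp h *\<^sub>R dil h k x - exp (- h) *\<^sub>R dil (- h) k x)" for x
  have \<psi>P: "H1_grad \<psi> P" unfolding \<psi>_def P_def[abs_def] by (rule H1_grad_dil_diff[OF fk])
  have \<psi>2: "in_Lp 2 \<psi>" and P2: "in_Lp 2 P" using \<psi>P by (auto intro: H1_gradD)
  define G where "G x = gauss R x *\<^sub>R P x + (\<chi> i. (- (x $ i / R\<^sup>2) * gauss R x) *\<^sub>R \<psi> x)" for x
  have LG: "H1_grad (loc_gen R h u) G"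
    unfolding loc_gen_def[abs_def] G_def[abs_def] using H1_grad_gauss[OF \<psi>P R] unfolding \<psi>_def f_def .
  \<comment> \<open>The chain-rule factor \<open>exp h\<close> is absorbed by the coordinate, since
    \<open>exp h\<close> times x is the dilated point. So x . \<nabla> commutes with the
    quotient.\<close>
  have radP: "radial P x = dil_diff h (radial k) x" for x
  proof -
    have "x $ i *\<^sub>R P x $ i = (1 / (2 * h)) *\<^sub>R (exp (3 * h / 2) *\<^sub>R ((exp h *\<^sub>R x) $ i *\<^sub>R k (exp h *\<^sub>R x) $ i)
        - exp (3 * (- h) / 2) *\<^sub>R ((exp (- h) *\<^sub>R x) $ i *\<^sub>R k (exp (- h) *\<^sub>R x) $ i))" for i
      by (simp add: P_def dil_def scaleR_diff_right mult_ac)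
    then show ?thesis
      unfolding radial_def dil_diff_def dil_def by (simp only: scaleR_sum_right sum_subtractf[symmetric])
  qed
  \<comment> \<open>The outer weight is moved onto \<open>g\<close>, and \<chi> g = k + (x/R^2) f;
    after that only \<open>f\<close>, \<open>k\<close> and quotients of them occur.\<close>
  have pt: "(\<Sum>i\<in>UNIV. g x $ i * cnj (G x $ i)) = (\<Sum>i\<in>UNIV. k x $ i * cnj (P x $ i))
      + (1 / R\<^sup>2) *\<^sub>R (f x * cnj (dil_diff h (radial k) x))
      - (1 / R\<^sup>2) *\<^sub>R ((radial k x + ((norm x)\<^sup>2 / R\<^sup>2) *\<^sub>R f x) * cnj (\<psi> x))" for x
  proof -
    have cg: "gauss R x *\<^sub>R g x $ i = k x $ i + (x $ i / R\<^sup>2) *\<^sub>R f x" for i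
      by (simp add: k_def f_def)
    have "g x $ i * cnj (G x $ i) = (gauss R x *\<^sub>R g x $ i) * cnj (P x $ i) - (x $ i / R\<^sup>2) *\<^sub>R ((gauss R x *\<^sub>R g x $ i) * cnj (\<psi> x))" for i
      by (simp add: G_def algebra_simps)
    then have "g x $ i * cnj (G x $ i) = k x $ i * cnj (P x $ i) + (1 / R\<^sup>2) *\<^sub>R (f x * cnj (x $ i *\<^sub>R P x $ i))
        - (1 / R\<^sup>2) *\<^sub>R ((x $ i *\<^sub>R k x $ i + ((x $ i * x $ i) / R\<^sup>2) *\<^sub>R f x) * cnj (\<psi> x))" for i
      unfolding cg by (simp add: algebra_simps)
    then have "(\<Sum>i\<in>UNIV. g x $ i * cnj (G x $ i)) = (\<Sum>i\<in>UNIV. k x $ i * cnj (P x $ i))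
        + (1 / R\<^sup>2) *\<^sub>R (f x * cnj (radial P x))
        - (1 / R\<^sup>2) *\<^sub>R ((radial k x + ((\<Sum>i\<in>UNIV. x $ i * x $ i) / R\<^sup>2) *\<^sub>R f x) * cnj (\<psi> x))"
      by (simp add: sum.distrib sum_subtractf radial_def scaleR_sum_right[symmetric] sum_distrib_left[symmetric]
          sum_distrib_right[symmetric] sum_divide_distrib scaleR_sum_left del: complex_cnj_scaleR scaleR_scaleR)
    moreover have "(\<Sum>i\<in>UNIV. x $ i * x $ i) = (norm x)\<^sup>2"
      by (simp add: power2_norm_eq_inner inner_vec_def)
    ultimately show ?thesis by (simp add: radP)
  qed
  have q\<rho>2: "in_Lp 2 (\<lambda>x. radial k x + ((norm x)\<^sup>2 / R\<^sup>2) *\<^sub>R f x)"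
    using in_L2_diff[OF \<Psi>2 q2] by (simp add: scaleR_2)
  note iA = integrable_sum_cnj(1)[OF k2 P2]
  note iB = integrable_mult_cnj(1)[OF f2 in_L2_dil_diff[OF q2, of h]]
  note iC = integrable_mult_cnj(1)[OF q\<rho>2 \<psi>2]
  have mg: "grad u \<in> borel_measurable lebesgue" "grad (loc_gen R h u) \<in> borel_measurable lebesgue"
    "g \<in> borel_measurable lebesgue" "G \<in> borel_measurable lebesgue"
    using in_L2_measurable in_H1_L2_grad H1_grad_in_H1[OF ug] H1_grad_in_H1[OF LG] H1_gradD(2)[OF ug] H1_gradD(2)[OF LG] by blast+
  have "(LINT x|lebesgue. (\<Sum>i\<in>UNIV. grad u x $ i * cnj (grad (loc_gen R h u) x $ i)))
      = (LINT x|lebesgue. (\<Sum>i\<in>UNIV. g x $ i * cnj (G x $ i)))"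
  proof (rule integral_cong_AE)
    show "AE x in lebesgue. (\<Sum>i\<in>UNIV. grad u x $ i * cnj (grad (loc_gen R h u) x $ i)) = (\<Sum>i\<in>UNIV. g x $ i * cnj (G x $ i))"
      using grad_AE[OF ug] grad_AE[OF LG] by eventually_elim simp
  qed (intro measurable_sum_cnj mg)+
  also have "\<dots> = (LINT x|lebesgue. (\<Sum>i\<in>UNIV. k x $ i * cnj (P x $ i))) + (1 / R\<^sup>2) *\<^sub>R pair_L2 f (dil_diff h (radial k))
      - (1 / R\<^sup>2) *\<^sub>R pair_L2 (\<lambda>x. radial k x + ((norm x)\<^sup>2 / R\<^sup>2) *\<^sub>R f x) \<psi>"
    unfolding pt pair_L2_def using iA iB iC by simp
  finally have E1: "(LINT x|lebesgue. (\<Sum>i\<in>UNIV. grad u x $ i * cnj (grad (loc_gen R h u) x $ i)))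
      = (LINT x|lebesgue. (\<Sum>i\<in>UNIV. k x $ i * cnj (P x $ i))) + (1 / R\<^sup>2) *\<^sub>R pair_L2 f (dil_diff h (radial k))
      - (1 / R\<^sup>2) *\<^sub>R pair_L2 (\<lambda>x. radial k x + ((norm x)\<^sup>2 / R\<^sup>2) *\<^sub>R f x) \<psi>" .
  \<comment> \<open>Skew symmetry moves the quotient from x . k back to \<open>f\<close>, for which
    the weak limit is available. The conjugation is invisible to the real part, so this term merges
    with the remaining one and doubles \<open>radial k\<close>.\<close>
  have sw: "pair_L2 f (dil_diff h (radial k)) = - cnj (pair_L2 (radial k) \<psi>)"
    unfolding pair_L2_cnj \<psi>_def by (rule pair_L2_dil_diff[OF f2 q2])
  from arg_cong[where f = Re, OF E1]
  have E: "Re (LINT x|lebesgue. (\<Sum>i\<in>UNIV. grad u x $ i * cnj (grad (loc_gen R h u) x $ i)))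
      = Re (LINT x|lebesgue. (\<Sum>i\<in>UNIV. k x $ i * cnj (P x $ i)))
        - 1 / R\<^sup>2 * (Re (pair_L2 (radial k) \<psi>) + Re (pair_L2 (\<lambda>x. radial k x + ((norm x)\<^sup>2 / R\<^sup>2) *\<^sub>R f x) \<psi>))"
    by (simp add: sw diff_divide_distrib add_divide_distrib)
  have "pair_L2 (radial k) \<psi> + pair_L2 (\<lambda>x. radial k x + ((norm x)\<^sup>2 / R\<^sup>2) *\<^sub>R f x) \<psi>
      = (LINT x|lebesgue. (2 *\<^sub>R radial k x + ((norm x)\<^sup>2 / R\<^sup>2) *\<^sub>R f x) * cnj (\<psi> x))"
    unfolding pair_L2_def using integrable_mult_cnj(1)[OF q2 \<psi>2] iC
    by (subst Bochner_Integration.integral_add[symmetric]) (auto simp: algebra_simps scaleR_2)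
  then have E2: "Re (pair_L2 (radial k) \<psi>) + Re (pair_L2 (\<lambda>x. radial k x + ((norm x)\<^sup>2 / R\<^sup>2) *\<^sub>R f x) \<psi>)
      = Re (LINT x|lebesgue. (2 *\<^sub>R radial k x + ((norm x)\<^sup>2 / R\<^sup>2) *\<^sub>R f x) * cnj (\<psi> x))"
    by (metis plus_complex.simps(1))
  define S where "S s = (LINT x|lebesgue. (\<Sum>i\<in>UNIV. k x $ i * cnj (dil s k x $ i)))" for s
  note iS = integrable_sum_cnj(1)[OF k2 in_L2_dil(1)[OF k2]]
  have "(\<Sum>i\<in>UNIV. k x $ i * cnj (P x $ i)) = (exp h / (2 * h)) *\<^sub>R (\<Sum>i\<in>UNIV. k x $ i * cnj (dil h k x $ i))
      - (exp (- h) / (2 * h)) *\<^sub>R (\<Sum>i\<in>UNIV. k x $ i * cnj (dil (- h) k x $ i))" for x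
    unfolding scaleR_sum_right sum_subtractf[symmetric] P_def
    by (intro sum.cong refl) (simp add: scaleR_diff_right right_diff_distrib)
  then have "(LINT x|lebesgue. (\<Sum>i\<in>UNIV. k x $ i * cnj (P x $ i))) = (exp h / (2 * h)) *\<^sub>R S h - (exp (- h) / (2 * h)) *\<^sub>R S (- h)"
    unfolding S_def using iS[of h] iS[of "- h"] by simp
  also have "S (- h) = cnj (S h)" unfolding S_def by (rule pair_vec_dil[OF k2])
  finally have "Re (LINT x|lebesgue. (\<Sum>i\<in>UNIV. k x $ i * cnj (P x $ i))) = (exp h - exp (- h)) / (2 * h) * Re (S h)"
    by (simp add: diff_divide_distrib left_diff_distrib)
  also have "\<dots> \<le> (exp h - exp (- h)) / (2 * h) * (L2_nrm k)\<^sup>2"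
  proof (rule mult_left_mono)
    have "norm (S h) \<le> L2_nrm k * L2_nrm (dil h k)" unfolding S_def by (rule integrable_sum_cnj(2)[OF k2 in_L2_dil(1)[OF k2]])
    then show "Re (S h) \<le> (L2_nrm k)\<^sup>2"
      using complex_Re_le_cmod[of "S h"] in_L2_dil(2)[OF k2] by (simp add: power2_eq_square)
    show "(exp h - exp (- h)) / (2 * h) \<ge> 0" using h by simp
  qed
  finally show ?thesis unfolding E E2 by (simp add: \<psi>_def)
qed

text \<open>The increment of V from x to exp(h) x is the time integral of x . \<nabla>V along the
  ray.\<close>

lemma nonincreasing_along_rays:
  assumes V: "loc_int V" and W: "loc_int W" and VW: "flow_deriv 1 0 (\<lambda>x. complex_of_real (V x)) (\<lambda>x. complex_of_real (W x))"
    and W0: "AE x in lebesgue. W x \<le> (0::real)" and h: "h \<ge> 0"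
  shows "AE x in lebesgue. V (exp h *\<^sub>R x) \<le> V x"
proof -
  obtain V' where V'[measurable]: "V' \<in> borel_measurable borel" and VV': "AE x in lebesgue. V x = V' x"
    by (rule ex_borel_AE_eq[OF loc_int_measurable[OF V]], rule that)
  obtain W1 where W1[measurable]: "W1 \<in> borel_measurable borel" and WW1: "AE x in lebesgue. W x = W1 x"
    by (rule ex_borel_AE_eq[OF loc_int_measurable[OF W]], rule that)
  \<comment> \<open>A representative that is nonpositive everywhere, so that no null set has to be
    followed along the rays.\<close>
  define W' where "W' x = min (W1 x) 0" for x
  have W'[measurable]: "W' \<in> borel_measurable borel" unfolding W'_def by measurable
  have WW': "AE x in lebesgue. W x = W' x" using WW1 W0 by eventually_elim (simp add: W'_def)
  have oc: "loc_int (\<lambda>x. complex_of_real (Z x))" if "loc_int Z" for Z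
    by (rule loc_int_cmult[OF that, of _ "\<lambda>x. 1"]) (use loc_int_measurable[OF that] in auto)
  note lV = oc[OF loc_int_cong_AE[OF V measurable_lebesgue_borel[OF V'] VV']]
  note lW = oc[OF loc_int_cong_AE[OF W measurable_lebesgue_borel[OF W'] WW']]
  have fd: "flow_deriv 1 0 (\<lambda>x. complex_of_real (V' x)) (\<lambda>x. complex_of_real (W' x))"
    by (rule flow_deriv_cong_AE[OF VW])
       (use VV' WW' loc_int_measurable[OF V] loc_int_measurable[OF W] measurable_lebesgue_borel[OF V'] measurable_lebesgue_borel[OF W']
         in \<open>auto elim: eventually_mono\<close>)
  have "AE x in lebesgue. complex_of_real (V' (flow 1 0 h x)) - complex_of_real (V' x)
      = (LINT s:{0..h}|lborel. complex_of_real (W' (flow 1 0 s x)))"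
    by (rule flow_increment[OF _ _ lV lW fd _ h]) (auto intro: measurable_compose[OF V'] measurable_compose[OF W'])
  then have "AE x in lebesgue. V' (exp h *\<^sub>R x) \<le> V' x"
  proof eventually_elim
    case (elim x)
    have "(LINT s:{0..h}|lborel. complex_of_real (W' (flow 1 0 s x))) = complex_of_real (LINT s:{0..h}|lborel. W' (flow 1 0 s x))"
      by (rule set_integral_complex_of_real)
    with elim have "complex_of_real (V' (exp h *\<^sub>R x) - V' x) = complex_of_real (LINT s:{0..h}|lborel. W' (flow 1 0 s x))"
      by (simp add: flow_def)
    then have "V' (exp h *\<^sub>R x) - V' x = (LINT s:{0..h}|lborel. W' (flow 1 0 s x))" by (simp only: of_real_eq_iff)
    also have "\<dots> = - (LINT s:{0..h}|lborel. - W' (flow 1 0 s x))" by (simp add: set_lebesgue_integral_def)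
    also have "\<dots> \<le> 0"
      unfolding set_lebesgue_integral_def neg_le_0_iff_le
      by (intro integral_nonneg_AE AE_I2) (auto simp: W'_def intro: mult_nonneg_nonpos)
    finally show ?case by simp
  qed
  with VV' AE_lebesgue_dilate[OF VV', of h] show ?thesis by eventually_elim simp
qed

lemma weighted_dil_swap:
  fixes F :: "real^3 \<Rightarrow> complex" and W :: "real^3 \<Rightarrow> real"
  assumes [measurable]: "W \<in> borel_measurable lebesgue" "F \<in> borel_measurable lebesgue"
    and i: "integrable lebesgue (\<lambda>x. \<bar>W x\<bar> * (norm (dil (- s) F x))\<^sup>2)"
  shows "integrable lebesgue (\<lambda>x. \<bar>W (exp s *\<^sub>R x)\<bar> * (norm (F x))\<^sup>2)"
    "(LINT x|lebesgue. \<bar>W (exp s *\<^sub>R x)\<bar> * (norm (F x))\<^sup>2) = (LINT x|lebesgue. \<bar>W x\<bar> * (norm (dil (- s) F x))\<^sup>2)"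
proof -
  have e: "\<bar>W (exp s *\<^sub>R x)\<bar> * (norm (dil (- s) F (exp s *\<^sub>R x)))\<^sup>2 = exp (- 3 * s) * (\<bar>W (exp s *\<^sub>R x)\<bar> * (norm (F x))\<^sup>2)" for x
  proof -
    have "(exp (3 * (- s) / 2))\<^sup>2 = exp (- 3 * s)" by (simp add: exp_of_nat_mult[symmetric])
    then show ?thesis by (simp add: dil_def power_mult_distrib exp_add[symmetric])
  qed
  have e3: "exp s ^ 3 * exp (- 3 * s) = 1" by (simp add: exp_of_nat_mult[symmetric] exp_add[symmetric])
  have "integrable lebesgue (\<lambda>x. exp (- 3 * s) * (\<bar>W (exp s *\<^sub>R x)\<bar> * (norm (F x))\<^sup>2))"
    using integrable_lebesgue_affine[OF _ i, of "exp s" 0] by (simp add: e)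
  from integrable_mult_right[OF this, of "exp s ^ 3"]
  show "integrable lebesgue (\<lambda>x. \<bar>W (exp s *\<^sub>R x)\<bar> * (norm (F x))\<^sup>2)"
    using e3 by (simp add: mult.assoc[symmetric])
  have "exp (- 3 * s) * (LINT x|lebesgue. \<bar>W (exp s *\<^sub>R x)\<bar> * (norm (F x))\<^sup>2)
      = 1 / exp s ^ 3 * (LINT x|lebesgue. \<bar>W x\<bar> * (norm (dil (- s) F x))\<^sup>2)"
    using integral_lebesgue_affine[OF _ borel_measurable_integrable[OF i], of "exp s" 0] by (simp add: e)
  then have "(exp s ^ 3 * exp (- 3 * s)) * (LINT x|lebesgue. \<bar>W (exp s *\<^sub>R x)\<bar> * (norm (F x))\<^sup>2)
      = (LINT x|lebesgue. \<bar>W x\<bar> * (norm (dil (- s) F x))\<^sup>2)"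
    by (simp only: mult.assoc) simp
  then show "(LINT x|lebesgue. \<bar>W (exp s *\<^sub>R x)\<bar> * (norm (F x))\<^sup>2) = (LINT x|lebesgue. \<bar>W x\<bar> * (norm (dil (- s) F x))\<^sup>2)"
    unfolding e3 by simp
qed

lemma dil_dil: "dil s (dil t f) = dil (s + t) f"
  by (simp add: dil_def fun_eq_iff exp_add[symmetric] scaleR_scaleR add.commute add_divide_distrib distrib_left)

text \<open>Moving the inverse dilation across turns the difference of the two pairings into an
  integral of V(x) - V(exp(h) x) against Re(f cnj D), D being the dilate of f. The difference of V
  is nonnegative, so Re(f cnj D) may be replaced by the mean of the squares; only then is the
  increment of V written through W and the dilation carried back to f, where \<open>B\<close>
  applies. The increment is at most \<open>h * B\<close>, and the quotient divides by
  \<open>2 * h\<close>.\<close>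

lemma potential_term_bound:
  fixes V W :: "real^3 \<Rightarrow> real"
  assumes \<delta>: "\<delta> > 3/2" and V: "in_Lp \<delta> V" and W: "in_Lp \<delta> W" and VW: "x_dot_grad V W"
    and W0: "AE x in lebesgue. W x \<le> 0" and fk: "H1_grad f k" and h: "0 < h"
    and B: "\<And>\<sigma>. \<bar>\<sigma>\<bar> \<le> h \<Longrightarrow> (LINT x|lebesgue. \<bar>W x\<bar> * (norm (dil \<sigma> f x))\<^sup>2) \<le> B"
  shows "Re (LINT x|lebesgue. complex_of_real (V x) * f x * cnj (dil_diff h f x)) \<le> B / 2"
proof -
  have lV: "loc_int V" and lW: "loc_int W" using V W \<delta> by (auto intro: loc_int_Lp)
  note mV[measurable] = loc_int_measurable[OF lV] and mW[measurable] = loc_int_measurable[OF lW]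
  note fd = flow_deriv_x_dot_grad[OF VW lV]
  have mono: "AE x in lebesgue. V (exp h *\<^sub>R x) \<le> V x"
    by (rule nonincreasing_along_rays[OF lV lW fd W0]) (use h in simp)
  note mf[measurable] = in_L2_measurable[OF H1_gradD(1)[OF fk]]
  note md[measurable] = in_L2_measurable[OF H1_gradD(1)[OF H1_grad_dil[OF fk]]]
  note mVh[measurable] = measurable_lebesgue_dilate[OF mV, of h]
  obtain C where C: "C \<ge> 0" "\<And>f g. H1_grad f g \<Longrightarrow> integrable lebesgue (\<lambda>x. \<bar>W x\<bar> * (norm (f x))\<^sup>2)"
    "\<And>f g. H1_grad f g \<Longrightarrow> (LINT x|lebesgue. \<bar>W x\<bar> * (norm (f x))\<^sup>2) \<le> C * (H1_nrm f)\<^sup>2"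
    by (rule potential_bound[OF \<delta> W], rule that)
  note iV = integrable_potential_form[OF \<delta> V fk H1_grad_dil[OF fk]]
  let ?D = "dil h f"
  have swap: "(LINT x|lebesgue. complex_of_real (V x) * f x * cnj (dil (- h) f x))
      = (LINT x|lebesgue. complex_of_real (V (exp h *\<^sub>R x)) * ?D x * cnj (f x))"
    and iVh: "integrable lebesgue (\<lambda>x. complex_of_real (V (exp h *\<^sub>R x)) * ?D x * cnj (f x))"
  proof -
    have m: "(\<lambda>x. complex_of_real (V x) * f x) \<in> borel_measurable lebesgue" by measurable
    have d: "dil h (\<lambda>x. complex_of_real (V x) * f x) x = complex_of_real (V (exp h *\<^sub>R x)) * ?D x" for x
      by (simp add: dil_def)
    show "(LINT x|lebesgue. complex_of_real (V x) * f x * cnj (dil (- h) f x))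
      = (LINT x|lebesgue. complex_of_real (V (exp h *\<^sub>R x)) * ?D x * cnj (f x))"
      using integral_dil_swap[OF m mf, of "- h"] by (simp add: d)
    have "integrable lebesgue (\<lambda>x. complex_of_real (V (exp h *\<^sub>R x)) * f (exp h *\<^sub>R x) * cnj (dil (- h) f (exp h *\<^sub>R x)))"
      using integrable_lebesgue_affine[OF _ iV[of "- h"], of "exp h" 0] by simp
    moreover have "complex_of_real (V (exp h *\<^sub>R x)) * ?D x * cnj (f x)
        = exp (3 * h) *\<^sub>R (complex_of_real (V (exp h *\<^sub>R x)) * f (exp h *\<^sub>R x) * cnj (dil (- h) f (exp h *\<^sub>R x)))" for x
    proof -
      have "exp (3 * h) * exp (3 * (- h) / 2) = exp (3 * h / 2)" by (simp add: exp_add[symmetric])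
      then show ?thesis by (simp add: dil_def exp_add[symmetric])
    qed
    ultimately show "integrable lebesgue (\<lambda>x. complex_of_real (V (exp h *\<^sub>R x)) * ?D x * cnj (f x))" by simp
  qed
  \<comment> \<open>The arithmetic mean of the squares dominates Re(f cnj D). Unlike that product it
    is a sum of two densities, each of which turns into the density of a dilated f when W is
    rescaled.\<close>
  define \<Theta> where "\<Theta> x = ((norm (f x))\<^sup>2 + (norm (?D x))\<^sup>2) / 2" for x
  have m\<Theta>[measurable]: "\<Theta> \<in> borel_measurable lebesgue" unfolding \<Theta>_def by measurable
  have "(LINT x|lebesgue. complex_of_real (V x) * f x * cnj (dil_diff h f x))
      = (LINT x|lebesgue. (1 / (2 * h)) *\<^sub>R (complex_of_real (V x) * f x * cnj (?D x) - complex_of_real (V x) * f x * cnj (dil (- h) f x)))"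
    by (simp add: dil_diff_def right_diff_distrib)
  also have "\<dots> = (1 / (2 * h)) *\<^sub>R ((LINT x|lebesgue. complex_of_real (V x) * f x * cnj (?D x))
      - (LINT x|lebesgue. complex_of_real (V (exp h *\<^sub>R x)) * ?D x * cnj (f x)))"
    using iV[of h] iV[of "- h"] by (simp add: swap)
  finally have E0: "Re (LINT x|lebesgue. complex_of_real (V x) * f x * cnj (dil_diff h f x))
      = 1 / (2 * h) * (Re (LINT x|lebesgue. complex_of_real (V x) * f x * cnj (?D x))
      - Re (LINT x|lebesgue. complex_of_real (V (exp h *\<^sub>R x)) * ?D x * cnj (f x)))"
    by simp
  have E: "Re (LINT x|lebesgue. complex_of_real (V x) * f x * cnj (dil_diff h f x))
      = 1 / (2 * h) * (LINT x|lebesgue. Re (complex_of_real (V x) * f x * cnj (?D x)) - Re (complex_of_real (V (exp h *\<^sub>R x)) * ?D x * cnj (f x)))"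
    unfolding E0 Bochner_Integration.integral_diff[OF integrable_Re[OF iV[of h]] integrable_Re[OF iVh]]
      integral_Re[OF iV[of h]] integral_Re[OF iVh] ..
  have iW: "integrable lebesgue (\<lambda>x. \<bar>W x\<bar> * (norm (dil s f x))\<^sup>2)" for s by (rule C(2)[OF H1_grad_dil[OF fk]])
  have s1: "integrable lebesgue (\<lambda>x. \<bar>W (exp s *\<^sub>R x)\<bar> * (norm (f x))\<^sup>2)"
     "(LINT x|lebesgue. \<bar>W (exp s *\<^sub>R x)\<bar> * (norm (f x))\<^sup>2) = (LINT x|lebesgue. \<bar>W x\<bar> * (norm (dil (- s) f x))\<^sup>2)" for s
    by (rule weighted_dil_swap[OF mW mf iW])+
  have s2: "integrable lebesgue (\<lambda>x. \<bar>W (exp s *\<^sub>R x)\<bar> * (norm (?D x))\<^sup>2)"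
     "(LINT x|lebesgue. \<bar>W (exp s *\<^sub>R x)\<bar> * (norm (?D x))\<^sup>2) = (LINT x|lebesgue. \<bar>W x\<bar> * (norm (dil (h - s) f x))\<^sup>2)" for s
    using weighted_dil_swap[OF mW md, of s h] iW[of "h - s"] by (simp_all add: dil_dil add.commute[of _ h])
  have nW: "norm (complex_of_real (\<Theta> x) * cnj (complex_of_real (W (exp (1 * s) *\<^sub>R x))))
      = (\<bar>W (exp s *\<^sub>R x)\<bar> * (norm (f x))\<^sup>2 + \<bar>W (exp s *\<^sub>R x)\<bar> * (norm (?D x))\<^sup>2) / 2" for s x
    unfolding norm_mult complex_mod_cnj norm_of_real by (simp add: \<Theta>_def algebra_simps add_divide_distrib)
  have oc: "loc_int (\<lambda>x. complex_of_real (Z x))" if "loc_int Z" for Z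
    by (rule loc_int_cmult[OF that, of _ "\<lambda>x. 1"]) (use loc_int_measurable[OF that] in auto)
  have iN: "integrable lebesgue (\<lambda>x. complex_of_real (\<Theta> x) * cnj (complex_of_real (W (exp (1 * s) *\<^sub>R x))))" for s
  proof (rule Bochner_Integration.integrable_bound)
    show "integrable lebesgue (\<lambda>x. (\<bar>W (exp s *\<^sub>R x)\<bar> * (norm (f x))\<^sup>2 + \<bar>W (exp s *\<^sub>R x)\<bar> * (norm (?D x))\<^sup>2) / 2)"
      using s1(1)[of s] s2(1)[of s] by simp
    have [measurable]: "(\<lambda>x. W (exp (1 * s) *\<^sub>R x)) \<in> borel_measurable lebesgue" using measurable_lebesgue_dilate[OF mW, of s] by simp
    show "(\<lambda>x. complex_of_real (\<Theta> x) * cnj (complex_of_real (W (exp (1 * s) *\<^sub>R x)))) \<in> borel_measurable lebesgue"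
      by measurable
  qed (unfold nW, simp)
  have bN: "(LINT x|lebesgue. norm (complex_of_real (\<Theta> x) * cnj (complex_of_real (W (exp (1 * s) *\<^sub>R x))))) \<le> B" if "s \<in> {0..h}" for s
  proof -
    have "(LINT x|lebesgue. norm (complex_of_real (\<Theta> x) * cnj (complex_of_real (W (exp (1 * s) *\<^sub>R x)))))
      = ((LINT x|lebesgue. \<bar>W x\<bar> * (norm (dil (- s) f x))\<^sup>2) + (LINT x|lebesgue. \<bar>W x\<bar> * (norm (dil (h - s) f x))\<^sup>2)) / 2"
      unfolding nW using s1[of s] s2[of s] by simp
    also have "\<dots> \<le> B" using B[of "- s"] B[of "h - s"] that by simp
    finally show ?thesis .
  qed
  have mc: "(\<lambda>x. complex_of_real (\<Theta> x)) \<in> borel_measurable lebesgue" by measurable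
  note AV = averaging[OF oc[OF lV] oc[OF lW] fd less_imp_le[OF h] mc iN bN]
  have AV1: "integrable lebesgue (\<lambda>x. complex_of_real (\<Theta> x) * cnj (complex_of_real (V (exp (1 * h) *\<^sub>R x)) - complex_of_real (V x)))"
    by (rule AV(1))
  have AV2: "(LINT x|lebesgue. complex_of_real (\<Theta> x) * cnj (complex_of_real (V (exp (1 * h) *\<^sub>R x)) - complex_of_real (V x)))
      = (LINT s:{0..h}|lborel. (LINT x|lebesgue. complex_of_real (\<Theta> x) * cnj (complex_of_real (W (exp (1 * s) *\<^sub>R x)))))"
    by (rule AV(2))
  have AV3: "set_integrable lborel {0..h} (\<lambda>s. LINT x|lebesgue. complex_of_real (\<Theta> x) * cnj (complex_of_real (W (exp (1 * s) *\<^sub>R x))))"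
    by (rule AV(3))
  have nB: "norm (LINT x|lebesgue. complex_of_real (\<Theta> x) * cnj (complex_of_real (V (exp (1 * h) *\<^sub>R x)) - complex_of_real (V x))) \<le> h * B"
    unfolding AV2
  proof (rule norm_set_integral_le[OF AV3])
    show "norm (LINT x|lebesgue. complex_of_real (\<Theta> x) * cnj (complex_of_real (W (exp (1 * s) *\<^sub>R x)))) \<le> B" if "s \<in> {0..h}" for s
      by (rule order_trans[OF integral_norm_bound bN[OF that]])
  qed (use h in simp)
  have eR: "complex_of_real (\<Theta> x) * cnj (complex_of_real (V (exp (1 * h) *\<^sub>R x)) - complex_of_real (V x))
      = complex_of_real (\<Theta> x * (V (exp h *\<^sub>R x) - V x))" for x by simp
  have bV: "\<bar>LINT x|lebesgue. \<Theta> x * (V (exp h *\<^sub>R x) - V x)\<bar> \<le> h * B"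
    using nB unfolding eR integral_complex_of_real norm_of_real .
  have iV': "integrable lebesgue (\<lambda>x. \<Theta> x * (V (exp h *\<^sub>R x) - V x))"
    using AV1 unfolding eR complex_of_real_integrable_eq .
  have "(LINT x|lebesgue. Re (complex_of_real (V x) * f x * cnj (?D x)) - Re (complex_of_real (V (exp h *\<^sub>R x)) * ?D x * cnj (f x)))
      \<le> (LINT x|lebesgue. - (\<Theta> x * (V (exp h *\<^sub>R x) - V x)))"
  proof (rule integral_mono_AE)
    show "integrable lebesgue (\<lambda>x. Re (complex_of_real (V x) * f x * cnj (?D x)) - Re (complex_of_real (V (exp h *\<^sub>R x)) * ?D x * cnj (f x)))"
      by (intro Bochner_Integration.integrable_diff integrable_Re iV iVh)
    show "integrable lebesgue (\<lambda>x. - (\<Theta> x * (V (exp h *\<^sub>R x) - V x)))" using iV' by simp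
    show "AE x in lebesgue. Re (complex_of_real (V x) * f x * cnj (?D x)) - Re (complex_of_real (V (exp h *\<^sub>R x)) * ?D x * cnj (f x))
        \<le> - (\<Theta> x * (V (exp h *\<^sub>R x) - V x))"
      using mono
    proof eventually_elim
      case (elim x)
      have "Re (f x * cnj (?D x)) \<le> norm (f x) * norm (?D x)"
        using complex_Re_le_cmod[of "f x * cnj (?D x)"] by (simp add: norm_mult)
      also have "\<dots> \<le> \<Theta> x"
        using sum_squares_bound[of "norm (f x)" "norm (?D x)"] by (simp add: \<Theta>_def)
      finally have "(V x - V (exp h *\<^sub>R x)) * Re (f x * cnj (?D x)) \<le> (V x - V (exp h *\<^sub>R x)) * \<Theta> x"
        using elim by (intro mult_left_mono) auto
      moreover have "Re (complex_of_real (V x) * f x * cnj (?D x)) - Re (complex_of_real (V (exp h *\<^sub>R x)) * ?D x * cnj (f x))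
          = (V x - V (exp h *\<^sub>R x)) * Re (f x * cnj (?D x))"
        by (simp add: algebra_simps)
      ultimately show ?case by (simp add: algebra_simps)
    qed
  qed
  also have "\<dots> \<le> h * B" using bV by simp
  finally show ?thesis unfolding E using h by (simp add: field_simps)
qed

section \<open>The nonlinear contribution\<close>

definition nonlin :: "real \<Rightarrow> real \<Rightarrow> (real^3 \<Rightarrow> complex) \<Rightarrow> real^3 \<Rightarrow> complex" where
  "nonlin b R u x = (norm x powr (- b) * (cmod (u x))\<^sup>2 * gauss R x) *\<^sub>R u x"

lemma pair_N_loc_gen:
  "pair_N b u (loc_gen R h u) = (LINT x|lebesgue. nonlin b R u x * cnj (dil_diff h (\<lambda>y. gauss R y *\<^sub>R u y) x))"
  unfolding pair_N_def loc_gen_def nonlin_def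
  by (intro Bochner_Integration.integral_cong refl) (simp add: scaleR_conv_of_real mult_ac)

lemma nonlin_measurable:
  assumes [measurable]: "u \<in> borel_measurable lebesgue" shows "nonlin b R u \<in> borel_measurable lebesgue"
proof -
  note [measurable] = measurable_norm_powr
  show ?thesis unfolding nonlin_def[abs_def] by measurable
qed

text \<open>One factor |x| compensates the singularity, |x|^(1-b) being at most 1 + |x|, and the
  Gaussian then bounds the weight by 1 + R. The cube of |u| is square integrable by the Sobolev
  inequality, and 64 is the root of 4096.\<close>

lemma nonlin_L2:
  assumes b: "0 < b" "b < 1" and ug: "H1_grad u g" and R: "R > 0"
  shows "in_Lp 2 (\<lambda>x. norm x powr 1 *\<^sub>R nonlin b R u x)"
    and "L2_nrm (\<lambda>x. norm x powr 1 *\<^sub>R nonlin b R u x) \<le> (1 + R) * (64 * L2_nrm g ^ 3)"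
proof -
  note mu[measurable] = in_L2_measurable[OF H1_gradD(1)[OF ug]]
  have m: "(\<lambda>x. norm x powr 1 *\<^sub>R nonlin b R u x) \<in> borel_measurable lebesgue"
    by (intro borel_measurable_scaleR measurable_norm_powr nonlin_measurable mu)
  define U where "U x = (cmod (u x))\<^sup>2 *\<^sub>R u x" for x
  have U3: "norm (U x) = norm (u x) ^ 3" for x by (simp add: U_def power2_eq_square power3_eq_cube)
  have nU: "(norm (U x))\<^sup>2 = norm (u x) ^ 6" for x unfolding U3 by (simp add: power_mult[symmetric])
  have mU: "U \<in> borel_measurable lebesgue" unfolding U_def[abs_def] by measurable
  have U2: "in_Lp 2 U" unfolding in_L2_iff nU using mU Sobolev_inequality(1)[OF ug] by simp
  have "(L2_nrm U)\<^sup>2 \<le> (64 * L2_nrm g ^ 3)\<^sup>2"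
    unfolding L2_nrm_power2 nU using Sobolev_inequality(2)[OF ug] by (simp add: power_mult_distrib power_mult[symmetric])
  then have LU: "L2_nrm U \<le> 64 * L2_nrm g ^ 3" by (rule power2_le_imp_le) (simp add: L2_nrm_nonneg)
  have le: "norm (norm x powr 1 *\<^sub>R nonlin b R u x) \<le> (1 + R) * norm (U x)" for x
  proof (cases "x = 0")
    case True
    have "0 \<le> (1 + R) * norm (U x)" using R by (intro mult_nonneg_nonneg) auto
    then show ?thesis using True by simp
  next
    case False
    have "norm x powr 1 * norm x powr (- b) = norm x powr (1 + - b)" by (rule powr_add[symmetric])
    also have "\<dots> \<le> 1 + norm x"
    proof (cases "norm x \<le> 1")
      case True
      then have "norm x powr (1 + - b) \<le> 1" using b by (intro powr_le1) auto
      then show ?thesis using norm_ge_zero[of x] by linarith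
    next
      case False
      then have "norm x powr (1 + - b) \<le> norm x powr 1" using b by (intro powr_mono) auto
      then show ?thesis by simp
    qed
    finally have A: "norm x powr 1 * norm x powr (- b) \<le> 1 + norm x" .
    have "norm x powr 1 * norm x powr (- b) * gauss R x \<le> (1 + norm x) * gauss R x"
      by (rule mult_right_mono[OF A less_imp_le[OF gauss_pos]])
    also have "\<dots> \<le> 1 + R" using gauss_le_1[of R x] norm_gauss_le(1)[OF R, of x] by (simp add: distrib_right)
    finally have B: "norm x powr 1 * norm x powr (- b) * gauss R x \<le> 1 + R" .
    have "norm (norm x powr 1 *\<^sub>R nonlin b R u x) = (norm x powr 1 * norm x powr (- b) * gauss R x) * norm (U x)"
      unfolding nonlin_def U_def using gauss_pos[of R x] by (simp add: abs_mult mult_ac)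
    also have "\<dots> \<le> (1 + R) * norm (U x)" by (rule mult_right_mono[OF B norm_ge_zero])
    finally show ?thesis .
  qed
  show "in_Lp 2 (\<lambda>x. norm x powr 1 *\<^sub>R nonlin b R u x)"
    by (rule in_L2_bound(1)[OF U2 m]) (use le in auto)
  have "L2_nrm (\<lambda>x. norm x powr 1 *\<^sub>R nonlin b R u x) \<le> (1 + R) * L2_nrm U"
    by (rule in_L2_bound(2)[OF U2 m]) (use le R in auto)
  also have "\<dots> \<le> (1 + R) * (64 * L2_nrm g ^ 3)" using R by (intro mult_left_mono LU) auto
  finally show "L2_nrm (\<lambda>x. norm x powr 1 *\<^sub>R nonlin b R u x) \<le> (1 + R) * (64 * L2_nrm g ^ 3)" .
qed

text \<open>The counterpart of the factor |x| spent on the nonlinearity: x . k divided by |x| is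
  still controlled by k.\<close>

lemma radial_L2:
  assumes k: "in_Lp 2 k"
  shows "in_Lp 2 (\<lambda>x. norm x powr (- 1) *\<^sub>R radial k x)"
    and "L2_nrm (\<lambda>x. norm x powr (- 1) *\<^sub>R radial k x) \<le> L2_nrm k"
proof -
  have m: "(\<lambda>x. norm x powr (- 1) *\<^sub>R radial k x) \<in> borel_measurable lebesgue"
    by (intro borel_measurable_scaleR measurable_norm_powr measurable_radial in_L2_measurable k)
  have le: "norm (norm x powr (- 1) *\<^sub>R radial k x) \<le> 1 * norm (k x)" for x
  proof (cases "x = 0")
    case True then show ?thesis by simp
  next
    case False
    have "norm (norm x powr (- 1) *\<^sub>R radial k x) = norm x powr (- 1) * norm (radial k x)" by simp
    also have "\<dots> \<le> norm x powr (- 1) * (norm x * norm (k x))" by (intro mult_left_mono norm_radial_le) auto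
    also have "\<dots> = 1 * norm (k x)" using False by (simp add: powr_minus)
    finally show ?thesis .
  qed
  show "in_Lp 2 (\<lambda>x. norm x powr (- 1) *\<^sub>R radial k x)"
    by (rule in_L2_bound(1)[OF k m AE_I2[OF le]])
  show "L2_nrm (\<lambda>x. norm x powr (- 1) *\<^sub>R radial k x) \<le> L2_nrm k"
    using in_L2_bound(2)[OF k m AE_I2[OF le]] by simp
qed

lemma nonlin_pair:
  "nonlin b R u x * cnj (gauss R x *\<^sub>R u x) = complex_of_real (norm x powr (- b) * (gauss R x)\<^sup>2 * cmod (u x) ^ 4)"
proof -
  have "nonlin b R u x * cnj (gauss R x *\<^sub>R u x) = (norm x powr (- b) * (gauss R x)\<^sup>2 * (cmod (u x))\<^sup>2) *\<^sub>R (u x * cnj (u x))"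
    by (simp add: nonlin_def power2_eq_square mult_ac)
  also have "\<dots> = complex_of_real (norm x powr (- b) * (gauss R x)\<^sup>2 * (cmod (u x))\<^sup>2 * (cmod (u x))\<^sup>2)"
    unfolding mult_cnj_eq_cmod_power2 by (simp add: scaleR_conv_of_real)
  finally show ?thesis by (simp add: power2_eq_square power4_eq_xxxx mult_ac)
qed

section \<open>The nonlinear pairing bounded through Young's inequality\<close>

lemma cmod_Young_quartic: "(cmod z)\<^sup>2 * Re (z * cnj z') \<le> 3/4 * cmod z ^ 4 + 1/4 * cmod z' ^ 4"
proof -
  define a c where "a = cmod z" and "c = cmod z'"
  have ac: "a \<ge> 0" "c \<ge> 0" by (simp_all add: a_def c_def)
  \<comment> \<open>The factorisation of 3 a^4 - 4 a^3 c + c^4, which has a double zero at a = c.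
    Equality there is what makes Young's inequality lossless to first order in the dilation
    parameter.\<close>
  have "0 \<le> (a - c)\<^sup>2 * (3 * a\<^sup>2 + 2 * a * c + c\<^sup>2)" using ac by (intro mult_nonneg_nonneg add_nonneg_nonneg) auto
  also have "\<dots> = 3 * a ^ 4 - 4 * (a ^ 3 * c) + c ^ 4" by algebra
  finally have *: "a ^ 3 * c \<le> 3/4 * a ^ 4 + 1/4 * c ^ 4" by linarith
  have "Re (z * cnj z') \<le> a * c" using complex_Re_le_cmod[of "z * cnj z'"] by (simp add: a_def c_def norm_mult)
  then have "a\<^sup>2 * Re (z * cnj z') \<le> a\<^sup>2 * (a * c)" by (intro mult_left_mono) auto
  also have "\<dots> = a ^ 3 * c" by algebra
  finally show ?thesis using * unfolding a_def c_def by linarith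
qed

lemma gauss_power2: "R > 0 \<Longrightarrow> (gauss R x)\<^sup>2 = exp (- ((norm x)\<^sup>2 / R\<^sup>2))"
proof -
  assume R: "R > 0"
  have "- (norm x)\<^sup>2 / (2 * R\<^sup>2) + - (norm x)\<^sup>2 / (2 * R\<^sup>2) = - ((norm x)\<^sup>2 / R\<^sup>2)" using R by (simp add: field_simps)
  then show ?thesis unfolding gauss_def power2_eq_square[of "exp _"] exp_add[symmetric] by simp
qed

text \<open>\<open>E\<close> is the factor acquired by the quartic density under a dilation by
  \<open>exp \<sigma>\<close>; the bounds supply a dominating function as \<sigma> tends to 0. For
  \<open>\<sigma> \<le> 1/8\<close> one has \<open>exp (2 * \<sigma>) \<le> 3/2\<close>, so
  \<open>E\<close> grows at most like exp(1 + \<rho>/2) and half of the Gaussian decay remains for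
  the linear factor 3 + 4 \<rho>. There 11 = 3 + 8, because t exp(-t) is at most 1 for t =
  \<rho>/2.\<close>

lemma scaling_quotient_bound:
  fixes b \<sigma> \<rho> :: real
  assumes b: "0 < b" "b < 1" and \<sigma>: "0 < \<sigma>" "\<sigma> \<le> 1/8" and \<rho>: "\<rho> \<ge> 0"
  defines "E \<equiv> exp ((3 - b) * \<sigma> + (exp (2 * \<sigma>) - 1) * \<rho>)"
  shows "E * exp (- \<rho>) \<le> exp 1" and "E \<ge> 1" and "(E - 1) / \<sigma> * exp (- \<rho>) \<le> 11 * exp 1"
proof -
  have "1 - 2 * \<sigma> \<le> exp (- 2 * \<sigma>)" using exp_ge_add_one_self[of "- 2 * \<sigma>"] by simp
  then have "3/4 \<le> exp (- 2 * \<sigma>)" using \<sigma> by linarith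
  then have e2: "exp (2 * \<sigma>) \<le> 3/2" by (simp add: exp_minus field_simps)
  have e1: "1 \<le> exp (2 * \<sigma>)" using \<sigma> by simp
  have "exp (2 * \<sigma>) * (1 - exp (- 2 * \<sigma>)) \<le> 2 * (2 * \<sigma>)"
    using exp_ge_add_one_self[of "- 2 * \<sigma>"] e2 \<sigma> by (intro mult_mono) auto
  moreover have "exp (2 * \<sigma>) * (1 - exp (- 2 * \<sigma>)) = exp (2 * \<sigma>) - 1"
    by (simp add: right_diff_distrib exp_add[symmetric])
  ultimately have e3: "exp (2 * \<sigma>) - 1 \<le> 4 * \<sigma>" by simp
  define z where "z = (3 - b) * \<sigma> + (exp (2 * \<sigma>) - 1) * \<rho>"
  have Ez: "E = exp z" by (simp add: E_def z_def)
  have b3: "(3 - b) * \<sigma> \<le> 3 * \<sigma>" "(3 - b) * \<sigma> \<ge> 0" using b \<sigma> by auto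
  have p1: "(exp (2 * \<sigma>) - 1) * \<rho> \<ge> 0" using e1 \<rho> by simp
  have p2: "(exp (2 * \<sigma>) - 1) * \<rho> \<le> 4 * \<sigma> * \<rho>" by (rule mult_right_mono[OF e3 \<rho>])
  have p3: "(exp (2 * \<sigma>) - 1) * \<rho> \<le> 1/2 * \<rho>" using e2 by (intro mult_right_mono \<rho>) auto
  have s34: "\<sigma> * (3 + 4 * \<rho>) = 3 * \<sigma> + 4 * \<sigma> * \<rho>" by (simp add: algebra_simps)
  have z: "0 \<le> z" "z \<le> \<sigma> * (3 + 4 * \<rho>)" "z - \<rho> \<le> 1 + - (\<rho> / 2)"
    unfolding z_def s34 using b3 p1 p2 p3 \<sigma> by linarith+
  show "E \<ge> 1" using z by (simp add: Ez)
  have E\<rho>: "E * exp (- \<rho>) \<le> exp 1 * exp (- (\<rho> / 2))"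
    unfolding Ez exp_add[symmetric] using z(3) by simp
  also have "\<dots> \<le> exp 1 * 1" using \<rho> by (intro mult_left_mono) auto
  finally show "E * exp (- \<rho>) \<le> exp 1" by simp
  have "E * (1 - exp (- z)) \<le> E * z" using exp_ge_add_one_self[of "- z"] by (intro mult_left_mono) (auto simp: Ez)
  moreover have "E * (1 - exp (- z)) = E - 1" by (simp add: Ez right_diff_distrib exp_add[symmetric])
  ultimately have "E - 1 \<le> E * z" by simp
  also have "\<dots> \<le> E * (\<sigma> * (3 + 4 * \<rho>))" by (rule mult_left_mono[OF z(2)]) (simp add: Ez)
  finally have "E - 1 \<le> E * (\<sigma> * (3 + 4 * \<rho>))" .
  then have "(E - 1) / \<sigma> \<le> E * (3 + 4 * \<rho>)" using \<sigma> by (simp add: divide_le_eq mult_ac)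
  then have "(E - 1) / \<sigma> * exp (- \<rho>) \<le> E * (3 + 4 * \<rho>) * exp (- \<rho>)" by (rule mult_right_mono) simp
  also have "\<dots> = (E * exp (- \<rho>)) * (3 + 4 * \<rho>)" by simp
  also have "\<dots> \<le> (exp 1 * exp (- (\<rho> / 2))) * (3 + 4 * \<rho>)" using \<rho> by (intro mult_right_mono E\<rho>) auto
  also have "\<dots> \<le> exp 1 * 11"
  proof -
    have "\<rho> / 2 \<le> exp (\<rho> / 2)" using exp_ge_add_one_self[of "\<rho> / 2"] by linarith
    then have "\<rho> / 2 * exp (- (\<rho> / 2)) \<le> exp (\<rho> / 2) * exp (- (\<rho> / 2))" by (rule mult_right_mono) simp
    then have "\<rho> / 2 * exp (- (\<rho> / 2)) \<le> 1" by (simp only: exp_minus_inverse)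
    moreover have "exp (- (\<rho> / 2)) \<le> 1" using \<rho> by simp
    moreover have "exp (- (\<rho> / 2)) * (3 + 4 * \<rho>) = 3 * exp (- (\<rho> / 2)) + 8 * (\<rho> / 2 * exp (- (\<rho> / 2)))"
      by (simp add: algebra_simps)
    ultimately have "exp (- (\<rho> / 2)) * (3 + 4 * \<rho>) \<le> 11" by linarith
    from mult_left_mono[OF this, of "exp 1"] show ?thesis by (simp add: mult.assoc)
  qed
  finally show "(E - 1) / \<sigma> * exp (- \<rho>) \<le> 11 * exp 1" by simp
qed

text \<open>Young's inequality compares \<open>N \<cdot> f(e\<^sup>-\<^sup>\<sigma> x)\<close> with quartic terms, whose
  integrals scale explicitly; dividing by \<open>\<sigma> \<rightarrow> 0\<close> replaces the
  integration by parts in \<open>N \<cdot> (x \<cdot> \<nabla>f)\<close>, for which \<open>u\<close> is not regular enough.\<close>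

lemma nonlin_radial_lower:
  assumes b: "0 < b" "b < 1" and ug: "H1_grad u g" and R: "R > 0"
    and fk: "H1_grad (\<lambda>x. gauss R x *\<^sub>R u x) k"
  defines "\<theta> \<equiv> \<lambda>x. norm x powr (- b) * (gauss R x)\<^sup>2 * cmod (u x) ^ 4"
  shows "integrable lebesgue \<theta>" and "integrable lebesgue (\<lambda>x. ((3 - b) + 2 * ((norm x)\<^sup>2 / R\<^sup>2)) * \<theta> x)"
    and "Re (LINT x|lebesgue. nonlin b R u x * cnj (radial k x))
      \<ge> - (1/4 * (LINT x|lebesgue. ((3 - b) + 2 * ((norm x)\<^sup>2 / R\<^sup>2)) * \<theta> x))"
proof -
  define f where "f x = gauss R x *\<^sub>R u x" for x
  define \<rho> where "\<rho> x = (norm x)\<^sup>2 / R\<^sup>2" for x :: "real^3"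
  have \<rho>0: "\<rho> x \<ge> 0" for x by (simp add: \<rho>_def)
  define N where "N = nonlin b R u"
  have fk': "H1_grad f k" using fk by (simp add: f_def[abs_def])
  note mu[measurable] = in_L2_measurable[OF H1_gradD(1)[OF ug]]
  note mf[measurable] = in_L2_measurable[OF H1_gradD(1)[OF fk']]
  note [measurable] = measurable_norm_powr
  have [measurable]: "\<rho> \<in> borel_measurable lebesgue" unfolding \<rho>_def by (rule measurable_lebesgue_borel) measurable
  have mN: "N \<in> borel_measurable lebesgue" unfolding N_def by (rule nonlin_measurable[OF mu])
  have m\<theta>[measurable]: "\<theta> \<in> borel_measurable lebesgue" unfolding \<theta>_def by measurable
  define p where "p x = norm x powr (- b) * norm (u x) ^ 4" for x
  have p0: "p x \<ge> 0" for x by (simp add: p_def)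
  obtain C where "C \<ge> 0" and iw: "\<And>f g. H1_grad f g \<Longrightarrow> integrable lebesgue (\<lambda>x. norm x powr (- b) * norm (f x) ^ 4)"
    and "\<And>f g. H1_grad f g \<Longrightarrow> (LINT x|lebesgue. norm x powr (- b) * norm (f x) ^ 4) \<le> C * H1_nrm f ^ 4"
    by (rule nonlinearity_bound[OF b], rule that)
  have ip: "integrable lebesgue p" unfolding p_def by (rule iw[OF ug])
  have \<theta>p: "\<theta> x = exp (- \<rho> x) * p x" for x unfolding \<theta>_def p_def \<rho>_def gauss_power2[OF R] by simp
  have \<theta>0: "\<theta> x \<ge> 0" for x unfolding \<theta>p using p0 by simp
  show i\<theta>: "integrable lebesgue \<theta>"
  proof (rule Bochner_Integration.integrable_bound[OF ip m\<theta>], rule AE_I2)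
    fix x show "norm (\<theta> x) \<le> norm (p x)"
      unfolding \<theta>p using mult_right_mono[of "exp (- \<rho> x)" 1 "p x"] p0[of x] \<rho>0[of x] by simp
  qed
  define E where "E \<sigma> x = exp ((3 - b) * \<sigma> + (exp (2 * \<sigma>) - 1) * \<rho> x)" for \<sigma> x
  have mE[measurable]: "E \<sigma> \<in> borel_measurable lebesgue" for \<sigma> unfolding E_def[abs_def] by measurable
  note SQ = scaling_quotient_bound[OF b _ _ \<rho>0, folded E_def]
  have iE: "integrable lebesgue (\<lambda>x. E \<sigma> x * \<theta> x)" if "0 < \<sigma>" "\<sigma> \<le> 1/8" for \<sigma>
  proof (rule Bochner_Integration.integrable_bound)
    show "integrable lebesgue (\<lambda>x. exp 1 * p x)" using ip by simp
    show "AE x in lebesgue. norm (E \<sigma> x * \<theta> x) \<le> norm (exp 1 * p x)"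
    proof (rule AE_I2)
      fix x show "norm (E \<sigma> x * \<theta> x) \<le> norm (exp 1 * p x)"
        using mult_right_mono[OF SQ(1)[OF that, of x] p0[of x]] p0[of x] \<theta>0[of x] SQ(2)[OF that, of x]
        by (simp add: \<theta>p mult.assoc abs_mult)
    qed
  qed measurable
  \<comment> \<open>With the weight m = |x|^-b \<chi>^-2 one has \<open>\<theta>\<close> = m |f|^4
    and \<open>N\<close> = m |f|^2 f. So \<open>M \<sigma>\<close> is the quartic term of Young's
    inequality at the dilated point, and a change of variables moves the dilation onto m, producing
    \<open>E \<sigma>\<close>.\<close>
  define M where "M \<sigma> x = norm x powr (- b) * inverse ((gauss R x)\<^sup>2) * norm (f (exp (- \<sigma>) *\<^sub>R x)) ^ 4" for \<sigma> x
  have ME: "M \<sigma> (exp \<sigma> *\<^sub>R y) = exp (- 3 * \<sigma>) * (E \<sigma> y * \<theta> y)" for \<sigma> y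
  proof -
    have 1: "norm (exp \<sigma> *\<^sub>R y) powr (- b) = exp (- (b * \<sigma>)) * norm y powr (- b)"
      by (simp add: powr_mult exp_powr_real mult.commute)
    have "\<rho> (exp \<sigma> *\<^sub>R y) = exp (2 * \<sigma>) * \<rho> y"
      by (simp add: \<rho>_def power_mult_distrib exp_double)
    then have 2: "inverse ((gauss R (exp \<sigma> *\<^sub>R y))\<^sup>2) = exp (exp (2 * \<sigma>) * \<rho> y)"
      unfolding gauss_power2[OF R] \<rho>_def[symmetric] by (simp add: exp_minus)
    have "norm (f y) ^ 4 = ((gauss R y)\<^sup>2)\<^sup>2 * norm (u y) ^ 4"
      using gauss_pos[of R y] by (simp add: f_def power_mult_distrib power_mult[symmetric])
    also have "((gauss R y)\<^sup>2)\<^sup>2 = exp (- \<rho> y) * exp (- \<rho> y)"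
      unfolding gauss_power2[OF R] \<rho>_def[symmetric] by (rule power2_eq_square)
    finally have 3: "norm (f (exp (- \<sigma>) *\<^sub>R exp \<sigma> *\<^sub>R y)) ^ 4 = exp (- \<rho> y) * exp (- \<rho> y) * norm (u y) ^ 4"
      by (simp add: exp_add[symmetric])
    have X: "exp (- (b * \<sigma>)) * exp (exp (2 * \<sigma>) * \<rho> y) * exp (- \<rho> y) = exp (- 3 * \<sigma>) * E \<sigma> y"
      unfolding E_def exp_add[symmetric] by (simp add: algebra_simps)
    have "M \<sigma> (exp \<sigma> *\<^sub>R y) = (exp (- (b * \<sigma>)) * exp (exp (2 * \<sigma>) * \<rho> y) * exp (- \<rho> y)) * (exp (- \<rho> y) * p y)"
      unfolding M_def 1 2 3 p_def by (simp only: mult_ac)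
    then show ?thesis unfolding X \<theta>p by (simp only: mult.assoc)
  qed
  have ME': "M \<sigma> x = exp (- 3 * \<sigma>) * (E \<sigma> (exp (- \<sigma>) *\<^sub>R x) * \<theta> (exp (- \<sigma>) *\<^sub>R x))" for \<sigma> x
    using ME[of \<sigma> "exp (- \<sigma>) *\<^sub>R x"] by (simp add: exp_add[symmetric])
  have iM: "integrable lebesgue (M \<sigma>)" and jM: "(LINT x|lebesgue. M \<sigma> x) = (LINT x|lebesgue. E \<sigma> x * \<theta> x)"
    if "0 < \<sigma>" "\<sigma> \<le> 1/8" for \<sigma>
  proof -
    have i: "integrable lebesgue (\<lambda>x. exp (- 3 * \<sigma>) * (E \<sigma> x * \<theta> x))" using iE[OF that] by simp
    show "integrable lebesgue (M \<sigma>)"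
      unfolding ME'[abs_def] using integrable_lebesgue_affine[OF _ i, of "exp (- \<sigma>)" 0] by simp
    have "(LINT x|lebesgue. M \<sigma> x) = (1 / exp (- \<sigma>) ^ 3) * (exp (- 3 * \<sigma>) * (LINT x|lebesgue. E \<sigma> x * \<theta> x))"
      unfolding ME' using integral_lebesgue_affine[OF _ borel_measurable_integrable[OF i], of "exp (- \<sigma>)" 0] by simp
    moreover have "exp (- 3 * \<sigma>) = exp (- \<sigma>) ^ 3" by (simp add: exp_of_nat_mult[symmetric])
    ultimately show "(LINT x|lebesgue. M \<sigma> x) = (LINT x|lebesgue. E \<sigma> x * \<theta> x)" by simp
  qed
  have lf: "loc_int f" and lk: "loc_int (radial k)" using fk' by (auto intro: loc_int_L2 loc_int_radial H1_gradD)
  have lk': "loc_int (\<lambda>x. (- 1) *\<^sub>R radial k x)"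
    by (rule loc_int_cmult[OF lk, of _ "\<lambda>x. 1"]) (use measurable_radial[OF in_L2_measurable[OF H1_gradD(2)[OF fk']]] in auto)
  have N2: "in_Lp 2 (\<lambda>x. norm x powr 1 *\<^sub>R N x)" unfolding N_def by (rule nonlin_L2(1)[OF b ug R])
  have k2: "in_Lp 2 (\<lambda>x. norm x powr (- 1) *\<^sub>R (- 1) *\<^sub>R radial k x)"
    using in_L2_scaleR[OF radial_L2(1)[OF H1_gradD(2)[OF fk']], of "- 1"] by simp
  \<comment> \<open>The flow runs backwards, \<open>\<kappa> = - 1\<close>. Young's inequality
    bounds the quotient from above, and its limit is minus the pairing with x . \<nabla>f, so an
    upper bound here is the lower bound wanted.\<close>
  note Q = flow_quotient_weak_limit[OF lf lk' flow_deriv_radial[OF fk'] _ _ _ mN N2 k2]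
  define I where "I \<sigma> = (LINT x|lebesgue. N x * cnj (f (exp (- 1 * \<sigma>) *\<^sub>R x) - f x))" for \<sigma>
  have iI: "integrable lebesgue (\<lambda>x. N x * cnj (f (exp (- 1 * \<sigma>) *\<^sub>R x) - f x))" if "0 < \<sigma>" "\<sigma> \<le> 1/8" for \<sigma>
    by (rule Q(1)) (use that in auto)
  have limI: "((\<lambda>\<sigma>. (1 / \<sigma>) *\<^sub>R I \<sigma>) \<longlongrightarrow> (LINT x|lebesgue. N x * cnj ((- 1) *\<^sub>R radial k x))) (at_right 0)"
    unfolding I_def by (rule Q(2)) auto
  have I_le: "Re (I \<sigma>) \<le> 1/4 * (LINT x|lebesgue. (E \<sigma> x - 1) * \<theta> x)" if \<sigma>: "0 < \<sigma>" "\<sigma> \<le> 1/8" for \<sigma>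
  proof -
    have "Re (I \<sigma>) = (LINT x|lebesgue. Re (N x * cnj (f (exp (- 1 * \<sigma>) *\<^sub>R x) - f x)))"
      unfolding I_def by (rule integral_Re[OF iI[OF \<sigma>], symmetric])
    also have "\<dots> \<le> (LINT x|lebesgue. 1/4 * (M \<sigma> x - \<theta> x))"
    proof (rule integral_mono)
      show "integrable lebesgue (\<lambda>x. Re (N x * cnj (f (exp (- 1 * \<sigma>) *\<^sub>R x) - f x)))" by (rule integrable_Re[OF iI[OF \<sigma>]])
      show "integrable lebesgue (\<lambda>x. 1/4 * (M \<sigma> x - \<theta> x))" using iM[OF \<sigma>] i\<theta> by simp
      fix x
      define v where "v = f (exp (- 1 * \<sigma>) *\<^sub>R x)"
      define m where "m = norm x powr (- b) * inverse ((gauss R x)\<^sup>2)"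
      have m0: "m \<ge> 0" by (simp add: m_def)
      have Nf: "N x = (m * (cmod (f x))\<^sup>2) *\<^sub>R f x"
        using gauss_pos[of R x] by (simp add: N_def nonlin_def m_def f_def power_mult_distrib field_simps)
      have N\<theta>: "Re (N x * cnj (f x)) = \<theta> x"
        unfolding N_def f_def nonlin_pair \<theta>_def by simp
      have m\<theta>: "m * cmod (f x) ^ 4 = \<theta> x"
        using gauss_pos[of R x] by (simp add: m_def \<theta>_def f_def power_mult_distrib power2_eq_square power4_eq_xxxx field_simps)
      have "Re (N x * cnj v) = m * ((cmod (f x))\<^sup>2 * Re (f x * cnj v))" unfolding Nf by (simp add: algebra_simps)
      also have "\<dots> \<le> m * (3/4 * cmod (f x) ^ 4 + 1/4 * cmod v ^ 4)" by (rule mult_left_mono[OF cmod_Young_quartic m0])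
      also have "\<dots> = 3/4 * \<theta> x + 1/4 * M \<sigma> x"
        unfolding m\<theta>[symmetric] by (simp add: M_def m_def v_def distrib_left)
      finally show "Re (N x * cnj (f (exp (- 1 * \<sigma>) *\<^sub>R x) - f x)) \<le> 1/4 * (M \<sigma> x - \<theta> x)"
        unfolding v_def[symmetric] complex_cnj_diff right_diff_distrib minus_complex.simps N\<theta> by linarith
    qed
    also have "\<dots> = 1/4 * (LINT x|lebesgue. (E \<sigma> x - 1) * \<theta> x)"
      using iM[OF \<sigma>] i\<theta> iE[OF \<sigma>] jM[OF \<sigma>] by (simp add: left_diff_distrib)
    finally show ?thesis .
  qed
  \<comment> \<open>The shift by 8 keeps the sequence in (0, 1/8], where the scaling bounds
    hold.\<close>
  define \<sigma> where "\<sigma> n = 1 / real (n + 8)" for n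
  have \<sigma>: "0 < \<sigma> n" "\<sigma> n \<le> 1/8" for n by (auto simp: \<sigma>_def divide_simps)
  have \<sigma>0: "\<sigma> \<longlonglongrightarrow> 0" unfolding \<sigma>_def by (rule LIMSEQ_ignore_initial_segment[OF lim_1_over_n])
  have \<sigma>r: "filterlim \<sigma> (at_right 0) sequentially"
    by (rule tendsto_imp_filterlim_at_right[OF \<sigma>0]) (use \<sigma> in auto)
  have \<sigma>a: "filterlim \<sigma> (at 0) sequentially"
    using \<sigma>0 \<sigma>(1) by (auto simp: filterlim_at less_imp_neq[symmetric])
  define D where "D x = ((3 - b) + 2 * \<rho> x) * \<theta> x" for x
  have lim: "(\<lambda>n. (E (\<sigma> n) x - 1) / \<sigma> n * \<theta> x) \<longlonglongrightarrow> D x" for x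
  proof -
    have "((\<lambda>s. E s x) has_real_derivative ((3 - b) + 2 * \<rho> x)) (at 0)"
      unfolding E_def by (auto intro!: derivative_eq_intros)
    then have "((\<lambda>h. (E h x - 1) / h) \<longlongrightarrow> (3 - b) + 2 * \<rho> x) (at 0)"
      by (simp add: DERIV_def E_def)
    from filterlim_compose[OF this \<sigma>a] show ?thesis unfolding D_def by (intro tendsto_intros)
  qed
  have bd: "norm ((E (\<sigma> n) x - 1) / \<sigma> n * \<theta> x) \<le> 11 * exp 1 * p x" for n x
  proof -
    have "(E (\<sigma> n) x - 1) / \<sigma> n * \<theta> x \<ge> 0" using SQ(2)[OF \<sigma>, of n x] \<sigma>[of n] \<theta>0[of x] by simp
    moreover have "(E (\<sigma> n) x - 1) / \<sigma> n * \<theta> x = ((E (\<sigma> n) x - 1) / \<sigma> n * exp (- \<rho> x)) * p x" by (simp add: \<theta>p)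
    ultimately show ?thesis using mult_right_mono[OF SQ(3)[OF \<sigma>, of n x] p0[of x]] by (simp only: real_norm_def abs_of_nonneg)
  qed
  have mD: "D \<in> borel_measurable lebesgue" unfolding D_def[abs_def] by measurable
  have ms: "(\<lambda>x. (E (\<sigma> n) x - 1) / \<sigma> n * \<theta> x) \<in> borel_measurable lebesgue" for n by measurable
  have id: "integrable lebesgue (\<lambda>x. 11 * exp 1 * p x)" using ip by simp
  have DC: "integrable lebesgue D" "(\<lambda>n. LINT x|lebesgue. (E (\<sigma> n) x - 1) / \<sigma> n * \<theta> x) \<longlonglongrightarrow> (LINT x|lebesgue. D x)"
    by (rule integrable_dominated_convergence[OF mD ms id AE_I2[OF lim] AE_I2[OF bd]],
        rule integral_dominated_convergence[OF mD ms id AE_I2[OF lim] AE_I2[OF bd]])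
  then show "integrable lebesgue (\<lambda>x. ((3 - b) + 2 * ((norm x)\<^sup>2 / R\<^sup>2)) * \<theta> x)"
    by (simp add: D_def[abs_def] \<rho>_def)
  have L1: "(\<lambda>n. Re ((1 / \<sigma> n) *\<^sub>R I (\<sigma> n))) \<longlonglongrightarrow> Re (LINT x|lebesgue. N x * cnj ((- 1) *\<^sub>R radial k x))"
    by (intro tendsto_Re filterlim_compose[OF limI \<sigma>r])
  have L2: "(\<lambda>n. 1/4 * (LINT x|lebesgue. (E (\<sigma> n) x - 1) / \<sigma> n * \<theta> x)) \<longlonglongrightarrow> 1/4 * (LINT x|lebesgue. D x)"
    by (intro tendsto_intros DC(2))
  have "Re (LINT x|lebesgue. N x * cnj ((- 1) *\<^sub>R radial k x)) \<le> 1/4 * (LINT x|lebesgue. D x)"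
  proof (rule LIMSEQ_le[OF L1 L2], intro exI allI impI)
    fix n
    have "(LINT x|lebesgue. (E (\<sigma> n) x - 1) / \<sigma> n * \<theta> x) = (1 / \<sigma> n) * (LINT x|lebesgue. (E (\<sigma> n) x - 1) * \<theta> x)"
      by simp
    moreover have "1 / \<sigma> n * Re (I (\<sigma> n)) \<le> 1 / \<sigma> n * (1/4 * (LINT x|lebesgue. (E (\<sigma> n) x - 1) * \<theta> x))"
      using \<sigma>[of n] by (intro mult_left_mono I_le) auto
    ultimately show "Re ((1 / \<sigma> n) *\<^sub>R I (\<sigma> n)) \<le> 1/4 * (LINT x|lebesgue. (E (\<sigma> n) x - 1) / \<sigma> n * \<theta> x)"
      by simp
  qed
  moreover have "(LINT x|lebesgue. N x * cnj ((- 1) *\<^sub>R radial k x)) = - (LINT x|lebesgue. N x * cnj (radial k x))"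
    by simp
  ultimately show "Re (LINT x|lebesgue. nonlin b R u x * cnj (radial k x))
      \<ge> - (1/4 * (LINT x|lebesgue. ((3 - b) + 2 * ((norm x)\<^sup>2 / R\<^sup>2)) * \<theta> x))"
    by (simp add: N_def D_def \<rho>_def)
qed

text \<open>With \<rho> = |x|^2/R^2 the difference of the two weights is |x|^-b times (3+b)/4 (1 -
  exp(-\<rho>)) + 1/2 \<rho> exp(-\<rho>), and the bracket is at most 3/2 min(1, \<rho>). Then
  |x|^-b min(1, \<rho>) is at most R^-b: outside radius R because |x|^-b decreases, inside because
  |x|^(2-b) increases.\<close>

lemma weight_error:
  assumes b: "0 < b" "b < 1" and R: "R > 0"
  shows "norm x powr (- b) * ((3 + b) / 4) - 3/2 * R powr (- b)
    \<le> norm x powr (- b) * (gauss R x)\<^sup>2 * ((3 + b) / 4 - 1/2 * ((norm x)\<^sup>2 / R\<^sup>2))"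
proof -
  define \<rho> where "\<rho> = (norm x)\<^sup>2 / R\<^sup>2"
  define e where "e = exp (- \<rho>)"
  have \<rho>0: "\<rho> \<ge> 0" by (simp add: \<rho>_def)
  have e: "0 < e" "e \<le> 1" "1 - e \<le> \<rho>" using \<rho>0 exp_ge_add_one_self[of "- \<rho>"] by (auto simp: e_def)
  have e1: "\<rho> * e \<le> 1"
  proof -
    have "\<rho> * exp (- \<rho>) \<le> exp \<rho> * exp (- \<rho>)"
      using exp_ge_add_one_self[of \<rho>] by (intro mult_right_mono) (linarith, simp)
    then show ?thesis unfolding e_def by (simp only: exp_minus_inverse)
  qed
  have e2: "\<rho> * e \<le> \<rho>" using mult_left_mono[OF e(2) \<rho>0] by simp
  define y where "y = (3 + b) / 4 * (1 - e)"
  have "y \<le> 1 * (1 - e)" unfolding y_def using b e by (intro mult_right_mono) auto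
  then have b1: "y \<le> 1 - e" by simp
  define w where "w = norm x powr (- b)"
  have w0: "w \<ge> 0" by (simp add: w_def)
  have bracket: "(3 + b) / 4 * (1 - e) + 1/2 * (\<rho> * e) \<le> 3/2 * min 1 \<rho>"
  proof (cases "1 \<le> \<rho>")
    case True
    then have m: "min 1 \<rho> = 1" by simp
    show ?thesis unfolding m y_def[symmetric] using b1 e e1 by linarith
  next
    case False
    then have m: "min 1 \<rho> = \<rho>" by simp
    show ?thesis unfolding m y_def[symmetric] using b1 e e2 by linarith
  qed
  have wm: "w * min 1 \<rho> \<le> R powr (- b)"
  proof (cases "norm x \<ge> R")
    case True
    then have "w \<le> R powr (- b)" unfolding w_def using R b by (intro powr_mono2') auto
    moreover have "w * min 1 \<rho> \<le> w * 1" by (intro mult_left_mono w0) auto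
    ultimately show ?thesis by simp
  next
    case False
    show ?thesis
    proof (cases "x = 0")
      case True then show ?thesis by (simp add: w_def)
    next
      case x: False
      have "w * min 1 \<rho> \<le> w * \<rho>" by (intro mult_left_mono w0) auto
      also have "\<dots> = norm x powr (2 - b) / R\<^sup>2"
      proof -
        have "norm x powr (2 - b) = norm x powr (- b) * norm x powr 2" using powr_add[of "norm x" "- b" 2] by simp
        also have "norm x powr 2 = (norm x)\<^sup>2" by simp
        finally have Z: "norm x powr (2 - b) = norm x powr (- b) * (norm x)\<^sup>2" .
        show ?thesis unfolding Z w_def \<rho>_def by simp
      qed
      also have "\<dots> \<le> R powr (2 - b) / R\<^sup>2"
        using False b R by (intro divide_right_mono powr_mono2) auto
      also have "\<dots> = R powr (- b)"
      proof -
        have "R powr (2 - b) = R powr (- b) * R powr 2" by (simp add: powr_add[symmetric])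
        also have "R powr 2 = R\<^sup>2" using R by simp
        finally have Z: "R powr (2 - b) = R powr (- b) * R\<^sup>2" .
        show ?thesis unfolding Z using R by simp
      qed
      finally show ?thesis .
    qed
  qed
  have "w * ((3 + b) / 4 * (1 - e) + 1/2 * (\<rho> * e)) \<le> w * (3/2 * min 1 \<rho>)"
    by (rule mult_left_mono[OF bracket w0])
  with wm have "w * ((3 + b) / 4 * (1 - e) + 1/2 * (\<rho> * e)) \<le> 3/2 * R powr (- b)" by linarith
  moreover have "w * (c * (1 - e) + 1/2 * (\<rho> * e)) = w * c - w * e * (c - 1/2 * \<rho>)" for c
    by (simp add: algebra_simps)
  note this[of "(3 + b) / 4"]
  ultimately show ?thesis
    unfolding gauss_power2[OF R] \<rho>_def[symmetric] e_def[symmetric] w_def[symmetric] by linarith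
qed

text \<open>In the limit the generator contributes x . \<nabla>f + 3/2 f. The first part is bounded
  below by -(3-b)/4 of the quartic integral and a Gaussian correction, and 3/2 - (3-b)/4 = (3+b)/4
  is the coefficient in the virial functional. Replacing the weight \<chi>^2 by 1 costs R^-b times
  the L^4 norm to the fourth power.\<close>

lemma nonlinear_term:
  assumes b: "0 < b" "b < 1" and ug: "H1_grad u g" and R: "R > 0"
  shows "\<exists>l. ((\<lambda>h. Re (pair_N b u (loc_gen R h u))) \<longlongrightarrow> l) (at_right 0) \<and>
      l \<ge> (3 + b) / 4 * (LINT x|lebesgue. norm x powr (- b) * cmod (u x) ^ 4) - 3/2 * R powr (- b) * (LINT x|lebesgue. cmod (u x) ^ 4)"
    and "0 < h \<Longrightarrow> h \<le> 1 \<Longrightarrow> norm (pair_N b u (loc_gen R h u))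
      \<le> exp 4 * ((1 + R) * (64 * L2_nrm g ^ 3) * ((2 + 1 / R) * H1_nrm u) + (LINT x|lebesgue. norm x powr (- b) * cmod (u x) ^ 4))"
proof -
  define f where "f x = gauss R x *\<^sub>R u x" for x
  define k where "k = grad f"
  have fH: "in_H1 f" unfolding f_def[abs_def] by (rule H1_grad_in_H1[OF H1_grad_gauss[OF ug R]])
  have fk: "H1_grad f k" unfolding k_def by (rule in_H1_grad[OF fH])
  have fk': "H1_grad (\<lambda>x. gauss R x *\<^sub>R u x) k" using fk by (simp add: f_def[abs_def])
  have Lk: "L2_nrm k \<le> (2 + 1 / R) * H1_nrm u"
    using L2_nrm_le_H1_nrm(2)[of f] H1_nrm_gauss_le[OF ug R] by (simp add: k_def f_def[abs_def])
  note mu = in_L2_measurable[OF H1_gradD(1)[OF ug]]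
  define \<theta> where "\<theta> x = norm x powr (- b) * (gauss R x)\<^sup>2 * cmod (u x) ^ 4" for x
  define p where "p x = norm x powr (- b) * cmod (u x) ^ 4" for x
  note NR = nonlin_radial_lower[OF b ug R fk', folded \<theta>_def]
  obtain C where "C \<ge> 0" and iw: "\<And>f g. H1_grad f g \<Longrightarrow> integrable lebesgue (\<lambda>x. norm x powr (- b) * norm (f x) ^ 4)"
    and "\<And>f g. H1_grad f g \<Longrightarrow> (LINT x|lebesgue. norm x powr (- b) * norm (f x) ^ 4) \<le> C * H1_nrm f ^ 4"
    by (rule nonlinearity_bound[OF b], rule that)
  obtain C' where "C' \<ge> 0" and i4: "\<And>f g. H1_grad f g \<Longrightarrow> integrable lebesgue (\<lambda>x. norm (f x) ^ 4)"
    and "\<And>f g. H1_grad f g \<Longrightarrow> (LINT x|lebesgue. norm (f x) ^ 4) \<le> C' * H1_nrm f ^ 4"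
    by (rule L4_bound, rule that)
  have ip: "integrable lebesgue p" unfolding p_def by (rule iw[OF ug])
  have \<theta>p: "\<theta> x \<le> p x" "\<theta> x \<ge> 0" for x
  proof -
    have "(gauss R x)\<^sup>2 \<le> 1" using gauss_pos[of R x] gauss_le_1[of R x] by (simp add: power_le_one)
    then have "(gauss R x)\<^sup>2 * p x \<le> 1 * p x" by (rule mult_right_mono) (simp add: p_def)
    then show "\<theta> x \<le> p x" by (simp add: \<theta>_def p_def mult_ac)
  qed (simp add: \<theta>_def)
  have Nf: "nonlin b R u x * cnj (f x) = complex_of_real (\<theta> x)" for x
    unfolding f_def nonlin_pair \<theta>_def ..
  have iNf: "integrable lebesgue (\<lambda>x. nonlin b R u x * cnj (f x))"
    unfolding Nf by (rule integrable_of_real[OF NR(1)])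
  \<comment> \<open>The weight exponent is \<open>a = 1\<close>: the factor |x| of x . \<nabla>f is
    handed to the nonlinearity, which is controlled in L^2 only after multiplication by |x|.\<close>
  have a01: "(0::real) \<le> 1" "(1::real) \<le> 1" by auto
  note DL = dil_diff_weak_limit[OF fk a01 nonlin_measurable[OF mu] nonlin_L2(1)[OF b ug R] radial_L2(1)[OF H1_gradD(2)[OF fk]] iNf]
  have P: "pair_N b u (loc_gen R h u) = (LINT x|lebesgue. nonlin b R u x * cnj (dil_diff h f x))" for h
    unfolding pair_N_loc_gen f_def[abs_def] ..
  define l where "l = Re ((LINT x|lebesgue. nonlin b R u x * cnj (radial k x)) + (3/2) *\<^sub>R (LINT x|lebesgue. nonlin b R u x * cnj (f x)))"
  have lim: "((\<lambda>h. Re (pair_N b u (loc_gen R h u))) \<longlongrightarrow> l) (at_right 0)"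
    unfolding P l_def by (rule tendsto_Re[OF DL(1)])
  have jNf: "(LINT x|lebesgue. nonlin b R u x * cnj (f x)) = complex_of_real (LINT x|lebesgue. \<theta> x)"
    unfolding Nf by (rule integral_complex_of_real)
  have "(3 + b) / 4 * (LINT x|lebesgue. p x) - 3/2 * R powr (- b) * (LINT x|lebesgue. cmod (u x) ^ 4)
      = (LINT x|lebesgue. (3 + b) / 4 * p x - 3/2 * R powr (- b) * cmod (u x) ^ 4)"
    using ip i4[OF ug] by simp
  also have "\<dots> \<le> (LINT x|lebesgue. 3/2 * \<theta> x - 1/4 * (((3 - b) + 2 * ((norm x)\<^sup>2 / R\<^sup>2)) * \<theta> x))"
  proof (rule integral_mono)
    show "integrable lebesgue (\<lambda>x. (3 + b) / 4 * p x - 3/2 * R powr (- b) * cmod (u x) ^ 4)" using ip i4[OF ug] by simp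
    show "integrable lebesgue (\<lambda>x. 3/2 * \<theta> x - 1/4 * (((3 - b) + 2 * ((norm x)\<^sup>2 / R\<^sup>2)) * \<theta> x))"
      using NR(1,2) by (intro Bochner_Integration.integrable_diff integrable_mult_right) auto
    fix x
    have "(norm x powr (- b) * ((3 + b) / 4) - 3/2 * R powr (- b)) * cmod (u x) ^ 4
      \<le> norm x powr (- b) * (gauss R x)\<^sup>2 * ((3 + b) / 4 - 1/2 * ((norm x)\<^sup>2 / R\<^sup>2)) * cmod (u x) ^ 4"
      by (rule mult_right_mono[OF weight_error[OF b R]]) simp
    moreover have "norm x powr (- b) * (gauss R x)\<^sup>2 * ((3 + b) / 4 - 1/2 * ((norm x)\<^sup>2 / R\<^sup>2)) * cmod (u x) ^ 4
      = 3/2 * \<theta> x - 1/4 * (((3 - b) + 2 * ((norm x)\<^sup>2 / R\<^sup>2)) * \<theta> x)"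
    proof -
      have A: "norm x powr (- b) * (gauss R x)\<^sup>2 * ((3 + b) / 4 - 1/2 * ((norm x)\<^sup>2 / R\<^sup>2)) * cmod (u x) ^ 4
          = ((3 + b) / 4 - 1/2 * ((norm x)\<^sup>2 / R\<^sup>2)) * \<theta> x"
        unfolding \<theta>_def by (simp only: mult_ac)
      have B: "(3 + b) / 4 - 1/2 * ((norm x)\<^sup>2 / R\<^sup>2) = 3/2 - 1/4 * ((3 - b) + 2 * ((norm x)\<^sup>2 / R\<^sup>2))"
        by (simp add: field_simps)
      show ?thesis unfolding A unfolding B left_diff_distrib[of "3/2"] by (simp only: mult.assoc)
    qed
    moreover have "(norm x powr (- b) * ((3 + b) / 4) - 3/2 * R powr (- b)) * cmod (u x) ^ 4
        = (3 + b) / 4 * p x - 3/2 * R powr (- b) * cmod (u x) ^ 4"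
      unfolding p_def by (simp add: algebra_simps)
    ultimately show "(3 + b) / 4 * p x - 3/2 * R powr (- b) * cmod (u x) ^ 4
        \<le> 3/2 * \<theta> x - 1/4 * (((3 - b) + 2 * ((norm x)\<^sup>2 / R\<^sup>2)) * \<theta> x)" by linarith
  qed
  also have "\<dots> = 3/2 * (LINT x|lebesgue. \<theta> x) - 1/4 * (LINT x|lebesgue. ((3 - b) + 2 * ((norm x)\<^sup>2 / R\<^sup>2)) * \<theta> x)"
    using NR(1,2) by (subst Bochner_Integration.integral_diff) (intro integrable_mult_right, auto)
  also have "\<dots> \<le> l" using NR(3) unfolding l_def jNf by simp
  finally show "\<exists>l. ((\<lambda>h. Re (pair_N b u (loc_gen R h u))) \<longlongrightarrow> l) (at_right 0) \<and>
      l \<ge> (3 + b) / 4 * (LINT x|lebesgue. norm x powr (- b) * cmod (u x) ^ 4) - 3/2 * R powr (- b) * (LINT x|lebesgue. cmod (u x) ^ 4)"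
    using lim unfolding p_def by blast
  show "norm (pair_N b u (loc_gen R h u))
      \<le> exp 4 * ((1 + R) * (64 * L2_nrm g ^ 3) * ((2 + 1 / R) * H1_nrm u) + (LINT x|lebesgue. norm x powr (- b) * cmod (u x) ^ 4))"
    if h: "0 < h" "h \<le> 1"
  proof -
    have "norm (LINT x|lebesgue. nonlin b R u x * cnj (f x)) = (LINT x|lebesgue. \<theta> x)"
      unfolding jNf using \<theta>p(2) by simp
    also have "\<dots> \<le> (LINT x|lebesgue. p x)" by (rule integral_mono[OF NR(1) ip \<theta>p(1)])
    finally have A: "norm (LINT x|lebesgue. nonlin b R u x * cnj (f x)) \<le> (LINT x|lebesgue. p x)" .
    have B: "L2_nrm (\<lambda>x. norm x powr 1 *\<^sub>R nonlin b R u x) * L2_nrm (\<lambda>x. norm x powr (- 1) *\<^sub>R radial k x)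
        \<le> (1 + R) * (64 * L2_nrm g ^ 3) * ((2 + 1 / R) * H1_nrm u)"
      using nonlin_L2(2)[OF b ug R] radial_L2(2)[OF H1_gradD(2)[OF fk]] Lk R
      by (intro mult_mono) (auto simp: L2_nrm_nonneg intro: order_trans)
    show ?thesis
      unfolding P p_def[symmetric]
      by (rule order_trans[OF DL(2)[OF h]], rule mult_left_mono[OF add_mono[OF B A]]) simp
  qed
qed

section \<open>Lower bounds for the derivative of the localized virial\<close>

text \<open>Since \<open>0 powr 0 = 0\<close>, the weight with exponent 0 is 1 only away from the
  origin; an inequality of norms is enough to return to the unweighted function.\<close>

lemma powr_zero_L2:
  assumes \<Psi>: "in_Lp 2 (\<Psi> :: real^3 \<Rightarrow> complex)" and c: "c = 0"
  shows "in_Lp 2 (\<lambda>x. norm x powr c *\<^sub>R \<Psi> x)" and "L2_nrm (\<lambda>x. norm x powr c *\<^sub>R \<Psi> x) \<le> L2_nrm \<Psi>"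
proof -
  have m: "(\<lambda>x. norm x powr c *\<^sub>R \<Psi> x) \<in> borel_measurable lebesgue"
    by (intro borel_measurable_scaleR measurable_norm_powr in_L2_measurable \<Psi>)
  have le: "norm (norm x powr c *\<^sub>R \<Psi> x) \<le> 1 * norm (\<Psi> x)" for x by (simp add: c)
  show "in_Lp 2 (\<lambda>x. norm x powr c *\<^sub>R \<Psi> x)" by (rule in_L2_bound(1)[OF \<Psi> m AE_I2[OF le]])
  have "L2_nrm (\<lambda>x. norm x powr c *\<^sub>R \<Psi> x) \<le> 1 * L2_nrm \<Psi>" by (rule in_L2_bound(2)[OF \<Psi> m AE_I2[OF le]]) simp
  then show "L2_nrm (\<lambda>x. norm x powr c *\<^sub>R \<Psi> x) \<le> L2_nrm \<Psi>" by simp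
qed

lemma dil_diff_limit_L2:
  fixes \<Psi> :: "real^3 \<Rightarrow> complex"
  assumes fk: "H1_grad f k" and \<Psi>: "in_Lp 2 \<Psi>" and q: "in_Lp 2 (radial k)"
  shows "((\<lambda>h. LINT x|lebesgue. \<Psi> x * cnj (dil_diff h f x))
      \<longlongrightarrow> (LINT x|lebesgue. \<Psi> x * cnj (radial k x + (3 / 2) *\<^sub>R f x))) (at_right 0)"
    and "0 < h \<Longrightarrow> h \<le> 1 \<Longrightarrow> norm (LINT x|lebesgue. \<Psi> x * cnj (dil_diff h f x))
      \<le> exp 4 * (L2_nrm \<Psi> * (L2_nrm (radial k) + L2_nrm f))"
proof -
  note f2 = H1_gradD(1)[OF fk]
  have a: "(0::real) \<le> 0" "(0::real) \<le> 1" by auto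
  note i = integrable_mult_cnj[OF \<Psi> f2] and iq = integrable_mult_cnj[OF \<Psi> q]
  note D = dil_diff_weak_limit[OF fk a in_L2_measurable[OF \<Psi>] powr_zero_L2(1)[OF \<Psi> refl] powr_zero_L2(1)[OF q minus_zero] i(1)]
  have "(LINT x|lebesgue. \<Psi> x * cnj (radial k x)) + (3 / 2) *\<^sub>R (LINT x|lebesgue. \<Psi> x * cnj (f x))
      = (LINT x|lebesgue. \<Psi> x * cnj (radial k x) + (3 / 2) *\<^sub>R (\<Psi> x * cnj (f x)))"
    using i(1) iq(1) by simp
  also have "\<dots> = (LINT x|lebesgue. \<Psi> x * cnj (radial k x + (3 / 2) *\<^sub>R f x))"
    by (intro Bochner_Integration.integral_cong refl) (simp add: distrib_left)
  finally show "((\<lambda>h. LINT x|lebesgue. \<Psi> x * cnj (dil_diff h f x))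
      \<longlongrightarrow> (LINT x|lebesgue. \<Psi> x * cnj (radial k x + (3 / 2) *\<^sub>R f x))) (at_right 0)"
    using D(1) by simp
  show "norm (LINT x|lebesgue. \<Psi> x * cnj (dil_diff h f x)) \<le> exp 4 * (L2_nrm \<Psi> * (L2_nrm (radial k) + L2_nrm f))"
    if h: "0 < h" "h \<le> 1"
  proof -
    have "L2_nrm (\<lambda>x. norm x powr 0 *\<^sub>R \<Psi> x) * L2_nrm (\<lambda>x. norm x powr (- 0) *\<^sub>R radial k x) \<le> L2_nrm \<Psi> * L2_nrm (radial k)"
      by (intro mult_mono powr_zero_L2(2) \<Psi> q) (auto simp: L2_nrm_nonneg)
    moreover have "norm (LINT x|lebesgue. \<Psi> x * cnj (f x)) \<le> L2_nrm \<Psi> * L2_nrm f" using i(2) by (simp add: pair_L2_def)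
    ultimately have "L2_nrm (\<lambda>x. norm x powr 0 *\<^sub>R \<Psi> x) * L2_nrm (\<lambda>x. norm x powr (- 0) *\<^sub>R radial k x)
        + norm (LINT x|lebesgue. \<Psi> x * cnj (f x)) \<le> L2_nrm \<Psi> * (L2_nrm (radial k) + L2_nrm f)"
      by (simp only: distrib_left add_mono)
    from order_trans[OF D(2)[OF h] mult_left_mono[OF this, of "exp 4"]] show ?thesis by simp
  qed
qed

text \<open>The Gaussian makes x . \<nabla>(\<chi>u) square integrable although x . \<nabla>u need
  not be: it equals \<chi> x . \<nabla>u - (|x|^2/R^2) \<chi>u, and \<chi>|x| \<le> R,
  \<chi>|x|^2/R^2 \<le> 2.\<close>

lemma gauss_gradient_bounds:
  assumes ug: "H1_grad u g" and R: "R > 0"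
  defines "f \<equiv> \<lambda>x. gauss R x *\<^sub>R u x"
    and "k \<equiv> \<lambda>x. gauss R x *\<^sub>R g x + (\<chi> i. (- (x $ i / R\<^sup>2) * gauss R x) *\<^sub>R u x)"
  shows "in_Lp 2 (radial k)" and "L2_nrm (radial k) \<le> R * L2_nrm g + 2 * L2_nrm u"
    and "in_Lp 2 (\<lambda>x. ((norm x)\<^sup>2 / R\<^sup>2) *\<^sub>R f x)" and "L2_nrm (\<lambda>x. ((norm x)\<^sup>2 / R\<^sup>2) *\<^sub>R f x) \<le> 2 * L2_nrm u"
proof -
  note u2 = H1_gradD(1)[OF ug] and g2 = H1_gradD(2)[OF ug]
  note mu[measurable] = in_L2_measurable[OF u2] and mg[measurable] = in_L2_measurable[OF g2]
  have mn2[measurable]: "(\<lambda>x::real^3. (norm x)\<^sup>2) \<in> borel_measurable lebesgue" by (rule measurable_lebesgue_borel) measurable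
  define a where "a x = gauss R x *\<^sub>R radial g x" for x
  define c where "c x = ((norm x)\<^sup>2 / R\<^sup>2) *\<^sub>R f x" for x
  have rk: "radial k = (\<lambda>x. a x - c x)"
  proof
    fix x :: "real^3"
    have "radial k x = (\<Sum>i\<in>UNIV. gauss R x *\<^sub>R (x $ i *\<^sub>R g x $ i) - ((x $ i * x $ i) / R\<^sup>2) *\<^sub>R f x)"
      unfolding radial_def by (intro sum.cong refl) (simp add: k_def f_def scaleR_add_right scaleR_diff_right mult_ac)
    also have "\<dots> = a x - ((\<Sum>i\<in>UNIV. x $ i * x $ i) / R\<^sup>2) *\<^sub>R f x"
      by (simp only: sum_subtractf scaleR_sum_right[symmetric] scaleR_sum_left[symmetric] sum_divide_distrib[symmetric] a_def radial_def)
    also have "(\<Sum>i\<in>UNIV. x $ i * x $ i) = (norm x)\<^sup>2" by (simp add: power2_norm_eq_inner inner_vec_def)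
    finally show "radial k x = a x - c x" by (simp add: c_def)
  qed
  have ma: "a \<in> borel_measurable lebesgue" unfolding a_def[abs_def]
    by (intro borel_measurable_scaleR gauss_measurable measurable_radial mg)
  have lea: "norm (a x) \<le> R * norm (g x)" for x
  proof -
    have "norm (a x) = gauss R x * norm (radial g x)" using gauss_pos[of R x] by (simp add: a_def)
    also have "\<dots> \<le> gauss R x * (norm x * norm (g x))" using gauss_pos[of R x] by (intro mult_left_mono norm_radial_le) auto
    also have "\<dots> = (norm x * gauss R x) * norm (g x)" by simp
    also have "\<dots> \<le> R * norm (g x)" by (intro mult_right_mono norm_gauss_le(1) R) auto
    finally show ?thesis .
  qed
  have a2: "in_Lp 2 a" by (rule in_L2_bound(1)[OF g2 ma AE_I2[OF lea]])
  have na: "L2_nrm a \<le> R * L2_nrm g" by (rule in_L2_bound(2)[OF g2 ma AE_I2[OF lea]]) (use R in simp)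
  have mc: "c \<in> borel_measurable lebesgue" unfolding c_def[abs_def] f_def by measurable
  have lec: "norm (c x) \<le> 2 * norm (u x)" for x
  proof -
    have "norm (c x) = ((norm x)\<^sup>2 / R\<^sup>2 * gauss R x) * norm (u x)" using gauss_pos[of R x] by (simp add: c_def f_def)
    also have "\<dots> \<le> 2 * norm (u x)" by (intro mult_right_mono norm_gauss_le(3) R) auto
    finally show ?thesis .
  qed
  have c2: "in_Lp 2 c" by (rule in_L2_bound(1)[OF u2 mc AE_I2[OF lec]])
  have nc: "L2_nrm c \<le> 2 * L2_nrm u" by (rule in_L2_bound(2)[OF u2 mc AE_I2[OF lec]]) simp
  show "in_Lp 2 (\<lambda>x. ((norm x)\<^sup>2 / R\<^sup>2) *\<^sub>R f x)" "L2_nrm (\<lambda>x. ((norm x)\<^sup>2 / R\<^sup>2) *\<^sub>R f x) \<le> 2 * L2_nrm u"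
    using c2 nc by (simp_all add: c_def[abs_def])
  show "in_Lp 2 (radial k)" unfolding rk by (rule in_L2_diff[OF a2 c2])
  have "L2_nrm (\<lambda>x. a x + (- 1) *\<^sub>R c x) \<le> L2_nrm a + L2_nrm c"
    using L2_nrm_triangle[OF a2 in_L2_scaleR[OF c2, of "- 1"]] unfolding L2_nrm_scaleR by simp
  then show "L2_nrm (radial k) \<le> R * L2_nrm g + 2 * L2_nrm u" unfolding rk using na nc by simp
qed

lemma sinh_quotient:
  shows "((\<lambda>h. (exp h - exp (- h)) / (2 * h)) \<longlongrightarrow> 1) (at_right (0::real))"
    and "0 < h \<Longrightarrow> h \<le> 1 \<Longrightarrow> (exp h - exp (- h)) / (2 * h) \<le> exp (1::real)"
proof -
  have "((\<lambda>h. exp h - exp (- h)) has_real_derivative 2) (at (0::real))"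
    by (auto intro!: derivative_eq_intros)
  then have "((\<lambda>h. (exp h - exp (- h)) / h) \<longlongrightarrow> 2) (at (0::real))"
    by (simp add: DERIV_def)
  then have "((\<lambda>h. (exp h - exp (- h)) / h) \<longlongrightarrow> 2) (at_right (0::real))"
    by (rule filterlim_mono) (auto simp: at_le)
  then have "((\<lambda>h. (exp h - exp (- h)) / h / 2) \<longlongrightarrow> 2 / 2) (at_right (0::real))"
    by (intro tendsto_intros) auto
  then show "((\<lambda>h. (exp h - exp (- h)) / (2 * h)) \<longlongrightarrow> 1) (at_right (0::real))" by (simp add: mult.commute)
  assume h: "0 < h" "h \<le> 1"
  have "exp h * (1 - exp (- 2 * h)) \<le> exp 1 * (2 * h)"
    using exp_ge_add_one_self[of "- 2 * h"] h by (intro mult_mono) auto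
  moreover have "exp h * (1 - exp (- 2 * h)) = exp h - exp (- h)" by (simp add: right_diff_distrib exp_add[symmetric])
  ultimately show "(exp h - exp (- h)) / (2 * h) \<le> exp 1" using h by (simp add: field_simps)
qed

text \<open>Here q stands for x . \<nabla>(\<chi>u), f for \<chi>u and z for u. The coefficient of
  |q|^2 is positive, so the square is completed at the price (3+\<rho>)^2/8 |f|^2; the decay of the
  Gaussian keeps (3+\<rho>)^2 exp(-\<rho>) at most 9, whence 9/8. The estimate does not involve the
  size of q.\<close>

lemma cross_term_bound:
  fixes q f :: complex
  assumes \<rho>: "\<rho> \<ge> 0" and f: "(cmod f)\<^sup>2 = exp (- \<rho>) * (cmod z)\<^sup>2"
  shows "Re ((2 *\<^sub>R q + \<rho> *\<^sub>R f) * cnj (q + (3 / 2) *\<^sub>R f)) \<ge> - (9/8) * (cmod z)\<^sup>2"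
proof -
  have E: "Re ((2 *\<^sub>R q + \<rho> *\<^sub>R f) * cnj (q + (3 / 2) *\<^sub>R f))
      = 2 * (cmod q)\<^sup>2 + (3 + \<rho>) * Re (q * cnj f) + 3/2 * \<rho> * (cmod f)\<^sup>2"
    unfolding cmod_power2 by (simp add: algebra_simps power2_eq_square)
  have "- Re (q * cnj f) \<le> cmod q * cmod f" using abs_Re_le_cmod[of "q * cnj f"] by (simp add: norm_mult)
  then have "(3 + \<rho>) * (- Re (q * cnj f)) \<le> (3 + \<rho>) * (cmod q * cmod f)" using \<rho> by (intro mult_left_mono) auto
  moreover have "0 \<le> 2 * (cmod q - (3 + \<rho>) / 4 * cmod f)\<^sup>2" by simp
  moreover have "2 * (cmod q - (3 + \<rho>) / 4 * cmod f)\<^sup>2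
      = 2 * (cmod q)\<^sup>2 - (3 + \<rho>) * (cmod q * cmod f) + (3 + \<rho>)\<^sup>2 / 8 * (cmod f)\<^sup>2"
    by (simp add: power2_eq_square field_simps)
  moreover have "0 \<le> 3/2 * \<rho> * (cmod f)\<^sup>2" using \<rho> by simp
  moreover have "(3 + \<rho>)\<^sup>2 / 8 * (cmod f)\<^sup>2 \<le> 9/8 * (cmod z)\<^sup>2"
  proof -
    have "(1 + \<rho> / 3)\<^sup>2 \<le> (exp (\<rho> / 3))\<^sup>2" using \<rho> by (intro power_mono exp_ge_add_one_self) auto
    also have "\<dots> = exp (2 * (\<rho> / 3))" by (rule exp_double[symmetric])
    also have "\<dots> \<le> exp \<rho>" using \<rho> by simp
    finally have "(3 + \<rho>)\<^sup>2 \<le> 9 * exp \<rho>" by (simp add: power2_eq_square field_simps)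
    then have "(3 + \<rho>)\<^sup>2 * exp (- \<rho>) \<le> 9 * exp \<rho> * exp (- \<rho>)" by (intro mult_right_mono) auto
    also have "\<dots> = 9" by (simp add: exp_add[symmetric])
    finally have "(3 + \<rho>)\<^sup>2 * exp (- \<rho>) / 8 * (cmod z)\<^sup>2 \<le> 9 / 8 * (cmod z)\<^sup>2"
      by (intro mult_right_mono divide_right_mono) auto
    then show ?thesis unfolding f by (simp add: mult.assoc)
  qed
  ultimately show ?thesis unfolding E by linarith
qed

text \<open>The first bound holds for all \<open>h\<close> in (0,1] and may depend badly on R; it
  serves as a uniform bound for Fatou's lemma. The second is accurate up to 1/R, but the range of
  admissible \<open>h\<close> depends on \<open>u\<close>. It comes from integrating
  \<open>cross_term_bound\<close>, whose cost is divided by R^2.\<close>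

lemma kinetic_term:
  assumes ug: "H1_grad u g" and R: "R \<ge> 1"
  shows "0 < h \<Longrightarrow> h \<le> 1 \<Longrightarrow> Re (LINT x|lebesgue. (\<Sum>i\<in>UNIV. grad u x $ i * cnj (grad (loc_gen R h u) x $ i)))
      \<le> (4 * exp 1 + exp 4 * ((2 * R + 6) * (R + 3))) * (H1_nrm u)\<^sup>2"
    and "\<epsilon> > 0 \<Longrightarrow> eventually (\<lambda>h. Re (LINT x|lebesgue. (\<Sum>i\<in>UNIV. grad u x $ i * cnj (grad (loc_gen R h u) x $ i)))
      \<le> (L2_nrm g)\<^sup>2 + 4 * (H1_nrm u)\<^sup>2 / R + \<epsilon>) (at_right 0)"
proof -
  have R0: "R > 0" using R by simp
  define f where "f = (\<lambda>x. gauss R x *\<^sub>R u x)"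
  define k where "k = (\<lambda>x. gauss R x *\<^sub>R g x + (\<chi> i. (- (x $ i / R\<^sup>2) * gauss R x) *\<^sub>R u x))"
  define A where "A = H1_nrm u"
  have fk: "H1_grad f k" unfolding f_def k_def by (rule H1_grad_gauss[OF ug R0])
  note u2 = H1_gradD(1)[OF ug] and f2 = H1_gradD(1)[OF fk]
  note B = L2_nrm_gauss_gradient_le[OF ug R0, folded k_def] gauss_gradient_bounds(1,2)[OF ug R0, folded k_def]
  have B4: "in_Lp 2 (\<lambda>x. ((norm x)\<^sup>2 / R\<^sup>2) *\<^sub>R f x)" unfolding f_def by (rule gauss_gradient_bounds(3)[OF ug R0])
  have B5: "L2_nrm (\<lambda>x. ((norm x)\<^sup>2 / R\<^sup>2) *\<^sub>R f x) \<le> 2 * L2_nrm u" unfolding f_def by (rule gauss_gradient_bounds(4)[OF ug R0])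
  have AG: "L2_nrm u \<le> A" "L2_nrm g \<le> A" "A \<ge> 0" "A\<^sup>2 = (L2_nrm u)\<^sup>2 + (L2_nrm g)\<^sup>2"
    using L2_nrm_le_H1_nrm[of u] L2_nrm_grad[OF ug] H1_nrm_eq[OF ug] H1_nrm_nonneg[of u] by (auto simp: A_def)
  define \<Psi> where "\<Psi> = (\<lambda>x. 2 *\<^sub>R radial k x + ((norm x)\<^sup>2 / R\<^sup>2) *\<^sub>R f x)"
  have \<Psi>2: "in_Lp 2 \<Psi>" unfolding \<Psi>_def by (rule in_L2_add[OF in_L2_scaleR[OF B(2)] B4])
  have Ru: "R * L2_nrm g + 2 * L2_nrm u \<le> (R + 2) * A"
  proof -
    have "R * L2_nrm g \<le> R * A" by (intro mult_left_mono AG) (use R in simp)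
    then show ?thesis unfolding distrib_right using AG(1) by linarith
  qed
  have nq: "L2_nrm (radial k) \<le> (R + 2) * A" using B(3) Ru by linarith
  have n\<Psi>: "L2_nrm \<Psi> \<le> (2 * R + 6) * A"
  proof -
    have "L2_nrm \<Psi> \<le> 2 * L2_nrm (radial k) + L2_nrm (\<lambda>x. ((norm x)\<^sup>2 / R\<^sup>2) *\<^sub>R f x)"
      using L2_nrm_triangle[OF in_L2_scaleR[OF B(2), of 2] B4] unfolding L2_nrm_scaleR[of 2 "radial k"] \<Psi>_def by simp
    also have "\<dots> \<le> 2 * ((R + 2) * A) + 2 * A" using nq B5 AG(1) by linarith
    finally show ?thesis by (simp add: algebra_simps)
  qed
  have nf: "L2_nrm f \<le> A" using in_L2_gauss(2)[OF u2, of R] AG(1) by (simp add: f_def)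
  note D = dil_diff_limit_L2[OF fk \<Psi>2 B(2)]
  have K: "Re (LINT x|lebesgue. (\<Sum>i\<in>UNIV. grad u x $ i * cnj (grad (loc_gen R h u) x $ i)))
    \<le> (exp h - exp (- h)) / (2 * h) * (L2_nrm k)\<^sup>2 - 1 / R\<^sup>2 * Re (LINT x|lebesgue. \<Psi> x * cnj (dil_diff h f x))" if "h > 0" for h
    unfolding \<Psi>_def f_def k_def
    by (rule kinetic_bound[OF ug R0 that \<Psi>2[unfolded \<Psi>_def f_def k_def] B(2)[unfolded k_def]])
  show "Re (LINT x|lebesgue. (\<Sum>i\<in>UNIV. grad u x $ i * cnj (grad (loc_gen R h u) x $ i)))
      \<le> (4 * exp 1 + exp 4 * ((2 * R + 6) * (R + 3))) * (H1_nrm u)\<^sup>2" if h: "0 < h" "h \<le> 1"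
  proof -
    have "L2_nrm u / R \<le> L2_nrm u / 1" using R by (intro divide_left_mono) (auto simp: L2_nrm_nonneg)
    then have "L2_nrm k \<le> 2 * A" using B(1) AG by simp
    then have "(L2_nrm k)\<^sup>2 \<le> (2 * A)\<^sup>2" by (intro power_mono L2_nrm_nonneg)
    then have "(exp h - exp (- h)) / (2 * h) * (L2_nrm k)\<^sup>2 \<le> exp 1 * (2 * A)\<^sup>2"
      using sinh_quotient(2)[OF h] by (intro mult_mono) auto
    moreover have "- (1 / R\<^sup>2 * Re (LINT x|lebesgue. \<Psi> x * cnj (dil_diff h f x))) \<le> exp 4 * ((2 * R + 6) * A * ((R + 3) * A))"
    proof -
      let ?z = "LINT x|lebesgue. \<Psi> x * cnj (dil_diff h f x)"
      have R2: "1 / R\<^sup>2 \<le> 1" using R by simp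
      have "- (1 / R\<^sup>2 * Re ?z) = 1 / R\<^sup>2 * (- Re ?z)" by simp
      also have "\<dots> \<le> 1 / R\<^sup>2 * norm ?z" using abs_Re_le_cmod[of ?z] by (intro mult_left_mono) auto
      also have "\<dots> \<le> 1 * norm ?z" by (intro mult_right_mono R2) auto
      also have "\<dots> \<le> exp 4 * (L2_nrm \<Psi> * (L2_nrm (radial k) + L2_nrm f))" using D(2)[OF h] by simp
      also have "\<dots> \<le> exp 4 * ((2 * R + 6) * A * ((R + 3) * A))"
      proof -
        have "L2_nrm (radial k) + L2_nrm f \<le> (R + 3) * A" using nq nf by (simp add: algebra_simps)
        then show ?thesis using n\<Psi> R AG(3) by (intro mult_left_mono mult_mono) (auto simp: L2_nrm_nonneg)
      qed
      finally show ?thesis .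
    qed
    ultimately have "Re (LINT x|lebesgue. (\<Sum>i\<in>UNIV. grad u x $ i * cnj (grad (loc_gen R h u) x $ i)))
      \<le> exp 1 * (2 * A)\<^sup>2 + exp 4 * ((2 * R + 6) * A * ((R + 3) * A))" using K[OF h(1)] by linarith
    also have "\<dots> = (4 * exp 1 + exp 4 * ((2 * R + 6) * (R + 3))) * (H1_nrm u)\<^sup>2"
      unfolding A_def[symmetric] by (simp add: power2_eq_square algebra_simps)
    finally show ?thesis .
  qed
  define \<Lambda> where "\<Lambda> = (LINT x|lebesgue. \<Psi> x * cnj (radial k x + (3 / 2) *\<^sub>R f x))"
  have s2: "in_Lp 2 (\<lambda>x. radial k x + (3 / 2) *\<^sub>R f x)" by (rule in_L2_add[OF B(2) in_L2_scaleR[OF f2]])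
  note i\<Lambda> = integrable_mult_cnj(1)[OF \<Psi>2 s2]
  have iu: "integrable lebesgue (\<lambda>x. (cmod (u x))\<^sup>2)" using u2 by (simp add: in_L2_iff)
  have "- (9/8) * (L2_nrm u)\<^sup>2 = (LINT x|lebesgue. - (9/8) * (cmod (u x))\<^sup>2)" by (simp add: L2_nrm_power2)
  also have "\<dots> \<le> (LINT x|lebesgue. Re (\<Psi> x * cnj (radial k x + (3 / 2) *\<^sub>R f x)))"
  proof (rule integral_mono)
    show "integrable lebesgue (\<lambda>x. - (9/8) * (cmod (u x))\<^sup>2)" using iu by (intro integrable_mult_right)
    show "integrable lebesgue (\<lambda>x. Re (\<Psi> x * cnj (radial k x + (3 / 2) *\<^sub>R f x)))" by (rule integrable_Re[OF i\<Lambda>])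
    fix x
    have "(cmod (f x))\<^sup>2 = exp (- ((norm x)\<^sup>2 / R\<^sup>2)) * (cmod (u x))\<^sup>2"
      using gauss_power2[OF R0, of x] by (simp add: f_def power_mult_distrib)
    then show "- (9/8) * (cmod (u x))\<^sup>2 \<le> Re (\<Psi> x * cnj (radial k x + (3 / 2) *\<^sub>R f x))"
      unfolding \<Psi>_def by (intro cross_term_bound) auto
  qed
  also have "\<dots> = Re \<Lambda>" unfolding \<Lambda>_def by (rule integral_Re[OF i\<Lambda>])
  finally have \<Lambda>: "- (9/8) * (L2_nrm u)\<^sup>2 \<le> Re \<Lambda>" .
  \<comment> \<open>With G and U the norms of the gradient and of u, the errors over R are: G^2 +
    U^2 from the mixed term of the square, U^2 from its last term, 2 U^2 covering the 9/8. Together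
    they are at most 4 times the squared H^1 norm.\<close>
  have l: "1 * (L2_nrm k)\<^sup>2 - 1 / R\<^sup>2 * Re \<Lambda> \<le> (L2_nrm g)\<^sup>2 + 4 * A\<^sup>2 / R"
  proof -
    define U G where "U = L2_nrm u" and "G = L2_nrm g"
    have UG: "U \<ge> 0" "G \<ge> 0" by (auto simp: U_def G_def L2_nrm_nonneg)
    have R2: "1 / R\<^sup>2 \<le> 1 / R" using R by (simp add: field_simps power2_eq_square)
    have "(L2_nrm k)\<^sup>2 \<le> (G + U / R)\<^sup>2" using B(1) unfolding U_def G_def by (intro power_mono L2_nrm_nonneg)
    also have "\<dots> = G\<^sup>2 + (2 * (G * U)) / R + 1 / R\<^sup>2 * U\<^sup>2" using R0 by (simp add: power2_eq_square field_simps)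
    also have "\<dots> \<le> G\<^sup>2 + (G\<^sup>2 + U\<^sup>2) / R + 1 / R * U\<^sup>2"
      using sum_squares_bound[of G U] R0 R2 by (intro add_mono divide_right_mono mult_right_mono) auto
    finally have 1: "(L2_nrm k)\<^sup>2 \<le> G\<^sup>2 + (G\<^sup>2 + U\<^sup>2) / R + 1 / R * U\<^sup>2" .
    have "- (1 / R\<^sup>2 * Re \<Lambda>) = 1 / R\<^sup>2 * (- Re \<Lambda>)" by simp
    also have "\<dots> \<le> 1 / R\<^sup>2 * (9/8 * U\<^sup>2)" using \<Lambda> unfolding U_def by (intro mult_left_mono) auto
    also have "\<dots> \<le> 1 / R * (2 * U\<^sup>2)" using R2 R0 by (intro mult_mono) auto
    finally have 2: "- (1 / R\<^sup>2 * Re \<Lambda>) \<le> 1 / R * (2 * U\<^sup>2)" .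
    have "(G\<^sup>2 + U\<^sup>2) / R + 1 / R * U\<^sup>2 + 1 / R * (2 * U\<^sup>2) = (G\<^sup>2 + 4 * U\<^sup>2) / R" using R0 by (simp add: field_simps)
    also have "\<dots> \<le> 4 * A\<^sup>2 / R" using R0 AG(4) UG unfolding U_def G_def by (intro divide_right_mono) auto
    finally show ?thesis using 1 2 unfolding G_def by linarith
  qed
  have lim: "((\<lambda>h. (exp h - exp (- h)) / (2 * h) * (L2_nrm k)\<^sup>2 - 1 / R\<^sup>2 * Re (LINT x|lebesgue. \<Psi> x * cnj (dil_diff h f x)))
      \<longlongrightarrow> 1 * (L2_nrm k)\<^sup>2 - 1 / R\<^sup>2 * Re \<Lambda>) (at_right 0)"
    unfolding \<Lambda>_def by (intro tendsto_intros sinh_quotient(1) D(1))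
  show "eventually (\<lambda>h. Re (LINT x|lebesgue. (\<Sum>i\<in>UNIV. grad u x $ i * cnj (grad (loc_gen R h u) x $ i)))
      \<le> (L2_nrm g)\<^sup>2 + 4 * (H1_nrm u)\<^sup>2 / R + \<epsilon>) (at_right 0)" if \<epsilon>: "\<epsilon> > 0"
  proof -
    have "1 * (L2_nrm k)\<^sup>2 - 1 / R\<^sup>2 * Re \<Lambda> < (L2_nrm g)\<^sup>2 + 4 * A\<^sup>2 / R + \<epsilon>" using l \<epsilon> by linarith
    from order_tendstoD(2)[OF lim this] eventually_at_right_less[of 0]
    show ?thesis
    proof eventually_elim
      case (elim h)
      then show ?case using K[of h] unfolding A_def by linarith
    qed
  qed
qed

section \<open>Continuity of dilations in H^1 and the potential contribution\<close>

lemma dilation_tendsto: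
  fixes p :: "real^3 \<Rightarrow> 'a::euclidean_space"
  assumes p: "in_Lp 2 p"
  shows "((\<lambda>s. L2_nrm (\<lambda>x. exp (c * s) *\<^sub>R dil s p x - p x)) \<longlongrightarrow> 0) (at 0)"
proof -
  define a where "a s = exp (c * s) * exp (3 * s / 2)" for s
  define e where "e s = L2_nrm (\<lambda>x. p (exp s *\<^sub>R x) - p x)" for s
  have d: "in_Lp 2 (\<lambda>x. p (exp s *\<^sub>R x) - p x)" for s
    using in_L2_diff[OF L2_affine(1)[OF p, of "exp s" 0] p] by simp
  have le: "norm (L2_nrm (\<lambda>x. exp (c * s) *\<^sub>R dil s p x - p x)) \<le> a s * e s + \<bar>a s - 1\<bar> * L2_nrm p" for s
  proof -
    have "exp (c * s) *\<^sub>R dil s p x - p x = a s *\<^sub>R (p (exp s *\<^sub>R x) - p x) + (a s - 1) *\<^sub>R p x" for x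
      by (simp add: dil_def a_def algebra_simps)
    then have "L2_nrm (\<lambda>x. exp (c * s) *\<^sub>R dil s p x - p x) \<le> \<bar>a s\<bar> * e s + \<bar>a s - 1\<bar> * L2_nrm p"
      using L2_nrm_triangle[OF in_L2_scaleR[OF d] in_L2_scaleR[OF p], of "a s" s "a s - 1"]
      unfolding L2_nrm_scaleR e_def by simp
    then show ?thesis by (simp add: a_def L2_nrm_nonneg)
  qed
  have "((\<lambda>s. a s * e s + \<bar>a s - 1\<bar> * L2_nrm p) \<longlongrightarrow> exp (c * 0) * exp (3 * 0 / 2) * 0 + \<bar>exp (c * 0) * exp (3 * 0 / 2) - 1\<bar> * L2_nrm p) (at 0)"
    unfolding a_def e_def by (intro tendsto_intros dilation_continuous_L2 p) auto
  then have "((\<lambda>s. a s * e s + \<bar>a s - 1\<bar> * L2_nrm p) \<longlongrightarrow> 0) (at 0)" by simp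
  then show ?thesis by (rule Lim_null_comparison[rotated]) (use le in auto)
qed

lemma H1_nrm_dil_le:
  assumes fk: "H1_grad f k" and s: "\<bar>s\<bar> \<le> 1"
  shows "(H1_nrm (dil s f))\<^sup>2 \<le> exp 2 * (H1_nrm f)\<^sup>2"
proof -
  have "(exp s)\<^sup>2 \<le> exp (2::real)" using s by (simp add: exp_double[symmetric])
  then have "(exp s)\<^sup>2 * (L2_nrm k)\<^sup>2 \<le> exp 2 * (L2_nrm k)\<^sup>2" by (rule mult_right_mono) simp
  moreover have "1 * (L2_nrm f)\<^sup>2 \<le> exp 2 * (L2_nrm f)\<^sup>2" by (rule mult_right_mono) auto
  ultimately show ?thesis
    unfolding H1_nrm_eq[OF H1_grad_dil[OF fk]] H1_nrm_eq[OF fk] L2_nrm_scaleR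
      in_L2_dil(2)[OF H1_gradD(1)[OF fk]] in_L2_dil(2)[OF H1_gradD(2)[OF fk]]
    by (simp add: power_mult_distrib distrib_left)
qed

lemma H1_nrm_dil_tendsto:
  assumes fk: "H1_grad f k"
  shows "((\<lambda>s. H1_nrm (\<lambda>x. dil s f x - f x)) \<longlongrightarrow> 0) (at 0)"
proof -
  have le: "norm (H1_nrm (\<lambda>x. dil s f x - f x)) \<le> L2_nrm (\<lambda>x. exp (0 * s) *\<^sub>R dil s f x - f x) + L2_nrm (\<lambda>x. exp (1 * s) *\<^sub>R dil s k x - k x)" for s
    using H1_nrm_le[OF H1_grad_diff[OF H1_grad_dil[OF fk] fk]] H1_nrm_nonneg by simp
  have "((\<lambda>s. L2_nrm (\<lambda>x. exp (0 * s) *\<^sub>R dil s f x - f x) + L2_nrm (\<lambda>x. exp (1 * s) *\<^sub>R dil s k x - k x)) \<longlongrightarrow> 0 + 0) (at 0)"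
    by (intro tendsto_add dilation_tendsto H1_gradD[OF fk])
  then have "((\<lambda>s. L2_nrm (\<lambda>x. exp (0 * s) *\<^sub>R dil s f x - f x) + L2_nrm (\<lambda>x. exp (1 * s) *\<^sub>R dil s k x - k x)) \<longlongrightarrow> 0) (at 0)"
    unfolding add_0_left .
  then show ?thesis by (rule Lim_null_comparison[rotated]) (use le in auto)
qed

lemma power2_add_weighted_le:
  fixes x y \<eta> :: real
  assumes "\<eta> > 0"
  shows "(x + y)\<^sup>2 \<le> (1 + \<eta>) * x\<^sup>2 + (1 + 1 / \<eta>) * y\<^sup>2"
proof -
  have "0 \<le> (\<eta> * x - y)\<^sup>2 / \<eta>" using assms by simp
  also have "\<dots> = \<eta> * x\<^sup>2 - 2 * x * y + 1 / \<eta> * y\<^sup>2" using assms by (simp add: power2_eq_square field_simps)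
  finally show ?thesis by (simp add: power2_eq_square algebra_simps)
qed

text \<open>The bound B/2 is used in two ways. Uniformly, the dilates of \<chi>u are bounded in H^1:
  9 is the square of 2 + 1/R at R = 1, and \<open>exp 2\<close> covers dilations with parameter at
  most 1. For small \<open>h\<close>, continuity of dilations in H^1 brings B close to the integral
  of |W| |\<chi>u|^2, which is at most minus the integral of W |u|^2 since W is nonpositive and
  \<chi> at most 1.\<close>

lemma potential_term:
  fixes V W :: "real^3 \<Rightarrow> real"
  assumes \<delta>: "\<delta> > 3/2" and V: "in_Lp \<delta> V" and W: "in_Lp \<delta> W" and VW: "x_dot_grad V W"
    and W0: "AE x in lebesgue. W x \<le> 0"
  obtains C where "C \<ge> 0"
    "\<And>u g R h. H1_grad u g \<Longrightarrow> R \<ge> 1 \<Longrightarrow> 0 < h \<Longrightarrow> h \<le> 1 \<Longrightarrow>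
      Re (LINT x|lebesgue. complex_of_real (V x) * u x * cnj (loc_gen R h u x)) \<le> C * (H1_nrm u)\<^sup>2"
    "\<And>u g R \<epsilon>. H1_grad u g \<Longrightarrow> R \<ge> 1 \<Longrightarrow> \<epsilon> > 0 \<Longrightarrow>
      eventually (\<lambda>h. Re (LINT x|lebesgue. complex_of_real (V x) * u x * cnj (loc_gen R h u x))
        \<le> - 1/2 * (LINT x|lebesgue. W x * (cmod (u x))\<^sup>2) + \<epsilon>) (at_right 0)"
proof -
  obtain C where C: "C \<ge> 0" "\<And>f g. H1_grad f g \<Longrightarrow> integrable lebesgue (\<lambda>x. \<bar>W x\<bar> * (norm (f x))\<^sup>2)"
    "\<And>f g. H1_grad f g \<Longrightarrow> (LINT x|lebesgue. \<bar>W x\<bar> * (norm (f x))\<^sup>2) \<le> C * (H1_nrm f)\<^sup>2"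
    by (rule potential_bound[OF \<delta> W], rule that)
  have mW[measurable]: "W \<in> borel_measurable lebesgue" using W by (simp add: in_Lp_def)
  have E: "(LINT x|lebesgue. complex_of_real (V x) * u x * cnj (loc_gen R h u x))
      = (LINT x|lebesgue. complex_of_real (V x) * (gauss R x *\<^sub>R u x) * cnj (dil_diff h (\<lambda>x. gauss R x *\<^sub>R u x) x))" for u R h
    unfolding loc_gen_def by (intro Bochner_Integration.integral_cong refl) simp
  note PT = potential_term_bound[OF \<delta> V W VW W0]
  show thesis
  proof (rule that[of "C * (exp 2 * 9)"])
    show "C * (exp 2 * 9) \<ge> 0" using C(1) by simp
  next
    fix u g and R h :: real assume ug: "H1_grad u g" and R: "R \<ge> 1" and h: "0 < h" "h \<le> 1"
    have R0: "R > 0" using R by simp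
    note fk = H1_grad_gauss[OF ug R0]
    let ?f = "\<lambda>x. gauss R x *\<^sub>R u x"
    have "H1_nrm ?f \<le> 3 * H1_nrm u"
    proof -
      have "H1_nrm ?f \<le> (2 + 1 / R) * H1_nrm u" by (rule H1_nrm_gauss_le[OF ug R0])
      also have "\<dots> \<le> 3 * H1_nrm u" using R by (intro mult_right_mono H1_nrm_nonneg) simp
      finally show ?thesis .
    qed
    then have f3: "(H1_nrm ?f)\<^sup>2 \<le> 9 * (H1_nrm u)\<^sup>2"
      using power_mono[of "H1_nrm ?f" "3 * H1_nrm u" 2] H1_nrm_nonneg[of ?f] by (simp add: power_mult_distrib)
    have "Re (LINT x|lebesgue. complex_of_real (V x) * ?f x * cnj (dil_diff h ?f x)) \<le> C * (exp 2 * (9 * (H1_nrm u)\<^sup>2)) / 2"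
    proof (rule PT[OF fk h(1)])
      fix s :: real assume "\<bar>s\<bar> \<le> h"
      then have s: "\<bar>s\<bar> \<le> 1" using h by simp
      have "(LINT x|lebesgue. \<bar>W x\<bar> * (norm (dil s ?f x))\<^sup>2) \<le> C * (H1_nrm (dil s ?f))\<^sup>2" by (rule C(3)[OF H1_grad_dil[OF fk]])
      also have "\<dots> \<le> C * (exp 2 * (H1_nrm ?f)\<^sup>2)" by (intro mult_left_mono H1_nrm_dil_le[OF fk s] C(1))
      also have "\<dots> \<le> C * (exp 2 * (9 * (H1_nrm u)\<^sup>2))" by (intro mult_left_mono f3 C(1)) auto
      finally show "(LINT x|lebesgue. \<bar>W x\<bar> * (norm (dil s ?f x))\<^sup>2) \<le> C * (exp 2 * (9 * (H1_nrm u)\<^sup>2))" .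
    qed
    also have "\<dots> \<le> C * (exp 2 * (9 * (H1_nrm u)\<^sup>2))" using C(1) by simp
    finally show "Re (LINT x|lebesgue. complex_of_real (V x) * u x * cnj (loc_gen R h u x)) \<le> C * (exp 2 * 9) * (H1_nrm u)\<^sup>2"
      unfolding E by (simp only: mult.assoc)
  next
    fix u g and R \<epsilon> :: real assume ug: "H1_grad u g" and R: "R \<ge> 1" and \<epsilon>: "\<epsilon> > 0"
    have R0: "R > 0" using R by simp
    define f where "f = (\<lambda>x. gauss R x *\<^sub>R u x)"
    have "in_H1 f" unfolding f_def by (rule H1_grad_in_H1[OF H1_grad_gauss[OF ug R0]])
    note fk = in_H1_grad[OF this]
    define m where "m s = (LINT x|lebesgue. \<bar>W x\<bar> * (norm (dil s f x))\<^sup>2)" for s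
    define m0 where "m0 = (LINT x|lebesgue. \<bar>W x\<bar> * (norm (f x))\<^sup>2)"
    have m00: "m 0 = m0" by (simp add: m_def m0_def dil_def)
    have m0n: "m0 \<ge> 0" unfolding m0_def by simp
    \<comment> \<open>The weight in the splitting of the square, chosen so that
      \<open>\<eta> * m0\<close> stays below half of \<open>\<epsilon>\<close>; adding 1 allows
      \<open>m0 = 0\<close>. The large factor \<open>1 + 1 / \<eta>\<close> then multiplies a
      quantity that vanishes with \<open>s\<close>.\<close>
    define \<eta> where "\<eta> = \<epsilon> / (2 * (m0 + 1))"
    have \<eta>: "\<eta> > 0" using \<epsilon> m0n by (simp add: \<eta>_def)
    have \<eta>m: "\<eta> * m0 \<le> \<epsilon> / 2"
    proof -
      have "\<eta> * m0 \<le> \<eta> * (m0 + 1)" using \<eta> by (intro mult_left_mono) auto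
      also have "\<dots> = \<epsilon> / 2" using m0n by (simp add: \<eta>_def field_simps)
      finally show ?thesis .
    qed
    define d where "d s = H1_nrm (\<lambda>x. dil s f x - f x)" for s
    have mle: "m s \<le> (1 + \<eta>) * m0 + (1 + 1 / \<eta>) * (C * (d s)\<^sup>2)" for s
    proof -
      note df = H1_grad_diff[OF H1_grad_dil[OF fk, of s] fk]
      note i1 = C(2)[OF fk] and i2 = C(2)[OF df] and i3 = C(2)[OF H1_grad_dil[OF fk, of s]]
      have "m s \<le> (LINT x|lebesgue. (1 + \<eta>) * (\<bar>W x\<bar> * (norm (f x))\<^sup>2) + (1 + 1 / \<eta>) * (\<bar>W x\<bar> * (norm (dil s f x - f x))\<^sup>2))"
        unfolding m_def
      proof (rule integral_mono[OF i3])
        show "integrable lebesgue (\<lambda>x. (1 + \<eta>) * (\<bar>W x\<bar> * (norm (f x))\<^sup>2) + (1 + 1 / \<eta>) * (\<bar>W x\<bar> * (norm (dil s f x - f x))\<^sup>2))"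
          by (intro Bochner_Integration.integrable_add integrable_mult_right i1 i2)
        fix x
        have "norm (dil s f x) \<le> norm (f x) + norm (dil s f x - f x)" using norm_triangle_ineq[of "f x" "dil s f x - f x"] by simp
        then have "(norm (dil s f x))\<^sup>2 \<le> (norm (f x) + norm (dil s f x - f x))\<^sup>2" by (intro power_mono) auto
        also have "\<dots> \<le> (1 + \<eta>) * (norm (f x))\<^sup>2 + (1 + 1 / \<eta>) * (norm (dil s f x - f x))\<^sup>2"
          by (rule power2_add_weighted_le[OF \<eta>])
        finally have "\<bar>W x\<bar> * (norm (dil s f x))\<^sup>2 \<le> \<bar>W x\<bar> * ((1 + \<eta>) * (norm (f x))\<^sup>2 + (1 + 1 / \<eta>) * (norm (dil s f x - f x))\<^sup>2)"
          by (rule mult_left_mono) simp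
        then show "\<bar>W x\<bar> * (norm (dil s f x))\<^sup>2 \<le> (1 + \<eta>) * (\<bar>W x\<bar> * (norm (f x))\<^sup>2) + (1 + 1 / \<eta>) * (\<bar>W x\<bar> * (norm (dil s f x - f x))\<^sup>2)"
          by (simp only: distrib_left mult.left_commute)
      qed
      also have "\<dots> = (1 + \<eta>) * m0 + (1 + 1 / \<eta>) * (LINT x|lebesgue. \<bar>W x\<bar> * (norm (dil s f x - f x))\<^sup>2)"
        unfolding m0_def using i1 i2 by (subst Bochner_Integration.integral_add) (intro integrable_mult_right, auto)
      also have "\<dots> \<le> (1 + \<eta>) * m0 + (1 + 1 / \<eta>) * (C * (d s)\<^sup>2)"
        unfolding d_def using \<eta> C(3)[OF df] by (intro add_left_mono mult_left_mono) auto
      finally show ?thesis .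
    qed
    have "((\<lambda>s. (1 + 1 / \<eta>) * (C * (d s)\<^sup>2)) \<longlongrightarrow> (1 + 1 / \<eta>) * (C * 0\<^sup>2)) (at 0)"
      unfolding d_def by (intro tendsto_intros H1_nrm_dil_tendsto[OF fk])
    then have "((\<lambda>s. (1 + 1 / \<eta>) * (C * (d s)\<^sup>2)) \<longlongrightarrow> 0) (at 0)" by simp
    then have "eventually (\<lambda>s. (1 + 1 / \<eta>) * (C * (d s)\<^sup>2) < \<epsilon> / 2) (at 0)"
      by (rule order_tendstoD) (use \<epsilon> in simp)
    then obtain r where r: "r > 0" "\<And>s. s \<noteq> 0 \<Longrightarrow> \<bar>s\<bar> < r \<Longrightarrow> (1 + 1 / \<eta>) * (C * (d s)\<^sup>2) < \<epsilon> / 2"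
      by (auto simp: eventually_at dist_real_def)
    have mr: "m s \<le> m0 + \<epsilon>" if "\<bar>s\<bar> < r" for s
    proof (cases "s = 0")
      case True then show ?thesis using m00 \<epsilon> by simp
    next
      case False
      have "(1 + \<eta>) * m0 = m0 + \<eta> * m0" by (simp add: distrib_right)
      then show ?thesis using mle[of s] r(2)[OF False that] \<eta>m by linarith
    qed
    have m0W: "m0 \<le> - (LINT x|lebesgue. W x * (cmod (u x))\<^sup>2)"
    proof -
      have "m0 \<le> (LINT x|lebesgue. \<bar>W x\<bar> * (norm (u x))\<^sup>2)" unfolding m0_def
      proof (rule integral_mono[OF C(2)[OF fk] C(2)[OF ug]])
        fix x
        have "norm (f x) \<le> norm (u x)"
          using gauss_pos[of R x] gauss_le_1[of R x] mult_right_mono[of "gauss R x" 1 "norm (u x)"] by (simp add: f_def)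
        then show "\<bar>W x\<bar> * (norm (f x))\<^sup>2 \<le> \<bar>W x\<bar> * (norm (u x))\<^sup>2" by (intro mult_left_mono power_mono) auto
      qed
      also have "\<dots> = (LINT x|lebesgue. - (W x * (cmod (u x))\<^sup>2))"
      proof (rule integral_cong_AE)
        note [measurable] = in_L2_measurable[OF H1_gradD(1)[OF ug]]
        show "(\<lambda>x. \<bar>W x\<bar> * (norm (u x))\<^sup>2) \<in> borel_measurable lebesgue" "(\<lambda>x. - (W x * (cmod (u x))\<^sup>2)) \<in> borel_measurable lebesgue"
          by measurable
        show "AE x in lebesgue. \<bar>W x\<bar> * (norm (u x))\<^sup>2 = - (W x * (cmod (u x))\<^sup>2)" using W0 by eventually_elim simp
      qed
      finally show ?thesis by simp
    qed
    have "eventually (\<lambda>h. 0 < h \<and> h < r) (at_right 0)"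
      unfolding eventually_at_right_field using r(1) by blast
    then show "eventually (\<lambda>h. Re (LINT x|lebesgue. complex_of_real (V x) * u x * cnj (loc_gen R h u x))
        \<le> - 1/2 * (LINT x|lebesgue. W x * (cmod (u x))\<^sup>2) + \<epsilon>) (at_right 0)"
    proof eventually_elim
      case (elim h)
      have "Re (LINT x|lebesgue. complex_of_real (V x) * f x * cnj (dil_diff h f x)) \<le> (m0 + \<epsilon>) / 2"
        by (rule PT[OF fk]) (use elim mr in \<open>auto simp: m_def\<close>)
      also have "\<dots> \<le> - 1/2 * (LINT x|lebesgue. W x * (cmod (u x))\<^sup>2) + \<epsilon>" using m0W \<epsilon> by simp
      finally show ?case unfolding E f_def .
    qed
  qed
qed

text \<open>The order of the quantifiers matters. The lower bound \<open>- C\<close> may depend on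
  R, as it only makes Fatou's lemma applicable; \<open>M\<close> is independent of R, u and h, so R
  can be chosen afterwards to make the error small on a given H^1 ball.\<close>

lemma virial_slice:
  fixes V W :: "real^3 \<Rightarrow> real"
  assumes b: "0 < b" "b < 1" and \<delta>: "\<delta> > 3/2" and V: "in_Lp \<delta> V" and W: "in_Lp \<delta> W" and VW: "x_dot_grad V W"
    and W0: "AE x in lebesgue. W x \<le> 0"
  defines "Q \<equiv> \<lambda>R h u. - 2 * Re (pair_H V u (loc_gen R h u) - pair_N b u (loc_gen R h u))"
  obtains M where "M \<ge> 0"
    "\<And>R A. R \<ge> 1 \<Longrightarrow> \<exists>C. \<forall>u h. in_H1 u \<longrightarrow> H1_nrm u \<le> A \<longrightarrow> 0 < h \<longrightarrow> h \<le> 1 \<longrightarrow> - C \<le> Q R h u"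
    "\<And>u R A \<epsilon>. in_H1 u \<Longrightarrow> H1_nrm u \<le> A \<Longrightarrow> R \<ge> 1 \<Longrightarrow> \<epsilon> > 0 \<Longrightarrow>
      eventually (\<lambda>h. - 2 * virial b W u - M * (A\<^sup>2 + A ^ 4) * (1 / R + R powr (- b)) - \<epsilon> \<le> Q R h u) (at_right 0)"
proof -
  obtain CP where CP: "CP \<ge> 0"
    "\<And>u g R h. H1_grad u g \<Longrightarrow> R \<ge> 1 \<Longrightarrow> 0 < h \<Longrightarrow> h \<le> 1 \<Longrightarrow>
      Re (LINT x|lebesgue. complex_of_real (V x) * u x * cnj (loc_gen R h u x)) \<le> CP * (H1_nrm u)\<^sup>2"
    "\<And>u g R \<epsilon>. H1_grad u g \<Longrightarrow> R \<ge> 1 \<Longrightarrow> \<epsilon> > 0 \<Longrightarrow>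
      eventually (\<lambda>h. Re (LINT x|lebesgue. complex_of_real (V x) * u x * cnj (loc_gen R h u x))
        \<le> - 1/2 * (LINT x|lebesgue. W x * (cmod (u x))\<^sup>2) + \<epsilon>) (at_right 0)"
    by (rule potential_term[OF \<delta> V W VW W0], rule that)
  obtain CN where CN: "CN \<ge> 0" "\<And>f g. H1_grad f g \<Longrightarrow> integrable lebesgue (\<lambda>x. norm x powr (- b) * norm (f x) ^ 4)"
    "\<And>f g. H1_grad f g \<Longrightarrow> (LINT x|lebesgue. norm x powr (- b) * norm (f x) ^ 4) \<le> CN * H1_nrm f ^ 4"
    by (rule nonlinearity_bound[OF b], rule that)
  obtain C4 where C4: "C4 \<ge> 0" "\<And>f g. H1_grad f g \<Longrightarrow> integrable lebesgue (\<lambda>x. norm (f x) ^ 4)"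
    "\<And>f g. H1_grad f g \<Longrightarrow> (LINT x|lebesgue. norm (f x) ^ 4) \<le> C4 * H1_nrm f ^ 4"
    by (rule L4_bound, rule that)
  define Kin where "Kin R h u = Re (LINT x|lebesgue. (\<Sum>i\<in>UNIV. grad u x $ i * cnj (grad (loc_gen R h u) x $ i)))" for R h u
  define Pot where "Pot R h u = Re (LINT x|lebesgue. complex_of_real (V x) * u x * cnj (loc_gen R h u x))" for R h u
  have Q: "Q R h u = - 2 * (Kin R h u + Pot R h u - Re (pair_N b u (loc_gen R h u)))" for R h u
    by (simp add: Q_def pair_H_def Kin_def Pot_def)
  show thesis
  \<comment> \<open>Twice the kinetic error constant 4 and twice 3/2 times the L^4 constant, the
    doubling coming from the factor -2 in \<open>Q\<close>.\<close>
  proof (rule that[of "8 + 3 * C4"])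
    show "8 + 3 * C4 \<ge> 0" using C4(1) by simp
  next
    fix R A :: real assume R: "R \<ge> 1"
    define c1 where "c1 = 4 * exp 1 + exp 4 * ((2 * R + 6) * (R + 3))"
    define c3 where "c3 = exp 4 * ((1 + R) * (64 * A ^ 3) * ((2 + 1 / R) * A) + CN * A ^ 4)"
    define C where "C = 2 * (c1 * A\<^sup>2 + CP * A\<^sup>2 + c3)"
    have c1: "c1 \<ge> 0" using R unfolding c1_def by (intro add_nonneg_nonneg mult_nonneg_nonneg) auto
    show "\<exists>C. \<forall>u h. in_H1 u \<longrightarrow> H1_nrm u \<le> A \<longrightarrow> 0 < h \<longrightarrow> h \<le> 1 \<longrightarrow> - C \<le> Q R h u"
    proof (intro exI[of _ C] allI impI)
      fix u h assume u: "in_H1 u" and A: "H1_nrm u \<le> A" and h: "0 < h" "h \<le> (1::real)"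
      note ug = in_H1_grad[OF u]
      have n: "H1_nrm u \<ge> 0" by (rule H1_nrm_nonneg)
      have pw: "H1_nrm u ^ j \<le> A ^ j" for j by (intro power_mono A n)
      have "Kin R h u \<le> c1 * (H1_nrm u)\<^sup>2" unfolding Kin_def c1_def by (rule kinetic_term(1)[OF ug R h])
      also have "\<dots> \<le> c1 * A\<^sup>2" by (intro mult_left_mono pw c1)
      finally have 1: "Kin R h u \<le> c1 * A\<^sup>2" .
      have "Pot R h u \<le> CP * (H1_nrm u)\<^sup>2" unfolding Pot_def by (rule CP(2)[OF ug R h])
      also have "\<dots> \<le> CP * A\<^sup>2" by (intro mult_left_mono pw CP(1))
      finally have 2: "Pot R h u \<le> CP * A\<^sup>2" .
      have R0: "R > 0" using R by simp
      have "norm (pair_N b u (loc_gen R h u))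
          \<le> exp 4 * ((1 + R) * (64 * L2_nrm (grad u) ^ 3) * ((2 + 1 / R) * H1_nrm u) + (LINT x|lebesgue. norm x powr (- b) * cmod (u x) ^ 4))"
        by (rule nonlinear_term(2)[OF b ug R0 h])
      also have "\<dots> \<le> exp 4 * ((1 + R) * (64 * A ^ 3) * ((2 + 1 / R) * A) + CN * A ^ 4)"
      proof (intro mult_left_mono add_mono mult_mono)
        show "L2_nrm (grad u) ^ 3 \<le> A ^ 3"
          using L2_nrm_le_H1_nrm(2)[of u] A by (intro power_mono L2_nrm_nonneg) auto
        show "(LINT x|lebesgue. norm x powr (- b) * cmod (u x) ^ 4) \<le> CN * A ^ 4"
          using CN(3)[OF ug] mult_left_mono[OF pw[of 4] CN(1)] by linarith
      qed (use R n A in \<open>auto simp: L2_nrm_nonneg\<close>)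
      finally have "norm (pair_N b u (loc_gen R h u)) \<le> exp 4 * ((1 + R) * (64 * A ^ 3) * ((2 + 1 / R) * A) + CN * A ^ 4)" .
      then have "- Re (pair_N b u (loc_gen R h u)) \<le> c3"
        unfolding c3_def[symmetric] using abs_Re_le_cmod[of "pair_N b u (loc_gen R h u)"] by linarith
      note 3 = this
      have "- (2 * (x + y + z)) \<le> - 2 * (x' + y' - z')" if "x' \<le> x" "y' \<le> y" "- z' \<le> z" for x y z x' y' z' :: real
      proof -
        have "(x' + y' - z') * 2 \<le> (x + y + z) * 2"
          using add_mono[OF add_mono[OF that(1,2)] that(3)] by (intro mult_right_mono) auto
        then show ?thesis by (simp only: mult_minus_left mult.commute neg_le_iff_le)
      qed
      from this[OF 1 2 3] show "- C \<le> Q R h u" unfolding Q C_def .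
    qed
  next
    fix u and R A \<epsilon> :: real assume u: "in_H1 u" and A: "H1_nrm u \<le> A" and R: "R \<ge> 1" and \<epsilon>: "\<epsilon> > 0"
    note ug = in_H1_grad[OF u]
    have R0: "R > 0" using R by simp
    have n: "H1_nrm u \<ge> 0" by (rule H1_nrm_nonneg)
    have pw: "H1_nrm u ^ j \<le> A ^ j" for j by (intro power_mono A n)
    \<comment> \<open>Three contributions, each known up to \<open>\<epsilon> / 6\<close>, and the
      outer factor 2.\<close>
    have \<epsilon>6: "\<epsilon> / 6 > 0" using \<epsilon> by simp
    obtain l where l: "((\<lambda>h. Re (pair_N b u (loc_gen R h u))) \<longlongrightarrow> l) (at_right 0)"
      "l \<ge> (3 + b) / 4 * (LINT x|lebesgue. norm x powr (- b) * cmod (u x) ^ 4) - 3/2 * R powr (- b) * (LINT x|lebesgue. cmod (u x) ^ 4)"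
      using nonlinear_term(1)[OF b ug R0] by blast
    have ev3: "eventually (\<lambda>h. l - \<epsilon> / 6 < Re (pair_N b u (loc_gen R h u))) (at_right 0)"
      by (rule order_tendstoD(1)[OF l(1)]) (use \<epsilon> in simp)
    have kA: "4 * (H1_nrm u)\<^sup>2 / R \<le> 4 * A\<^sup>2 / R" using pw[of 2] R0 by (intro divide_right_mono) auto
    have nA: "3/2 * R powr (- b) * (LINT x|lebesgue. cmod (u x) ^ 4) \<le> 3/2 * R powr (- b) * (C4 * A ^ 4)"
      using C4(3)[OF ug] mult_left_mono[OF pw[of 4] C4(1)] by (intro mult_left_mono) auto
    have err: "8 * A\<^sup>2 / R + 3 * R powr (- b) * (C4 * A ^ 4) \<le> (8 + 3 * C4) * (A\<^sup>2 + A ^ 4) * (1 / R + R powr (- b))"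
    proof -
      have "(8 + 3 * C4) * (A\<^sup>2 + A ^ 4) * (1 / R + R powr (- b)) = 8 * A\<^sup>2 / R + 3 * R powr (- b) * (C4 * A ^ 4)
        + (8 * A ^ 4 * (1 / R) + 3 * C4 * (A\<^sup>2 + A ^ 4) * (1 / R) + 8 * (A\<^sup>2 + A ^ 4) * R powr (- b) + 3 * C4 * A\<^sup>2 * R powr (- b))"
        by (simp add: algebra_simps)
      moreover have "0 \<le> 8 * A ^ 4 * (1 / R) + 3 * C4 * (A\<^sup>2 + A ^ 4) * (1 / R) + 8 * (A\<^sup>2 + A ^ 4) * R powr (- b) + 3 * C4 * A\<^sup>2 * R powr (- b)"
        using C4(1) R0 by (intro add_nonneg_nonneg mult_nonneg_nonneg) auto
      ultimately show ?thesis by linarith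
    qed
    have vir: "virial b W u = (L2_nrm (grad u))\<^sup>2 - 1/2 * (LINT x|lebesgue. W x * (cmod (u x))\<^sup>2)
        - (3 + b) / 4 * (LINT x|lebesgue. norm x powr (- b) * cmod (u x) ^ 4)"
      by (simp add: virial_def L2_nrm_power2)
    show "eventually (\<lambda>h. - 2 * virial b W u - (8 + 3 * C4) * (A\<^sup>2 + A ^ 4) * (1 / R + R powr (- b)) - \<epsilon> \<le> Q R h u) (at_right 0)"
      using kinetic_term(2)[OF ug R \<epsilon>6, folded Kin_def] CP(3)[OF ug R \<epsilon>6, folded Pot_def] ev3
    proof eventually_elim
      case (elim h)
      define E where "E = (8 + 3 * C4) * (A\<^sup>2 + A ^ 4) * (1 / R + R powr (- b))"
      define r where "r = R powr (- b) * (C4 * A ^ 4)"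
      define a where "a = A\<^sup>2 / R"
      have "4 * (H1_nrm u)\<^sup>2 / R \<le> 4 * a" "3/2 * R powr (- b) * (LINT x|lebesgue. cmod (u x) ^ 4) \<le> 3/2 * r"
        "8 * a + 3 * r \<le> E"
        using kA nA err unfolding E_def r_def a_def by (simp_all only: times_divide_eq_right mult.assoc)
      then have "Kin R h u + Pot R h u - Re (pair_N b u (loc_gen R h u)) \<le> virial b W u + E / 2 + \<epsilon> / 2"
        unfolding vir using l(2) elim by linarith
      then show ?case unfolding Q E_def[symmetric] by simp
    qed
  qed
qed

section \<open>Integration of the virial inequality in time\<close>

text \<open>Uniformity in \<open>h\<close> comes from the increment formula: the quotient of
  \<chi>u, paired with a fixed L^2 function, is controlled by the L^2 norms of x . \<nabla>(\<chi>u)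
  and \<chi>u.\<close>

lemma loc_gen_pairing_bound:
  assumes u: "in_H1 u" and A: "H1_nrm u \<le> A" and R: "R \<ge> 1" and h: "0 < h" "h \<le> 1"
  shows "\<bar>Im (pair_L2 u (loc_gen R h u))\<bar> \<le> exp 4 * (A * ((R + 3) * A))"
proof -
  have R0: "R > 0" using R by simp
  note ug = in_H1_grad[OF u]
  define f where "f = (\<lambda>x. gauss R x *\<^sub>R u x)"
  define k where "k = (\<lambda>x. gauss R x *\<^sub>R grad u x + (\<chi> i. (- (x $ i / R\<^sup>2) * gauss R x) *\<^sub>R u x))"
  have fk: "H1_grad f k" unfolding f_def k_def by (rule H1_grad_gauss[OF ug R0])
  note B = gauss_gradient_bounds(1,2)[OF ug R0, folded k_def]
  have A0: "A \<ge> 0" using H1_nrm_nonneg[of u] A by simp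
  have un: "L2_nrm u \<le> A" "L2_nrm (grad u) \<le> A" using L2_nrm_le_H1_nrm[of u] A by auto
  have nf: "L2_nrm f \<le> A" using in_L2_gauss(2)[OF in_H1_L2[OF u], of R] un(1) by (simp add: f_def)
  have "R * L2_nrm (grad u) \<le> R * A" using un(2) R by (intro mult_left_mono) auto
  then have nq: "L2_nrm (radial k) + L2_nrm f \<le> (R + 3) * A"
    unfolding distrib_right using B(2) un(1) nf by linarith
  have "pair_L2 u (loc_gen R h u) = (LINT x|lebesgue. f x * cnj (dil_diff h f x))"
    unfolding pair_L2_def loc_gen_def f_def by (intro Bochner_Integration.integral_cong refl) simp
  then have "norm (pair_L2 u (loc_gen R h u)) \<le> exp 4 * (L2_nrm f * (L2_nrm (radial k) + L2_nrm f))"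
    using dil_diff_limit_L2(2)[OF fk H1_gradD(1)[OF fk] B(1) h] by simp
  also have "\<dots> \<le> exp 4 * (A * ((R + 3) * A))"
    using nf nq A0 by (intro mult_left_mono mult_mono) (auto simp: L2_nrm_nonneg)
  finally show ?thesis using abs_Im_le_cmod[of "pair_L2 u (loc_gen R h u)"] by linarith
qed

text \<open>The threshold in \<open>h\<close> below which \<open>\<beta>\<close> bounds the
  derivative varies with \<open>t\<close>, so the inequality cannot be integrated at any single
  \<open>h\<close>. Adding \<open>C\<close> makes the derivatives nonnegative, and Fatou's lemma
  integrates the lower limit; the increments of \<open>G h\<close> stay below \<open>2 * D\<close>
  for every \<open>h\<close>.\<close>

lemma derivatives_not_eventually_bounded_below:
  fixes G Q :: "real \<Rightarrow> real \<Rightarrow> real"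
  assumes der: "\<And>h t. 0 < h \<Longrightarrow> h \<le> 1 \<Longrightarrow> t \<ge> 0 \<Longrightarrow> (G h has_real_derivative Q h t) (at t within {0..})"
    and lower: "\<And>h t. 0 < h \<Longrightarrow> h \<le> 1 \<Longrightarrow> t \<ge> 0 \<Longrightarrow> - C \<le> Q h t" and C: "C \<ge> 0"
    and bd: "\<And>h t. 0 < h \<Longrightarrow> h \<le> 1 \<Longrightarrow> t \<ge> 0 \<Longrightarrow> \<bar>G h t\<bar> \<le> D"
    and ev: "\<And>t. t \<ge> 0 \<Longrightarrow> eventually (\<lambda>h. \<beta> \<le> Q h t) (at_right 0)" and \<beta>: "\<beta> > 0"
  shows False
proof -
  have D: "D \<ge> 0" using bd[of 1 0] by simp
  \<comment> \<open>Long enough for growth at rate \<open>\<beta>\<close> to exceed the largest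
    possible increment \<open>2 * D\<close> by 1.\<close>
  define T where "T = (2 * D + 1) / \<beta>"
  have T: "T \<ge> 0" "\<beta> * T = 2 * D + 1" using \<beta> D by (auto simp: T_def)
  define \<eta> where "\<eta> n = 1 / real (n + 1)" for n
  have \<eta>: "0 < \<eta> n" "\<eta> n \<le> 1" for n by (auto simp: \<eta>_def)
  have "\<eta> \<longlonglongrightarrow> 0" unfolding \<eta>_def by (rule LIMSEQ_ignore_initial_segment[OF lim_1_over_n])
  then have \<eta>r: "filterlim \<eta> (at_right 0) sequentially"
    by (rule tendsto_imp_filterlim_at_right) (use \<eta> in auto)
  define g where "g n t = indicat_real {0..T} t *\<^sub>R (Q (\<eta> n) t + C)" for n t
  have g0: "g n t \<ge> 0" for n t using lower[OF \<eta>, of t n] by (auto simp: g_def indicator_def)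
  have ig: "integrable lebesgue (g n)" and jg: "(LINT t|lebesgue. g n t) \<le> 2 * D + C * T" for n
  proof -
    \<comment> \<open>\<open>Q (\<eta> n)\<close> is an exact derivative of which no continuity in
      time is assumed. The gauge integral applies to every derivative, and nonnegativity upgrades it
      to Lebesgue integrability.\<close>
    have "((\<lambda>t. Q (\<eta> n) t + C) has_integral ((G (\<eta> n) T + C * T) - (G (\<eta> n) 0 + C * 0))) {0..T}"
    proof (rule fundamental_theorem_of_calculus[OF T(1)])
      fix t assume t: "t \<in> {0..T}"
      have "(G (\<eta> n) has_real_derivative Q (\<eta> n) t) (at t within {0..T})"
        by (rule DERIV_subset[OF der[OF \<eta>]]) (use t in auto)
      then have "((\<lambda>t. G (\<eta> n) t + C * t) has_real_derivative (Q (\<eta> n) t + C)) (at t within {0..T})"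
        by (auto intro!: derivative_eq_intros)
      then show "((\<lambda>t. G (\<eta> n) t + C * t) has_vector_derivative (Q (\<eta> n) t + C)) (at t within {0..T})"
        by (simp add: has_real_derivative_iff_has_vector_derivative)
    qed
    then have I: "((\<lambda>t. Q (\<eta> n) t + C) has_integral (G (\<eta> n) T - G (\<eta> n) 0 + C * T)) {0..T}"
      by (simp add: algebra_simps)
    have ai: "(\<lambda>t. Q (\<eta> n) t + C) absolutely_integrable_on {0..T}"
    proof (rule nonnegative_absolutely_integrable_1)
      show "(\<lambda>t. Q (\<eta> n) t + C) integrable_on {0..T}" using I by blast
      show "0 \<le> Q (\<eta> n) t + C" if "t \<in> {0..T}" for t using lower[OF \<eta>, of t n] that by simp
    qed
    then show "integrable lebesgue (g n)" by (simp add: set_integrable_def g_def[abs_def])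
    have "(LINT t|lebesgue. g n t) = integral {0..T} (\<lambda>t. Q (\<eta> n) t + C)"
      using set_lebesgue_integral_eq_integral(2)[OF ai] by (simp add: set_lebesgue_integral_def g_def)
    also have "\<dots> = G (\<eta> n) T - G (\<eta> n) 0 + C * T" by (rule integral_unique[OF I])
    also have "\<dots> \<le> 2 * D + C * T" using bd[OF \<eta>, of T n] bd[OF \<eta>, of 0 n] T(1) by simp
    finally show "(LINT t|lebesgue. g n t) \<le> 2 * D + C * T" .
  qed
  have ij: "integrable lebesgue (\<lambda>t. indicat_real {0..T} t *\<^sub>R (\<beta> + C))"
    by (intro integrable_scaleR_left integrable_real_indicator) (auto simp: emeasure_lborel_Icc_eq)
  have "ennreal ((\<beta> + C) * T) = (\<integral>\<^sup>+t. ennreal (indicat_real {0..T} t *\<^sub>R (\<beta> + C)) \<partial>lebesgue)"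
    using ij \<beta> C T(1) by (subst nn_integral_eq_integral[OF ij]) (auto simp: mult.commute)
  also have "\<dots> \<le> (\<integral>\<^sup>+t. liminf (\<lambda>n. ennreal (g n t)) \<partial>lebesgue)"
  proof (rule nn_integral_mono)
    fix t
    show "ennreal (indicat_real {0..T} t *\<^sub>R (\<beta> + C)) \<le> liminf (\<lambda>n. ennreal (g n t))"
    proof (cases "t \<in> {0..T}")
      case True
      then have "eventually (\<lambda>n. \<beta> \<le> Q (\<eta> n) t) sequentially"
        using filterlim_iff[THEN iffD1, OF \<eta>r] ev[of t] by auto
      then show ?thesis
        by (intro Liminf_bounded) (auto elim!: eventually_mono intro!: ennreal_leI mult_left_mono simp: g_def)
    qed simp
  qed
  also have "\<dots> \<le> liminf (\<lambda>n. \<integral>\<^sup>+t. ennreal (g n t) \<partial>lebesgue)"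
    using borel_measurable_integrable[OF ig] by (intro nn_integral_liminf) simp
  also have "\<dots> \<le> liminf (\<lambda>n::nat. ennreal (2 * D + C * T))"
  proof (rule Liminf_mono, rule always_eventually, rule allI)
    fix n
    have "(\<integral>\<^sup>+t. ennreal (g n t) \<partial>lebesgue) = ennreal (LINT t|lebesgue. g n t)"
      by (rule nn_integral_eq_integral[OF ig AE_I2[OF g0]])
    also have "\<dots> \<le> ennreal (2 * D + C * T)" by (rule ennreal_leI[OF jg])
    finally show "(\<integral>\<^sup>+t. ennreal (g n t) \<partial>lebesgue) \<le> ennreal (2 * D + C * T)" .
  qed
  also have "\<dots> = ennreal (2 * D + C * T)" by (rule Liminf_const) simp
  finally have "ennreal ((\<beta> + C) * T) \<le> ennreal (2 * D + C * T)" .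
  then have "(\<beta> + C) * T \<le> 2 * D + C * T"
    by (rule ennreal_le_iff[THEN iffD1, rotated]) (use D C T(1) in auto)
  then show False using T(2) by (simp add: distrib_right)
qed

lemma error_weight_small:
  fixes b c \<epsilon> :: real
  assumes b: "b > 0" and \<epsilon>: "\<epsilon> > 0"
  obtains R where "R \<ge> 1" "c * (1 / R + R powr (- b)) < \<epsilon>"
proof -
  have "((\<lambda>R. c * (inverse R + R powr (- b))) \<longlongrightarrow> c * (0 + 0)) at_top"
    using b by (intro tendsto_intros tendsto_inverse_0_at_top tendsto_neg_powr filterlim_ident) auto
  then have "((\<lambda>R. c * (inverse R + R powr (- b))) \<longlongrightarrow> 0) at_top" by simp
  then have "eventually (\<lambda>R. c * (inverse R + R powr (- b)) < \<epsilon>) at_top" by (rule order_tendstoD) (rule \<epsilon>)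
  then have "eventually (\<lambda>R. c * (inverse R + R powr (- b)) < \<epsilon> \<and> R \<ge> 1) at_top"
    using eventually_ge_at_top[of 1] by eventually_elim simp
  then obtain R where "c * (inverse R + R powr (- b)) < \<epsilon>" "R \<ge> 1"
    using eventually_happens'[OF trivial_limit_at_top_linorder] by blast
  then show thesis by (intro that[of R]) (simp_all add: inverse_eq_divide)
qed

theorem theorem1p7:
  fixes b s_c \<delta> :: real and V W :: "real^3 \<Rightarrow> real" and Q u0 :: "real^3 \<Rightarrow> complex"
    and u :: "real \<Rightarrow> real^3 \<Rightarrow> complex" and T :: ereal
  assumes "0 < b" and "b < 1" and "s_c = (1 + b) / 2"
    and "\<And>x. 0 \<le> V x"
    and "\<delta> > 3/2" and "in_Lp \<delta> V" and "x_dot_grad V W" and "in_Lp \<delta> W"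
    and "AE x in lebesgue. W x \<le> 0"
    and "AE x in lebesgue. 2 * V x + W x \<ge> 0"
    and "ground_state b Q"
    and "in_H1 u0"
    and "mass u0 powr ((1 - s_c) / s_c) * energy b V u0
           < (mass Q powr (1 - s_c) * energy b (\<lambda>_. 0) Q powr s_c) powr (1 / s_c)"
    and "L2_nrm u0 powr (2 * (1 - s_c)) * Hhalf_nrm V u0 powr (2 * s_c)
           > L2_nrm Q powr (2 * (1 - s_c)) * L2_nrm (grad Q) powr (2 * s_c)"
    and "maximal_nls_solution b V u0 T u"
    and "\<exists>\<beta>0<0. (SUP t\<in>time_interval T. ereal (virial b W (u t))) \<le> ereal \<beta>0"
  shows "\<not> (T = \<infinity> \<and> (SUP t\<in>{0..}. ereal (L2_nrm (grad (u t)))) < \<infinity>)"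
proof
  assume glob: "T = \<infinity> \<and> (SUP t\<in>{0..}. ereal (L2_nrm (grad (u t)))) < \<infinity>"
  note b = assms(1,2) and \<delta> = assms(5) and V = assms(6) and VW = assms(7) and W = assms(8) and W0 = assms(9)
  have TI: "time_interval T = {0..}" using glob by (auto simp: time_interval_def)
  have sol: "nls_solution b V u0 T u" using assms(15) by (simp add: maximal_nls_solution_def)
  have u: "in_H1 (u t)" and cont: "((\<lambda>s. H1_nrm (\<lambda>x. u s x - u t x)) \<longlongrightarrow> 0) (at t within {0..})" if "t \<ge> 0" for t
    using sol that unfolding nls_solution_def continuous_H1_def TI by auto
  have der: "((\<lambda>s. pair_L2 (u s) \<phi>) has_vector_derivative nls_rhs b V (u t) \<phi>) (at t within {0..})"
    if t: "t \<ge> 0" and \<phi>: "in_H1 \<phi>" for t \<phi>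
  proof -
    obtain D where D: "((\<lambda>s. pair_L2 (u s) \<phi>) has_vector_derivative D) (at t within {0..})"
      and eq: "\<i> * D - pair_H V (u t) \<phi> + pair_N b (u t) \<phi> = 0"
      using sol t \<phi> unfolding nls_solution_def TI by fastforce
    have "D = - \<i> * (\<i> * D)" by simp
    also have "\<i> * D = pair_H V (u t) \<phi> - pair_N b (u t) \<phi>" using eq by (simp add: algebra_simps)
    finally have "D = nls_rhs b V (u t) \<phi>" by (simp add: nls_rhs_def)
    then show ?thesis using D by simp
  qed
  obtain n :: nat where n: "(SUP t\<in>{0..}. ereal (L2_nrm (grad (u t)))) < ereal (real n)"
    using glob less_PInf_Ex_of_nat by auto
  \<comment> \<open>Conservation of mass fixes the L^2 part, the assumed finite supremum bounds the
    gradient; all constants below depend on the solution through \<open>A\<close> alone.\<close>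
  define A where "A = L2_nrm (u 0) + real n"
  have A: "H1_nrm (u t) \<le> A" if t: "t \<ge> 0" for t
  proof -
    have "ereal (L2_nrm (grad (u t))) \<le> (SUP t\<in>{0..}. ereal (L2_nrm (grad (u t))))" using t by (intro SUP_upper) auto
    with n have "ereal (L2_nrm (grad (u t))) < ereal (real n)" by (rule le_less_trans[rotated])
    then have "L2_nrm (grad (u t)) \<le> real n" by simp
    moreover have "L2_nrm (u t) = L2_nrm (u 0)"
      by (rule mass_conservation[where u = u, OF b \<delta> V]) (use u cont der t in auto)
    ultimately show ?thesis using H1_nrm_le[OF in_H1_grad[OF u[OF t]]] by (simp add: A_def)
  qed
  obtain \<beta>0 :: real where \<beta>0: "\<beta>0 < 0" "(SUP t\<in>time_interval T. ereal (virial b W (u t))) \<le> ereal \<beta>0"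
    using assms(16) by blast
  have vir: "virial b W (u t) \<le> \<beta>0" if "t \<ge> 0" for t
  proof -
    have "ereal (virial b W (u t)) \<le> (SUP t\<in>time_interval T. ereal (virial b W (u t)))"
      unfolding TI using that by (intro SUP_upper) auto
    also note \<beta>0(2)
    finally show ?thesis by simp
  qed
  define Q where "Q R h v = - 2 * Re (pair_H V v (loc_gen R h v) - pair_N b v (loc_gen R h v))" for R h v
  obtain M where M: "M \<ge> 0"
    "\<And>R A. R \<ge> 1 \<Longrightarrow> \<exists>C. \<forall>u h. in_H1 u \<longrightarrow> H1_nrm u \<le> A \<longrightarrow> 0 < h \<longrightarrow> h \<le> 1 \<longrightarrow> - C \<le> Q R h u"
    "\<And>u R A \<epsilon>. in_H1 u \<Longrightarrow> H1_nrm u \<le> A \<Longrightarrow> R \<ge> 1 \<Longrightarrow> \<epsilon> > 0 \<Longrightarrow>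
      eventually (\<lambda>h. - 2 * virial b W u - M * (A\<^sup>2 + A ^ 4) * (1 / R + R powr (- b)) - \<epsilon> \<le> Q R h u) (at_right 0)"
    by (rule virial_slice[OF b \<delta> V W VW W0, folded Q_def], rule that)
  \<comment> \<open>The main term -2K is at least twice the modulus of \<open>\<beta>0\<close>. Half
    of that modulus is allotted to the error in R and half to \<open>\<epsilon>\<close>, which
    leaves a rate of at least \<open>- \<beta>0\<close>.\<close>
  have \<beta>2: "- \<beta>0 / 2 > 0" using \<beta>0(1) by simp
  obtain R where R: "R \<ge> 1" and err: "M * (A\<^sup>2 + A ^ 4) * (1 / R + R powr (- b)) < - \<beta>0 / 2"
    by (rule error_weight_small[OF b(1) \<beta>2], rule that)
  have R0: "R > 0" using R by simp
  obtain C where C: "\<And>u h. in_H1 u \<Longrightarrow> H1_nrm u \<le> A \<Longrightarrow> 0 < h \<Longrightarrow> h \<le> 1 \<Longrightarrow> - C \<le> Q R h u"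
    using M(2)[OF R, of A] by blast
  show False
  proof (rule derivatives_not_eventually_bounded_below[of "\<lambda>h t. Im (pair_L2 (u t) (loc_gen R h (u t)))" "\<lambda>h t. Q R h (u t)"
        "\<bar>C\<bar>" "exp 4 * (A * ((R + 3) * A))" "- \<beta>0"])
    fix h t :: real assume h: "0 < h" "h \<le> 1" and t: "t \<ge> 0"
    show "((\<lambda>t. Im (pair_L2 (u t) (loc_gen R h (u t)))) has_real_derivative Q R h (u t)) (at t within {0..})"
      unfolding Q_def by (rule loc_gen_derivative[where u = u, OF b \<delta> V]) (use u cont der R0 h t in auto)
    show "- \<bar>C\<bar> \<le> Q R h (u t)" using C[OF u[OF t] A[OF t] h] by linarith
    show "\<bar>Im (pair_L2 (u t) (loc_gen R h (u t)))\<bar> \<le> exp 4 * (A * ((R + 3) * A))"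
      by (rule loc_gen_pairing_bound[OF u[OF t] A[OF t] R h])
  next
    fix t :: real assume t: "t \<ge> 0"
    show "eventually (\<lambda>h. - \<beta>0 \<le> Q R h (u t)) (at_right 0)"
      using M(3)[OF u[OF t] A[OF t] R \<beta>2]
    proof eventually_elim
      case (elim h)
      then show ?case using err vir[OF t] by linarith
    qed
  qed (use \<beta>0(1) in auto)
qed

end
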